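(* Let $\rho_0$ be a Borel probability measure on $\mathbb{R}$ with $\int_{\mathbb{R}}x^2\,d\rho_0(x)<\infty$ and let $v_0:\mathbb{R}\to\mathbb{R}$ be absolutely continuous. Let $W:\mathbb{R}\to\mathbb{R}$ be continuously differentiable and even, with $\sup_{x\in\mathbb{R}}\frac{|W'(x)|}{1+|x|}<\infty$, and let $c>0$ be such that $x\mapsto W(x)+\frac{c}{2}x^2$ is convex. Then there is a locally Lipschitz continuous $X:[0,\infty)\to L^2(\rho_0)$ which satisfies the pressureless Euler flow equation $$\dot X(t)=\mathbb{E}_{\rho_0}\left[v_0-\int_0^t (W'*\rho_s)(X(s))\,ds\,\Big|\,X(t)\right]\quad\text{for a.e. } t\ge 0,\qquad \rho_s:=X(s)_{\#}\rho_0,$$ and the initial condition $X(0)=\mathrm{id}_{\mathbb{R}}$ $\rho_0$-almost everywhere. Moreover, $X$ has the following properties. (i) For Lebesgue almost every $t,s\in[0,\infty)$ with $s\le t$, $E(t)\le E(s)$, where $$E(\tau):=\int_{\mathbb{R}}\frac12\dot X(\tau)^2\,d\rho_0+\int_{\mathbb{R}}\int_{\mathbb{R}}\frac12 W(X(y,\tau)-X(z,\tau))\,d\rho_0(y)\,d\rho_0(z).$$ (ii) For $t\ge 0$ and $y,z\in\mathrm{supp}(\rho_0)$ with $y\ge z$, $$0\le X(y,t)-X(z,t)\le \cosh(\sqrt{c}\,t)(y-z)+\frac{1}{\sqrt{c}}\sinh(\sqrt{c}\,t)\int_z^y|v_0'(x)|\,dx.$$ (iii) For $0<s\le t$ and $y,z\in\mathrm{supp}(\rho_0)$,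 $$\frac{|X(y,t)-X(z,t)|}{\sinh(\sqrt{c}\,t)}\le\frac{|X(y,s)-X(z,s)|}{\sinh(\sqrt{c}\,s)}.$$
   Context: Absolute continuity of $v_0$ on $\mathbb{R}$ is meant in the usual $\varepsilon$-$\delta$ sense on the whole line: for each $\varepsilon>0$ there is $\delta>0$ such that $\sum_i|v_0(b_i)-v_0(a_i)|<\varepsilon$ for every finite family of disjoint intervals $(a_i,b_i)$ with $\sum_i(b_i-a_i)<\delta$; $v_0'$ is its a.e. derivative. $X$ is locally Lipschitz if $X:[0,T]\to L^2(\rho_0)$ is Lipschitz for every $T\ge 0$; then $\dot X(t)=\lim_{\tau\to0}\frac{X(t+\tau)-X(t)}{\tau}$ exists in $L^2(\rho_0)$ for a.e. $t>0$. Each $X(t)$ is regarded as a function $X(t):\mathbb{R}\to\mathbb{R}$, $y\mapsto X(y,t)$; pointwise statements concern this chosen representative of the class in $L^2(\rho_0)$. $X(t)_{\#}\rho_0$ is the push-forward measure, $(W'*\rho_s)(x)=\int_{\mathbb{R}}W'(x-y)\,d\rho_s(y)$, and $\mathrm{supp}(\rho_0)=\{y:\rho_0((y-\delta,y+\delta))>0\text{ for all }\delta>0\}$. For $g\in L^2(\rho_0)$ and Borel $Y:\mathbb{R}\to\mathbb{R}$, $\mathbb{E}_{\rho_0}[g|Y]$ is the ($\rho_0$-a.e. unique) element of $L^2(\rho_0)$ such that $\int \mathbb{E}_{\rho_0}[g|Y]\,h(Y)\,d\rho_0=\int g\,h(Y)\,d\rho_0$ for every Borel $h$ with $h(Y)\in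 L^2(\rho_0)$, and $\mathbb{E}_{\rho_0}[g|Y]=f(Y)$ $\rho_0$-a.e. for some Borel $f:\mathbb{R}\to\mathbb{R}$. *)

theory Defs
  imports "HOL-Analysis.Analysis" "HOL-Probability.Probability"
begin

definition abs_cont :: "(real \<Rightarrow> real) \<Rightarrow> bool" where
  "abs_cont f \<longleftrightarrow> (\<forall>\<epsilon>>0. \<exists>\<delta>>0. \<forall>(n::nat) a b.
     (\<forall>i<n. a i < b i) \<longrightarrow> disjoint_family_on (\<lambda>i. {a i<..<b i}) {..<n} \<longrightarrow>
     (\<Sum>i<n. b i - a i) < \<delta> \<longrightarrow> (\<Sum>i<n. \<bar>f (b i) - f (a i)\<bar>) < \<epsilon>)"

definition msupp :: "real measure \<Rightarrow> real set" where
  "msupp \<rho> = {y. \<forall>\<delta>>0. emeasure \<rho> {y - \<delta><..<y + \<delta>} > 0}"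

definition convol :: "(real \<Rightarrow> real) \<Rightarrow> real measure \<Rightarrow> real \<Rightarrow> real" where
  "convol f \<mu> x = (\<integral>y. f (x - y) \<partial>\<mu>)"

text \<open>Elements of $L^2(M)$ are represented by functions; two of them are the same element
  iff they agree almost everywhere.\<close>

definition L2 :: "'a measure \<Rightarrow> ('a \<Rightarrow> real) set" where
  "L2 M = {f \<in> borel_measurable M. integrable M (\<lambda>y. (f y)\<^sup>2)}"

definition L2_norm :: "'a measure \<Rightarrow> ('a \<Rightarrow> real) \<Rightarrow> real" where
  "L2_norm M f = sqrt (\<integral>y. (f y)\<^sup>2 \<partial>M)"

definition L2_locally_lipschitz :: "'a measure \<Rightarrow> (real \<Rightarrow> 'a \<Rightarrow> real) \<Rightarrow> bool" where
  "L2_locally_lipschitz M X \<longleftrightarrow> (\<forall>t\<ge>0. X t \<in> L2 M) \<and>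
     (\<forall>T\<ge>0. \<exists>C. \<forall>s\<in>{0..T}. \<forall>t\<in>{0..T}. L2_norm M (\<lambda>y. X t y - X s y) \<le> C * \<bar>t - s\<bar>)"

text \<open>The two-sided limit at \<open>t\<close> is used only for \<open>t > 0\<close>, where \<open>X\<close> near \<open>t\<close> does not involve
  negative times.\<close>

definition has_L2_derivative ::
    "'a measure \<Rightarrow> (real \<Rightarrow> 'a \<Rightarrow> real) \<Rightarrow> ('a \<Rightarrow> real) \<Rightarrow> real \<Rightarrow> bool" where
  "has_L2_derivative M X D t \<longleftrightarrow> D \<in> L2 M \<and>
     ((\<lambda>\<tau>. L2_norm M (\<lambda>y. (X (t + \<tau>) y - X t y) / \<tau> - D y)) \<longlongrightarrow> 0) (at 0)"

definition L2_deriv :: "'a measure \<Rightarrow> (real \<Rightarrow> 'a \<Rightarrow> real) \<Rightarrow> real \<Rightarrow> 'a \<Rightarrow> real" where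
  "L2_deriv M X t = (SOME D. has_L2_derivative M X D t)"

text \<open>The $L^2(M)$-valued Bochner integral over \<open>N\<close>, following
  \<^const>\<open>has_bochner_integral\<close>, which does not apply directly because $L^2(M)$ depends on
  the term \<open>M\<close> and so is not a type. Measurability of the norms in
  \<open>has_L2_integral\<close> takes the place of measurability of \<open>F\<close>.\<close>

definition L2_simple :: "'b measure \<Rightarrow> 'a measure \<Rightarrow> ('b \<Rightarrow> 'a \<Rightarrow> real) \<Rightarrow> bool" where
  "L2_simple N M S \<longleftrightarrow> simple_function N S \<and> (\<forall>s\<in>space N. S s \<in> L2 M) \<and>
     emeasure N {s \<in> space N. S s \<noteq> (\<lambda>_. 0)} \<noteq> \<infinity>"

definition L2_simple_integral :: "'b measure \<Rightarrow> ('b \<Rightarrow> 'a \<Rightarrow> real) \<Rightarrow> 'a \<Rightarrow> real" where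
  "L2_simple_integral N S y = (\<Sum>g\<in>S ` space N. measure N {s \<in> space N. S s = g} * g y)"

definition has_L2_integral ::
    "'b measure \<Rightarrow> 'a measure \<Rightarrow> ('b \<Rightarrow> 'a \<Rightarrow> real) \<Rightarrow> ('a \<Rightarrow> real) \<Rightarrow> bool" where
  "has_L2_integral N M F G \<longleftrightarrow> (\<forall>s\<in>space N. F s \<in> L2 M) \<and> G \<in> L2 M \<and>
     (\<exists>S. (\<forall>i::nat. L2_simple N M (S i)) \<and>
       (\<forall>i. (\<lambda>s. L2_norm M (\<lambda>y. F s y - S i s y)) \<in> borel_measurable N) \<and>
       (\<lambda>i. \<integral>\<^sup>+s. ennreal (L2_norm M (\<lambda>y. F s y - S i s y)) \<partial>N) \<longlonglongrightarrow> 0 \<and>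
       (\<lambda>i. L2_norm M (\<lambda>y. L2_simple_integral N (S i) y - G y)) \<longlonglongrightarrow> 0)"

definition cond_exp_given :: "'a measure \<Rightarrow> ('a \<Rightarrow> real) \<Rightarrow> ('a \<Rightarrow> real) \<Rightarrow> 'a \<Rightarrow> real" where
  "cond_exp_given M g Y = real_cond_exp M (vimage_algebra (space M) Y borel) g"

text \<open>Conditioning on the sigma-algebra generated by \<open>Y\<close> agrees with the description of
  $E[g|Y]$ by test functions \<open>h(Y)\<close> in $L^2$.\<close>

lemma cond_exp_given_charact:
  assumes "prob_space M" and Y: "Y \<in> borel_measurable M" and g: "g \<in> L2 M" and e: "e \<in> L2 M"
    and f: "f \<in> borel_measurable borel" "AE y in M. e y = f (Y y)"
    and test: "\<And>h. h \<in> borel_measurable borel \<Longrightarrow> (\<lambda>y. h (Y y)) \<in> L2 M \<Longrightarrow>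
      (\<integral>y. e y * h (Y y) \<partial>M) = (\<integral>y. g y * h (Y y) \<partial>M)"
  shows "AE y in M. cond_exp_given M g Y y = e y"
proof -
  interpret prob_space M by fact
  let ?F = "vimage_algebra (space M) Y borel"
  have sub: "subalgebra M ?F"
    unfolding subalgebra_def using Y by (auto simp: sets_vimage_algebra2 measurable_sets)
  interpret finite_measure_subalgebra M ?F
    by standard (rule sub)
  have Yf: "Y \<in> measurable ?F borel" by (rule measurable_vimage_algebra1) simp
  have gi: "integrable M g" and ei: "integrable M e"
    using g e by (auto simp: L2_def intro: square_integrable_imp_integrable)
  have em: "e \<in> borel_measurable M" using e by (simp add: L2_def)
  have fY: "(\<lambda>y. f (Y y)) \<in> borel_measurable ?F" "(\<lambda>y. f (Y y)) \<in> borel_measurable M"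
    using measurable_compose[OF Yf f(1)] measurable_compose[OF Y f(1)] by auto
  have fi: "integrable M (\<lambda>y. f (Y y))"
    using ei integrable_cong_AE[OF em fY(2) f(2)] by simp
  have "AE y in M. real_cond_exp M ?F g y = f (Y y)"
  proof (rule real_cond_exp_charact[OF _ gi fi fY(1)])
    fix A assume "A \<in> sets ?F"
    then obtain B where B: "B \<in> sets borel" and A: "A = Y -` B \<inter> space M"
      by (auto simp: sets_vimage_algebra2)
    let ?h = "indicator B :: real \<Rightarrow> real"
    have h: "?h \<in> borel_measurable borel" using B by simp
    have "(\<lambda>y. ?h (Y y)) \<in> borel_measurable M" using measurable_compose[OF Y h] .
    moreover have "integrable M (\<lambda>y. (?h (Y y))\<^sup>2)"
      by (rule integrable_const_bound[where B=1])
        (use calculation in \<open>auto simp: indicator_def\<close>)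
    ultimately have "(\<lambda>y. ?h (Y y)) \<in> L2 M" by (simp add: L2_def)
    then have *: "(\<integral>y. e y * ?h (Y y) \<partial>M) = (\<integral>y. g y * ?h (Y y) \<partial>M)" by (rule test[OF h])
    have "(\<integral>y\<in>A. g y \<partial>M) = (\<integral>y. g y * ?h (Y y) \<partial>M)"
      unfolding set_lebesgue_integral_def
      by (rule Bochner_Integration.integral_cong) (auto simp: A indicator_def)
    also have "\<dots> = (\<integral>y. f (Y y) * ?h (Y y) \<partial>M)"
      unfolding *[symmetric]
      by (rule integral_cong_AE)
        (use f(2) em fY(2) \<open>(\<lambda>y. ?h (Y y)) \<in> borel_measurable M\<close> in auto)
    also have "\<dots> = (\<integral>y\<in>A. f (Y y) \<partial>M)"
      unfolding set_lebesgue_integral_def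
      by (rule Bochner_Integration.integral_cong) (auto simp: A indicator_def)
    finally show "(\<integral>y\<in>A. g y \<partial>M) = (\<integral>y\<in>A. f (Y y) \<partial>M)" .
  qed
  with f(2) show ?thesis unfolding cond_exp_given_def by auto
qed

definition is_flow_solution ::
    "real measure \<Rightarrow> (real \<Rightarrow> real) \<Rightarrow> (real \<Rightarrow> real) \<Rightarrow> (real \<Rightarrow> real \<Rightarrow> real) \<Rightarrow> bool" where
  "is_flow_solution \<rho> v W' X \<longleftrightarrow>
     (AE t in lborel. t > 0 \<longrightarrow>
       (\<exists>D. has_L2_derivative \<rho> X D t) \<and>
       (\<exists>G. has_L2_integral (lebesgue_on {0..t}) \<rho>
              (\<lambda>s y. convol W' (distr \<rho> borel (X s)) (X s y)) G \<and>
            (AE y in \<rho>. L2_deriv \<rho> X t y = cond_exp_given \<rho> (\<lambda>y. v y - G y) (X t) y)))"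

definition energy ::
    "real measure \<Rightarrow> (real \<Rightarrow> real) \<Rightarrow> (real \<Rightarrow> real \<Rightarrow> real) \<Rightarrow> real \<Rightarrow> real" where
  "energy \<rho> W X \<tau> = (\<integral>y. 1/2 * (L2_deriv \<rho> X \<tau> y)\<^sup>2 \<partial>\<rho>) +
     (\<integral>z. (\<integral>y. 1/2 * W (X \<tau> y - X \<tau> z) \<partial>\<rho>) \<partial>\<rho>)"

end

theory Submission
  imports Defs "HOL-Complex_Analysis.Great_Picard" "HOL-Real_Asymp.Real_Asymp"
begin

text \<open>Approximate \<open>\<rho>\<^sub>0\<close> by finitely many particles at points of its support. In each time step they move
  freely, stick together when they meet (the new positions are the isotonic regression of the free
  ones, and velocities are averaged over clusters), and then the force acts. Semiconvexity of \<open>W\<close>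
  bounds the gaps between neighbouring particles as in (ii) and (iii); these bounds make the positions
  equicontinuous, and a subsequence converges to a flow \<open>X\<close>. Let \<open>V\<close> and \<open>Z\<close> be the velocity and
  position that particles would have under the same force if they never stuck. Then \<open>X t\<close> is the
  conditional expectation of \<open>Z t\<close> given \<open>X t\<close>, and by (iii) \<open>X t\<close> is a function of \<open>X s\<close> for \<open>s \<le> t\<close>.
  Hence the increments of \<open>X\<close> differ from their projections by mutually orthogonal residuals, which
  vanish on refinement of the time interval, so the derivative of \<open>X\<close> at \<open>t\<close> is the conditional
  expectation of \<open>V t\<close> given \<open>X t\<close>, except at countably many \<open>t\<close>. Projections do not
  increase kinetic energy, and semiconvexity of \<open>W\<close> makes the change of potential energy at most the
  work of the force up to terms of second order, so the energy decreases.\<close>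

section \<open>Isotonic regression\<close>

text \<open>The obstacle: conditional expectations given approximate positions need not converge to
  the one given the limit, since particles may merge only in the limit. So the velocities of the
  sticky particles never pass to the limit. What passes is linear: the velocities and positions
  without sticking are Riemann sums and converge pointwise, and the discrete orthogonality of
  \<open>Z - X\<close> to functions of \<open>X\<close> survives when tested with bounded continuous
  functions. The flow equation and the energy inequality are then derived for the limit itself, from
  this orthogonality and from the factorization of \<open>X t\<close> through \<open>X s\<close>. As
  that factorization rests on (iii), the bound (iii) is an ingredient and not a by-product.
  Convergence is needed at every point of the support, because (ii) and (iii) are pointwise. Gap
  bounds compare particles only with each other; conservation of momentum fixes their mean position.
  All dominated convergence arguments over space then rest on the weight \<open>1 + |y|\<close>,
  which lies in \<open>L2 \<rho>\<close>.\<close>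

lemma sum_mult_mono_nonpos:
  fixes w y :: "real \<Rightarrow> real"
  assumes "finite A" and "mono_on A y" and "\<And>a. a \<in> A \<Longrightarrow> y a \<le> Y"
    and "\<And>a. a \<in> A \<Longrightarrow> 0 \<le> (\<Sum>b\<in>{b\<in>A. b \<le> a}. w b)"
  shows "(\<Sum>a\<in>A. w a * y a) \<le> Y * (\<Sum>a\<in>A. w a)"
  using assms
proof (induction A arbitrary: Y rule: finite_linorder_max_induct)
  case (insert b A)
  have lt: "\<And>a. a \<in> A \<Longrightarrow> a < b" using insert by auto
  have nb: "b \<notin> A" using lt by auto
  have eq: "{c \<in> insert b A. c \<le> a} = {c \<in> A. c \<le> a}" if "a \<in> A" for a
    using that lt by force
  \<comment> \<open>Summation by parts, one point at a time: below \<open>b\<close> the bound is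
    taken to be \<open>y b\<close>; afterwards the total weight, itself a partial sum and so
    nonnegative, allows \<open>y b\<close> to be raised to \<open>Y\<close>.\<close>
  have "(\<Sum>a\<in>A. w a * y a) \<le> y b * (\<Sum>a\<in>A. w a)"
  proof (rule insert.IH)
    show "mono_on A y" using insert.prems(1) by (auto simp: mono_on_def)
    show "y a \<le> y b" if "a \<in> A" for a
      using insert.prems(1) that lt[OF that] by (auto simp: mono_on_def)
    show "0 \<le> (\<Sum>c\<in>{c\<in>A. c \<le> a}. w c)" if "a \<in> A" for a
      using insert.prems(3)[of a] that eq[OF that] by simp
  qed
  then have "(\<Sum>a\<in>insert b A. w a * y a) \<le> y b * (\<Sum>a\<in>insert b A. w a)"
    using insert nb by (simp add: algebra_simps)
  also have "\<dots> \<le> Y * (\<Sum>a\<in>insert b A. w a)"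
  proof (rule mult_right_mono)
    show "y b \<le> Y" using insert.prems(2) by auto
    have "{c \<in> insert b A. c \<le> b} = insert b A" using lt by force
    then show "0 \<le> (\<Sum>a\<in>insert b A. w a)" using insert.prems(3)[of b] by simp
  qed
  finally show ?case .
qed simp

lemma sum_weighted_avg_zero:
  fixes m z :: "'a \<Rightarrow> real"
  assumes "(\<Sum>b\<in>B. m b) \<noteq> 0"
  shows "(\<Sum>b\<in>B. m b * (z b - (\<Sum>b\<in>B. m b * z b) / (\<Sum>b\<in>B. m b))) = 0"
proof -
  define r where "r = (\<Sum>b\<in>B. m b * z b) / (\<Sum>b\<in>B. m b)"
  have "(\<Sum>b\<in>B. m b * (z b - r)) = (\<Sum>b\<in>B. m b * z b) - (\<Sum>b\<in>B. m b) * r"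
    by (simp add: right_diff_distrib sum_subtractf sum_distrib_right)
  also have "\<dots> = 0" using assms by (simp add: r_def)
  finally show ?thesis by (simp add: r_def)
qed

lemma sum_level_sets:
  fixes w x \<phi> :: "real \<Rightarrow> real"
  assumes "finite A" and "\<And>c. (\<Sum>a\<in>{a\<in>A. x a = c}. w a) = 0"
  shows "(\<Sum>a\<in>A. w a * \<phi> (x a)) = 0"
proof -
  have "(\<Sum>a\<in>A. w a * \<phi> (x a)) = (\<Sum>c\<in>x ` A. \<Sum>a\<in>{a\<in>A. x a = c}. w a * \<phi> (x a))"
    by (rule sum.image_gen[OF assms(1)])
  also have "\<dots> = (\<Sum>c\<in>x ` A. \<phi> c * (\<Sum>a\<in>{a\<in>A. x a = c}. w a))"
    by (intro sum.cong refl) (simp add: sum_distrib_left mult.commute)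
  finally show ?thesis by (simp add: assms(2))
qed

text \<open>These are the optimality conditions for the monotone \<open>x\<close> with least
  weighted square distance to \<open>z\<close>: the residual has mean zero on every block, and its
  partial sums are nonnegative. Together they say that the residual is orthogonal to
  \<open>x\<close> and has nonpositive product with every monotone function.\<close>

definition isotonic_regression :: "real set \<Rightarrow> (real \<Rightarrow> real) \<Rightarrow> (real \<Rightarrow> real) \<Rightarrow> (real \<Rightarrow> real) \<Rightarrow> bool"
  where "isotonic_regression A m z x \<longleftrightarrow> mono_on A x \<and>
    (\<forall>c. (\<Sum>a\<in>{a\<in>A. x a = c}. m a * (z a - x a)) = 0) \<and>
    (\<forall>a\<in>A. 0 \<le> (\<Sum>b\<in>{b\<in>A. b \<le> a}. m b * (z b - x b)))"

lemma isotonic_regression_sum_zero: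
  assumes "finite A" "isotonic_regression A m z x"
  shows "(\<Sum>a\<in>A. m a * (z a - x a) * \<phi> (x a)) = 0"
  using sum_level_sets[OF assms(1), where x=x and w="\<lambda>a. m a * (z a - x a)" and \<phi>=\<phi>] assms(2)
  unfolding isotonic_regression_def by blast

text \<open>The last block is the final segment with the largest average.\<close>

lemma isotonic_regression_exists:
  assumes "finite A" and "\<And>a. a \<in> A \<Longrightarrow> m a > 0"
  shows "\<exists>x. isotonic_regression A m z x"
  using assms
proof (induction A rule: finite_psubset_induct)
  case (psubset A)
  show ?case
  proof (cases "A = {}")
    case True
    then show ?thesis by (auto simp: isotonic_regression_def)
  next
    case False
    define U where "U a = {b\<in>A. a \<le> b}" for a
    have fU: "finite (U a)" for a using psubset by (auto simp: U_def)
    have mU: "(\<Sum>b\<in>U a. m b) > 0" if "a \<in> A" for a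
      by (rule sum_pos[OF fU]) (use that psubset.prems in \<open>auto simp: U_def\<close>)
    define avg where "avg a = (\<Sum>b\<in>U a. m b * z b) / (\<Sum>b\<in>U a. m b)" for a
    obtain a0 where a0: "a0 \<in> A" "\<And>a. a \<in> A \<Longrightarrow> avg a \<le> avg a0"
    proof -
      have "Max (avg ` A) \<in> avg ` A" using psubset(1) False by simp
      moreover have "avg a \<le> Max (avg ` A)" if "a \<in> A" for a using psubset(1) that by simp
      ultimately show ?thesis using that by (metis imageE)
    qed
    define M where "M = avg a0"
    have U_le: "(\<Sum>b\<in>U a. m b * (z b - M)) \<le> 0" if "a \<in> A" for a
    proof -
      have "(\<Sum>b\<in>U a. m b * z b) \<le> M * (\<Sum>b\<in>U a. m b)"
        using a0(2)[OF that] mU[OF that] unfolding M_def by (simp add: avg_def[of a] divide_le_eq)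
      then show ?thesis by (simp add: algebra_simps sum_subtractf sum_distrib_left)
    qed
    have U_0: "(\<Sum>b\<in>U a0. m b * (z b - M)) = 0"
      using mU[OF a0(1)] sum_weighted_avg_zero[of m "U a0" z] by (simp add: M_def avg_def)
    \<comment> \<open>A nonempty upper set is the final segment that begins at its minimum, so the
      maximality of \<open>M\<close> applies to it.\<close>
    have upper: "(\<Sum>b\<in>C. m b * (z b - M)) \<le> 0" if "C \<subseteq> A" "\<And>b c. b \<in> C \<Longrightarrow> c \<in> A \<Longrightarrow> b \<le> c \<Longrightarrow> c \<in> C" for C
    proof (cases "C = {}")
      case False
      have fC: "finite C" using that psubset(1) finite_subset by blast
      have "C = U (Min C)"
        using that(1) that(2)[OF Min_in[OF fC False]] Min_le[OF fC] by (auto simp: U_def)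
      then show ?thesis using U_le[of "Min C"] Min_in[OF fC False] that(1) by auto
    qed simp
    define B where "B = {b\<in>A. b < a0}"
    have BA: "B \<subset> A" using a0 by (auto simp: B_def)
    have fB: "finite B" using BA psubset(1) finite_subset by blast
    obtain xB where xB: "isotonic_regression B m z xB"
      using psubset.IH[OF BA] psubset.prems BA by blast
    have AB: "A = B \<union> U a0" "B \<inter> U a0 = {}" by (auto simp: B_def U_def)
    \<comment> \<open>Otherwise the top block \<open>C\<close> of the smaller regression has average
      above \<open>M\<close>, and joined to the last block it would form a final segment whose
      average exceeds the maximum.\<close>
    have xB_le: "xB b \<le> M" if b: "b \<in> B" for b
    proof (rule ccontr)
      assume "\<not> xB b \<le> M"
      define \<beta> where "\<beta> = Max (xB ` B)"
      have bM: "M < \<beta>"         using \<open>\<not> xB b \<le> M\<close> Max_ge[of "xB ` B" "xB b"] fB b unfolding \<beta>_def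
        by (meson finite_imageI imageI less_le_trans not_le)
      define C where "C = {a\<in>B. xB a = \<beta>}"
      have "\<beta> \<in> xB ` B" unfolding \<beta>_def by (rule Max_in) (use fB b in auto)
      then have Cne: "C \<noteq> {}" by (auto simp: C_def)
      have fC: "finite C" using fB by (auto simp: C_def)
      have "(\<Sum>a\<in>C. m a * (z a - \<beta>)) = 0"
        using xB by (auto simp: isotonic_regression_def C_def intro!: sum.cong)
      moreover have "(\<Sum>a\<in>C. m a * (z a - M)) = (\<Sum>a\<in>C. m a * (z a - \<beta>)) + (\<beta> - M) * (\<Sum>a\<in>C. m a)"
        by (simp add: sum_distrib_left algebra_simps flip: sum.distrib)
      moreover have "(\<Sum>a\<in>C. m a) > 0"
        by (rule sum_pos[OF fC Cne]) (use psubset.prems BA in \<open>auto simp: C_def\<close>)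
      ultimately have "(\<Sum>a\<in>C. m a * (z a - M)) > 0" using bM by simp
      moreover have "(\<Sum>a\<in>C \<union> U a0. m a * (z a - M)) \<le> 0"
      proof (rule upper)
        show "C \<union> U a0 \<subseteq> A" using BA by (auto simp: C_def U_def)
        fix b c assume h: "b \<in> C \<union> U a0" "c \<in> A" "b \<le> c"
        show "c \<in> C \<union> U a0"
        proof (cases "a0 \<le> c")
          case False
          then have c: "c \<in> B" "b \<in> C" using h by (auto simp: B_def U_def)
          then have "\<beta> \<le> xB c"
            using xB h by (auto simp: isotonic_regression_def C_def mono_on_def)
          moreover have "xB c \<le> \<beta>" using c fB by (auto simp: \<beta>_def)
          ultimately show ?thesis using c by (auto simp: C_def)
        qed (use h in \<open>auto simp: U_def\<close>)
      qed
      moreover have "(\<Sum>a\<in>C \<union> U a0. m a * (z a - M)) = (\<Sum>a\<in>C. m a * (z a - M)) + (\<Sum>a\<in>U a0. m a * (z a - M))"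
        by (rule sum.union_disjoint) (use fC fU AB in \<open>auto simp: C_def\<close>)
      ultimately show False using U_0 by simp
    qed
    define x where "x a = (if a < a0 then xB a else M)" for a
    have xx: "x b = xB b" if "b \<in> B" for b using that by (auto simp: B_def x_def)
    have xM: "x b = M" if "b \<in> U a0" for b using that by (auto simp: U_def x_def)
    have "isotonic_regression A m z x"
      unfolding isotonic_regression_def
    proof (intro conjI allI ballI)
      show "mono_on A x"
        using xB xB_le by (auto simp: mono_on_def isotonic_regression_def x_def B_def)
    next
      fix c
      have "(\<Sum>a\<in>{a\<in>A. x a = c}. m a * (z a - x a))
        = (\<Sum>a\<in>{a\<in>B. x a = c}. m a * (z a - x a)) + (\<Sum>a\<in>{a\<in>U a0. x a = c}. m a * (z a - x a))"
        by (subst sum.union_disjoint[symmetric]) (use fB fU AB in \<open>auto intro!: sum.cong\<close>)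
      moreover have "(\<Sum>a\<in>{a\<in>B. x a = c}. m a * (z a - x a)) = (\<Sum>a\<in>{a\<in>B. xB a = c}. m a * (z a - xB a))"
        by (rule sum.cong) (auto simp: xx)
      moreover have "\<dots> = 0" using xB by (auto simp: isotonic_regression_def)
      moreover have "(\<Sum>a\<in>{a\<in>U a0. x a = c}. m a * (z a - x a)) = 0"
      proof (cases "c = M")
        case True
        then have "{a\<in>U a0. x a = c} = U a0" using xM by auto
        then show ?thesis using U_0 xM by simp
      next
        case False
        then have "{a\<in>U a0. x a = c} = {}" using xM by auto
        then show ?thesis by (metis sum.empty)
      qed
      ultimately show "(\<Sum>a\<in>{a\<in>A. x a = c}. m a * (z a - x a)) = 0" by simp
    next
      fix a assume a: "a \<in> A"
      show "0 \<le> (\<Sum>b\<in>{b\<in>A. b \<le> a}. m b * (z b - x b))"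
      proof (cases "a < a0")
        case True
        then have "{b\<in>A. b \<le> a} = {b\<in>B. b \<le> a}" by (auto simp: B_def)
        moreover have "(\<Sum>b\<in>{b\<in>B. b \<le> a}. m b * (z b - x b)) = (\<Sum>b\<in>{b\<in>B. b \<le> a}. m b * (z b - xB b))"
          by (rule sum.cong) (auto simp: xx)
        ultimately show ?thesis using xB a True by (auto simp: isotonic_regression_def B_def)
      next
        case False
        have e1: "{b\<in>A. b \<le> a} = B \<union> {b\<in>U a0. b \<le> a}" using False by (auto simp: B_def U_def)
        have "(\<Sum>b\<in>{b\<in>A. b \<le> a}. m b * (z b - x b))
          = (\<Sum>b\<in>B. m b * (z b - x b)) + (\<Sum>b\<in>{b\<in>U a0. b \<le> a}. m b * (z b - x b))"
          unfolding e1 by (rule sum.union_disjoint) (use fB fU AB in auto)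
        moreover have "(\<Sum>b\<in>B. m b * (z b - x b)) = (\<Sum>b\<in>B. m b * (z b - xB b) * 1)"
          by (rule sum.cong) (auto simp: xx)
        moreover have "\<dots> = 0"
          using isotonic_regression_sum_zero[OF fB xB, of "\<lambda>_. 1"] by simp
        moreover have "(\<Sum>b\<in>{b\<in>U a0. b \<le> a}. m b * (z b - x b)) = (\<Sum>b\<in>{b\<in>U a0. b \<le> a}. m b * (z b - M))"
          by (rule sum.cong) (auto simp: xM)
        \<comment> \<open>The residual of the last block sums to zero, so its part up to
          \<open>a\<close> is minus its part beyond \<open>a\<close>; the latter runs over a final
          segment and is nonpositive.\<close>
        moreover have "(\<Sum>b\<in>U a0. m b * (z b - M)) =
           (\<Sum>b\<in>{b\<in>U a0. b \<le> a}. m b * (z b - M)) + (\<Sum>b\<in>{b\<in>A. a < b}. m b * (z b - M))"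
          by (subst sum.union_disjoint[symmetric])
            (use False fU psubset(1) in \<open>auto simp: U_def intro!: sum.cong\<close>)
        moreover have "(\<Sum>b\<in>{b\<in>A. a < b}. m b * (z b - M)) \<le> 0"
          by (rule upper) auto
        ultimately show ?thesis using U_0 by simp
      qed
    qed
    then show ?thesis by blast
  qed
qed

text \<open>This inequality characterizes the projection onto a convex cone. Summation by parts
  bounds the product of the residual with \<open>y\<close> by the largest value of \<open>y\<close>
  times the total residual, which is zero; and the residual is orthogonal to
  \<open>x\<close>.\<close>

lemma isotonic_regression_variational:
  assumes "finite A" "isotonic_regression A m z x" "mono_on A y"
  shows "(\<Sum>a\<in>A. m a * (z a - x a) * (x a - y a)) \<ge> 0"
proof -
  have 0: "(\<Sum>a\<in>A. m a * (z a - x a)) = 0"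
    using isotonic_regression_sum_zero[OF assms(1,2), of "\<lambda>_. 1"] by simp
  have "(\<Sum>a\<in>A. m a * (z a - x a) * y a) \<le> Max (y ` A) * (\<Sum>a\<in>A. m a * (z a - x a))"
    by (rule sum_mult_mono_nonpos) (use assms in \<open>auto simp: isotonic_regression_def\<close>)
  moreover have "(\<Sum>a\<in>A. m a * (z a - x a) * x a) = 0"
    using isotonic_regression_sum_zero[OF assms(1,2), of "\<lambda>t. t"] by simp
  ultimately show ?thesis using 0 by (simp add: right_diff_distrib sum_subtractf)
qed

definition neighbours :: "real set \<Rightarrow> real \<Rightarrow> real \<Rightarrow> bool" where
  "neighbours A p q \<longleftrightarrow> p \<in> A \<and> q \<in> A \<and> p < q \<and> A \<inter> {p<..<q} = {}"

text \<open>Gap estimates are available only for neighbouring particles; two arbitrary points are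
  compared by passing through the points between them.\<close>

lemma mono_on_neighbours:
  fixes f :: "real \<Rightarrow> real"
  assumes "finite A" and "\<And>p q. neighbours A p q \<Longrightarrow> f p \<le> f q"
  shows "mono_on A f"
proof -
  have "f p \<le> f q" if "p \<in> A" "q \<in> A" "p \<le> q" for p q
    using that
  proof (induction "card {b\<in>A. p < b \<and> b \<le> q}" arbitrary: p rule: less_induct)
    case less
    show ?case
    proof (cases "p = q")
      case False
      define B where "B = {b\<in>A. p < b}"
      have B: "finite B" "q \<in> B" using less False assms(1) by (auto simp: B_def)
      define r where "r = Min B"
      have r: "r \<in> A" "p < r" "r \<le> q" "\<And>b. b \<in> A \<Longrightarrow> p < b \<Longrightarrow> r \<le> b"
        using Min_in[OF B(1)] Min_le[OF B(1)] B(2) unfolding r_def by (auto simp: B_def)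
      have "f p \<le> f r" using r less by (intro assms(2)) (force simp: neighbours_def)
      also have "f r \<le> f q"
      proof (rule less.hyps)
        show "card {b\<in>A. r < b \<and> b \<le> q} < card {b\<in>A. p < b \<and> b \<le> q}"
          by (rule psubset_card_mono) (use r assms(1) in auto)
      qed (use r less in auto)
      finally show ?thesis .
    qed simp
  qed
  then show ?thesis by (auto simp: mono_on_def)
qed

text \<open>The conditional expectation of \<open>u\<close> given \<open>x\<close> under the masses
  \<open>m\<close>: the velocity of particles that have merged.\<close>

definition level_avg :: "real set \<Rightarrow> (real \<Rightarrow> real) \<Rightarrow> (real \<Rightarrow> real) \<Rightarrow> (real \<Rightarrow> real) \<Rightarrow> real \<Rightarrow> real" where
  "level_avg A m x u a = (\<Sum>b\<in>{b\<in>A. x b = x a}. m b * u b) / (\<Sum>b\<in>{b\<in>A. x b = x a}. m b)"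

context
  fixes A :: "real set" and m :: "real \<Rightarrow> real"
  assumes fin: "finite A" and pos: "\<And>a. a \<in> A \<Longrightarrow> m a > 0"
begin

lemma level_weight_pos: "a \<in> A \<Longrightarrow> (\<Sum>b\<in>{b\<in>A. x b = x a}. m b) > 0"
  by (rule sum_pos) (use fin pos in auto)

lemma level_avg_sum_zero:
  "(\<Sum>a\<in>A. m a * (u a - level_avg A m x u a) * \<phi> (x a)) = 0"
proof (rule sum_level_sets[OF fin, where x=x and w="\<lambda>a. m a * (u a - level_avg A m x u a)" and \<phi>=\<phi>])
  fix c
  show "(\<Sum>a\<in>{a\<in>A. x a = c}. m a * (u a - level_avg A m x u a)) = 0"
  proof (cases "{a\<in>A. x a = c} = {}")
    case False
    then obtain a where a: "a \<in> A" "x a = c" by auto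
    have e: "level_avg A m x u b = level_avg A m x u a" if "x b = c" for b
      using that a by (simp add: level_avg_def)
    have "(\<Sum>b\<in>{b\<in>A. x b = c}. m b * (u b - level_avg A m x u b))
       = (\<Sum>b\<in>{b\<in>A. x b = c}. m b * (u b - level_avg A m x u a))"
      by (rule sum.cong) (auto simp: e)
    also have "\<dots> = 0"
      using level_weight_pos[OF a(1), of x] a(2) sum_weighted_avg_zero[of m "{b\<in>A. x b = c}" u]
      by (simp add: level_avg_def)
    finally show ?thesis .
  qed (metis sum.empty)
qed

lemma level_avg_le:
  assumes "a \<in> A" "\<And>b. b \<in> A \<Longrightarrow> x b = x a \<Longrightarrow> u b \<le> B"
  shows "level_avg A m x u a \<le> B"
proof -
  have "(\<Sum>b\<in>{b\<in>A. x b = x a}. m b * u b) \<le> (\<Sum>b\<in>{b\<in>A. x b = x a}. m b * B)"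
    by (intro sum_mono mult_left_mono) (use assms pos in \<open>auto intro: less_imp_le\<close>)
  then show ?thesis
    using level_weight_pos[OF assms(1), of x]
    by (simp add: level_avg_def divide_le_eq mult.commute sum_distrib_left)
qed

lemma level_avg_ge:
  assumes "a \<in> A" "\<And>b. b \<in> A \<Longrightarrow> x b = x a \<Longrightarrow> B \<le> u b"
  shows "B \<le> level_avg A m x u a"
proof -
  have "(\<Sum>b\<in>{b\<in>A. x b = x a}. m b * B) \<le> (\<Sum>b\<in>{b\<in>A. x b = x a}. m b * u b)"
    by (intro sum_mono mult_left_mono) (use assms pos in \<open>auto intro: less_imp_le\<close>)
  then show ?thesis
    using level_weight_pos[OF assms(1), of x]
    by (simp add: level_avg_def le_divide_eq mult.commute sum_distrib_left)
qed

lemma isotonic_regression_level_avg: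
  assumes "isotonic_regression A m (\<lambda>a. x a + h * u a) x'" "a \<in> A"
  shows "x' a = level_avg A m x' x a + h * level_avg A m x' u a"
proof -
  let ?L = "{b\<in>A. x' b = x' a}"
  have "0 = (\<Sum>b\<in>?L. m b * (x b + h * u b - x' b))"
    using assms by (simp add: isotonic_regression_def)
  also have "\<dots> = (\<Sum>b\<in>?L. m b * x b) + h * (\<Sum>b\<in>?L. m b * u b) - (\<Sum>b\<in>?L. m b * x' b)"
    by (simp add: algebra_simps sum_subtractf sum.distrib sum_distrib_left)
  also have "(\<Sum>b\<in>?L. m b * x' b) = x' a * (\<Sum>b\<in>?L. m b)"
    by (simp add: sum_distrib_left mult.commute)
  finally show ?thesis
    using level_weight_pos[OF assms(2), of x'] by (simp add: level_avg_def field_simps)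
qed

text \<open>At a gap the initial segment up to \<open>p\<close> is a union of whole blocks, so the
  partial sum of the residual vanishes there. As the partial sums before \<open>p\<close> and at
  \<open>q\<close> are nonnegative, the summand at \<open>p\<close> is nonpositive and the one at
  \<open>q\<close> nonnegative.\<close>

lemma isotonic_regression_gap:
  assumes iso: "isotonic_regression A m z x" and pq: "neighbours A p q" and less: "x p < x q"
  shows "z p \<le> x p" "x q \<le> z q"
proof -
  let ?w = "\<lambda>b. m b * (z b - x b)"
  let ?S = "\<lambda>a. \<Sum>b\<in>{b\<in>A. b \<le> a}. ?w b"
  have p: "p \<in> A" "q \<in> A" "p < q" and nb: "\<And>b. b \<in> A \<Longrightarrow> p < b \<Longrightarrow> q \<le> b"
    using pq by (auto simp: neighbours_def)
  have mono: "\<And>a b. a \<in> A \<Longrightarrow> b \<in> A \<Longrightarrow> a \<le> b \<Longrightarrow> x a \<le> x b"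
    and S: "\<And>a. a \<in> A \<Longrightarrow> 0 \<le> ?S a"
    using iso by (auto simp: isotonic_regression_def mono_on_def)
  have "{b\<in>A. b \<le> p} = {b\<in>A. x b \<le> x p}"
    using mono[OF _ p(1)] mono[OF p(2)] nb less by (auto simp: not_le) (meson leD le_less_linear order_less_le_trans)
  then have "?S p = (\<Sum>b\<in>{b\<in>A. x b \<le> x p}. ?w b)" by simp
  also have "\<dots> = (\<Sum>b\<in>A. ?w b * (if x b \<le> x p then 1 else 0))"
    using fin by (simp add: sum.If_cases if_distrib Int_def cong: if_cong)
  also have "\<dots> = 0" by (rule isotonic_regression_sum_zero[OF fin iso])
  finally have Sp: "?S p = 0" .
  have "{b\<in>A. b \<le> q} = insert q {b\<in>A. b \<le> p}" using p nb by force
  then have "?S q = ?w q + ?S p" using fin p by simp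
  then show "x q \<le> z q" using S[OF p(2)] Sp pos[OF p(2)] by (simp add: zero_le_mult_iff)
  have "?S p = ?w p + (\<Sum>b\<in>{b\<in>A. b < p}. ?w b)"
  proof -
    have "{b\<in>A. b \<le> p} = insert p {b\<in>A. b < p}" using p by force
    then show ?thesis using fin by simp
  qed
  moreover have "0 \<le> (\<Sum>b\<in>{b\<in>A. b < p}. ?w b)"
  proof (cases "{b\<in>A. b < p} = {}")
    case False
    have r: "Max {b\<in>A. b < p} \<in> {b\<in>A. b < p}" by (rule Max_in) (use False fin in auto)
    have "{b\<in>A. b < p} = {b\<in>A. b \<le> Max {b\<in>A. b < p}}"
      using r Max_ge[of "{b\<in>A. b < p}"] fin by auto
    then show ?thesis using S[of "Max {b\<in>A. b < p}"] r by auto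
  qed (metis sum.empty order_refl)
  ultimately show "z p \<le> x p" using Sp pos[OF p(1)] by (simp add: add_nonneg_eq_0_iff mult_le_0_iff not_less)
     (smt (verit) mult_pos_pos)
qed

text \<open>First bound: collisions only slow the growth of a gap that survives. Second bound: the
  block of \<open>p\<close> lies to the left of \<open>p\<close> and that of \<open>q\<close> to the
  right of \<open>q\<close>, so averaging the old positions over blocks can only widen the old gap;
  hence the gap gains at least the difference of the averaged velocities.\<close>

lemma isotonic_step:
  assumes iso: "isotonic_regression A m (\<lambda>a. x a + h * u a) x'" and mono: "mono_on A x"
    and pq: "neighbours A p q" and less: "x' p < x' q"
  shows "x' q - x' p \<le> (x q - x p) + h * (u q - u p)"
    and "h * (level_avg A m x' u q - level_avg A m x' u p) \<le> (x' q - x' p) - (x q - x p)"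
proof -
  have p: "p \<in> A" "q \<in> A" "p < q" and nb: "\<And>b. b \<in> A \<Longrightarrow> p < b \<Longrightarrow> q \<le> b"
    using pq by (auto simp: neighbours_def)
  have mono': "\<And>a b. a \<in> A \<Longrightarrow> b \<in> A \<Longrightarrow> a \<le> b \<Longrightarrow> x' a \<le> x' b"
    using iso by (auto simp: isotonic_regression_def mono_on_def)
  show "x' q - x' p \<le> (x q - x p) + h * (u q - u p)"
    using isotonic_regression_gap[OF iso pq less] by (simp add: algebra_simps)
  have "level_avg A m x' x p \<le> x p"
  proof (rule level_avg_le[OF p(1)])
    fix b assume b: "b \<in> A" "x' b = x' p"
    then have "\<not> q \<le> b" using mono'[OF p(2) b(1)] less by auto
    then have "b \<le> p" using nb[OF b(1)] by force
    then show "x b \<le> x p" using mono b p by (auto simp: mono_on_def)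
  qed
  moreover have "x q \<le> level_avg A m x' x q"
  proof (rule level_avg_ge[OF p(2)])
    fix b assume b: "b \<in> A" "x' b = x' q"
    then have "\<not> b \<le> p" using mono'[OF b(1) p(1)] less by auto
    then have "q \<le> b" using nb[OF b(1)] by force
    then show "x q \<le> x b" using mono b p by (auto simp: mono_on_def)
  qed
  ultimately show "h * (level_avg A m x' u q - level_avg A m x' u p) \<le> (x' q - x' p) - (x q - x p)"
    using isotonic_regression_level_avg[OF iso p(1)] isotonic_regression_level_avg[OF iso p(2)]
    by (simp add: algebra_simps)
qed

end

section \<open>A sticky particle scheme\<close>

text \<open>Particles start at the points of \<open>A\<close>, with masses \<open>m\<close>. A step of length \<open>h\<close> moves them
  freely, lets those which meet stick together, and then adds the force with weight \<open>kappa\<close>. This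
  weight, instead of \<open>h\<close>, makes \<open>cosh\<close> and \<open>sinh\<close> of \<open>sqrt c * (k * h)\<close> exact solutions of the
  recursion that bounds the gaps between particles.\<close>

lemma le_sinh_real:
  assumes "0 \<le> (x::real)" shows "x \<le> sinh x"
proof -
  have "sinh 0 - 0 \<le> sinh x - x"
  proof (rule DERIV_nonneg_imp_nondecreasing[OF assms])
    fix t :: real
    have "((\<lambda>x. sinh x - x) has_real_derivative cosh t - 1) (at t)"
      by (auto intro!: derivative_eq_intros)
    then show "\<exists>y. ((\<lambda>x. sinh x - x) has_real_derivative y) (at t) \<and> 0 \<le> y"
      using cosh_real_ge_1[of t] by auto
  qed
  then show ?thesis by simp
qed

locale particle_scheme =
  fixes A :: "real set" and m W' v G :: "real \<Rightarrow> real" and c h :: real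
  assumes fin: "finite A" and pos: "\<And>a. a \<in> A \<Longrightarrow> m a > 0" and mass: "(\<Sum>a\<in>A. m a) = 1"
    and c: "c > 0" and h: "h > 0"
    and W'_mono: "\<And>x y. x \<le> y \<Longrightarrow> W' x + c * x \<le> W' y + c * y"
    and W'_odd: "\<And>x. W' (- x) = - W' x"
    and G_mono: "mono G"
    and v_le: "\<And>p q. p \<in> A \<Longrightarrow> q \<in> A \<Longrightarrow> p \<le> q \<Longrightarrow> v q - v p \<le> G q - G p"
begin

definition kappa :: real where "kappa = (2 * cosh (sqrt c * h) - 2) / (h * c)"

definition force :: "(real \<Rightarrow> real) \<Rightarrow> real \<Rightarrow> real" where
  "force x a = - (\<Sum>b\<in>A. m b * W' (x a - x b))"

text \<open>The force is evaluated at the new positions, so particles at one place leave the step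
  with one velocity.\<close>

definition step :: "(real \<Rightarrow> real) \<times> (real \<Rightarrow> real) \<Rightarrow> (real \<Rightarrow> real) \<times> (real \<Rightarrow> real)" where
  "step = (\<lambda>(x, u). let x' = SOME x'. isotonic_regression A m (\<lambda>a. x a + h * u a) x'
     in (x', \<lambda>a. level_avg A m x' u a + kappa * force x' a))"

definition pos_at :: "nat \<Rightarrow> real \<Rightarrow> real" where "pos_at k = fst ((step ^^ k) (\<lambda>a. a, v))"
definition vel_at :: "nat \<Rightarrow> real \<Rightarrow> real" where "vel_at k = snd ((step ^^ k) (\<lambda>a. a, v))"

definition free_vel :: "nat \<Rightarrow> real \<Rightarrow> real" where
  "free_vel k a = v a + (\<Sum>i<k. kappa * force (pos_at (Suc i)) a)"
definition free_pos :: "nat \<Rightarrow> real \<Rightarrow> real" where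
  "free_pos k a = a + (\<Sum>j<k. h * free_vel j a)"

text \<open>In continuous time this solves \<open>w'' = c * w\<close> with initial value
  \<open>a\<close> and initial velocity \<open>G a\<close>. Only differences between two points
  matter.\<close>

definition gap_bound :: "nat \<Rightarrow> real \<Rightarrow> real" where
  "gap_bound k a = cosh (sqrt c * (k * h)) * a + 1 / sqrt c * sinh (sqrt c * (k * h)) * G a"

lemma pos_at_0: "pos_at 0 = (\<lambda>a. a)" and vel_at_0: "vel_at 0 = v"
  by (simp_all add: pos_at_def vel_at_def)

lemma pos_at_Suc: "isotonic_regression A m (\<lambda>a. pos_at k a + h * vel_at k a) (pos_at (Suc k))"
proof -
  have "pos_at (Suc k) = (SOME x'. isotonic_regression A m (\<lambda>a. pos_at k a + h * vel_at k a) x')"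
    by (simp add: pos_at_def vel_at_def step_def case_prod_beta Let_def)
  moreover have "isotonic_regression A m (\<lambda>a. pos_at k a + h * vel_at k a)
      (SOME x'. isotonic_regression A m (\<lambda>a. pos_at k a + h * vel_at k a) x')"
    by (rule someI_ex[OF isotonic_regression_exists[OF fin pos]])
  ultimately show ?thesis by (simp only:)
qed

lemma vel_at_Suc:
  "vel_at (Suc k) a = level_avg A m (pos_at (Suc k)) (vel_at k) a + kappa * force (pos_at (Suc k)) a"
  by (simp add: pos_at_def vel_at_def step_def case_prod_beta Let_def)

lemma pos_at_mono: "mono_on A (pos_at k)"
proof (cases k)
  case (Suc j)
  then show ?thesis using pos_at_Suc[of j] by (simp add: isotonic_regression_def)
qed (simp add: pos_at_0 mono_on_def)

lemma kappa_pos: "kappa > 0"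
proof -
  have "cosh (sqrt c * h) > cosh 0" using c h by (subst cosh_real_nonneg_less_iff) auto
  then show ?thesis using c h by (simp add: kappa_def)
qed

lemma hkc: "kappa * (h * c) = 2 * cosh (sqrt c * h) - 2"
  using c h by (simp add: kappa_def)

text \<open>Semiconvexity bounds only repulsion. Attraction has no such bound, but it closes gaps,
  and gaps are to be bounded from above.\<close>

lemma force_le:
  assumes "x p \<le> x q"
  shows "force x q - force x p \<le> c * (x q - x p)"
proof -
  have "force x q - force x p = (\<Sum>b\<in>A. m b * (W' (x p - x b) - W' (x q - x b)))"
    by (simp add: force_def right_diff_distrib sum_subtractf)
  also have "\<dots> \<le> (\<Sum>b\<in>A. m b * (c * (x q - x p)))"
  proof (intro sum_mono mult_left_mono)
    fix b assume "b \<in> A"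
    show "W' (x p - x b) - W' (x q - x b) \<le> c * (x q - x p)"
      using W'_mono[of "x p - x b" "x q - x b"] assms by (simp add: algebra_simps)
    show "0 \<le> m b" using pos[OF \<open>b \<in> A\<close>] by simp
  qed
  also have "\<dots> = c * (x q - x p)" by (simp add: mass flip: sum_distrib_right)
  finally show ?thesis .
qed

lemma force_sum: "(\<Sum>a\<in>A. m a * force x a) = 0"
proof -
  define S where "S = (\<Sum>a\<in>A. \<Sum>b\<in>A. m a * m b * W' (x a - x b))"
  have "S = (\<Sum>b\<in>A. \<Sum>a\<in>A. m a * m b * W' (x a - x b))" unfolding S_def by (rule sum.swap)
  also have "\<dots> = (\<Sum>a\<in>A. \<Sum>b\<in>A. - (m a * m b * W' (x a - x b)))"
  proof (intro sum.cong refl)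
    fix a b
    show "m b * m a * W' (x b - x a) = - (m a * m b * W' (x a - x b))"
      using W'_odd[of "x a - x b"] by simp
  qed
  also have "\<dots> = - S" by (simp add: S_def sum_negf)
  finally have "S = 0" by simp
  then show ?thesis by (simp add: S_def force_def sum_distrib_left sum_negf mult.assoc)
qed

lemma cosh_rec: "cosh (sqrt c * (Suc (Suc k) * h)) = 2 * cosh (sqrt c * h) * cosh (sqrt c * (Suc k * h)) - cosh (sqrt c * (k * h))"
  and sinh_rec: "sinh (sqrt c * (Suc (Suc k) * h)) = 2 * cosh (sqrt c * h) * sinh (sqrt c * (Suc k * h)) - sinh (sqrt c * (k * h))"
proof -
  have 1: "sqrt c * (Suc (Suc k) * h) = sqrt c * (Suc k * h) + sqrt c * h"
    and 2: "sqrt c * (k * h) = sqrt c * (Suc k * h) - sqrt c * h" by (simp_all add: algebra_simps)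
  show "cosh (sqrt c * (Suc (Suc k) * h)) = 2 * cosh (sqrt c * h) * cosh (sqrt c * (Suc k * h)) - cosh (sqrt c * (k * h))"
    unfolding 1 2 cosh_add cosh_diff by (simp add: algebra_simps)
  show "sinh (sqrt c * (Suc (Suc k) * h)) = 2 * cosh (sqrt c * h) * sinh (sqrt c * (Suc k * h)) - sinh (sqrt c * (k * h))"
    unfolding 1 2 sinh_add sinh_diff by (simp add: algebra_simps)
qed

lemma gap_bound_rec:
  "gap_bound (Suc (Suc k)) a = 2 * cosh (sqrt c * h) * gap_bound (Suc k) a - gap_bound k a"
  unfolding gap_bound_def cosh_rec sinh_rec by (simp add: algebra_simps)

lemma time_step_mono: "sqrt c * (k * h) \<le> sqrt c * (Suc k * h)" "0 \<le> sqrt c * (real k * h)"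
  using c h by auto

lemma gap_bound_mono:
  assumes "p \<le> q"
  shows "0 \<le> gap_bound k q - gap_bound k p"
    "gap_bound k q - gap_bound k p \<le> gap_bound (Suc k) q - gap_bound (Suc k) p"
proof -
  have e: "gap_bound k q - gap_bound k p = cosh (sqrt c * (k * h)) * (q - p)
    + 1 / sqrt c * (sinh (sqrt c * (k * h)) * (G q - G p))" for k
    by (simp add: gap_bound_def algebra_simps)
  have g: "0 \<le> G q - G p" using monoD[OF G_mono assms] by simp
  have s: "0 \<le> sinh (sqrt c * (real k * h))" using time_step_mono(2)[of k] by simp
  show "0 \<le> gap_bound k q - gap_bound k p"
    unfolding e using g s assms c by (intro add_nonneg_nonneg mult_nonneg_nonneg) auto
  show "gap_bound k q - gap_bound k p \<le> gap_bound (Suc k) q - gap_bound (Suc k) p"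
  proof -
    have "cosh (sqrt c * (k * h)) \<le> cosh (sqrt c * (Suc k * h))"
      using time_step_mono[of k] time_step_mono(2)[of "Suc k"] by (subst cosh_real_nonneg_le_iff) auto
    moreover have "sinh (sqrt c * (k * h)) \<le> sinh (sqrt c * (Suc k * h))"
      unfolding sinh_real_le_iff by (rule time_step_mono)
    ultimately show ?thesis
      unfolding e using g assms c by (intro add_mono mult_left_mono mult_right_mono) auto
  qed
qed

lemma vel_at_eq: "pos_at (Suc k) p = pos_at (Suc k) q \<Longrightarrow> vel_at (Suc k) p = vel_at (Suc k) q"
  by (simp add: vel_at_Suc level_avg_def force_def)

text \<open>\<open>d\<close> is the gap, \<open>e\<close> what one free step would add to it,
  \<open>w\<close> the bound of (ii) and \<open>s\<close> the denominator of (iii). In each step the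
  pair is either stuck, with \<open>d\<close> and \<open>e\<close> zero, or obeys the two bounds of
  \<open>isotonic_step\<close> with the force estimated by \<open>L * d\<close>. Since
  \<open>w\<close> and \<open>s\<close> solve the resulting recursion with equality, they dominate.
  The recursion is of second order, so the induction must carry bounds for \<open>e\<close> as
  well.\<close>

lemma gap_invariant:
  assumes pq: "neighbours A p q"
  defines "d \<equiv> \<lambda>k. pos_at k q - pos_at k p"
    and "e \<equiv> \<lambda>k. h * (vel_at k q - vel_at k p)"
    and "w \<equiv> \<lambda>k. gap_bound k q - gap_bound k p"
    and "s \<equiv> \<lambda>k. sinh (sqrt c * (real k * h))"
  shows "d k \<le> w k \<and> e k \<le> w (Suc k) - w k \<and> e k * s k \<le> d k * (s (Suc k) - s k) \<and>
    (d (Suc k) * s k \<le> d k * s (Suc k))"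
proof -
  have pq': "p \<in> A" "q \<in> A" "p \<le> q" using pq by (auto simp: neighbours_def)
  define L where "L = 2 * cosh (sqrt c * h) - 2"
  have L: "L \<ge> 0" using cosh_real_ge_1[of "sqrt c * h"] by (simp add: L_def)
  have w_rec: "w (Suc (Suc k)) = (L + 2) * w (Suc k) - w k" for k
    by (simp add: w_def gap_bound_rec L_def algebra_simps)
  have s_rec: "s (Suc (Suc k)) = (L + 2) * s (Suc k) - s k" for k
    unfolding s_def sinh_rec by (simp add: L_def)
  have s_mono: "0 \<le> s k" "s k \<le> s (Suc k)" for k using time_step_mono[of k] by (auto simp: s_def)
  have w_mono: "0 \<le> w k" "w k \<le> w (Suc k)" for k
    using gap_bound_mono[OF pq'(3)] by (auto simp: w_def)
  have d0: "0 \<le> d k" for k using pos_at_mono[of k] pq' by (auto simp: d_def mono_on_def)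
  have step: "(d (Suc k) = 0 \<and> e (Suc k) = 0) \<or>
     (d (Suc k) \<le> d k + e k \<and> e (Suc k) \<le> d (Suc k) - d k + L * d (Suc k))" for k
  proof (cases "d (Suc k) = 0")
    case True
    then show ?thesis using vel_at_eq[of k q p] by (simp add: d_def e_def)
  next
    case False
    then have lt: "pos_at (Suc k) p < pos_at (Suc k) q" using d0[of "Suc k"] by (simp add: d_def)
    note st = isotonic_step[OF fin pos pos_at_Suc pos_at_mono pq lt]
    have e1: "e (Suc k) = h * (level_avg A m (pos_at (Suc k)) (vel_at k) q - level_avg A m (pos_at (Suc k)) (vel_at k) p)
      + kappa * h * (force (pos_at (Suc k)) q - force (pos_at (Suc k)) p)"
      by (simp add: e_def vel_at_Suc algebra_simps)
    have e2: "kappa * h * (force (pos_at (Suc k)) q - force (pos_at (Suc k)) p) \<le> kappa * h * (c * d (Suc k))"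
      using force_le[of "pos_at (Suc k)" p q] lt kappa_pos h
      by (intro mult_left_mono) (auto simp: d_def)
    have e3: "kappa * h * (c * d (Suc k)) = L * d (Suc k)"
      unfolding L_def hkc[symmetric] by (simp add: mult.assoc)
    have "e (Suc k) \<le> d (Suc k) - d k + L * d (Suc k)"
      using st(2) e2 unfolding e1 e3 by (simp add: d_def)
    then show ?thesis using st(1) by (simp add: d_def e_def)
  qed
  have last: "d (Suc k) * s k \<le> d k * s (Suc k)" if "e k * s k \<le> d k * (s (Suc k) - s k)" for k
  proof -
    from step[of k] consider "d (Suc k) = 0" | "d (Suc k) \<le> d k + e k" by blast
    then show ?thesis
    proof cases
      case 1
      then show ?thesis using d0[of k] s_mono[of "Suc k"] by simp
    next
      case 2
      then have "d (Suc k) * s k \<le> (d k + e k) * s k" using s_mono by (intro mult_right_mono) auto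
      then show ?thesis using that by (simp add: algebra_simps)
    qed
  qed
  show ?thesis
  proof (induction k)
    case 0
    \<comment> \<open>The free motion starts with at most \<open>h * (G q - G p)\<close>; the first
      increment of \<open>w\<close> has \<open>sinh (sqrt c * h) / sqrt c\<close> in place of
      \<open>h\<close>, which is no smaller.\<close>
    have "sqrt c * h \<le> sinh (sqrt c * h)"
      using c h by (intro le_sinh_real) auto
    then have "h \<le> 1 / sqrt c * sinh (sqrt c * h)" using c by (simp add: field_simps)
    then have "h * (G q - G p) \<le> 1 / sqrt c * sinh (sqrt c * h) * (G q - G p)"
      using monoD[OF G_mono pq'(3)] by (intro mult_right_mono) auto
    moreover have "e 0 \<le> h * (G q - G p)"
      using v_le[OF pq'] h by (auto simp: e_def vel_at_0 intro!: mult_left_mono)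
    moreover have "w (Suc 0) - w 0 = (cosh (sqrt c * h) - 1) * (q - p) + 1 / sqrt c * sinh (sqrt c * h) * (G q - G p)"
      by (simp add: w_def gap_bound_def diff_divide_distrib algebra_simps)
    moreover have "0 \<le> (cosh (sqrt c * h) - 1) * (q - p)"
      using cosh_real_ge_1[of "sqrt c * h"] pq' by simp
    ultimately have "e 0 \<le> w (Suc 0) - w 0" by linarith
    moreover have "s 0 = 0" by (simp add: s_def)
    moreover have "d 0 \<le> w 0" by (simp add: d_def w_def gap_bound_def pos_at_0)
    ultimately show ?case using d0[of 0] s_mono(1)[of "Suc 0"] by simp
  next
    case (Suc k)
    have main: "d (Suc k) \<le> w (Suc k)" "e (Suc k) \<le> w (Suc (Suc k)) - w (Suc k)"
      "e (Suc k) * s (Suc k) \<le> d (Suc k) * (s (Suc (Suc k)) - s (Suc k))"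
    proof -
      consider "d (Suc k) = 0 \<and> e (Suc k) = 0" |
        "d (Suc k) \<le> d k + e k \<and> e (Suc k) \<le> d (Suc k) - d k + L * d (Suc k)"
        using step[of k] by blast
      then have "d (Suc k) \<le> w (Suc k) \<and> e (Suc k) \<le> w (Suc (Suc k)) - w (Suc k) \<and>
        e (Suc k) * s (Suc k) \<le> d (Suc k) * (s (Suc (Suc k)) - s (Suc k))"
      proof cases
        case 1
        then show ?thesis using w_mono by simp
      next
        case 2
        have d1: "d (Suc k) \<le> w (Suc k)" using 2 Suc by linarith
        then have "L * d (Suc k) \<le> L * w (Suc k)" using L by (rule mult_left_mono)
        then have e1: "e (Suc k) \<le> w (Suc (Suc k)) - w (Suc k)"
          using 2 Suc unfolding w_rec by (simp add: algebra_simps)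
        have "e (Suc k) * s (Suc k) \<le> (d (Suc k) - d k + L * d (Suc k)) * s (Suc k)"
          using 2 s_mono by (intro mult_right_mono) auto
        \<comment> \<open>The last part of the induction hypothesis replaces
          \<open>d k * s (Suc k)\<close> by \<open>d (Suc k) * s k\<close>, and the recursion for
          \<open>s\<close> collects the rest.\<close>
        also have "\<dots> \<le> d (Suc k) * (s (Suc (Suc k)) - s (Suc k))"
          using Suc unfolding s_rec by (simp add: algebra_simps)
        finally show ?thesis using d1 e1 by blast
      qed
      then show "d (Suc k) \<le> w (Suc k)" "e (Suc k) \<le> w (Suc (Suc k)) - w (Suc k)"
        "e (Suc k) * s (Suc k) \<le> d (Suc k) * (s (Suc (Suc k)) - s (Suc k))" by auto
    qed
    then show ?case using last by blast
  qed
qed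

lemma pos_at_gap_le:
  assumes "p \<in> A" "q \<in> A" "p \<le> q"
  shows "pos_at k q - pos_at k p \<le> gap_bound k q - gap_bound k p"
proof -
  have "mono_on A (\<lambda>a. gap_bound k a - pos_at k a)"
  proof (rule mono_on_neighbours[OF fin])
    fix p q assume "neighbours A p q"
    from gap_invariant[OF this, of k]
    show "gap_bound k p - pos_at k p \<le> gap_bound k q - pos_at k q" by simp
  qed
  then show ?thesis using assms by (auto simp: mono_on_def algebra_simps)
qed

lemma pos_at_gap_Suc:
  assumes "p \<in> A" "q \<in> A" "p \<le> q"
  shows "(pos_at (Suc k) q - pos_at (Suc k) p) * sinh (sqrt c * (real k * h))
    \<le> (pos_at k q - pos_at k p) * sinh (sqrt c * (real (Suc k) * h))"
proof -
  have "mono_on A (\<lambda>a. pos_at k a * sinh (sqrt c * (real (Suc k) * h)) - pos_at (Suc k) a * sinh (sqrt c * (real k * h)))"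
  proof (rule mono_on_neighbours[OF fin])
    fix p q assume "neighbours A p q"
    from gap_invariant[OF this, of k]
    show "pos_at k p * sinh (sqrt c * (real (Suc k) * h)) - pos_at (Suc k) p * sinh (sqrt c * (real k * h))
      \<le> pos_at k q * sinh (sqrt c * (real (Suc k) * h)) - pos_at (Suc k) q * sinh (sqrt c * (real k * h))"
      by (simp add: left_diff_distrib)
  qed
  then show ?thesis using assms by (auto simp: mono_on_def left_diff_distrib algebra_simps)
qed

lemma pos_at_gap_sinh:
  assumes "p \<in> A" "q \<in> A" "p \<le> q" "0 < j" "j \<le> k"
  shows "(pos_at k q - pos_at k p) / sinh (sqrt c * (real k * h))
    \<le> (pos_at j q - pos_at j p) / sinh (sqrt c * (real j * h))"
  using assms(5)
proof (induction k rule: dec_induct)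
  case (step k)
  have s: "sinh (sqrt c * (real i * h)) > 0" if "0 < i" for i :: nat
    using that c h by simp
  have "(pos_at (Suc k) q - pos_at (Suc k) p) / sinh (sqrt c * (real (Suc k) * h))
     \<le> (pos_at k q - pos_at k p) / sinh (sqrt c * (real k * h))"
    using pos_at_gap_Suc[OF assms(1-3), of k] s[of k] s[of "Suc k"] step assms(4)
    by (simp add: divide_le_eq le_divide_eq mult.commute del: of_nat_Suc)
  also note step.IH
  finally show ?case .
qed simp

text \<open>A zero gap stays zero by the monotonicity behind (iii). At \<open>k = 0\<close> the
  factor \<open>sinh 0\<close> gives no information, but there the positions are the starting points
  themselves.\<close>

lemma pos_at_stick:
  assumes "p \<in> A" "q \<in> A" "pos_at k p = pos_at k q"
  shows "pos_at (Suc k) p = pos_at (Suc k) q"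
proof (cases "k = 0")
  case False
  then have s: "sinh (sqrt c * (real k * h)) > 0" using c h by simp
  have "pos_at (Suc k) p = pos_at (Suc k) q"
    if "p \<in> A" "q \<in> A" "p \<le> q" "pos_at k p = pos_at k q" for p q
  proof -
    have "(pos_at (Suc k) q - pos_at (Suc k) p) * sinh (sqrt c * (real k * h)) \<le> 0"
      using pos_at_gap_Suc[OF that(1-3), of k] that(4) by simp
    then have "pos_at (Suc k) q - pos_at (Suc k) p \<le> 0" using s by (meson mult_pos_pos not_le)
    moreover have "pos_at (Suc k) p \<le> pos_at (Suc k) q"
      using pos_at_mono[of "Suc k"] that by (auto simp: mono_on_def)
    ultimately show ?thesis by simp
  qed
  then show ?thesis using assms by (metis linear)
qed (use assms in \<open>simp add: pos_at_0\<close>)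

lemma factor_through:
  assumes "\<And>a b. a \<in> A \<Longrightarrow> b \<in> A \<Longrightarrow> g a = g b \<Longrightarrow> f a = f b"
  shows "\<exists>\<phi>. \<forall>a\<in>A. f a = \<phi> (g a)"
proof (intro exI ballI)
  fix a assume a: "a \<in> A"
  have "(SOME b. b \<in> A \<and> g b = g a) \<in> A \<and> g (SOME b. b \<in> A \<and> g b = g a) = g a"
    by (rule someI[of _ a]) (use a in simp)
  then show "f a = (\<lambda>t. f (SOME b. b \<in> A \<and> g b = t)) (g a)" using assms[OF a] by auto
qed

lemma pos_at_factor: "\<exists>f. \<forall>a\<in>A. pos_at (Suc k) a = f (pos_at k a)"
  by (rule factor_through[where g="pos_at k" and f="pos_at (Suc k)"]) (rule pos_at_stick)

text \<open>The force is the same for both velocities and cancels in their difference. A test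
  function of the later position is one of the earlier position, because stuck particles stay
  together, so the induction hypothesis covers it; merging adds a residual of mean zero on each
  block.\<close>

lemma free_vel_orthogonal: "(\<Sum>a\<in>A. m a * (free_vel k a - vel_at k a) * \<phi> (pos_at k a)) = 0"
proof (induction k arbitrary: \<phi>)
  case 0
  then show ?case by (simp add: free_vel_def vel_at_0)
next
  case (Suc k)
  obtain f where f: "\<And>a. a \<in> A \<Longrightarrow> pos_at (Suc k) a = f (pos_at k a)"
    using pos_at_factor[of k] by auto
  have "(\<Sum>a\<in>A. m a * (free_vel (Suc k) a - vel_at (Suc k) a) * \<phi> (pos_at (Suc k) a))
    = (\<Sum>a\<in>A. m a * (free_vel k a - vel_at k a) * \<phi> (f (pos_at k a)))
    + (\<Sum>a\<in>A. m a * (vel_at k a - level_avg A m (pos_at (Suc k)) (vel_at k) a) * \<phi> (pos_at (Suc k) a))"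
    unfolding sum.distrib[symmetric]
    by (intro sum.cong refl) (simp add: free_vel_def vel_at_Suc f algebra_simps)
  then show ?case using Suc[of "\<lambda>t. \<phi> (f t)"] level_avg_sum_zero[OF fin pos] by simp
qed

lemma free_pos_orthogonal: "(\<Sum>a\<in>A. m a * (free_pos k a - pos_at k a) * \<phi> (pos_at k a)) = 0"
proof (induction k arbitrary: \<phi>)
  case 0
  then show ?case by (simp add: free_pos_def pos_at_0)
next
  case (Suc k)
  obtain f where f: "\<And>a. a \<in> A \<Longrightarrow> pos_at (Suc k) a = f (pos_at k a)"
    using pos_at_factor[of k] by auto
  have "(\<Sum>a\<in>A. m a * (free_pos (Suc k) a - pos_at (Suc k) a) * \<phi> (pos_at (Suc k) a))
    = (\<Sum>a\<in>A. m a * (free_pos k a - pos_at k a) * \<phi> (f (pos_at k a)))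
    + h * (\<Sum>a\<in>A. m a * (free_vel k a - vel_at k a) * \<phi> (f (pos_at k a)))
    + (\<Sum>a\<in>A. m a * ((pos_at k a + h * vel_at k a) - pos_at (Suc k) a) * \<phi> (pos_at (Suc k) a))"
    unfolding sum.distrib[symmetric] sum_distrib_left
    by (intro sum.cong refl) (simp add: free_pos_def f algebra_simps)
  then show ?case
    using Suc[of "\<lambda>t. \<phi> (f t)"] free_vel_orthogonal[of k "\<lambda>t. \<phi> (f t)"]
      isotonic_regression_sum_zero[OF fin pos_at_Suc] by simp
qed

lemma sum_sq_le_of_inner:
  assumes "(\<Sum>a\<in>A. m a * (f a)\<^sup>2) \<le> (\<Sum>a\<in>A. m a * (g a * f a))"
  shows "(\<Sum>a\<in>A. m a * (f a)\<^sup>2) \<le> (\<Sum>a\<in>A. m a * (g a)\<^sup>2)"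
proof -
  have "0 \<le> (\<Sum>a\<in>A. m a * (g a - f a)\<^sup>2)" by (intro sum_nonneg mult_nonneg_nonneg less_imp_le[OF pos]) auto
  also have "\<dots> = (\<Sum>a\<in>A. m a * (g a)\<^sup>2) - 2 * (\<Sum>a\<in>A. m a * (g a * f a)) + (\<Sum>a\<in>A. m a * (f a)\<^sup>2)"
    unfolding sum_distrib_left sum.distrib[symmetric] sum_subtractf[symmetric]
    by (intro sum.cong refl) (simp add: power2_eq_square algebra_simps)
  finally show ?thesis using assms by simp
qed

lemma vel_at_energy: "(\<Sum>a\<in>A. m a * (vel_at k a)\<^sup>2) \<le> (\<Sum>a\<in>A. m a * (free_vel k a)\<^sup>2)"
proof (rule sum_sq_le_of_inner)
  have "\<exists>\<phi>. \<forall>a\<in>A. vel_at k a = \<phi> (pos_at k a)"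
  proof (cases k)
    case 0
    then show ?thesis by (auto simp: pos_at_0)
  next
    case (Suc j)
    show ?thesis
      unfolding Suc
      by (rule factor_through[where g="pos_at (Suc j)" and f="vel_at (Suc j)"]) (rule vel_at_eq)
  qed
  then obtain \<phi> where "\<And>a. a \<in> A \<Longrightarrow> vel_at k a = \<phi> (pos_at k a)" by auto
  then have "(\<Sum>a\<in>A. m a * (free_vel k a - vel_at k a) * vel_at k a) = 0"
    using free_vel_orthogonal[of k \<phi>] by simp
  then show "(\<Sum>a\<in>A. m a * (vel_at k a)\<^sup>2) \<le> (\<Sum>a\<in>A. m a * (free_vel k a * vel_at k a))"
    by (simp add: power2_eq_square right_diff_distrib left_diff_distrib sum_subtractf mult.assoc)
qed

text \<open>The old positions are monotone, hence admissible in the variational inequality, so a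
  step moves no farther in mean square than the free motion \<open>h * vel_at k\<close>. Merging
  does not raise kinetic energy, which brings in \<open>free_vel\<close>, a velocity with an
  explicit formula.\<close>

lemma pos_at_step: "(\<Sum>a\<in>A. m a * (pos_at (Suc k) a - pos_at k a)\<^sup>2) \<le> h\<^sup>2 * (\<Sum>a\<in>A. m a * (free_vel k a)\<^sup>2)"
proof -
  have "(\<Sum>a\<in>A. m a * (pos_at (Suc k) a - pos_at k a)\<^sup>2) \<le> (\<Sum>a\<in>A. m a * (h * vel_at k a)\<^sup>2)"
  proof (rule sum_sq_le_of_inner)
    have "0 \<le> (\<Sum>a\<in>A. m a * ((pos_at k a + h * vel_at k a) - pos_at (Suc k) a) * (pos_at (Suc k) a - pos_at k a))"
      by (rule isotonic_regression_variational[OF fin pos_at_Suc pos_at_mono])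
    also have "\<dots> = (\<Sum>a\<in>A. m a * (h * vel_at k a * (pos_at (Suc k) a - pos_at k a)))
       - (\<Sum>a\<in>A. m a * (pos_at (Suc k) a - pos_at k a)\<^sup>2)"
      unfolding sum_subtractf[symmetric]
      by (intro sum.cong refl) (simp add: power2_eq_square algebra_simps)
    finally show "(\<Sum>a\<in>A. m a * (pos_at (Suc k) a - pos_at k a)\<^sup>2)
      \<le> (\<Sum>a\<in>A. m a * (h * vel_at k a * (pos_at (Suc k) a - pos_at k a)))" by simp
  qed
  also have "\<dots> = h\<^sup>2 * (\<Sum>a\<in>A. m a * (vel_at k a)\<^sup>2)"
    by (simp add: power_mult_distrib sum_distrib_left algebra_simps)
  also have "\<dots> \<le> h\<^sup>2 * (\<Sum>a\<in>A. m a * (free_vel k a)\<^sup>2)"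
    using vel_at_energy by (intro mult_left_mono) auto
  finally show ?thesis .
qed

text \<open>Gap bounds leave a common translation free, and this identity fixes it. Forces cancel in
  pairs, and the residual is orthogonal to constants.\<close>

lemma momentum: "(\<Sum>a\<in>A. m a * pos_at k a) = (\<Sum>a\<in>A. m a * a) + k * h * (\<Sum>a\<in>A. m a * v a)"
proof -
  have V: "(\<Sum>a\<in>A. m a * free_vel k a) = (\<Sum>a\<in>A. m a * v a)" for k
  proof (induction k)
    case (Suc k)
    have "(\<Sum>a\<in>A. m a * free_vel (Suc k) a) = (\<Sum>a\<in>A. m a * free_vel k a)
      + kappa * (\<Sum>a\<in>A. m a * force (pos_at (Suc k)) a)"
      unfolding sum_distrib_left sum.distrib[symmetric]
      by (intro sum.cong refl) (simp add: free_vel_def algebra_simps)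
    then show ?case using Suc by (simp add: force_sum)
  qed (simp add: free_vel_def)
  have "(\<Sum>a\<in>A. m a * pos_at k a) = (\<Sum>a\<in>A. m a * free_pos k a)"
    using free_pos_orthogonal[of k "\<lambda>_. 1"] by (simp add: right_diff_distrib sum_subtractf)
  also have "\<dots> = (\<Sum>a\<in>A. m a * a) + k * h * (\<Sum>a\<in>A. m a * v a)"
  proof (induction k)
    case (Suc k)
    have "(\<Sum>a\<in>A. m a * free_pos (Suc k) a) = (\<Sum>a\<in>A. m a * free_pos k a)
      + h * (\<Sum>a\<in>A. m a * free_vel k a)"
      unfolding sum_distrib_left sum.distrib[symmetric]
      by (intro sum.cong refl) (simp add: free_pos_def algebra_simps)
    then show ?case using Suc by (simp add: V algebra_simps)
  qed (simp add: free_pos_def)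
  finally show ?thesis .
qed

end

section \<open>The space of square integrable functions\<close>

lemma L2_borel [measurable_dest]: "f \<in> L2 M \<Longrightarrow> f \<in> borel_measurable M"
  by (simp add: L2_def)

lemma L2_integrable_sq: "f \<in> L2 M \<Longrightarrow> integrable M (\<lambda>y. (f y)\<^sup>2)"
  by (simp add: L2_def)

lemma L2_dominated:
  assumes "g \<in> L2 M" "f \<in> borel_measurable M" "AE y in M. \<bar>f y\<bar> \<le> \<bar>g y\<bar>"
  shows "f \<in> L2 M"
proof -
  have "AE y in M. norm ((f y)\<^sup>2) \<le> norm ((g y)\<^sup>2)"
    using assms(3) by eventually_elim (simp add: abs_le_square_iff)
  then have "integrable M (\<lambda>y. (f y)\<^sup>2)"
    using assms(1,2) by (intro Bochner_Integration.integrable_bound[OF L2_integrable_sq[OF assms(1)]]) auto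
  then show ?thesis using assms(2) by (simp add: L2_def)
qed

lemma L2_mult_integrable:
  assumes "f \<in> L2 M" "g \<in> L2 M" shows "integrable M (\<lambda>y. f y * g y)"
proof (rule Bochner_Integration.integrable_bound)
  show "integrable M (\<lambda>y. (f y)\<^sup>2 + (g y)\<^sup>2)"
    using assms by (intro Bochner_Integration.integrable_add L2_integrable_sq)
  have "\<bar>a * b\<bar> \<le> a\<^sup>2 + b\<^sup>2" for a b :: real
  proof -
    have "2 * (\<bar>a\<bar> * \<bar>b\<bar>) \<le> a\<^sup>2 + b\<^sup>2"
      using zero_le_power2[of "\<bar>a\<bar> - \<bar>b\<bar>"] by (simp add: power2_diff)
    moreover have "0 \<le> \<bar>a\<bar> * \<bar>b\<bar>" by simp
    ultimately show ?thesis unfolding abs_mult by linarith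
  qed
  then show "AE y in M. norm (f y * g y) \<le> norm ((f y)\<^sup>2 + (g y)\<^sup>2)" by simp
qed (use assms in auto)

lemma L2_cmult: assumes "f \<in> L2 M" shows "(\<lambda>y. c * f y) \<in> L2 M"
  unfolding L2_def using L2_borel[OF assms] L2_integrable_sq[OF assms]
  by (simp add: power_mult_distrib)

lemma L2_add: assumes "f \<in> L2 M" "g \<in> L2 M" shows "(\<lambda>y. f y + g y) \<in> L2 M"
  using assms L2_integrable_sq L2_mult_integrable[OF assms]
  by (auto simp: L2_def power2_sum mult.assoc intro!: Bochner_Integration.integrable_add)

lemma L2_diff: assumes "f \<in> L2 M" "g \<in> L2 M" shows "(\<lambda>y. f y - g y) \<in> L2 M"
  using L2_add[OF assms(1) L2_cmult[OF assms(2), of "-1"]] by simp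

lemma L2_zero: "(\<lambda>_. 0) \<in> L2 M" by (simp add: L2_def)

lemma L2_sum: "finite I \<Longrightarrow> (\<And>i. i \<in> I \<Longrightarrow> f i \<in> L2 M) \<Longrightarrow> (\<lambda>y. \<Sum>i\<in>I. f i y) \<in> L2 M"
  by (induction I rule: finite_induct) (auto intro: L2_add L2_zero)

lemma L2_abs: assumes "f \<in> L2 M" shows "(\<lambda>y. \<bar>f y\<bar>) \<in> L2 M"
  unfolding L2_def using L2_borel[OF assms] L2_integrable_sq[OF assms] by simp

lemma L2_norm_nonneg: "0 \<le> L2_norm M f" by (simp add: L2_norm_def)

lemma L2_norm_sq: "(L2_norm M f)\<^sup>2 = (\<integral>y. (f y)\<^sup>2 \<partial>M)"
  by (simp add: L2_norm_def)

lemma L2_norm_minus_commute: "L2_norm M (\<lambda>y. f y - g y) = L2_norm M (\<lambda>y. g y - f y)"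
  by (simp add: L2_norm_def power2_commute)

lemma L2_norm_cmult: "L2_norm M (\<lambda>y. c * f y) = \<bar>c\<bar> * L2_norm M f"
  by (simp add: L2_norm_def power_mult_distrib real_sqrt_mult)

lemma L2_norm_cong_AE:
  assumes "f \<in> borel_measurable M" "g \<in> borel_measurable M" "AE y in M. f y = g y"
  shows "L2_norm M f = L2_norm M g"
proof -
  have "(\<integral>y. (f y)\<^sup>2 \<partial>M) = (\<integral>y. (g y)\<^sup>2 \<partial>M)"
    using assms by (intro integral_cong_AE) auto
  then show ?thesis by (simp add: L2_norm_def)
qed

lemma L2_norm_mono:
  assumes "g \<in> L2 M" "f \<in> L2 M" "AE y in M. \<bar>f y\<bar> \<le> \<bar>g y\<bar>"
  shows "L2_norm M f \<le> L2_norm M g"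
proof -
  have "AE y in M. (f y)\<^sup>2 \<le> (g y)\<^sup>2"
    using assms(3) by eventually_elim (simp add: abs_le_square_iff)
  then show ?thesis unfolding L2_norm_def
    by (intro real_sqrt_le_mono integral_mono_AE L2_integrable_sq assms)
qed

lemma L2_Cauchy_Schwarz:
  assumes f: "f \<in> L2 M" and g: "g \<in> L2 M"
  shows "\<bar>\<integral>y. f y * g y \<partial>M\<bar> \<le> L2_norm M f * L2_norm M g"
proof -
  define A where "A = (\<integral>y. (f y)\<^sup>2 \<partial>M)"
  define B where "B = (\<integral>y. f y * g y \<partial>M)"
  define C where "C = (\<integral>y. (g y)\<^sup>2 \<partial>M)"
  have quad: "0 \<le> A - 2 * s * B + s\<^sup>2 * C" for s
  proof -
    have "0 \<le> (\<integral>y. (f y - s * g y)\<^sup>2 \<partial>M)" by simp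
    also have "\<dots> = (\<integral>y. (f y)\<^sup>2 - 2 * s * (f y * g y) + s\<^sup>2 * (g y)\<^sup>2 \<partial>M)"
      by (rule Bochner_Integration.integral_cong) (auto simp: power2_eq_square algebra_simps)
    also have "\<dots> = A - 2 * s * B + s\<^sup>2 * C"
      using L2_integrable_sq[OF f] L2_integrable_sq[OF g] L2_mult_integrable[OF f g]
      by (simp add: A_def B_def C_def)
    finally show ?thesis .
  qed
  have AC: "0 \<le> A" "0 \<le> C" by (simp_all add: A_def C_def)
  have "B\<^sup>2 \<le> A * C"
  proof (cases "C = 0")
    case True
    have "B = 0"
    proof (rule ccontr)
      assume "B \<noteq> 0"
      \<comment> \<open>With \<open>C = 0\<close> the quadratic is linear in \<open>s\<close>, and
        this \<open>s\<close> gives it the value -1.\<close>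
      then show False using quad[of "(A + 1) / (2 * B)"] True by simp
    qed
    then show ?thesis using AC by simp
  next
    case False
    then have "0 \<le> A - B\<^sup>2 / C" using quad[of "B / C"] by (simp add: power2_eq_square field_simps)
    then show ?thesis using False AC by (simp add: field_simps)
  qed
  then have "sqrt (B\<^sup>2) \<le> sqrt (A * C)" by (rule real_sqrt_le_mono)
  then show ?thesis by (simp add: A_def B_def C_def L2_norm_def real_sqrt_mult)
qed

lemma L2_norm_triangle:
  assumes f: "f \<in> L2 M" and g: "g \<in> L2 M"
  shows "L2_norm M (\<lambda>y. f y + g y) \<le> L2_norm M f + L2_norm M g"
proof (rule power2_le_imp_le)
  have "(L2_norm M (\<lambda>y. f y + g y))\<^sup>2 = (\<integral>y. (f y)\<^sup>2 + 2 * (f y * g y) + (g y)\<^sup>2 \<partial>M)"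
    unfolding L2_norm_sq by (rule Bochner_Integration.integral_cong) (auto simp: power2_eq_square algebra_simps)
  also have "\<dots> = (L2_norm M f)\<^sup>2 + 2 * (\<integral>y. f y * g y \<partial>M) + (L2_norm M g)\<^sup>2"
    using L2_integrable_sq[OF f] L2_integrable_sq[OF g] L2_mult_integrable[OF f g] by (simp add: L2_norm_sq)
  also have "\<dots> \<le> (L2_norm M f + L2_norm M g)\<^sup>2"
    using L2_Cauchy_Schwarz[OF f g] by (simp add: power2_sum)
  finally show "(L2_norm M (\<lambda>y. f y + g y))\<^sup>2 \<le> (L2_norm M f + L2_norm M g)\<^sup>2" .
qed (simp add: L2_norm_nonneg)

lemma L2_norm_triangle_diff:
  assumes f: "f \<in> L2 M" and g: "g \<in> L2 M" and k: "k \<in> L2 M"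
  shows "L2_norm M (\<lambda>y. f y - k y) \<le> L2_norm M (\<lambda>y. f y - g y) + L2_norm M (\<lambda>y. g y - k y)"
  using L2_norm_triangle[OF L2_diff[OF f g] L2_diff[OF g k]] by simp

lemma L2_norm_sum_le:
  "finite I \<Longrightarrow> (\<And>i. i \<in> I \<Longrightarrow> f i \<in> L2 M) \<Longrightarrow>
   L2_norm M (\<lambda>y. \<Sum>i\<in>I. f i y) \<le> (\<Sum>i\<in>I. L2_norm M (f i))"
proof (induction I rule: finite_induct)
  case empty
  then show ?case by (simp add: L2_norm_def)
next
  case (insert i I)
  have "L2_norm M (\<lambda>y. \<Sum>i\<in>insert i I. f i y) = L2_norm M (\<lambda>y. f i y + (\<Sum>i\<in>I. f i y))"
    using insert by simp
  also have "\<dots> \<le> L2_norm M (f i) + L2_norm M (\<lambda>y. \<Sum>i\<in>I. f i y)"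
    using insert by (intro L2_norm_triangle L2_sum) auto
  finally show ?case using insert by simp
qed

lemma L2_norm_orthogonal_sum:
  assumes "finite I" "\<And>i. i \<in> I \<Longrightarrow> f i \<in> L2 M"
    and "\<And>i j. i \<in> I \<Longrightarrow> j \<in> I \<Longrightarrow> i \<noteq> j \<Longrightarrow> (\<integral>y. f i y * f j y \<partial>M) = 0"
  shows "(L2_norm M (\<lambda>y. \<Sum>i\<in>I. f i y))\<^sup>2 = (\<Sum>i\<in>I. (L2_norm M (f i))\<^sup>2)"
proof -
  have "(L2_norm M (\<lambda>y. \<Sum>i\<in>I. f i y))\<^sup>2 = (\<integral>y. (\<Sum>i\<in>I. \<Sum>j\<in>I. f i y * f j y) \<partial>M)"
    unfolding L2_norm_sq by (simp add: power2_eq_square sum_product)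
  also have "\<dots> = (\<Sum>i\<in>I. \<Sum>j\<in>I. (\<integral>y. f i y * f j y \<partial>M))"
    using assms(2) by (simp add: L2_mult_integrable)
  also have "\<dots> = (\<Sum>i\<in>I. \<Sum>j\<in>I. if j = i then (L2_norm M (f i))\<^sup>2 else 0)"
    using assms(3) by (intro sum.cong refl) (auto simp: L2_norm_sq simp flip: power2_eq_square)
  also have "\<dots> = (\<Sum>i\<in>I. (L2_norm M (f i))\<^sup>2)" using assms(1) by simp
  finally show ?thesis .
qed

lemma L2_norm_dominated_tendsto:
  assumes g: "g \<in> L2 M" and f: "\<And>n. f n \<in> borel_measurable M" and k: "k \<in> borel_measurable M"
    and lim: "AE y in M. (\<lambda>n. f n y) \<longlonglongrightarrow> k y"
    and bound: "\<And>n. AE y in M. \<bar>f n y\<bar> \<le> g y"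
  shows "(\<lambda>n. L2_norm M (\<lambda>y. f n y - k y)) \<longlonglongrightarrow> 0"
proof -
  have all: "AE y in M. \<forall>n. \<bar>f n y\<bar> \<le> g y" using bound by (simp add: AE_all_countable)
  have kb: "AE y in M. \<bar>k y\<bar> \<le> g y"
    using lim all
  proof eventually_elim
    case (elim y)
    then show ?case by (intro LIMSEQ_le_const2[OF tendsto_rabs]) auto
  qed
  have "(\<lambda>n. \<integral>y. (f n y - k y)\<^sup>2 \<partial>M) \<longlonglongrightarrow> (\<integral>y. 0 \<partial>M)"
  proof (rule integral_dominated_convergence)
    show "integrable M (\<lambda>y. 4 * (g y)\<^sup>2)" using L2_integrable_sq[OF g] by simp
    show "AE y in M. (\<lambda>n. (f n y - k y)\<^sup>2) \<longlonglongrightarrow> 0"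
      using lim by eventually_elim (auto intro!: tendsto_eq_intros)
    show "AE y in M. norm ((f n y - k y)\<^sup>2) \<le> 4 * (g y)\<^sup>2" for n
      using all kb
    proof eventually_elim
      case (elim y)
      have "\<bar>f n y\<bar> \<le> g y" using elim by simp
      then have "\<bar>f n y - k y\<bar> \<le> \<bar>2 * g y\<bar>" using elim(2) by linarith
      then have "(f n y - k y)\<^sup>2 \<le> (2 * g y)\<^sup>2" by (simp only: abs_le_square_iff)
      then show ?case by (simp add: power_mult_distrib)
    qed
  qed (use f k in auto)
  then have "(\<lambda>n. sqrt (\<integral>y. (f n y - k y)\<^sup>2 \<partial>M)) \<longlonglongrightarrow> sqrt 0"
    by (intro tendsto_real_sqrt) simp
  then show ?thesis by (simp add: L2_norm_def)
qed

section \<open>Conditional expectation as a projection\<close>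

abbreviation sigma_gen :: "'a measure \<Rightarrow> ('a \<Rightarrow> real) \<Rightarrow> 'a measure" where
  "sigma_gen M Y \<equiv> vimage_algebra (space M) Y borel"

context prob_space
begin

lemma L2_integrable: "f \<in> L2 M \<Longrightarrow> integrable M f"
  by (auto simp: L2_def intro: square_integrable_imp_integrable)

lemma L2_const: "(\<lambda>_. c) \<in> L2 M" by (simp add: L2_def)

lemma L2_norm_const: "L2_norm M (\<lambda>_. c) = \<bar>c\<bar>"
  by (simp add: L2_norm_def prob_space)

context
  fixes Y :: "'a \<Rightarrow> real"
  assumes Y: "Y \<in> borel_measurable M"
begin

lemma sigma_gen_subalgebra: "subalgebra M (sigma_gen M Y)"
  unfolding subalgebra_def using Y by (auto simp: sets_vimage_algebra2 measurable_sets)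

lemma sigma_gen_measurable: "g \<in> borel_measurable (sigma_gen M Y) \<Longrightarrow> g \<in> borel_measurable M"
  by (rule measurable_from_subalg[OF sigma_gen_subalgebra])

lemma sigma_gen_borel: "\<phi> \<in> borel_measurable borel \<Longrightarrow> (\<lambda>y. \<phi> (Y y)) \<in> borel_measurable (sigma_gen M Y)"
  by (rule measurable_compose[OF measurable_vimage_algebra1]) auto

lemma cond_exp_given_sigma: "finite_measure_subalgebra M (sigma_gen M Y)"
  by standard (rule sigma_gen_subalgebra)

lemma cond_exp_given_measurable: "cond_exp_given M f Y \<in> borel_measurable (sigma_gen M Y)"
  by (simp add: cond_exp_given_def)

lemma cond_exp_given_L2:
  assumes "f \<in> L2 M" shows "cond_exp_given M f Y \<in> L2 M"
proof -
  interpret S: finite_measure_subalgebra M "sigma_gen M Y" by (rule cond_exp_given_sigma)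
  have sq: "convex_on UNIV (\<lambda>t::real. t\<^sup>2)" by (rule convex_power2)
  have f: "integrable M f" "integrable M (\<lambda>y. (f y)\<^sup>2)"
    using assms L2_integrable L2_integrable_sq by auto
  have "AE y in M. (cond_exp_given M f Y y)\<^sup>2 \<le> real_cond_exp M (sigma_gen M Y) (\<lambda>y. (f y)\<^sup>2) y"
    unfolding cond_exp_given_def
    by (rule S.real_cond_exp_jensens_inequality(2)[where I=UNIV and q="\<lambda>t. t\<^sup>2"]) (use f sq in auto)
  then have ae: "AE y in M. norm ((cond_exp_given M f Y y)\<^sup>2)
      \<le> norm (real_cond_exp M (sigma_gen M Y) (\<lambda>y. (f y)\<^sup>2) y)"
    by eventually_elim auto
  have m: "cond_exp_given M f Y \<in> borel_measurable M"
    by (rule sigma_gen_measurable[OF cond_exp_given_measurable])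
  have "integrable M (\<lambda>y. (cond_exp_given M f Y y)\<^sup>2)"
    by (rule Bochner_Integration.integrable_bound[OF S.real_cond_exp_int(1)[OF f(2)] _ ae]) (use m in auto)
  then show ?thesis using m by (simp add: L2_def)
qed

lemma cond_exp_given_inner:
  assumes "f \<in> L2 M" "g \<in> L2 M" "g \<in> borel_measurable (sigma_gen M Y)"
  shows "(\<integral>y. cond_exp_given M f Y y * g y \<partial>M) = (\<integral>y. f y * g y \<partial>M)"
proof -
  interpret S: finite_measure_subalgebra M "sigma_gen M Y" by (rule cond_exp_given_sigma)
  show ?thesis
    using S.real_cond_exp_intg(2)[of g f] L2_mult_integrable[OF assms(2,1)] assms
    by (simp add: cond_exp_given_def L2_borel mult.commute)
qed

lemma cond_exp_given_diff:
  assumes "f \<in> L2 M" "g \<in> L2 M"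
  shows "AE y in M. cond_exp_given M (\<lambda>y. f y - g y) Y y = cond_exp_given M f Y y - cond_exp_given M g Y y"
proof -
  interpret S: finite_measure_subalgebra M "sigma_gen M Y" by (rule cond_exp_given_sigma)
  show ?thesis using S.real_cond_exp_diff[of f g] assms L2_integrable
    by (simp add: cond_exp_given_def)
qed

lemma cond_exp_given_cmult:
  assumes "f \<in> L2 M"
  shows "AE y in M. cond_exp_given M (\<lambda>y. c * f y) Y y = c * cond_exp_given M f Y y"
proof -
  interpret S: finite_measure_subalgebra M "sigma_gen M Y" by (rule cond_exp_given_sigma)
  show ?thesis using S.real_cond_exp_cmult[of f c] assms L2_integrable
    by (simp add: cond_exp_given_def)
qed

lemma cond_exp_given_norm_sq:
  assumes "f \<in> L2 M"
  shows "(L2_norm M (cond_exp_given M f Y))\<^sup>2 = (\<integral>y. f y * cond_exp_given M f Y y \<partial>M)"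
  using cond_exp_given_inner[OF assms cond_exp_given_L2[OF assms] cond_exp_given_measurable]
  unfolding L2_norm_sq by (simp add: power2_eq_square)

lemma cond_exp_given_norm_le:
  assumes "f \<in> L2 M" shows "L2_norm M (cond_exp_given M f Y) \<le> L2_norm M f"
proof -
  have "(L2_norm M (cond_exp_given M f Y))\<^sup>2 \<le> L2_norm M f * L2_norm M (cond_exp_given M f Y)"
    unfolding cond_exp_given_norm_sq[OF assms]
    using L2_Cauchy_Schwarz[OF assms cond_exp_given_L2[OF assms]] by simp
  then show ?thesis
    using L2_norm_nonneg[of M "cond_exp_given M f Y"] L2_norm_nonneg[of M f]
    by (cases "L2_norm M (cond_exp_given M f Y) = 0") (auto simp: power2_eq_square mult_le_cancel_right)
qed

lemma cond_exp_given_dist_le: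
  assumes "f \<in> L2 M" "g \<in> L2 M"
  shows "L2_norm M (\<lambda>y. cond_exp_given M f Y y - cond_exp_given M g Y y) \<le> L2_norm M (\<lambda>y. f y - g y)"
proof -
  have m: "cond_exp_given M f Y \<in> borel_measurable M" for f
    by (rule sigma_gen_measurable[OF cond_exp_given_measurable])
  have "L2_norm M (\<lambda>y. cond_exp_given M f Y y - cond_exp_given M g Y y)
      = L2_norm M (cond_exp_given M (\<lambda>y. f y - g y) Y)"
    using cond_exp_given_diff[OF assms] m by (intro L2_norm_cong_AE) auto
  also have "\<dots> \<le> L2_norm M (\<lambda>y. f y - g y)"
    by (rule cond_exp_given_norm_le[OF L2_diff[OF assms]])
  finally show ?thesis .
qed

lemma cond_exp_given_residual_norm_le:
  assumes "f \<in> L2 M"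
  shows "L2_norm M (\<lambda>y. f y - cond_exp_given M f Y y) \<le> L2_norm M f"
proof (rule power2_le_imp_le)
  let ?p = "cond_exp_given M f Y"
  have p: "?p \<in> L2 M" by (rule cond_exp_given_L2[OF assms])
  have "(L2_norm M (\<lambda>y. f y - ?p y))\<^sup>2 = (\<integral>y. (f y)\<^sup>2 - 2 * (f y * ?p y) + (?p y)\<^sup>2 \<partial>M)"
    unfolding L2_norm_sq by (rule Bochner_Integration.integral_cong) (auto simp: power2_eq_square algebra_simps)
  also have "\<dots> = (L2_norm M f)\<^sup>2 - 2 * (\<integral>y. f y * ?p y \<partial>M) + (L2_norm M ?p)\<^sup>2"
    using L2_integrable_sq[OF assms] L2_integrable_sq[OF p] L2_mult_integrable[OF assms p]
    by (simp add: L2_norm_sq)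
  also have "\<dots> = (L2_norm M f)\<^sup>2 - (L2_norm M ?p)\<^sup>2"
    by (simp flip: cond_exp_given_norm_sq[OF assms])
  also have "\<dots> \<le> (L2_norm M f)\<^sup>2" by simp
  finally show "(L2_norm M (\<lambda>y. f y - ?p y))\<^sup>2 \<le> (L2_norm M f)\<^sup>2" .
qed (rule L2_norm_nonneg)

lemma cond_exp_given_residual_orthogonal:
  assumes "f \<in> L2 M" "g \<in> L2 M" "g \<in> borel_measurable (sigma_gen M Y)"
  shows "(\<integral>y. (f y - cond_exp_given M f Y y) * g y \<partial>M) = 0"
  using cond_exp_given_inner[OF assms] L2_mult_integrable[OF assms(1,2)]
    L2_mult_integrable[OF cond_exp_given_L2[OF assms(1)] assms(2)]
  by (simp add: left_diff_distrib)

lemma sigma_gen_coarser: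
  assumes "\<phi> \<in> borel_measurable borel" "\<And>y. y \<in> space M \<Longrightarrow> Y' y = \<phi> (Y y)"
  shows "sets (sigma_gen M Y') \<subseteq> sets (sigma_gen M Y)"
proof
  fix B assume "B \<in> sets (sigma_gen M Y')"
  then obtain C where C: "C \<in> sets borel" "B = Y' -` C \<inter> space M"
    by (auto simp: sets_vimage_algebra2)
  then have "B = Y -` (\<phi> -` C) \<inter> space M" using assms(2) by auto
  moreover have "\<phi> -` C \<in> sets borel" using measurable_sets[OF assms(1) C(1)] by simp
  ultimately show "B \<in> sets (sigma_gen M Y)" by (auto simp: sets_vimage_algebra2)
qed

end

end

section \<open>Sticky flows in the space of square integrable functions\<close>

text \<open>\<open>X\<close> is the flow, \<open>V\<close> and \<open>Z\<close> are velocity and position of particles that never stick. Once two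
  points are in the same place they stay together, so the sigma-algebras generated by \<open>X t\<close> decrease
  in time.\<close>

locale sticky_flow = prob_space M for M :: "'a measure" +
  fixes X Z V :: "real \<Rightarrow> 'a \<Rightarrow> real" and L K :: "real \<Rightarrow> real"
  assumes X_L2: "\<And>t. 0 \<le> t \<Longrightarrow> X t \<in> L2 M"
    and Z_L2: "\<And>t. 0 \<le> t \<Longrightarrow> Z t \<in> L2 M"
    and V_L2: "\<And>t. 0 \<le> t \<Longrightarrow> V t \<in> L2 M"
    and K_nonneg: "\<And>T. 0 \<le> K T"
    and L_nonneg: "\<And>T. 0 \<le> L T"
    and X_lip: "\<And>T s t. 0 \<le> s \<Longrightarrow> s \<le> t \<Longrightarrow> t \<le> T \<Longrightarrow> L2_norm M (\<lambda>y. X t y - X s y) \<le> L T * (t - s)"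
    and V_lip: "\<And>T s t. 0 \<le> s \<Longrightarrow> s \<le> t \<Longrightarrow> t \<le> T \<Longrightarrow> L2_norm M (\<lambda>y. V t y - V s y) \<le> K T * (t - s)"
    and Z_V: "\<And>T a b r. 0 \<le> a \<Longrightarrow> a \<le> b \<Longrightarrow> b \<le> T \<Longrightarrow> 0 \<le> r \<Longrightarrow> r \<le> T \<Longrightarrow>
      L2_norm M (\<lambda>y. (Z b y - Z a y) - (b - a) * V r y) \<le> (b - a) * (K T * (\<bar>a - r\<bar> + \<bar>b - r\<bar>))"
    and factor: "\<And>s t. 0 < s \<Longrightarrow> s \<le> t \<Longrightarrow>
      \<exists>\<phi>\<in>borel_measurable borel. \<forall>y\<in>space M. X t y = \<phi> (X s y)"
    and orthogonal: "\<And>t g. 0 < t \<Longrightarrow> g \<in> L2 M \<Longrightarrow> g \<in> borel_measurable (sigma_gen M (X t)) \<Longrightarrow>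
      (\<integral>y. (Z t y - X t y) * g y \<partial>M) = 0"
begin

definition P :: "real \<Rightarrow> ('a \<Rightarrow> real) \<Rightarrow> 'a \<Rightarrow> real" where "P t f = cond_exp_given M f (X t)"

lemma X_borel: "0 \<le> t \<Longrightarrow> X t \<in> borel_measurable M"
  using X_L2 L2_borel by blast

lemma P_L2: "0 \<le> t \<Longrightarrow> f \<in> L2 M \<Longrightarrow> P t f \<in> L2 M"
  unfolding P_def by (rule cond_exp_given_L2[OF X_borel])

lemma P_measurable: "0 \<le> t \<Longrightarrow> P t f \<in> borel_measurable (sigma_gen M (X t))"
  unfolding P_def by (rule cond_exp_given_measurable[OF X_borel])

lemma measurable_earlier:
  assumes "0 < s" "s \<le> t" "g \<in> borel_measurable (sigma_gen M (X t))"
  shows "g \<in> borel_measurable (sigma_gen M (X s))"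
proof -
  obtain \<phi> where "\<phi> \<in> borel_measurable borel" "\<And>y. y \<in> space M \<Longrightarrow> X t y = \<phi> (X s y)"
    using factor[OF assms(1,2)] by blast
  then have "sets (sigma_gen M (X t)) \<subseteq> sets (sigma_gen M (X s))"
    by (intro sigma_gen_coarser[OF X_borel]) (use assms in auto)
  then show ?thesis using assms(3) by (auto simp: measurable_def)
qed

lemma P_P_inner:
  assumes "0 < s" "s \<le> t" "f \<in> L2 M" "g \<in> L2 M"
  shows "(\<integral>y. P s f y * P t g y \<partial>M) = (\<integral>y. f y * P t g y \<partial>M)"
  unfolding P_def[of s]
  by (rule cond_exp_given_inner[OF X_borel _ _ measurable_earlier])
    (use assms in \<open>auto intro: P_L2 P_measurable\<close>)

lemma P_norm_sq: "0 \<le> t \<Longrightarrow> f \<in> L2 M \<Longrightarrow> (L2_norm M (P t f))\<^sup>2 = (\<integral>y. f y * P t f y \<partial>M)"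
  unfolding P_def by (rule cond_exp_given_norm_sq[OF X_borel])

text \<open>For nested projections the loss of squared norm is exactly the squared distance, so one
  real function of time decides continuity in the norm.\<close>

lemma P_diff_norm_sq:
  assumes "0 < s" "s \<le> t" "f \<in> L2 M"
  shows "(L2_norm M (\<lambda>y. P s f y - P t f y))\<^sup>2 = (L2_norm M (P s f))\<^sup>2 - (L2_norm M (P t f))\<^sup>2"
proof -
  have p: "P s f \<in> L2 M" "P t f \<in> L2 M" using assms by (auto intro: P_L2)
  have "(L2_norm M (\<lambda>y. P s f y - P t f y))\<^sup>2 = (\<integral>y. (P s f y)\<^sup>2 - 2 * (P s f y * P t f y) + (P t f y)\<^sup>2 \<partial>M)"
    unfolding L2_norm_sq by (rule Bochner_Integration.integral_cong) (auto simp: power2_eq_square algebra_simps)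
  also have "\<dots> = (L2_norm M (P s f))\<^sup>2 - 2 * (\<integral>y. P s f y * P t f y \<partial>M) + (L2_norm M (P t f))\<^sup>2"
    using L2_integrable_sq[OF p(1)] L2_integrable_sq[OF p(2)] L2_mult_integrable[OF p]
    by (simp add: L2_norm_sq)
  also have "(\<integral>y. P s f y * P t f y \<partial>M) = (L2_norm M (P t f))\<^sup>2"
    using P_P_inner[of s t f f] P_norm_sq[of t f] assms by simp
  finally show ?thesis by simp
qed

text \<open>Since \<open>L2_norm M (P t f)\<close> is monotone in \<open>t\<close>, \<open>P t f\<close> has at most countably many discontinuities.\<close>

lemma P_continuous:
  assumes f: "f \<in> L2 M"
  obtains N where "countable N" "\<And>t \<epsilon>. 0 < t \<Longrightarrow> t \<notin> N \<Longrightarrow> 0 < \<epsilon> \<Longrightarrow>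
    \<exists>\<delta>>0. \<forall>s>0. \<bar>s - t\<bar> < \<delta> \<longrightarrow> L2_norm M (\<lambda>y. P s f y - P t f y) < \<epsilon>"
proof -
  define \<phi> where "\<phi> t = - (L2_norm M (P t f))\<^sup>2" for t
  have diff: "(L2_norm M (\<lambda>y. P s f y - P t f y))\<^sup>2 = \<bar>\<phi> s - \<phi> t\<bar>" if "0 < s" "0 < t" for s t
  proof -
    have "(L2_norm M (\<lambda>y. P s f y - P t f y))\<^sup>2 = \<bar>\<phi> s - \<phi> t\<bar>" if "0 < s" "s \<le> t" for s t
    proof -
      have "\<phi> t - \<phi> s = (L2_norm M (\<lambda>y. P s f y - P t f y))\<^sup>2"
        using P_diff_norm_sq[OF that f] by (simp add: \<phi>_def)
      moreover have "0 \<le> (L2_norm M (\<lambda>y. P s f y - P t f y))\<^sup>2" by simp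
      ultimately show ?thesis by linarith
    qed
    from this[of s t] this[of t s] show ?thesis
      using that L2_norm_minus_commute[of M "P s f" "P t f"]
      by (cases "s \<le> t") (auto simp: abs_minus_commute)
  qed
  have "mono_on {0<..} \<phi>"
  proof (rule mono_onI)
    fix s t :: real assume "s \<in> {0<..}" "t \<in> {0<..}" "s \<le> t"
    then have "0 \<le> (L2_norm M (P s f))\<^sup>2 - (L2_norm M (P t f))\<^sup>2"
      using P_diff_norm_sq[of s t f] f by (metis greaterThan_iff zero_le_power2)
    then show "\<phi> s \<le> \<phi> t" by (simp add: \<phi>_def)
  qed
  then have cnt: "countable {t\<in>{0<..}. \<not> continuous (at t within {0<..}) \<phi>}"
    by (rule mono_on_ctble_discont)
  show thesis
  proof (rule that[OF cnt])
    fix t \<epsilon> :: real assume t: "0 < t" "t \<notin> {t\<in>{0<..}. \<not> continuous (at t within {0<..}) \<phi>}" "0 < \<epsilon>"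
    then have "continuous (at t within {0<..}) \<phi>" by simp
    then obtain \<delta> where \<delta>: "\<delta> > 0" "\<And>s. 0 < s \<Longrightarrow> dist s t < \<delta> \<Longrightarrow> dist (\<phi> s) (\<phi> t) < \<epsilon>\<^sup>2"
      unfolding continuous_within_eps_delta using t by (metis greaterThan_iff zero_less_power)
    show "\<exists>\<delta>>0. \<forall>s>0. \<bar>s - t\<bar> < \<delta> \<longrightarrow> L2_norm M (\<lambda>y. P s f y - P t f y) < \<epsilon>"
    proof (intro exI[of _ \<delta>] conjI allI impI)
      fix s :: real assume s: "0 < s" "\<bar>s - t\<bar> < \<delta>"
      then have "(L2_norm M (\<lambda>y. P s f y - P t f y))\<^sup>2 < \<epsilon>\<^sup>2"
        using \<delta>(2)[of s] diff[of s t] t by (simp add: dist_real_def)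
      then show "L2_norm M (\<lambda>y. P s f y - P t f y) < \<epsilon>" using t(3) by (simp add: power_less_imp_less_base)
    qed (rule \<delta>(1))
  qed
qed

definition U :: "real \<Rightarrow> 'a \<Rightarrow> real" where "U t = P t (V t)"

text \<open>The vector \<open>V t\<close> is frozen while the projection varies: continuity of
  \<open>P s (V t)\<close> at \<open>s = t\<close> is what differentiability of \<open>X\<close> at
  \<open>t\<close> will be drawn from.\<close>

definition regular_time :: "real \<Rightarrow> bool" where
  "regular_time t \<longleftrightarrow> 0 < t \<and> (\<forall>\<epsilon>>0. \<exists>\<delta>>0. \<forall>s>0. \<bar>s - t\<bar> < \<delta> \<longrightarrow>
    L2_norm M (\<lambda>y. P s (V t) y - U t y) < \<epsilon>)"

lemma P_dist_le:
  "0 \<le> t \<Longrightarrow> f \<in> L2 M \<Longrightarrow> g \<in> L2 M \<Longrightarrow> L2_norm M (\<lambda>y. P t f y - P t g y) \<le> L2_norm M (\<lambda>y. f y - g y)"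
  unfolding P_def by (rule cond_exp_given_dist_le[OF X_borel])

text \<open>The exceptional set in \<open>P_continuous\<close> depends on the function, and there
  are uncountably many \<open>V t\<close>. Rational times suffice: \<open>V\<close> is Lipschitz and
  projections are contractions, so \<open>V t\<close> may be replaced by \<open>V\<close> at a
  rational time close to \<open>t\<close>.\<close>

lemma regular_time_countable: "\<exists>N. countable N \<and> (\<forall>t>0. t \<notin> N \<longrightarrow> regular_time t)"
proof -
  define Q where "Q r N \<longleftrightarrow> countable N \<and> (0 \<le> r \<longrightarrow> (\<forall>t \<epsilon>. 0 < t \<longrightarrow> t \<notin> N \<longrightarrow> 0 < \<epsilon> \<longrightarrow>
    (\<exists>\<delta>>0. \<forall>s>0. \<bar>s - t\<bar> < \<delta> \<longrightarrow> L2_norm M (\<lambda>y. P s (V (of_rat r)) y - P t (V (of_rat r)) y) < \<epsilon>)))"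
    for r :: rat and N
  have "\<exists>N. Q r N" for r
  proof (cases "0 \<le> r")
    case True
    then have v: "V (of_rat r) \<in> L2 M" by (intro V_L2) simp
    obtain N where "countable N" "\<And>t \<epsilon>. 0 < t \<Longrightarrow> t \<notin> N \<Longrightarrow> 0 < \<epsilon> \<Longrightarrow>
      \<exists>\<delta>>0. \<forall>s>0. \<bar>s - t\<bar> < \<delta> \<longrightarrow> L2_norm M (\<lambda>y. P s (V (of_rat r)) y - P t (V (of_rat r)) y) < \<epsilon>"
      by (rule P_continuous[OF v]) blast
    then have "Q r N" unfolding Q_def by blast
    then show ?thesis ..
  next
    case False
    then have "Q r {}" by (simp add: Q_def)
    then show ?thesis ..
  qed
  then have "\<forall>r. \<exists>N. Q r N" by simp
  from choice[OF this] obtain N where QN: "\<And>r. Q r (N r)" by blast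
  have N: "\<And>r. countable (N r)"
    "\<And>r t \<epsilon>. r \<ge> 0 \<Longrightarrow> 0 < t \<Longrightarrow> t \<notin> N r \<Longrightarrow> 0 < \<epsilon> \<Longrightarrow>
      \<exists>\<delta>>0. \<forall>s>0. \<bar>s - t\<bar> < \<delta> \<longrightarrow> L2_norm M (\<lambda>y. P s (V (of_rat r)) y - P t (V (of_rat r)) y) < \<epsilon>"
    using QN unfolding Q_def by blast+
  have "regular_time t" if t: "0 < t" "t \<notin> (\<Union>r. N r)" for t
    unfolding regular_time_def
  proof (intro conjI allI impI t(1))
    fix \<epsilon> :: real assume \<epsilon>: "0 < \<epsilon>"
    define \<eta> where "\<eta> = \<epsilon> / (3 * (K t + 1))"
    have \<eta>: "\<eta> > 0" using \<epsilon> K_nonneg[of t] by (simp add: \<eta>_def)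
    obtain r where r: "max 0 (t - \<eta>) < of_rat r" "of_rat r < t"
      using of_rat_dense[of "max 0 (t - \<eta>)" t] t \<eta> by auto
    have r0: "r \<ge> 0" using r by (metis less_imp_le max_less_iff_conj zero_less_of_rat_iff)
    define f where "f = V (of_rat r)"
    have f: "f \<in> L2 M" unfolding f_def using r by (intro V_L2) auto
    have Vt: "V t \<in> L2 M" using t by (intro V_L2) simp
    have Vf: "L2_norm M (\<lambda>y. V t y - f y) < \<epsilon> / 3"
    proof -
      have "L2_norm M (\<lambda>y. V t y - f y) \<le> K t * (t - of_rat r)"
        unfolding f_def using r by (intro V_lip) auto
      also have "\<dots> \<le> (K t + 1) * (t - of_rat r)" using r by (intro mult_right_mono) auto
      also have "\<dots> < (K t + 1) * \<eta>" using r K_nonneg[of t] by (intro mult_strict_left_mono) auto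
      also have "\<dots> = \<epsilon> / 3"
      proof -
        have "k * (\<epsilon> / (3 * k)) = \<epsilon> / 3" if "k > 0" for k :: real using that by simp
        from this[of "K t + 1"] show ?thesis unfolding \<eta>_def using K_nonneg[of t] by linarith
      qed
      finally show ?thesis .
    qed
    obtain \<delta> where \<delta>: "\<delta> > 0" "\<And>s. s > 0 \<Longrightarrow> \<bar>s - t\<bar> < \<delta> \<Longrightarrow> L2_norm M (\<lambda>y. P s f y - P t f y) < \<epsilon> / 3"
      using N(2)[OF r0 t(1), of "\<epsilon> / 3"] t(2) \<epsilon> unfolding f_def by auto
    show "\<exists>\<delta>>0. \<forall>s>0. \<bar>s - t\<bar> < \<delta> \<longrightarrow> L2_norm M (\<lambda>y. P s (V t) y - U t y) < \<epsilon>"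
    proof (intro exI[of _ \<delta>] conjI allI impI \<delta>(1))
      fix s :: real assume s: "s > 0" "\<bar>s - t\<bar> < \<delta>"
      have p: "P s (V t) \<in> L2 M" "P s f \<in> L2 M" "P t f \<in> L2 M" "P t (V t) \<in> L2 M"
        using s t f Vt by (auto intro: P_L2)
      have "L2_norm M (\<lambda>y. P s (V t) y - P t (V t) y) \<le> L2_norm M (\<lambda>y. P s (V t) y - P s f y)
        + L2_norm M (\<lambda>y. P s f y - P t (V t) y)"
        by (rule L2_norm_triangle_diff) (use p in auto)
      also have "L2_norm M (\<lambda>y. P s f y - P t (V t) y) \<le> L2_norm M (\<lambda>y. P s f y - P t f y)
        + L2_norm M (\<lambda>y. P t f y - P t (V t) y)"
        by (rule L2_norm_triangle_diff) (use p in auto)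
      also have "L2_norm M (\<lambda>y. P s (V t) y - P s f y) \<le> L2_norm M (\<lambda>y. V t y - f y)"
        by (rule P_dist_le) (use s Vt f in auto)
      also have "L2_norm M (\<lambda>y. P t f y - P t (V t) y) \<le> L2_norm M (\<lambda>y. V t y - f y)"
        using P_dist_le[of t f "V t"] t Vt f by (simp add: L2_norm_minus_commute[of M f])
      finally show "L2_norm M (\<lambda>y. P s (V t) y - U t y) < \<epsilon>"
        using Vf \<delta>(2)[OF s] by (simp add: U_def)
    qed
  qed
  moreover have "countable (\<Union>r. N r)" using N(1) by blast
  ultimately show ?thesis by blast
qed

text \<open>Given \<open>X t\<close>, the increments of \<open>X\<close> and of \<open>Z\<close>
  have the same conditional expectation: \<open>Z t - X t\<close> is orthogonal to functions of
  \<open>X t\<close>, and so is \<open>Z s - X s\<close>, because these are also functions of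
  \<open>X s\<close>.\<close>

lemma P_increment:
  assumes "0 < s" "s \<le> t" and f: "f \<in> L2 M"
  shows "L2_norm M (\<lambda>y. P t (\<lambda>y. X t y - X s y) y - P t f y) \<le> L2_norm M (\<lambda>y. (Z t y - Z s y) - f y)"
proof -
  have l: "X t \<in> L2 M" "X s \<in> L2 M" "Z t \<in> L2 M" "Z s \<in> L2 M" using assms by (auto intro: X_L2 Z_L2)
  define D where "D y = X t y - X s y" for y
  define E where "E y = Z t y - Z s y" for y
  have DE: "D \<in> L2 M" "E \<in> L2 M" unfolding D_def E_def using l by (auto intro: L2_diff)
  have pL: "P t (\<lambda>y. D y - E y) \<in> L2 M" using assms DE by (intro P_L2 L2_diff) auto
  have pm: "P t (\<lambda>y. D y - E y) \<in> borel_measurable (sigma_gen M (X t))"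
    using assms by (intro P_measurable) auto
  let ?p = "P t (\<lambda>y. D y - E y)"
  have zero: "(L2_norm M ?p)\<^sup>2 = 0"
  proof -
    have 1: "(\<integral>y. (Z t y - X t y) * ?p y \<partial>M) = 0"
      using assms pL pm by (intro orthogonal) auto
    have 2: "(\<integral>y. (Z s y - X s y) * ?p y \<partial>M) = 0"
      using assms pL by (intro orthogonal measurable_earlier[OF _ _ pm]) auto
    have i: "integrable M (\<lambda>y. (Z t y - X t y) * ?p y)" "integrable M (\<lambda>y. (Z s y - X s y) * ?p y)"
      using l pL by (auto intro!: L2_mult_integrable L2_diff)
    have "(L2_norm M ?p)\<^sup>2 = (\<integral>y. (D y - E y) * ?p y \<partial>M)"
      using assms DE by (intro P_norm_sq L2_diff) auto
    also have "\<dots> = (\<integral>y. (Z s y - X s y) * ?p y - (Z t y - X t y) * ?p y \<partial>M)"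
      by (rule Bochner_Integration.integral_cong) (auto simp: D_def E_def algebra_simps)
    also have "\<dots> = 0" using i 1 2 by simp
    finally show ?thesis .
  qed
  have t0: "0 \<le> t" using assms by simp
  have pD: "P t D \<in> L2 M" "P t E \<in> L2 M" "P t f \<in> L2 M" using t0 DE f by (auto intro: P_L2)
  have "L2_norm M (\<lambda>y. P t D y - P t E y) = L2_norm M ?p"
  proof (rule L2_norm_cong_AE)
    show "AE y in M. P t D y - P t E y = ?p y"
      using cond_exp_given_diff[OF X_borel[OF t0] DE] by (auto simp: P_def)
  qed (use pD pL in \<open>auto dest: L2_borel\<close>)
  then have "L2_norm M (\<lambda>y. P t D y - P t E y) = 0" using zero by simp
  moreover have "L2_norm M (\<lambda>y. P t D y - P t f y) \<le> L2_norm M (\<lambda>y. P t D y - P t E y) + L2_norm M (\<lambda>y. P t E y - P t f y)"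
    by (rule L2_norm_triangle_diff) (use pD in auto)
  moreover have "L2_norm M (\<lambda>y. P t E y - P t f y) \<le> L2_norm M (\<lambda>y. E y - f y)"
    using t0 DE f by (intro P_dist_le) auto
  ultimately show ?thesis by (simp add: D_def[abs_def] E_def[abs_def])
qed

text \<open>Split \<open>{a..b}\<close> into \<open>n\<close> equal parts and each increment of \<open>X\<close> into its projection and a residual.
  The residuals are orthogonal to each other and of size \<open>1 / n\<close>, so their sum is of size \<open>1 / sqrt n\<close>.\<close>

lemma increment_bound:
  assumes ab: "0 < a" "a \<le> b" "b \<le> T" and f: "f \<in> L2 M" and u: "u \<in> L2 M"
    and Zf: "\<And>s t. a \<le> s \<Longrightarrow> s \<le> t \<Longrightarrow> t \<le> b \<Longrightarrow> L2_norm M (\<lambda>y. (Z t y - Z s y) - (t - s) * f y) \<le> (t - s) * \<epsilon>"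
    and fu: "\<And>t. a \<le> t \<Longrightarrow> t \<le> b \<Longrightarrow> L2_norm M (\<lambda>y. P t f y - u y) \<le> \<eta>"
  shows "L2_norm M (\<lambda>y. (X b y - X a y) - (b - a) * u y) \<le> (b - a) * (\<epsilon> + \<eta>)"
proof -
  have main: "L2_norm M (\<lambda>y. (X b y - X a y) - (b - a) * u y)
    \<le> (b - a) * (\<epsilon> + \<eta>) + L T * (b - a) / sqrt (real (Suc k))" for k
  proof -
    define n where "n = Suc k"
    define \<tau> where "\<tau> = (b - a) / n"
    have \<tau>: "0 \<le> \<tau>" using ab by (simp add: \<tau>_def)
    define r where "r i = a + real i * \<tau>" for i :: nat
    have r0: "r 0 = a" and rn: "r n = b" by (auto simp: r_def \<tau>_def n_def)
    have r_mono: "i \<le> j \<Longrightarrow> r i \<le> r j" for i j using \<tau> by (auto simp: r_def intro!: mult_right_mono)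
    have ra: "a \<le> r i" "0 < r i" for i using r_mono[of 0 i] r0 ab by auto
    have rb: "r i \<le> b" if "i \<le> n" for i using r_mono[OF that] rn by simp
    have r_Suc: "r (Suc i) - r i = \<tau>" for i by (simp add: r_def algebra_simps)
    define D where "D i y = X (r (Suc i)) y - X (r i) y" for i y
    define Q where "Q i = P (r (Suc i)) (D i)" for i
    define R where "R i y = D i y - Q i y" for i y
    have D: "D i \<in> L2 M" for i unfolding D_def using ra by (intro L2_diff X_L2) (auto intro: less_imp_le)
    have Q: "Q i \<in> L2 M" for i unfolding Q_def using ra D by (intro P_L2) (auto intro: less_imp_le)
    have R: "R i \<in> L2 M" for i unfolding R_def using D Q by (intro L2_diff) auto
    have R_norm: "L2_norm M (R i) \<le> L T * \<tau>" if "i < n" for i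
    proof -
      have "L2_norm M (R i) \<le> L2_norm M (D i)"
        unfolding R_def[abs_def] Q_def P_def
        by (rule cond_exp_given_residual_norm_le[OF X_borel D]) (use ra in \<open>auto intro: less_imp_le\<close>)
      also have "\<dots> \<le> L T * (r (Suc i) - r i)"
        unfolding D_def using ra rb[of "Suc i"] that ab r_mono[of i "Suc i"]
        by (intro X_lip) (auto intro: less_imp_le)
      finally show ?thesis by (simp add: r_Suc)
    qed
    \<comment> \<open>Residuals are taken at the right endpoint of each interval. For
      \<open>i < j\<close> everything in \<open>R j\<close> is a function of
      \<open>X (r (Suc i))\<close>, and \<open>R i\<close> is orthogonal to such functions.\<close>
    have R_orth_less: "(\<integral>y. R i y * R j y \<partial>M) = 0" if "i < j" for i j
    proof -
      have m: "X (r (Suc j)) \<in> borel_measurable (sigma_gen M (X (r (Suc j))))"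
        "X (r j) \<in> borel_measurable (sigma_gen M (X (r j)))"
        "Q j \<in> borel_measurable (sigma_gen M (X (r (Suc j))))"
        using P_measurable[OF less_imp_le[OF ra(2)[of "Suc j"]]]
        by (simp_all add: Q_def measurable_vimage_algebra1)
      have ij: "r (Suc i) \<le> r (Suc j)" "r (Suc i) \<le> r j" using that by (auto intro: r_mono)
      have [measurable]: "X (r (Suc j)) \<in> borel_measurable (sigma_gen M (X (r (Suc i))))"
        "X (r j) \<in> borel_measurable (sigma_gen M (X (r (Suc i))))"
        "Q j \<in> borel_measurable (sigma_gen M (X (r (Suc i))))"
        by (rule measurable_earlier[OF ra(2)], rule ij, rule m)+
      have Rm: "R j \<in> borel_measurable (sigma_gen M (X (r (Suc i))))"
        unfolding R_def[abs_def] D_def[abs_def] by measurable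
      have "(\<integral>y. (D i y - cond_exp_given M (D i) (X (r (Suc i))) y) * R j y \<partial>M) = 0"
        by (rule cond_exp_given_residual_orthogonal[OF X_borel[OF less_imp_le[OF ra(2)]] D R Rm])
      then show ?thesis by (simp add: R_def[of i] Q_def P_def)
    qed
    have R_orth: "(\<integral>y. R i y * R j y \<partial>M) = 0" if "i \<noteq> j" for i j
      using R_orth_less[of i j] R_orth_less[of j i] that by (cases "i < j") (auto simp: mult.commute)
    have "(L2_norm M (\<lambda>y. \<Sum>i<n. R i y))\<^sup>2 = (\<Sum>i<n. (L2_norm M (R i))\<^sup>2)"
      using R R_orth by (intro L2_norm_orthogonal_sum) auto
    also have "\<dots> \<le> (\<Sum>i<n. (L T * \<tau>)\<^sup>2)"
      using R_norm by (intro sum_mono power_mono) (auto simp: L2_norm_nonneg)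
    also have "\<dots> = (sqrt n * (L T * \<tau>))\<^sup>2" by (simp add: power_mult_distrib)
    finally have "L2_norm M (\<lambda>y. \<Sum>i<n. R i y) \<le> sqrt n * (L T * \<tau>)"
      by (rule power2_le_imp_le) (use \<tau> L_nonneg[of T] in auto)
    also have "\<dots> = L T * (b - a) / sqrt n"
    proof -
      have "s * (l * (d / (s * s))) = l * d / s" if "s > 0" for s l d :: real
        using that by (simp add: field_simps)
      from this[of "sqrt n" "L T" "b - a"] show ?thesis by (simp add: \<tau>_def n_def)
    qed
    finally have Rsum: "L2_norm M (\<lambda>y. \<Sum>i<n. R i y) \<le> L T * (b - a) / sqrt n" .
    have Qu: "L2_norm M (\<lambda>y. Q i y - \<tau> * u y) \<le> \<tau> * (\<epsilon> + \<eta>)" if i: "i < n" for i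
    proof -
      have rr: "0 < r i" "r i \<le> r (Suc i)" "0 \<le> r (Suc i)" using ra r_mono[of i "Suc i"] by (auto intro: less_imp_le)
      have l: "(\<lambda>y. \<tau> * f y) \<in> L2 M" "(\<lambda>y. \<tau> * u y) \<in> L2 M" "P (r (Suc i)) f \<in> L2 M"
         "P (r (Suc i)) (\<lambda>y. \<tau> * f y) \<in> L2 M" "(\<lambda>y. \<tau> * P (r (Suc i)) f y) \<in> L2 M"
        using f u rr by (auto intro!: L2_cmult P_L2)
      have "L2_norm M (\<lambda>y. Q i y - P (r (Suc i)) (\<lambda>y. \<tau> * f y) y)
        \<le> L2_norm M (\<lambda>y. (Z (r (Suc i)) y - Z (r i) y) - \<tau> * f y)"
        unfolding Q_def D_def using rr l by (intro P_increment) auto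
      also have "\<dots> \<le> \<tau> * \<epsilon>"
        using Zf[of "r i" "r (Suc i)"] ra rr rb[of "Suc i"] i by (simp add: r_Suc)
      finally have 1: "L2_norm M (\<lambda>y. Q i y - P (r (Suc i)) (\<lambda>y. \<tau> * f y) y) \<le> \<tau> * \<epsilon>" .
      have "L2_norm M (\<lambda>y. P (r (Suc i)) (\<lambda>y. \<tau> * f y) y - \<tau> * u y) = L2_norm M (\<lambda>y. \<tau> * (P (r (Suc i)) f y - u y))"
      proof (rule L2_norm_cong_AE)
        show "AE y in M. P (r (Suc i)) (\<lambda>y. \<tau> * f y) y - \<tau> * u y = \<tau> * (P (r (Suc i)) f y - u y)"
          using cond_exp_given_cmult[OF X_borel[OF rr(3)] f, of \<tau>] by (auto simp: P_def right_diff_distrib)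
      qed (use l u in \<open>auto dest: L2_borel\<close>)
      also have "\<dots> \<le> \<tau> * \<eta>"
        unfolding L2_norm_cmult using \<tau> fu[of "r (Suc i)"] ra rb[of "Suc i"] i by (simp add: mult_left_mono)
      finally have 2: "L2_norm M (\<lambda>y. P (r (Suc i)) (\<lambda>y. \<tau> * f y) y - \<tau> * u y) \<le> \<tau> * \<eta>" .
      show ?thesis
        using L2_norm_triangle_diff[OF Q[of i] l(4) l(2)] 1 2 by (simp add: distrib_left)
    qed
    have telescope: "(\<Sum>i<n. D i y) = X b y - X a y" for y
      using sum_lessThan_telescope[of "\<lambda>i. X (r i) y" n] by (simp add: D_def r0 rn)
    have n\<tau>: "real n * \<tau> = b - a" by (simp add: \<tau>_def n_def)
    have "L2_norm M (\<lambda>y. (X b y - X a y) - (b - a) * u y)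
      = L2_norm M (\<lambda>y. (\<Sum>i<n. Q i y - \<tau> * u y) + (\<Sum>i<n. R i y))"
      by (rule arg_cong[where f="L2_norm M"], rule ext)
        (simp add: R_def sum_subtractf flip: telescope n\<tau>)
    also have "\<dots> \<le> L2_norm M (\<lambda>y. \<Sum>i<n. Q i y - \<tau> * u y) + L2_norm M (\<lambda>y. \<Sum>i<n. R i y)"
      using Q R u by (intro L2_norm_triangle L2_sum L2_diff L2_cmult) auto
    also have "L2_norm M (\<lambda>y. \<Sum>i<n. Q i y - \<tau> * u y) \<le> (\<Sum>i<n. L2_norm M (\<lambda>y. Q i y - \<tau> * u y))"
      using Q u by (intro L2_norm_sum_le L2_diff L2_cmult) auto
    also have "\<dots> \<le> (\<Sum>i<n. \<tau> * (\<epsilon> + \<eta>))" using Qu by (intro sum_mono) auto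
    also have "\<dots> = (b - a) * (\<epsilon> + \<eta>)" by (simp flip: n\<tau>)
    finally show ?thesis using Rsum by (simp add: n_def)
  qed
  have lim: "(\<lambda>k. (b - a) * (\<epsilon> + \<eta>) + L T * (b - a) / sqrt (real (Suc k))) \<longlonglongrightarrow> (b - a) * (\<epsilon> + \<eta>) + 0"
  proof (intro tendsto_add tendsto_const)
    have "filterlim (\<lambda>k. sqrt (real (Suc k))) at_top sequentially"
      by (rule filterlim_compose[OF sqrt_at_top]) (rule filterlim_compose[OF filterlim_real_sequentially filterlim_Suc])
    then show "(\<lambda>k. L T * (b - a) / sqrt (real (Suc k))) \<longlonglongrightarrow> 0"
      by (intro real_tendsto_divide_at_top[OF tendsto_const])
  qed
  show ?thesis using LIMSEQ_le_const[OF lim] main by auto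
qed

text \<open>Close to a regular time, increments of \<open>Z\<close> are nearly multiples of
  \<open>V t\<close>, and projections of \<open>V t\<close> are nearly \<open>U t\<close>.
  \<open>increment_bound\<close> transfers this to \<open>X\<close>, with \<open>t\<close> as the
  left or as the right end of the interval.\<close>

lemma has_L2_derivative_regular:
  assumes t: "regular_time t"
  shows "has_L2_derivative M X (U t) t"
  unfolding has_L2_derivative_def
proof
  have t0: "0 < t" using t by (simp add: regular_time_def)
  have Vt: "V t \<in> L2 M" using t0 by (intro V_L2) simp
  have U: "U t \<in> L2 M" unfolding U_def using t0 by (intro P_L2 Vt) simp
  show "U t \<in> L2 M" by (rule U)
  show "((\<lambda>\<tau>. L2_norm M (\<lambda>y. (X (t + \<tau>) y - X t y) / \<tau> - U t y)) \<longlongrightarrow> 0) (at 0)"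
  proof (rule LIM_I)
    fix \<epsilon> :: real assume \<epsilon>: "0 < \<epsilon>"
    obtain \<delta> where \<delta>: "\<delta> > 0" "\<And>s. s > 0 \<Longrightarrow> \<bar>s - t\<bar> < \<delta> \<Longrightarrow> L2_norm M (\<lambda>y. P s (V t) y - U t y) < \<epsilon> / 4"
    proof -
      have "\<epsilon> / 4 > 0" using \<epsilon> by simp
      then have "\<exists>\<delta>>0. \<forall>s>0. \<bar>s - t\<bar> < \<delta> \<longrightarrow> L2_norm M (\<lambda>y. P s (V t) y - U t y) < \<epsilon> / 4"
        using t unfolding regular_time_def by blast
      then show ?thesis using that by blast
    qed
    define T where "T = t + 1"
    define \<kappa> where "\<kappa> = \<epsilon> / (8 * (K T + 1))"
    have \<kappa>: "\<kappa> > 0" using \<epsilon> K_nonneg[of T] by (simp add: \<kappa>_def)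
    \<comment> \<open>The bound by \<open>t\<close> keeps all times positive, and the bound by 1
      keeps them below \<open>T = t + 1\<close>.\<close>
    define d where "d = min (min \<delta> \<kappa>) (min t 1)"
    have d: "d > 0" "d \<le> \<delta>" "d \<le> \<kappa>" "d \<le> t" "d \<le> 1" using \<delta> \<kappa> t0 by (auto simp: d_def)
    have bound: "L2_norm M (\<lambda>y. (X b y - X a y) - (b - a) * U t y) \<le> (b - a) * (\<epsilon> / 4 + \<epsilon> / 4)"
      if ab: "t - d < a" "a \<le> b" "b < t + d" for a b
    proof (rule increment_bound[where T=T, OF _ _ _ Vt U])
      show "0 < a" "a \<le> b" "b \<le> T" using ab d by (auto simp: T_def)
      show "L2_norm M (\<lambda>y. P s (V t) y - U t y) \<le> \<epsilon> / 4" if "a \<le> s" "s \<le> b" for s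
        using \<delta>(2)[of s] that ab d by (simp add: abs_less_iff less_imp_le)
      fix p q assume pq: "a \<le> p" "p \<le> q" "q \<le> b"
      have "L2_norm M (\<lambda>y. (Z q y - Z p y) - (q - p) * V t y) \<le> (q - p) * (K T * (\<bar>p - t\<bar> + \<bar>q - t\<bar>))"
        using pq ab d t0 by (intro Z_V) (auto simp: T_def)
      also have "\<dots> \<le> (q - p) * ((K T + 1) * (\<kappa> + \<kappa>))"
        using pq ab d K_nonneg[of T] by (intro mult_left_mono mult_mono) auto
      also have "(K T + 1) * (\<kappa> + \<kappa>) = \<epsilon> / 4"
      proof -
        have "k * (\<epsilon> / (8 * k) + \<epsilon> / (8 * k)) = \<epsilon> / 4" if "k > 0" for k :: real
          using that by (simp add: field_simps)
        from this[of "K T + 1"] show ?thesis unfolding \<kappa>_def using K_nonneg[of T] by linarith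
      qed
      finally show "L2_norm M (\<lambda>y. (Z q y - Z p y) - (q - p) * V t y) \<le> (q - p) * (\<epsilon> / 4)" .
    qed
    show "\<exists>s>0. \<forall>\<tau>. \<tau> \<noteq> 0 \<and> norm (\<tau> - 0) < s \<longrightarrow>
      norm (L2_norm M (\<lambda>y. (X (t + \<tau>) y - X t y) / \<tau> - U t y) - 0) < \<epsilon>"
    proof (intro exI[of _ d] conjI allI impI d(1))
      fix \<tau> :: real assume "\<tau> \<noteq> 0 \<and> norm (\<tau> - 0) < d"
      then have \<tau>: "\<tau> \<noteq> 0" "\<bar>\<tau>\<bar> < d" by auto
      have "L2_norm M (\<lambda>y. (X (t + \<tau>) y - X t y) / \<tau> - U t y)
        = L2_norm M (\<lambda>y. (1 / \<tau>) * ((X (t + \<tau>) y - X t y) - \<tau> * U t y))"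
        using \<tau> by (simp add: right_diff_distrib diff_divide_distrib)
      also have "\<dots> = (1 / \<bar>\<tau>\<bar>) * L2_norm M (\<lambda>y. (X (t + \<tau>) y - X t y) - \<tau> * U t y)"
        unfolding L2_norm_cmult by simp
      finally have eq: "L2_norm M (\<lambda>y. (X (t + \<tau>) y - X t y) / \<tau> - U t y)
        = (1 / \<bar>\<tau>\<bar>) * L2_norm M (\<lambda>y. (X (t + \<tau>) y - X t y) - \<tau> * U t y)" .
      have "L2_norm M (\<lambda>y. (X (t + \<tau>) y - X t y) - \<tau> * U t y) \<le> \<bar>\<tau>\<bar> * (\<epsilon> / 2)"
      proof (cases "\<tau> > 0")
        case True
        then show ?thesis using bound[of t "t + \<tau>"] \<tau> d by simp
      next
        case False
        have "L2_norm M (\<lambda>y. (X (t + \<tau>) y - X t y) - \<tau> * U t y)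
          = L2_norm M (\<lambda>y. (-1) * ((X t y - X (t + \<tau>) y) - (t - (t + \<tau>)) * U t y))"
          by (simp add: algebra_simps)
        also have "\<dots> = L2_norm M (\<lambda>y. (X t y - X (t + \<tau>) y) - (t - (t + \<tau>)) * U t y)"
          unfolding L2_norm_cmult by simp
        also have "\<dots> \<le> (t - (t + \<tau>)) * (\<epsilon> / 4 + \<epsilon> / 4)"
          using False \<tau> d by (intro bound) auto
        also have "\<dots> = \<bar>\<tau>\<bar> * (\<epsilon> / 2)" using False by simp
        finally show ?thesis .
      qed
      then have "L2_norm M (\<lambda>y. (X (t + \<tau>) y - X t y) / \<tau> - U t y) \<le> (1 / \<bar>\<tau>\<bar>) * (\<bar>\<tau>\<bar> * (\<epsilon> / 2))"
        unfolding eq by (rule mult_left_mono) simp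
      also have "\<dots> < \<epsilon>" using \<tau> \<epsilon> by simp
      finally show "norm (L2_norm M (\<lambda>y. (X (t + \<tau>) y - X t y) / \<tau> - U t y) - 0) < \<epsilon>"
        by (simp add: L2_norm_nonneg)
    qed
  qed
qed

end

text \<open>\<open>E\<close> may jump down, so the argument avoids continuity: increments over short
  intervals are at most \<epsilon> times their length, and they are chained over steps of length
  \<open>\<delta> / 2\<close>.\<close>

lemma antimono_of_local_bound:
  fixes E :: "real \<Rightarrow> real"
  assumes loc: "\<And>T \<epsilon>. 0 < T \<Longrightarrow> 0 < \<epsilon> \<Longrightarrow>
      \<exists>\<delta>>0. \<forall>s t. 0 < s \<longrightarrow> s \<le> t \<longrightarrow> t \<le> T \<longrightarrow> t - s < \<delta> \<longrightarrow> E t - E s \<le> (t - s) * \<epsilon>"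
    and st: "0 < s" "s \<le> t"
  shows "E t \<le> E s"
proof (rule field_le_epsilon)
  fix e :: real assume e: "0 < e"
  define \<epsilon> where "\<epsilon> = e / (t - s + 1)"
  have \<epsilon>: "\<epsilon> > 0" using e st by (simp add: \<epsilon>_def)
  obtain \<delta> where \<delta>: "\<delta> > 0" "\<And>p q. 0 < p \<Longrightarrow> p \<le> q \<Longrightarrow> q \<le> t \<Longrightarrow> q - p < \<delta> \<Longrightarrow> E q - E p \<le> (q - p) * \<epsilon>"
    using loc[of t \<epsilon>] st \<epsilon> by auto
  have chain: "E q - E p \<le> (q - p) * \<epsilon>" if "0 < p" "p \<le> q" "q \<le> t" "q - p \<le> real n * (\<delta> / 2)" for p q n
    using that
  proof (induction n arbitrary: q)
    case 0
    then have "p = q" by simp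
    then show ?case by simp
  next
    case (Suc n)
    define r where "r = max p (q - \<delta> / 2)"
    have r: "p \<le> r" "r \<le> q" "q - r < \<delta>" "r - p \<le> real n * (\<delta> / 2)"
      using Suc.prems \<delta>(1) by (auto simp: r_def algebra_simps max_def)
    have "E r - E p \<le> (r - p) * \<epsilon>" using r Suc.prems by (intro Suc.IH) auto
    moreover have "E q - E r \<le> (q - r) * \<epsilon>" using r Suc.prems by (intro \<delta>(2)) auto
    ultimately show ?case by (simp add: algebra_simps)
  qed
  obtain n :: nat where "(t - s) / (\<delta> / 2) < real n" using reals_Archimedean2 by blast
  then have "t - s \<le> real n * (\<delta> / 2)" using \<delta>(1) by (simp add: field_simps)
  then have "E t - E s \<le> (t - s) * \<epsilon>" using chain[of s t n] st by simp
  also have "\<dots> \<le> (t - s + 1) * \<epsilon>" using \<epsilon> by (intro mult_right_mono) auto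
  also have "\<dots> = e" using st by (simp add: \<epsilon>_def)
  finally show "E t \<le> E s + e" by simp
qed

locale sticky_flow_force = sticky_flow M X Z V L K
  for M :: "'a measure" and X Z V :: "real \<Rightarrow> 'a \<Rightarrow> real" and L K :: "real \<Rightarrow> real" +
  fixes F :: "real \<Rightarrow> 'a \<Rightarrow> real" and pot :: "real \<Rightarrow> real"
  assumes F_L2: "\<And>t. 0 \<le> t \<Longrightarrow> F t \<in> L2 M"
    and F_bound: "\<And>t T. 0 \<le> t \<Longrightarrow> t \<le> T \<Longrightarrow> L2_norm M (F t) \<le> K T"
    and V_bound: "\<And>t T. 0 \<le> t \<Longrightarrow> t \<le> T \<Longrightarrow> L2_norm M (V t) \<le> K T"
    and F_measurable: "\<And>t. 0 < t \<Longrightarrow> F t \<in> borel_measurable (sigma_gen M (X t))"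
    and V_F: "\<And>T \<epsilon>. 0 < T \<Longrightarrow> 0 < \<epsilon> \<Longrightarrow> \<exists>\<delta>>0. \<forall>s t. 0 \<le> s \<longrightarrow> s \<le> t \<longrightarrow> t \<le> T \<longrightarrow> t - s < \<delta> \<longrightarrow>
      L2_norm M (\<lambda>y. (V t y - V s y) - (t - s) * F t y) \<le> (t - s) * \<epsilon>"
    and pot_le: "\<And>s t T. 0 < s \<Longrightarrow> s \<le> t \<Longrightarrow> t \<le> T \<Longrightarrow>
      pot t - pot s \<le> - (\<integral>y. F t y * (X t y - X s y) \<partial>M) + K T * (t - s)\<^sup>2"
begin

text \<open>The norm of \<open>P t (V s)\<close> is at most that of \<open>U s\<close>, since
  projecting first at the earlier time \<open>s\<close> changes nothing. The mixed term is then
  split by the inequality between arithmetic and geometric mean.\<close>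

lemma kinetic_increment:
  assumes st: "0 < s" "s \<le> t"
  shows "(L2_norm M (U t))\<^sup>2 / 2 - (L2_norm M (U s))\<^sup>2 / 2 \<le> (\<integral>y. U t y * (V t y - V s y) \<partial>M)"
proof -
  have l: "V t \<in> L2 M" "V s \<in> L2 M" "U t \<in> L2 M" "U s \<in> L2 M" "P t (V s) \<in> L2 M"
    using st by (auto simp: U_def intro!: V_L2 P_L2 less_imp_le[of 0])
  have Um: "U t \<in> borel_measurable (sigma_gen M (X t))" unfolding U_def using st by (intro P_measurable) auto
  have le: "L2_norm M (P t (V s)) \<le> L2_norm M (U s)"
  proof -
    have "(L2_norm M (P t (V s)))\<^sup>2 = (\<integral>y. U s y * P t (V s) y \<partial>M)"
      using P_norm_sq[of t "V s"] P_P_inner[of s t "V s" "V s"] st l by (simp add: U_def)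
    also have "\<dots> \<le> L2_norm M (U s) * L2_norm M (P t (V s))"
      using L2_Cauchy_Schwarz[OF l(4,5)] by simp
    finally show ?thesis
      using L2_norm_nonneg[of M "P t (V s)"] L2_norm_nonneg[of M "U s"]
      by (cases "L2_norm M (P t (V s)) = 0") (auto simp: power2_eq_square mult_le_cancel_right)
  qed
  have "(\<integral>y. U t y * (V t y - V s y) \<partial>M) = (\<integral>y. V t y * U t y \<partial>M) - (\<integral>y. V s y * U t y \<partial>M)"
    using L2_mult_integrable[OF l(1,3)] L2_mult_integrable[OF l(2,3)] by (simp add: algebra_simps)
  also have "(\<integral>y. V t y * U t y \<partial>M) = (L2_norm M (U t))\<^sup>2"
    using P_norm_sq[of t "V t"] st l by (simp add: U_def)
  also have "(\<integral>y. V s y * U t y \<partial>M) = (\<integral>y. P t (V s) y * U t y \<partial>M)"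
    unfolding P_def using st l Um by (intro cond_exp_given_inner[symmetric] X_borel) auto
  finally have eq: "(\<integral>y. U t y * (V t y - V s y) \<partial>M) = (L2_norm M (U t))\<^sup>2 - (\<integral>y. P t (V s) y * U t y \<partial>M)" .
  have "(\<integral>y. P t (V s) y * U t y \<partial>M) \<le> L2_norm M (P t (V s)) * L2_norm M (U t)"
    using L2_Cauchy_Schwarz[OF l(5,3)] by simp
  also have "\<dots> \<le> L2_norm M (U s) * L2_norm M (U t)"
    using le by (intro mult_right_mono L2_norm_nonneg)
  also have "\<dots> \<le> (L2_norm M (U s))\<^sup>2 / 2 + (L2_norm M (U t))\<^sup>2 / 2"
    using zero_le_power2[of "L2_norm M (U s) - L2_norm M (U t)"] by (simp add: power2_diff)
  finally show ?thesis using eq by (simp add: field_simps)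
qed

text \<open>\<open>F t\<close> is a function of \<open>X t\<close>, hence of \<open>X s\<close>, and
  so orthogonal to both residuals. The work along the sticky motion is thus computed along
  \<open>Z\<close>, whose velocity \<open>V\<close> is known.\<close>

lemma F_increment: "0 < s \<Longrightarrow> s \<le> t \<Longrightarrow>
  (\<integral>y. F t y * (X t y - X s y) \<partial>M) = (\<integral>y. F t y * (Z t y - Z s y) \<partial>M)"
proof -
  assume st: "0 < s" "s \<le> t"
  have l: "F t \<in> L2 M" "X t \<in> L2 M" "X s \<in> L2 M" "Z t \<in> L2 M" "Z s \<in> L2 M"
    using st by (auto intro!: F_L2 X_L2 Z_L2)
  have 1: "(\<integral>y. (Z t y - X t y) * F t y \<partial>M) = 0"
    using st l by (intro orthogonal F_measurable) auto
  have 2: "(\<integral>y. (Z s y - X s y) * F t y \<partial>M) = 0"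
    using st l by (intro orthogonal measurable_earlier[OF _ _ F_measurable]) auto
  have i: "integrable M (\<lambda>y. (Z t y - X t y) * F t y)" "integrable M (\<lambda>y. (Z s y - X s y) * F t y)"
    "integrable M (\<lambda>y. F t y * (Z t y - Z s y))"
    using l by (auto intro!: L2_mult_integrable L2_diff)
  have "(\<integral>y. F t y * (X t y - X s y) \<partial>M)
    = (\<integral>y. F t y * (Z t y - Z s y) - (Z t y - X t y) * F t y + (Z s y - X s y) * F t y \<partial>M)"
    by (rule Bochner_Integration.integral_cong) (auto simp: algebra_simps)
  then show ?thesis using i 1 2 by simp
qed

text \<open>To first order, kinetic gain and potential loss both equal \<open>t - s\<close> times
  the integral of \<open>V t * F t\<close>; in the kinetic term \<open>U t\<close> may be replaced
  by \<open>V t\<close> because \<open>F t\<close> is a function of \<open>X t\<close>. The two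
  cancel, and the remainders are small against \<open>t - s\<close>, uniformly on bounded time
  intervals.\<close>

lemma total_energy_antimono:
  assumes "0 < s" "s \<le> t"
  shows "(L2_norm M (U t))\<^sup>2 / 2 + pot t \<le> (L2_norm M (U s))\<^sup>2 / 2 + pot s"
proof (rule antimono_of_local_bound[where E="\<lambda>t. (L2_norm M (U t))\<^sup>2 / 2 + pot t", OF _ assms])
  fix T \<epsilon> :: real assume T: "0 < T" and \<epsilon>: "0 < \<epsilon>"
  define k where "k = K T"
  have k: "0 \<le> k" using K_nonneg by (simp add: k_def)
  define \<eta> where "\<eta> = \<epsilon> / (2 * (k + 1))"
  have \<eta>: "\<eta> > 0" using k \<epsilon> by (simp add: \<eta>_def)
  obtain \<delta> where \<delta>: "\<delta> > 0" "\<And>s t. 0 \<le> s \<Longrightarrow> s \<le> t \<Longrightarrow> t \<le> T \<Longrightarrow> t - s < \<delta> \<Longrightarrow>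
      L2_norm M (\<lambda>y. (V t y - V s y) - (t - s) * F t y) \<le> (t - s) * \<eta>"
    using V_F[OF T \<eta>] by auto
  define d where "d = min \<delta> (\<epsilon> / (2 * (k * k + k + 1)))"
  have kk: "0 < k * k + k + 1" using k by (simp add: add_nonneg_pos)
  show "\<exists>\<delta>>0. \<forall>s t. 0 < s \<longrightarrow> s \<le> t \<longrightarrow> t \<le> T \<longrightarrow> t - s < \<delta> \<longrightarrow>
    ((L2_norm M (U t))\<^sup>2 / 2 + pot t) - ((L2_norm M (U s))\<^sup>2 / 2 + pot s) \<le> (t - s) * \<epsilon>"
  proof (intro exI[of _ d] conjI allI impI)
    show "d > 0" using \<delta>(1) \<epsilon> kk by (simp add: d_def)
    fix s t assume st: "0 < s" "s \<le> t" "t \<le> T" "t - s < d"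
    have l: "V t \<in> L2 M" "V s \<in> L2 M" "U t \<in> L2 M" "F t \<in> L2 M" "Z t \<in> L2 M" "Z s \<in> L2 M"
      using st by (auto simp: U_def intro!: V_L2 P_L2 F_L2 Z_L2)
    have Uk: "L2_norm M (U t) \<le> k"
    proof -
      have "L2_norm M (U t) \<le> L2_norm M (V t)"
        unfolding U_def P_def using st l by (intro cond_exp_given_norm_le X_borel) auto
      also have "\<dots> \<le> k" unfolding k_def using st by (intro V_bound) auto
      finally show ?thesis .
    qed
    define rV where "rV y = (V t y - V s y) - (t - s) * F t y" for y
    define rZ where "rZ y = (Z t y - Z s y) - (t - s) * V t y" for y
    have r: "rV \<in> L2 M" "rZ \<in> L2 M" unfolding rV_def rZ_def using l by (auto intro!: L2_diff L2_cmult)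
    have nV: "L2_norm M rV \<le> (t - s) * \<eta>" unfolding rV_def using st \<delta>(2)[of s t] by (simp add: d_def)
    have nZ: "L2_norm M rZ \<le> (t - s) * (k * (t - s))"
      unfolding rZ_def k_def using Z_V[of s t T t] st by simp
    have UF: "(\<integral>y. U t y * F t y \<partial>M) = (\<integral>y. V t y * F t y \<partial>M)"
      unfolding U_def P_def using st l F_measurable[of t] by (intro cond_exp_given_inner X_borel) auto
    have "(\<integral>y. U t y * (V t y - V s y) \<partial>M) = (\<integral>y. (t - s) * (U t y * F t y) + U t y * rV y \<partial>M)"
      by (rule Bochner_Integration.integral_cong) (auto simp: rV_def algebra_simps)
    also have "\<dots> = (t - s) * (\<integral>y. V t y * F t y \<partial>M) + (\<integral>y. U t y * rV y \<partial>M)"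
      using L2_mult_integrable[OF l(3,4)] L2_mult_integrable[OF l(3) r(1)] by (simp add: UF)
    also have "(\<integral>y. U t y * rV y \<partial>M) \<le> L2_norm M (U t) * L2_norm M rV"
      using L2_Cauchy_Schwarz[OF l(3) r(1)] by simp
    also have "\<dots> \<le> k * ((t - s) * \<eta>)"
      using Uk nV k by (intro mult_mono) (auto simp: L2_norm_nonneg)
    finally have kin: "(\<integral>y. U t y * (V t y - V s y) \<partial>M) \<le> (t - s) * (\<integral>y. V t y * F t y \<partial>M) + k * ((t - s) * \<eta>)"
      by simp
    have "(\<integral>y. F t y * (X t y - X s y) \<partial>M) = (\<integral>y. F t y * (Z t y - Z s y) \<partial>M)"
      using st by (intro F_increment) auto
    also have "\<dots> = (\<integral>y. (t - s) * (V t y * F t y) + F t y * rZ y \<partial>M)"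
      by (rule Bochner_Integration.integral_cong) (auto simp: rZ_def algebra_simps)
    also have "\<dots> = (t - s) * (\<integral>y. V t y * F t y \<partial>M) + (\<integral>y. F t y * rZ y \<partial>M)"
      using L2_mult_integrable[OF l(1,4)] L2_mult_integrable[OF l(4) r(2)] by simp
    finally have potF: "(\<integral>y. F t y * (X t y - X s y) \<partial>M) = (t - s) * (\<integral>y. V t y * F t y \<partial>M) + (\<integral>y. F t y * rZ y \<partial>M)" .
    have FZ: "- (\<integral>y. F t y * rZ y \<partial>M) \<le> k * ((t - s) * (k * (t - s)))"
    proof -
      have "- (\<integral>y. F t y * rZ y \<partial>M) \<le> L2_norm M (F t) * L2_norm M rZ"
        using L2_Cauchy_Schwarz[OF l(4) r(2)] by simp
      also have "\<dots> \<le> k * ((t - s) * (k * (t - s)))"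
        using F_bound[of t T] nZ k st by (intro mult_mono) (auto simp: L2_norm_nonneg k_def)
      finally show ?thesis .
    qed
    have "((L2_norm M (U t))\<^sup>2 / 2 + pot t) - ((L2_norm M (U s))\<^sup>2 / 2 + pot s)
      \<le> k * ((t - s) * \<eta>) + k * ((t - s) * (k * (t - s))) + k * (t - s)\<^sup>2"
      using kinetic_increment[of s t] pot_le[of s t T] kin potF FZ st by (simp add: k_def)
    also have "\<dots> = (t - s) * (k * \<eta> + (k * k + k) * (t - s))"
      by (simp add: algebra_simps power2_eq_square)
    also have "\<dots> \<le> (t - s) * \<epsilon>"
    proof (rule mult_left_mono)
      have "k * \<eta> \<le> (k + 1) * \<eta>" using \<eta> by simp
      also have "\<dots> = \<epsilon> / 2"
      proof -
        have "c * (\<epsilon> / (2 * c)) = \<epsilon> / 2" if "c > 0" for c :: real using that by simp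
        from this[of "k + 1"] show ?thesis using k by (simp only: \<eta>_def)
      qed
      finally have 1: "k * \<eta> \<le> \<epsilon> / 2" .
      have "(k * k + k) * (t - s) \<le> (k * k + k + 1) * (\<epsilon> / (2 * (k * k + k + 1)))"
        using st k by (intro mult_mono) (auto simp: d_def)
      also have "\<dots> = \<epsilon> / 2"
      proof -
        have "c * (\<epsilon> / (2 * c)) = \<epsilon> / 2" if "c > 0" for c :: real using that by simp
        from this[OF kk] show ?thesis .
      qed
      finally show "k * \<eta> + (k * k + k) * (t - s) \<le> \<epsilon>" using 1 by simp
    qed (use st in simp)
    finally show "((L2_norm M (U t))\<^sup>2 / 2 + pot t) - ((L2_norm M (U s))\<^sup>2 / 2 + pot s) \<le> (t - s) * \<epsilon>" .
  qed
qed

end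

section \<open>Absolutely continuous functions\<close>

text \<open>The definition speaks of families indexed by \<open>{..<n}\<close> and of nondegenerate
  intervals. The families used later are indexed by pairs or integers and may contain intervals that
  are empty.\<close>

lemma abs_cont_family:
  assumes "abs_cont f" "0 < \<epsilon>"
  obtains \<delta> where "\<delta> > 0" "\<And>(I::'i set) a b. finite I \<Longrightarrow> (\<And>i. i \<in> I \<Longrightarrow> a i \<le> b i) \<Longrightarrow>
    disjoint_family_on (\<lambda>i. {a i<..<b i}) I \<Longrightarrow> (\<Sum>i\<in>I. b i - a i) < \<delta> \<Longrightarrow>
    (\<Sum>i\<in>I. \<bar>f (b i) - f (a i)\<bar>) < \<epsilon>"
proof -
  obtain \<delta> where \<delta>: "\<delta> > 0" "\<And>(n::nat) a b. (\<forall>i<n. a i < b i) \<Longrightarrow>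
      disjoint_family_on (\<lambda>i. {a i<..<b i}) {..<n} \<Longrightarrow>
      (\<Sum>i<n. b i - a i) < \<delta> \<Longrightarrow> (\<Sum>i<n. \<bar>f (b i) - f (a i)\<bar>) < \<epsilon>"
  proof -
    from assms have "\<exists>\<delta>>0. \<forall>(n::nat) a b. (\<forall>i<n. a i < b i) \<longrightarrow>
      disjoint_family_on (\<lambda>i. {a i<..<b i}) {..<n} \<longrightarrow>
      (\<Sum>i<n. b i - a i) < \<delta> \<longrightarrow> (\<Sum>i<n. \<bar>f (b i) - f (a i)\<bar>) < \<epsilon>"
      unfolding abs_cont_def by simp
    then show ?thesis using that by blast
  qed
  show thesis
  proof (rule that[OF \<delta>(1)])
    fix I :: "'i set" and a b
    assume I: "finite I" "\<And>i. i \<in> I \<Longrightarrow> a i \<le> b i" "disjoint_family_on (\<lambda>i. {a i<..<b i}) I"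
      "(\<Sum>i\<in>I. b i - a i) < \<delta>"
    define J where "J = {i\<in>I. a i < b i}"
    have J: "finite J" "J \<subseteq> I" using I by (auto simp: J_def)
    have eq: "a i = b i" if "i \<in> I - J" for i using I(2)[of i] that by (force simp: J_def)
    obtain h where h: "bij_betw h {..<card J} J"
      using ex_bij_betw_nat_finite[OF J(1)] by (auto simp: atLeast0LessThan)
    have hJ: "h i \<in> J" if "i < card J" for i using h that by (auto simp: bij_betw_def)
    have "(\<Sum>i<card J. \<bar>f (b (h i)) - f (a (h i))\<bar>) < \<epsilon>"
    proof (rule \<delta>(2))
      show "\<forall>i<card J. a (h i) < b (h i)" using hJ by (auto simp: J_def)
      show "disjoint_family_on (\<lambda>i. {a (h i)<..<b (h i)}) {..<card J}"
        unfolding disjoint_family_on_def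
      proof (intro ballI impI)
        fix i j assume ij: "i \<in> {..<card J}" "j \<in> {..<card J}" "i \<noteq> j"
        then have "h i \<noteq> h j" using h by (auto simp: bij_betw_def inj_on_def)
        then show "{a (h i)<..<b (h i)} \<inter> {a (h j)<..<b (h j)} = {}"
          using I(3) hJ J(2) ij unfolding disjoint_family_on_def by (metis lessThan_iff subsetD)
      qed
      have "(\<Sum>i<card J. b (h i) - a (h i)) = (\<Sum>i\<in>J. b i - a i)"
        by (rule sum.reindex_bij_betw[OF h])
      also have "\<dots> = (\<Sum>i\<in>I. b i - a i)" using I J eq by (intro sum.mono_neutral_left) auto
      finally show "(\<Sum>i<card J. b (h i) - a (h i)) < \<delta>" using I(4) by simp
    qed
    also have "(\<Sum>i<card J. \<bar>f (b (h i)) - f (a (h i))\<bar>) = (\<Sum>i\<in>J. \<bar>f (b i) - f (a i)\<bar>)"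
      by (rule sum.reindex_bij_betw[OF h, where g="\<lambda>i. \<bar>f (b i) - f (a i)\<bar>"])
    also have "\<dots> = (\<Sum>i\<in>I. \<bar>f (b i) - f (a i)\<bar>)"
      using I J eq by (intro sum.mono_neutral_left) auto
    finally show "(\<Sum>i\<in>I. \<bar>f (b i) - f (a i)\<bar>) < \<epsilon>" .
  qed
qed

section \<open>Variation along sorted lists and on intervals\<close>

fun list_var :: "(real \<Rightarrow> real) \<Rightarrow> real list \<Rightarrow> real" where
  "list_var f (x # y # l) = \<bar>f y - f x\<bar> + list_var f (y # l)"
| "list_var f [x] = 0"
| "list_var f [] = 0"

lemma list_var_nonneg: "0 \<le> list_var f l"
  by (induction f l rule: list_var.induct) auto

lemma list_var_split: "list_var f (l1 @ r # l2) = list_var f (l1 @ [r]) + list_var f (r # l2)"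
  by (induction f l1 rule: list_var.induct) auto

lemma list_var_Cons_le: "list_var f l \<le> list_var f (x # l)"
  by (cases l) (auto simp: list_var_nonneg)

lemma list_var_insert: "list_var f (l1 @ l2) \<le> list_var f (l1 @ r # l2)"
proof (induction f l1 rule: list_var.induct)
  case (2 f x)
  show ?case by (cases l2) (auto simp: list_var_nonneg)
next
  case (3 f)
  show ?case by (simp add: list_var_Cons_le)
qed auto

lemma list_var_append: "list_var f l + list_var f m \<le> list_var f (l @ m)"
proof (induction f l rule: list_var.induct)
  case (2 f x)
  show ?case using list_var_Cons_le[of f m x] by simp
qed auto

lemma list_var_sum: "list_var f l = (\<Sum>j<length l - 1. \<bar>f (l ! Suc j) - f (l ! j)\<bar>)"
proof (induction f l rule: list_var.induct)
  case (1 f x y l)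
  have "(\<Sum>j<length (x # y # l) - 1. \<bar>f ((x # y # l) ! Suc j) - f ((x # y # l) ! j)\<bar>)
    = \<bar>f y - f x\<bar> + (\<Sum>j<length l. \<bar>f ((y # l) ! Suc j) - f ((y # l) ! j)\<bar>)"
    by (simp add: sum.lessThan_Suc_shift del: sum.lessThan_Suc)
  then show ?case using 1 by simp
qed auto

lemma list_gaps_sum_le:
  assumes "sorted l" "set l \<subseteq> {p..q}" "p \<le> (q::real)"
  shows "(\<Sum>j<length l - 1. l ! Suc j - l ! j) \<le> q - p"
proof (cases "l = []")
  case False
  have "(\<Sum>j<length l - 1. l ! Suc j - l ! j) = l ! (length l - 1) - l ! 0"
    by (rule sum_lessThan_telescope)
  moreover have "l ! (length l - 1) \<in> set l" "l ! 0 \<in> set l" using False by auto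
  ultimately show ?thesis using assms(2) by (smt (verit, ccfv_SIG) atLeastAtMost_iff subsetD)
qed (use assms in simp)

lemma sorted_split:
  "sorted l \<Longrightarrow> \<exists>l1 l2. l = l1 @ l2 \<and> (\<forall>x\<in>set l1. x \<le> r) \<and> (\<forall>x\<in>set l2. (r::real) < x)"
proof (induction l)
  case (Cons a l)
  show ?case
  proof (cases "a \<le> r")
    case True
    from Cons obtain l1 l2 where "l = l1 @ l2" "\<forall>x\<in>set l1. x \<le> r" "\<forall>x\<in>set l2. r < x" by auto
    then show ?thesis using True by (intro exI[of _ "a # l1"] exI[of _ l2]) auto
  next
    case False
    then show ?thesis using Cons.prems by (intro exI[of _ "[]"] exI[of _ "a # l"]) auto
  qed
qed simp

text \<open>Lists may repeat points and miss the ends of the interval. Inserting a point never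
  lowers the sum, so on a nonempty interval this is the usual variation, and lists can be cut and
  joined at any intermediate point.\<close>

definition variation :: "(real \<Rightarrow> real) \<Rightarrow> real \<Rightarrow> real \<Rightarrow> real" where
  "variation f p q = Sup {list_var f l | l. sorted l \<and> set l \<subseteq> {p..q}}"

lemma list_var_split_le:
  assumes "sorted l" "set l \<subseteq> {p..q}" "p \<le> r" "r \<le> q"
  obtains l1 l2 where "sorted l1" "set l1 \<subseteq> {p..r}" "sorted l2" "set l2 \<subseteq> {r..q}"
    "list_var f l \<le> list_var f l1 + list_var f l2"
proof -
  obtain l1 l2 where l: "l = l1 @ l2" "\<forall>x\<in>set l1. x \<le> r" "\<forall>x\<in>set l2. r < x"
    using sorted_split[OF assms(1)] by blast
  show thesis
  proof (rule that)
    show "sorted (l1 @ [r])" "sorted (r # l2)" using l assms(1) by (auto simp: sorted_append)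
    show "set (l1 @ [r]) \<subseteq> {p..r}" "set (r # l2) \<subseteq> {r..q}"
      using l assms by (auto simp: subset_iff less_imp_le)
    show "list_var f l \<le> list_var f (l1 @ [r]) + list_var f (r # l2)"
      using list_var_insert[of f l1 l2 r] list_var_split[of f l1 r l2] l(1) by simp
  qed
qed

context
  fixes f :: "real \<Rightarrow> real"
  assumes ac: "abs_cont f"
begin

text \<open>Absolute continuity on the whole line is uniform, so one \<delta> for \<epsilon> = 1
  bounds the variation on all short intervals by 1. Cutting long intervals gives linear growth,
  which later bounds initial velocities by multiples of \<open>1 + |y|\<close>.\<close>

lemma list_var_growth:
  obtains \<delta> where "\<delta> > 0"
    "\<And>n l p q. sorted l \<Longrightarrow> set l \<subseteq> {p..q} \<Longrightarrow> p \<le> q \<Longrightarrow> q - p \<le> real n * \<delta> \<Longrightarrow> list_var f l \<le> real n"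
proof -
  obtain \<delta> where \<delta>: "\<delta> > 0" "\<And>(I::nat set) a b. finite I \<Longrightarrow> (\<And>i. i \<in> I \<Longrightarrow> a i \<le> b i) \<Longrightarrow>
    disjoint_family_on (\<lambda>i. {a i<..<b i}) I \<Longrightarrow> (\<Sum>i\<in>I. b i - a i) < \<delta> \<Longrightarrow>
    (\<Sum>i\<in>I. \<bar>f (b i) - f (a i)\<bar>) < 1"
    by (rule abs_cont_family[OF ac zero_less_one]) blast
  have one: "list_var f l \<le> 1" if l: "sorted l" "set l \<subseteq> {p..q}" "p \<le> q" "q - p < \<delta>" for l p q
  proof -
    have "(\<Sum>j<length l - 1. \<bar>f (l ! Suc j) - f (l ! j)\<bar>) < 1"
    proof (rule \<delta>(2))
      show "l ! i \<le> l ! Suc i" if "i \<in> {..<length l - 1}" for i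
        using l(1) that by (auto intro!: sorted_nth_mono)
      show "disjoint_family_on (\<lambda>i. {l ! i<..<l ! Suc i}) {..<length l - 1}"
        unfolding disjoint_family_on_def
      proof (intro ballI impI)
        fix i j assume ij: "i \<in> {..<length l - 1}" "j \<in> {..<length l - 1}" "i \<noteq> j"
        have "{l ! i<..<l ! Suc i} \<inter> {l ! j<..<l ! Suc j} = {}" if "i < j" "j < length l - 1" for i j
        proof -
          have "l ! Suc i \<le> l ! j" using l(1) that by (intro sorted_nth_mono) auto
          then show ?thesis by auto
        qed
        from this[of i j] this[of j i] show "{l ! i<..<l ! Suc i} \<inter> {l ! j<..<l ! Suc j} = {}"
          using ij by (cases "i < j") auto
      qed
      show "(\<Sum>j\<in>{..<length l - 1}. l ! Suc j - l ! j) < \<delta>"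
        using list_gaps_sum_le[OF l(1-3)] l(4) by simp
    qed simp
    then show ?thesis by (simp add: list_var_sum)
  qed
  have "list_var f l \<le> real n" if "sorted l" "set l \<subseteq> {p..q}" "p \<le> q" "q - p \<le> real n * (\<delta> / 2)" for n l p q
    using that
  proof (induction n arbitrary: l p)
    case 0
    have "(\<Sum>j<length l - 1. \<bar>f (l ! Suc j) - f (l ! j)\<bar>) = 0"
    proof (intro sum.neutral ballI)
      fix j assume "j \<in> {..<length l - 1}"
      then have "l ! Suc j \<in> set l" "l ! j \<in> set l" by auto
      then have "l ! Suc j = p" "l ! j = p" using 0 by auto
      then show "\<bar>f (l ! Suc j) - f (l ! j)\<bar> = 0" by simp
    qed
    then show ?case by (simp add: list_var_sum)
  next
    case (Suc n)
    define r where "r = min q (p + \<delta> / 2)"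
    have r: "p \<le> r" "r \<le> q" "r - p < \<delta>" "q - r \<le> real n * (\<delta> / 2)"
      using Suc.prems \<delta>(1) by (auto simp: r_def min_def algebra_simps)
    obtain l1 l2 where l: "sorted l1" "set l1 \<subseteq> {p..r}" "sorted l2" "set l2 \<subseteq> {r..q}"
      "list_var f l \<le> list_var f l1 + list_var f l2"
      using list_var_split_le[OF Suc.prems(1,2) r(1,2)] by blast
    have "list_var f l1 \<le> 1" by (rule one[OF l(1,2) r(1,3)])
    moreover have "list_var f l2 \<le> real n" by (rule Suc.IH[OF l(3,4) r(2,4)])
    ultimately show ?case using l(5) by simp
  qed
  then show thesis using \<delta>(1) by (intro that[of "\<delta> / 2"]) auto
qed

lemma list_var_bdd: "bdd_above {list_var f l | l. sorted l \<and> set l \<subseteq> {p..q}}"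
proof (cases "p \<le> q")
  case True
  obtain \<delta> where \<delta>: "\<delta> > 0"
    "\<And>n l p q. sorted l \<Longrightarrow> set l \<subseteq> {p..q} \<Longrightarrow> p \<le> q \<Longrightarrow> q - p \<le> real n * \<delta> \<Longrightarrow> list_var f l \<le> real n"
    by (rule list_var_growth) blast
  obtain n :: nat where "(q - p) / \<delta> < n" using reals_Archimedean2 by blast
  then have "q - p \<le> real n * \<delta>" using \<delta>(1) by (simp add: field_simps)
  then have "list_var f l \<le> n" if "sorted l" "set l \<subseteq> {p..q}" for l
    using \<delta>(2)[OF that True] by simp
  then show ?thesis by (auto intro!: bdd_aboveI)
next
  case False
  then have "{list_var f l | l. sorted l \<and> set l \<subseteq> {p..q}} \<subseteq> {0}" by auto
  then show ?thesis by (rule bdd_above_mono[rotated]) simp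
qed

lemma list_var_le_variation: "sorted l \<Longrightarrow> set l \<subseteq> {p..q} \<Longrightarrow> list_var f l \<le> variation f p q"
  unfolding variation_def by (rule cSup_upper[OF _ list_var_bdd]) auto

lemma variation_le: "(\<And>l. sorted l \<Longrightarrow> set l \<subseteq> {p..q} \<Longrightarrow> list_var f l \<le> B) \<Longrightarrow> variation f p q \<le> B"
  unfolding variation_def
proof (rule cSup_least)
  have "0 \<in> {list_var f l | l. sorted l \<and> set l \<subseteq> {p..q}}" by (rule CollectI, rule exI[of _ "[]"]) simp
  then show "{list_var f l | l. sorted l \<and> set l \<subseteq> {p..q}} \<noteq> {}" by blast
qed auto

lemma variation_nonneg: "0 \<le> variation f p q"
  using list_var_le_variation[of "[]"] by simp

lemma variation_add:
  assumes "p \<le> r" "r \<le> q"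
  shows "variation f p q = variation f p r + variation f r q"
proof (rule antisym)
  show "variation f p q \<le> variation f p r + variation f r q"
  proof (rule variation_le)
    fix l assume l: "sorted l" "set l \<subseteq> {p..q}"
    obtain l1 l2 where l': "sorted l1" "set l1 \<subseteq> {p..r}" "sorted l2" "set l2 \<subseteq> {r..q}"
      "list_var f l \<le> list_var f l1 + list_var f l2"
      using list_var_split_le[OF l assms] by blast
    then show "list_var f l \<le> variation f p r + variation f r q"
      using list_var_le_variation[OF l'(1,2)] list_var_le_variation[OF l'(3,4)] by simp
  qed
  have "variation f p r \<le> variation f p q - variation f r q"
  proof (rule variation_le)
    fix l assume l: "sorted l" "set l \<subseteq> {p..r}"
    have "variation f r q \<le> variation f p q - list_var f l"
    proof (rule variation_le)
      fix m assume m: "sorted m" "set m \<subseteq> {r..q}"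
      have "list_var f l + list_var f m \<le> list_var f (l @ m)" by (rule list_var_append)
      also have "\<dots> \<le> variation f p q"
        by (rule list_var_le_variation) (use l m assms in \<open>fastforce simp: sorted_append\<close>)+
      finally show "list_var f m \<le> variation f p q - list_var f l" by simp
    qed
    then show "list_var f l \<le> variation f p q - variation f r q" by simp
  qed
  then show "variation f p r + variation f r q \<le> variation f p q" by simp
qed

lemma abs_diff_le_variation: "p \<le> q \<Longrightarrow> \<bar>f q - f p\<bar> \<le> variation f p q"
  using list_var_le_variation[of "[p, q]" p q] by simp

lemma variation_growth: "\<exists>C. \<forall>p q. p \<le> q \<longrightarrow> variation f p q \<le> C * (1 + (q - p))"
proof -
  obtain \<delta> where \<delta>: "\<delta> > 0"
    "\<And>n l p q. sorted l \<Longrightarrow> set l \<subseteq> {p..q} \<Longrightarrow> p \<le> q \<Longrightarrow> q - p \<le> real n * \<delta> \<Longrightarrow> list_var f l \<le> real n"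
    by (rule list_var_growth) blast
  have "variation f p q \<le> (1 / \<delta> + 1) * (1 + (q - p))" if "p \<le> q" for p q
  proof -
    define n where "n = nat \<lceil>(q - p) / \<delta>\<rceil>"
    have n: "(q - p) / \<delta> \<le> n" "real n \<le> (q - p) / \<delta> + 1"
      using that \<delta>(1) by (auto simp: n_def of_nat_nat)
    then have "q - p \<le> real n * \<delta>" using \<delta>(1) by (simp add: field_simps)
    then have "variation f p q \<le> n" using \<delta>(2) that by (intro variation_le) auto
    also have "\<dots> \<le> (q - p) / \<delta> + 1" by (rule n)
    also have "\<dots> \<le> (1 / \<delta> + 1) * (1 + (q - p))" 
    proof -
      have "(1 / \<delta> + 1) * (1 + (q - p)) = 1 / \<delta> + (q - p) / \<delta> + 1 + (q - p)"
        by (simp add: algebra_simps add_divide_distrib diff_divide_distrib)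
      moreover have "0 \<le> 1 / \<delta>" using \<delta>(1) by simp
      ultimately show ?thesis using that by linarith
    qed
    finally show ?thesis .
  qed
  then show ?thesis by blast
qed

text \<open>Each interval gets a list that attains its variation up to \<open>\<eta>\<close>, where
  all these errors together are at most \<open>\<epsilon> / 2\<close>. The gaps of all lists,
  indexed by pairs, form one disjoint family to which absolute continuity of \<open>f\<close>
  applies.\<close>

lemma variation_abs_cont:
  assumes "0 < \<epsilon>"
  obtains \<delta> where "\<delta> > 0" "\<And>(I::'i set) a b. finite I \<Longrightarrow> (\<And>i. i \<in> I \<Longrightarrow> a i \<le> b i) \<Longrightarrow>
    disjoint_family_on (\<lambda>i. {a i<..<b i}) I \<Longrightarrow> (\<Sum>i\<in>I. b i - a i) < \<delta> \<Longrightarrow>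
    (\<Sum>i\<in>I. variation f (a i) (b i)) < \<epsilon>"
proof -
  have e2: "0 < \<epsilon> / 2" using assms by simp
  obtain \<delta> where \<delta>: "\<delta> > 0" "\<And>(I::('i \<times> nat) set) a b. finite I \<Longrightarrow> (\<And>i. i \<in> I \<Longrightarrow> a i \<le> b i) \<Longrightarrow>
    disjoint_family_on (\<lambda>i. {a i<..<b i}) I \<Longrightarrow> (\<Sum>i\<in>I. b i - a i) < \<delta> \<Longrightarrow>
    (\<Sum>i\<in>I. \<bar>f (b i) - f (a i)\<bar>) < \<epsilon> / 2"
    by (rule abs_cont_family[OF ac e2]) blast
  show thesis
  proof (rule that[OF \<delta>(1)])
    fix I :: "'i set" and a b
    assume I: "finite I" "\<And>i. i \<in> I \<Longrightarrow> a i \<le> b i" "disjoint_family_on (\<lambda>i. {a i<..<b i}) I"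
      "(\<Sum>i\<in>I. b i - a i) < \<delta>"
    define \<eta> where "\<eta> = \<epsilon> / 2 / (card I + 1)"
    have \<eta>: "\<eta> > 0" using assms by (simp add: \<eta>_def)
    have "\<exists>l. sorted l \<and> set l \<subseteq> {a i..b i} \<and> variation f (a i) (b i) \<le> list_var f l + \<eta>" for i
    proof (rule ccontr)
      assume "\<not> ?thesis"
      then have "variation f (a i) (b i) \<le> variation f (a i) (b i) - \<eta>"
        by (intro variation_le) force
      then show False using \<eta> by simp
    qed
    then obtain l where l: "\<And>i. sorted (l i)" "\<And>i. set (l i) \<subseteq> {a i..b i}"
      "\<And>i. variation f (a i) (b i) \<le> list_var f (l i) + \<eta>" by metis
    define J where "J = Sigma I (\<lambda>i. {..<length (l i) - 1})"
    have J_mem: "l i ! j \<in> {a i..b i}" "l i ! Suc j \<in> {a i..b i}" if "(i, j) \<in> J" for i j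
      using l(2)[of i] that by (auto simp: J_def subset_iff)
    have "(\<Sum>k\<in>J. \<bar>f (l (fst k) ! Suc (snd k)) - f (l (fst k) ! snd k)\<bar>) < \<epsilon> / 2"
    proof (rule \<delta>(2))
      show "finite J" using I by (auto simp: J_def)
      show "l (fst k) ! snd k \<le> l (fst k) ! Suc (snd k)" if "k \<in> J" for k
        using l(1) that by (auto simp: J_def intro!: sorted_nth_mono)
      show "disjoint_family_on (\<lambda>k. {l (fst k) ! snd k<..<l (fst k) ! Suc (snd k)}) J"
        unfolding disjoint_family_on_def
      proof (intro ballI impI)
        fix k k' assume k: "k \<in> J" "k' \<in> J" "k \<noteq> k'"
        obtain i j i' j' where kk: "k = (i, j)" "k' = (i', j')" by (cases k, cases k')
        show "{l (fst k) ! snd k<..<l (fst k) ! Suc (snd k)} \<inter> {l (fst k') ! snd k'<..<l (fst k') ! Suc (snd k')} = {}"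
        proof (cases "i = i'")
          case False
          have "{l i ! j<..<l i ! Suc j} \<subseteq> {a i<..<b i}" "{l i' ! j'<..<l i' ! Suc j'} \<subseteq> {a i'<..<b i'}"
            using J_mem[of i j] J_mem[of i' j'] k kk by auto
          moreover have "{a i<..<b i} \<inter> {a i'<..<b i'} = {}"
            using I(3) k kk False by (auto simp: disjoint_family_on_def J_def)
          ultimately show ?thesis using kk by fastforce
        next
          case True
          have "{l i ! j<..<l i ! Suc j} \<inter> {l i ! j'<..<l i ! Suc j'} = {}"
            if "j < j'" "j' < length (l i) - 1" for j j'
          proof -
            have "l i ! Suc j \<le> l i ! j'" using l(1) that by (intro sorted_nth_mono) auto
            then show ?thesis by auto
          qed
          from this[of j j'] this[of j' j] show ?thesis
            using k kk True by (cases "j < j'") (auto simp: J_def)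
        qed
      qed
      have "(\<Sum>k\<in>J. l (fst k) ! Suc (snd k) - l (fst k) ! snd k)
        = (\<Sum>i\<in>I. \<Sum>j<length (l i) - 1. l i ! Suc j - l i ! j)"
        unfolding J_def using I(1) by (subst sum.Sigma) (auto simp: case_prod_beta)
      also have "\<dots> \<le> (\<Sum>i\<in>I. b i - a i)"
        using l I(2) by (intro sum_mono list_gaps_sum_le) auto
      finally show "(\<Sum>k\<in>J. l (fst k) ! Suc (snd k) - l (fst k) ! snd k) < \<delta>" using I(4) by simp
    qed
    also have "(\<Sum>k\<in>J. \<bar>f (l (fst k) ! Suc (snd k)) - f (l (fst k) ! snd k)\<bar>) = (\<Sum>i\<in>I. list_var f (l i))"
      unfolding J_def list_var_sum using I(1) by (subst sum.Sigma) (auto simp: case_prod_beta)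
    finally have small: "(\<Sum>i\<in>I. list_var f (l i)) < \<epsilon> / 2" .
    have "(\<Sum>i\<in>I. variation f (a i) (b i)) \<le> (\<Sum>i\<in>I. list_var f (l i) + \<eta>)" using l by (intro sum_mono) auto
    also have "\<dots> = (\<Sum>i\<in>I. list_var f (l i)) + card I * \<eta>" by (simp add: sum.distrib)
    also have "card I * \<eta> \<le> \<epsilon> / 2" using assms by (simp add: \<eta>_def field_simps)
    finally show "(\<Sum>i\<in>I. variation f (a i) (b i)) < \<epsilon>" using small by simp
  qed
qed

end

section \<open>Densities of monotone absolutely continuous functions\<close>

lemma abs_cont_interval_measure:
  fixes g :: "real \<Rightarrow> real"
  assumes mono: "mono g" and cont: "continuous_on UNIV g"
    and ac: "\<And>\<epsilon>. 0 < \<epsilon> \<Longrightarrow> \<exists>\<delta>>0. \<forall>(I::int set) a b. finite I \<longrightarrow> (\<forall>i\<in>I. a i \<le> b i) \<longrightarrow>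
      disjoint_family_on (\<lambda>i. {a i<..<b i}) I \<longrightarrow> (\<Sum>i\<in>I. b i - a i) < \<delta> \<longrightarrow>
      (\<Sum>i\<in>I. g (b i) - g (a i)) < \<epsilon>"
  shows "absolutely_continuous lborel (interval_measure g)"
  unfolding absolutely_continuous_def
proof
  fix N assume N: "N \<in> null_sets (lborel :: real measure)"
  let ?\<mu> = "interval_measure g"
  have Ioc: "emeasure ?\<mu> {p<..q} = ennreal (g q - g p)" if "p \<le> q" for p q
    using that mono cont by (intro emeasure_interval_measure_Ioc)
      (auto simp: mono_def continuous_on_eq_continuous_at intro: continuous_at_imp_continuous_at_within)
  have Nb: "N \<in> sets borel" using N by auto
  have small: "emeasure ?\<mu> N \<le> ennreal \<epsilon>" if \<epsilon>: "0 < \<epsilon>" for \<epsilon>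
  proof -
    obtain \<delta> where \<delta>: "\<delta> > 0" "\<And>(I::int set) a b. finite I \<Longrightarrow> (\<forall>i\<in>I. a i \<le> b i) \<Longrightarrow>
      disjoint_family_on (\<lambda>i. {a i<..<b i}) I \<Longrightarrow> (\<Sum>i\<in>I. b i - a i) < \<delta> \<Longrightarrow>
      (\<Sum>i\<in>I. g (b i) - g (a i)) < \<epsilon>"
      using ac[OF \<epsilon>] by blast
    obtain Op where O1: "open Op" and O2: "N \<subseteq> Op" and O3: "emeasure lborel (Op - N) < ennreal \<delta>"
      using outer_regular_lborel[OF _ \<delta>(1), of N] Nb by auto
    have Olt: "emeasure lborel Op < ennreal \<delta>"
    proof -
      have "Op = (Op - N) \<union> N" using O2 by auto
      then have "emeasure lborel Op \<le> emeasure lborel (Op - N) + emeasure lborel N"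
        using emeasure_subadditive[of "Op - N" lborel N] O1 Nb by simp
      then show ?thesis using O3 N by (simp add: null_setsD1)
    qed
    \<comment> \<open>The hypothesis handles finite families only, while \<open>Op\<close> may have
      infinitely many components. It is exhausted by unions \<open>B n\<close> of dyadic intervals
      of length \<open>d n\<close> inside it; the index bound \<open>4 ^ n\<close> makes them finite
      and still lets them reach out to about \<open>2 ^ n\<close>.\<close>
    define d where "d n = (1 / 2 ^ n :: real)" for n :: nat
    have d: "d n > 0" for n by (simp add: d_def)
    define S where "S n = {k::int. \<bar>k\<bar> \<le> 4 ^ n \<and> {real_of_int k * d n..real_of_int (k + 1) * d n} \<subseteq> Op}" for n
    have fS: "finite (S n)" for n
      by (rule finite_subset[of _ "{-(4^n)..4^n}"]) (auto simp: S_def abs_le_iff)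
    define B where "B n = (\<Union>k\<in>S n. {real_of_int k * d n<..real_of_int (k + 1) * d n})" for n
    have le: "real_of_int k * d n \<le> real_of_int (k + 1) * d n" for k n
      using d[of n] by (intro mult_right_mono) auto
    have disj_aux: "{real_of_int k * d n<..real_of_int (k + 1) * d n} \<inter> {real_of_int j * d n<..real_of_int (j + 1) * d n} = {}"
      if "k < j" for k j n
    proof -
      have "real_of_int (k + 1) * d n \<le> real_of_int j * d n" using that d[of n] by (intro mult_right_mono) auto
      then show ?thesis by auto
    qed
    have disj: "disjoint_family_on (\<lambda>k. {real_of_int k * d n<..real_of_int (k + 1) * d n}) (S n)" for n
      proof (unfold disjoint_family_on_def, intro ballI impI)
      fix k j :: int assume "k \<noteq> j"
      then consider "k < j" | "j < k" by linarith
      then show "{real_of_int k * d n<..real_of_int (k + 1) * d n} \<inter> {real_of_int j * d n<..real_of_int (j + 1) * d n} = {}"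
        using disj_aux[of k j n] disj_aux[of j k n] by cases (auto simp only: Int_commute)
    qed
    have disj': "disjoint_family_on (\<lambda>k. {real_of_int k * d n<..<real_of_int (k + 1) * d n}) (S n)" for n
      using disj[of n] unfolding disjoint_family_on_def by fastforce
    have Bb: "B n \<in> sets borel" for n unfolding B_def using fS by auto
    have B\<mu>: "emeasure ?\<mu> (B n) \<le> ennreal \<epsilon>" for n
    proof -
      have "ennreal (\<Sum>k\<in>S n. real_of_int (k + 1) * d n - real_of_int k * d n)
        = (\<Sum>k\<in>S n. ennreal (real_of_int (k + 1) * d n - real_of_int k * d n))"
        using le by (intro sum_ennreal[symmetric]) simp
      also have "\<dots> = (\<Sum>k\<in>S n. emeasure lborel {real_of_int k * d n<..real_of_int (k + 1) * d n})"
        using le by (intro sum.cong refl emeasure_lborel_Ioc[symmetric])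
      also have "\<dots> = emeasure lborel (B n)"
        unfolding B_def by (rule sum_emeasure[OF _ disj fS]) auto
      also have "\<dots> \<le> emeasure lborel Op"
        by (rule emeasure_mono) (use O1 in \<open>auto simp: B_def S_def\<close>)
      also note Olt
      finally have "(\<Sum>k\<in>S n. real_of_int (k + 1) * d n - real_of_int k * d n) < \<delta>"
        by (subst (asm) ennreal_less_iff) (auto intro!: sum_nonneg simp: le[simplified])
      then have lt: "(\<Sum>k\<in>S n. g (real_of_int (k + 1) * d n) - g (real_of_int k * d n)) < \<epsilon>"
        using le fS disj' by (intro \<delta>(2)) auto
      have "emeasure ?\<mu> (B n) = (\<Sum>k\<in>S n. emeasure ?\<mu> {real_of_int k * d n<..real_of_int (k + 1) * d n})"
        unfolding B_def by (rule sum_emeasure[OF _ disj fS, symmetric]) auto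
      also have "\<dots> = (\<Sum>k\<in>S n. ennreal (g (real_of_int (k + 1) * d n) - g (real_of_int k * d n)))"
        using le by (intro sum.cong refl Ioc)
      also have "\<dots> = ennreal (\<Sum>k\<in>S n. g (real_of_int (k + 1) * d n) - g (real_of_int k * d n))"
        using monoD[OF mono le] by (intro sum_ennreal) simp
      also have "\<dots> \<le> ennreal \<epsilon>" using lt by (intro ennreal_leI) simp
      finally show ?thesis .
    qed
    \<comment> \<open>Each point of \<open>Op\<close> lies in \<open>B m\<close> for all large
      \<open>m\<close>. The tail intersections increase by construction and their union covers
      \<open>Op\<close>, so continuity of the measure from below applies.\<close>
    define A where "A n = (\<Inter>m\<in>{n..}. B m)" for n
    have Ab: "A n \<in> sets borel" for n unfolding A_def using Bb by (intro sets.countable_INT) auto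
    have "Op \<subseteq> (\<Union>n. A n)"
    proof
      fix x assume x: "x \<in> Op"
      obtain e where e: "e > 0" "ball x e \<subseteq> Op" using O1 x open_contains_ball by blast
      obtain n1 where n1: "(1/2) ^ n1 < e" using real_arch_pow_inv[of e "1/2"] e by auto
      obtain n2 :: nat where n2: "\<bar>x\<bar> + 1 < real n2" using reals_Archimedean2 by blast
      have "x \<in> B m" if m: "max n1 n2 \<le> m" for m
      proof -
        define k where "k = \<lceil>x * 2 ^ m\<rceil> - 1"
        have k: "real_of_int k < x * 2 ^ m" "x * 2 ^ m \<le> real_of_int k + 1"
          using ceiling_correct[of "x * 2 ^ m"] by (auto simp: k_def)
        have dm: "d m < e"
        proof -
          have "d m = (1/2) ^ m" by (simp add: d_def power_divide)
          also have "\<dots> \<le> (1/2) ^ n1" using m by (intro power_decreasing) auto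
          finally show ?thesis using n1 by simp
        qed
        have mem: "real_of_int k * d m < x" "x \<le> real_of_int (k + 1) * d m"
          using k by (auto simp: d_def divide_less_eq le_divide_eq)
        have "{real_of_int k * d m..real_of_int (k + 1) * d m} \<subseteq> ball x e"
        proof
          fix t assume "t \<in> {real_of_int k * d m..real_of_int (k + 1) * d m}"
          moreover have "real_of_int (k + 1) * d m = real_of_int k * d m + d m" by (simp add: algebra_simps)
          ultimately have "\<bar>x - t\<bar> \<le> d m" using mem by auto
          then show "t \<in> ball x e" using dm by (simp add: dist_real_def)
        qed
        moreover have "\<bar>k\<bar> \<le> 4 ^ m"
        proof -
          have "real n2 \<le> 2 ^ m"
          proof -
            have "real n2 \<le> real m" using m by simp
            also have "\<dots> \<le> 2 ^ m" by (rule less_imp_le[OF of_nat_less_two_power])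
            finally show ?thesis .
          qed
          then have "\<bar>x\<bar> + 1 \<le> 2 ^ m" using n2 by linarith
          moreover have "\<bar>x * 2 ^ m\<bar> + 1 \<le> (\<bar>x\<bar> + 1) * 2 ^ m"
            by (simp add: abs_mult distrib_right)
          moreover have "(\<bar>x\<bar> + 1) * 2 ^ m \<le> 2 ^ m * 2 ^ m"
            by (rule mult_right_mono[OF calculation(1)]) simp
          moreover have "\<bar>real_of_int k\<bar> \<le> \<bar>x * 2 ^ m\<bar> + 1" using k by linarith
          moreover have "(2::real) ^ m * 2 ^ m = 4 ^ m" by (simp flip: power_mult_distrib)
          ultimately have "real_of_int \<bar>k\<bar> \<le> real_of_int (4 ^ m)" by simp
          then show ?thesis by (simp only: of_int_le_iff)
        qed
        ultimately have "k \<in> S m" using e(2) by (auto simp: S_def)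
        then show ?thesis using mem by (auto simp: B_def)
      qed
      then have "x \<in> A (max n1 n2)" unfolding A_def by blast
      then show "x \<in> (\<Union>n. A n)" by blast
    qed
    then have "emeasure ?\<mu> N \<le> emeasure ?\<mu> (\<Union>n. A n)"
      using O2 Ab by (intro emeasure_mono) auto
    also have "\<dots> = (SUP n. emeasure ?\<mu> (A n))"
    proof (rule SUP_emeasure_incseq[symmetric])
      show "range A \<subseteq> sets ?\<mu>" using Ab by auto
      show "incseq A" by (force simp: incseq_def A_def)
    qed
    also have "\<dots> \<le> ennreal \<epsilon>"
    proof (rule SUP_least)
      fix n
      have "emeasure ?\<mu> (A n) \<le> emeasure ?\<mu> (B n)"
        using Bb by (intro emeasure_mono) (auto simp: A_def)
      then show "emeasure ?\<mu> (A n) \<le> ennreal \<epsilon>" using B\<mu>[of n] by simp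
    qed
    finally show ?thesis .
  qed
  have "emeasure ?\<mu> N \<le> 0"
  proof (rule ennreal_le_epsilon)
    fix e :: real assume "0 < e"
    then show "emeasure ?\<mu> N \<le> 0 + ennreal e" using small by simp
  qed
  then show "N \<in> null_sets ?\<mu>" using Nb by (auto simp: null_sets_def)
qed

text \<open>The Radon-Nikodym density has extended real values. It is finite almost everywhere on
  bounded intervals, where \<open>g\<close> has finite increments, so passing to real values loses
  nothing.\<close>

lemma mono_abs_cont_density:
  fixes g :: "real \<Rightarrow> real"
  assumes mono: "mono g" and cont: "continuous_on UNIV g"
    and ac: "\<And>\<epsilon>. 0 < \<epsilon> \<Longrightarrow> \<exists>\<delta>>0. \<forall>(I::int set) a b. finite I \<longrightarrow> (\<forall>i\<in>I. a i \<le> b i) \<longrightarrow>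
      disjoint_family_on (\<lambda>i. {a i<..<b i}) I \<longrightarrow> (\<Sum>i\<in>I. b i - a i) < \<delta> \<longrightarrow>
      (\<Sum>i\<in>I. g (b i) - g (a i)) < \<epsilon>"
  obtains k where "k \<in> borel_measurable borel" "\<And>x. 0 \<le> k x"
    "\<And>p q. p \<le> q \<Longrightarrow> set_integrable lborel {p..q} k"
    "\<And>p q. p \<le> q \<Longrightarrow> (LBINT x:{p..q}. k x) = g q - g p"
proof -
  obtain d where d: "d \<in> borel_measurable lborel" "density lborel d = interval_measure g"
    using sigma_finite_measure.Radon_Nikodym[OF sigma_finite_lborel abs_cont_interval_measure[OF assms]] by auto
  have dm [measurable]: "d \<in> borel_measurable borel" using d(1) by simp
  define k where "k x = enn2real (d x)" for x
  have km [measurable]: "k \<in> borel_measurable borel" unfolding k_def by measurable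
  have nn: "(\<integral>\<^sup>+x. d x * indicator {p..q} x \<partial>lborel) = ennreal (g q - g p)" if "p \<le> q" for p q
  proof -
    have "(\<integral>\<^sup>+x. d x * indicator {p..q} x \<partial>lborel) = emeasure (density lborel d) {p..q}"
      by (simp add: emeasure_density)
    also have "\<dots> = emeasure (interval_measure g) {p..q}" by (simp only: d(2))
    also have "\<dots> = ennreal (g q - g p)"
      using that mono cont by (intro emeasure_interval_measure_Icc) (auto simp: mono_def)
    finally show ?thesis .
  qed
  have nnk: "(\<integral>\<^sup>+x. ennreal (indicator {p..q} x * k x) \<partial>lborel) = ennreal (g q - g p)" if "p \<le> q" for p q
  proof -
    have "AE x in lborel. d x * indicator {p..q} x \<noteq> \<infinity>"
      by (rule nn_integral_PInf_AE) (use nn[OF that] in \<open>auto simp: infinity_ennreal_def\<close>)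
    then have "AE x in lborel. ennreal (indicator {p..q} x * k x) = d x * indicator {p..q} x"
      by eventually_elim (auto simp: k_def indicator_def less_top ennreal_enn2real_if)
    then have "(\<integral>\<^sup>+x. ennreal (indicator {p..q} x * k x) \<partial>lborel) = (\<integral>\<^sup>+x. d x * indicator {p..q} x \<partial>lborel)"
      by (rule nn_integral_cong_AE)
    then show ?thesis using nn[OF that] by simp
  qed
  have hb: "has_bochner_integral lborel (\<lambda>x. indicator {p..q} x * k x) (g q - g p)" if "p \<le> q" for p q
    by (rule has_bochner_integral_nn_integral)
      (use nnk[OF that] monoD[OF mono that] in \<open>auto simp: k_def\<close>)
  show thesis
  proof (rule that[OF km])
    show "0 \<le> k x" for x by (simp add: k_def)
    show "set_integrable lborel {p..q} k" if "p \<le> q" for p q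
      using hb[OF that] by (simp add: set_integrable_def has_bochner_integral_iff)
    show "(LBINT x:{p..q}. k x) = g q - g p" if "p \<le> q" for p q
      using hb[OF that] by (simp add: set_lebesgue_integral_def has_bochner_integral_iff)
  qed
qed

text \<open>Lebesgue differentiation of \<open>k\<close> yields the right-hand difference quotients.
  The left-hand ones are right-hand quotients of the reflected function, and the reflection of a
  null set is null.\<close>

lemma has_derivative_of_integral:
  fixes f k :: "real \<Rightarrow> real"
  assumes k: "\<And>p q. p \<le> q \<Longrightarrow> set_integrable lborel {p..q} k"
    and f: "\<And>p q. p \<le> q \<Longrightarrow> (LBINT x:{p..q}. k x) = f q - f p"
  shows "AE x in lborel. (f has_real_derivative k x) (at x)"
proof -
  have ki: "k integrable_on {p..q}" "integral {p..q} k = f q - f p" if "p \<le> q" for p q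
    using set_borel_integral_eq_integral[OF k[OF that]] f[OF that] by auto
  have ki': "k integrable_on cbox p q" for p q
    using ki(1)[of p q] by (cases "p \<le> q") auto
  have kn: "(\<lambda>x. k (- x)) integrable_on cbox p q" for p q
    using ki'[of "- q" "- p"] Henstock_Kurzweil_Integration.integrable_reflect_real[where f=k and a="- q" and b="- p"] by simp
  have kn': "integral {p..q} (\<lambda>x. k (- x)) = f (- p) - f (- q)" if "p \<le> q" for p q
    using Henstock_Kurzweil_Integration.integral_reflect_real[where f=k and a="- q" and b="- p"] ki(2)[of "- q" "- p"] that by simp
  obtain N1 where N1: "negligible N1" "\<And>x e. \<lbrakk>x \<notin> N1; 0 < e\<rbrakk> \<Longrightarrow>
      \<exists>d>0. \<forall>h. 0 < h \<and> h < d \<longrightarrow> norm (integral (cbox x (x + h *\<^sub>R One)) k /\<^sub>R h ^ DIM(real) - k x) < e"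
    using integrable_ccontinuous_explicit[of k] ki' by blast
  obtain N2 where N2: "negligible N2" "\<And>x e. \<lbrakk>x \<notin> N2; 0 < e\<rbrakk> \<Longrightarrow>
      \<exists>d>0. \<forall>h. 0 < h \<and> h < d \<longrightarrow>
        norm (integral (cbox x (x + h *\<^sub>R One)) (\<lambda>x. k (- x)) /\<^sub>R h ^ DIM(real) - k (- x)) < e"
    using integrable_ccontinuous_explicit[of "\<lambda>x. k (- x)"] kn by blast
  have "negligible (uminus ` N2)"
    by (rule negligible_differentiable_image_negligible[OF _ N2(1)])
      (auto intro!: differentiable_on_minus differentiable_on_ident)
  then have "negligible (N1 \<union> uminus ` N2)" using N1(1) by simp
  then have null: "N1 \<union> uminus ` N2 \<in> null_sets lebesgue" by (simp add: negligible_iff_null_sets)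
  have "(f has_real_derivative k x) (at x)" if x: "x \<notin> N1 \<union> uminus ` N2" for x
    unfolding DERIV_def
  proof (rule LIM_I)
    fix e :: real assume e: "0 < e"
    have x1: "x \<notin> N1" and x2: "- x \<notin> N2" using x by (auto simp: image_iff)
    obtain d1 where d1: "d1 > 0" "\<And>h. 0 < h \<Longrightarrow> h < d1 \<Longrightarrow> \<bar>(f (x + h) - f x) / h - k x\<bar> < e"
      using N1(2)[OF x1 e] ki(2) by (auto simp: divide_inverse mult.commute)
    obtain d2 where d2: "d2 > 0" "\<And>h. 0 < h \<Longrightarrow> h < d2 \<Longrightarrow> \<bar>(f x - f (x - h)) / h - k x\<bar> < e"
      using N2(2)[OF x2 e] kn' by (auto simp: divide_inverse mult.commute)
    show "\<exists>s>0. \<forall>h. h \<noteq> 0 \<and> norm (h - 0) < s \<longrightarrow> norm ((f (x + h) - f x) / h - k x) < e"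
    proof (intro exI[of _ "min d1 d2"] conjI allI impI)
      show "min d1 d2 > 0" using d1 d2 by simp
      fix h :: real assume h: "h \<noteq> 0 \<and> norm (h - 0) < min d1 d2"
      show "norm ((f (x + h) - f x) / h - k x) < e"
      proof (cases "h > 0")
        case True
        then show ?thesis using d1(2)[of h] h by simp
      next
        case False
        then have "\<bar>(f x - f (x - (- h))) / (- h) - k x\<bar> < e" using h by (intro d2(2)) auto
        moreover have "(f x - f (x - (- h))) / (- h) = (f (x + h) - f x) / h"
          using h by (simp add: field_simps)
        ultimately show ?thesis by simp
      qed
    qed
  qed
  then have "AE x in lebesgue. (f has_real_derivative k x) (at x)"
    by (intro AE_I'[OF null]) auto
  then show ?thesis by (simp add: AE_completion_iff)
qed

definition total_variation :: "(real \<Rightarrow> real) \<Rightarrow> real \<Rightarrow> real" where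
  "total_variation f x = (if 0 \<le> x then variation f 0 x else - variation f x 0)"

context
  fixes f :: "real \<Rightarrow> real"
  assumes ac: "abs_cont f"
begin

lemma total_variation_diff:
  assumes "p \<le> q" shows "total_variation f q - total_variation f p = variation f p q"
proof -
  have 0: "variation f 0 0 = 0" using variation_add[OF ac, of 0 0 0] by simp
  consider "0 \<le> p" | "p < 0" "0 \<le> q" | "q < 0" using assms by linarith
  then show ?thesis
  proof cases
    case 1
    then show ?thesis using variation_add[OF ac, of 0 p q] assms by (simp add: total_variation_def)
  next
    case 2
    then show ?thesis using variation_add[OF ac, of p 0 q] assms by (simp add: total_variation_def)
  next
    case 3
    then show ?thesis using variation_add[OF ac, of p q 0] assms by (simp add: total_variation_def)
  qed
qed

lemma continuous_if_diff_le_variation: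
  assumes "\<And>p q. p \<le> q \<Longrightarrow> \<bar>g q - g p\<bar> \<le> C * variation f p q" "0 \<le> C"
  shows "continuous_on UNIV (g :: real \<Rightarrow> real)"
  unfolding continuous_on_iff
proof (intro ballI allI impI)
  fix x e :: real assume e: "0 < e"
  have e': "0 < e / (C + 1)" using e assms(2) by simp
  obtain \<delta> where \<delta>: "\<delta> > 0" "\<And>(I::unit set) a b. finite I \<Longrightarrow> (\<And>i. i \<in> I \<Longrightarrow> a i \<le> b i) \<Longrightarrow>
    disjoint_family_on (\<lambda>i. {a i<..<b i}) I \<Longrightarrow> (\<Sum>i\<in>I. b i - a i) < \<delta> \<Longrightarrow>
    (\<Sum>i\<in>I. variation f (a i) (b i)) < e / (C + 1)"
    by (rule variation_abs_cont[OF ac e']) blast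
  have small: "\<bar>g q - g p\<bar> < e" if "p \<le> q" "q - p < \<delta>" for p q
  proof -
    have "(\<Sum>i\<in>{()}. variation f p q) < e / (C + 1)"
      using that by (intro \<delta>(2)) (auto simp: disjoint_family_on_def)
    then have v: "variation f p q < e / (C + 1)" by simp
    have "\<bar>g q - g p\<bar> \<le> C * variation f p q" by (rule assms(1)[OF that(1)])
    also have "\<dots> \<le> (C + 1) * variation f p q"
      using variation_nonneg[OF ac, of p q] by (intro mult_right_mono) auto
    also have "\<dots> < (C + 1) * (e / (C + 1))" using v assms(2) by (intro mult_strict_left_mono) auto
    also have "\<dots> = e" using assms(2) by simp
    finally show ?thesis .
  qed
  show "\<exists>d>0. \<forall>y\<in>UNIV. dist y x < d \<longrightarrow> dist (g y) (g x) < e"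
  proof (intro exI[of _ \<delta>] conjI ballI impI \<delta>(1))
    fix y assume "dist y x < \<delta>"
    then show "dist (g y) (g x) < e"
      using small[of x y] small[of y x] by (cases "x \<le> y") (auto simp: dist_real_def abs_minus_commute)
  qed
qed

lemma density_if_diff_le_variation:
  fixes g :: "real \<Rightarrow> real"
  assumes mono: "mono g" and le: "\<And>p q. p \<le> q \<Longrightarrow> g q - g p \<le> 2 * variation f p q"
  obtains k where "k \<in> borel_measurable borel" "\<And>x. 0 \<le> k x"
    "\<And>p q. p \<le> q \<Longrightarrow> set_integrable lborel {p..q} k"
    "\<And>p q. p \<le> q \<Longrightarrow> (LBINT x:{p..q}. k x) = g q - g p"
proof -
  have cont: "continuous_on UNIV g"
    by (rule continuous_if_diff_le_variation[where C=2]) (use le monoD[OF mono] in auto)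
  have "\<exists>\<delta>>0. \<forall>(I::int set) a b. finite I \<longrightarrow> (\<forall>i\<in>I. a i \<le> b i) \<longrightarrow>
      disjoint_family_on (\<lambda>i. {a i<..<b i}) I \<longrightarrow> (\<Sum>i\<in>I. b i - a i) < \<delta> \<longrightarrow>
      (\<Sum>i\<in>I. g (b i) - g (a i)) < \<epsilon>" if "0 < \<epsilon>" for \<epsilon>
  proof -
    have e2: "0 < \<epsilon> / 2" using that by simp
    obtain \<delta> where \<delta>: "\<delta> > 0" "\<And>(I::int set) a b. finite I \<Longrightarrow> (\<And>i. i \<in> I \<Longrightarrow> a i \<le> b i) \<Longrightarrow>
      disjoint_family_on (\<lambda>i. {a i<..<b i}) I \<Longrightarrow> (\<Sum>i\<in>I. b i - a i) < \<delta> \<Longrightarrow>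
      (\<Sum>i\<in>I. variation f (a i) (b i)) < \<epsilon> / 2"
      by (rule variation_abs_cont[OF ac e2]) blast
    show ?thesis
    proof (intro exI[of _ \<delta>] conjI allI impI \<delta>(1))
      fix I :: "int set" and a b
      assume I: "finite I" "\<forall>i\<in>I. a i \<le> b i" "disjoint_family_on (\<lambda>i. {a i<..<b i}) I" "(\<Sum>i\<in>I. b i - a i) < \<delta>"
      have "(\<Sum>i\<in>I. g (b i) - g (a i)) \<le> (\<Sum>i\<in>I. 2 * variation f (a i) (b i))"
        using I le by (intro sum_mono) auto
      also have "\<dots> = 2 * (\<Sum>i\<in>I. variation f (a i) (b i))" by (simp add: sum_distrib_left)
      also have "(\<Sum>i\<in>I. variation f (a i) (b i)) < \<epsilon> / 2" using I by (intro \<delta>(2)) auto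
      finally show "(\<Sum>i\<in>I. g (b i) - g (a i)) < \<epsilon>" by simp
    qed
  qed
  then show thesis using mono_abs_cont_density[OF mono cont] that by blast
qed

text \<open>The Jordan decomposition makes \<open>f\<close> a difference of two monotone functions
  with densities \<open>k1\<close> and \<open>k2\<close>. \<open>G\<close> is a primitive of
  \<open>|k1 - k2|\<close> rather than the variation of \<open>f\<close>: the last claim then
  follows from \<open>deriv f = k\<close> almost everywhere, without identifying the variation with
  the integral of the absolute derivative.\<close>

lemma abs_cont_deriv:
  obtains G C where "mono G" "continuous_on UNIV G" "\<And>p q. p \<le> q \<Longrightarrow> G q - G p \<le> C * (1 + (q - p))"
    "\<And>p q. p \<le> q \<Longrightarrow> \<bar>f q - f p\<bar> \<le> G q - G p"
    "\<And>p q. p \<le> q \<Longrightarrow> (LINT x:{p..q}|lebesgue. \<bar>deriv f x\<bar>) = G q - G p"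
proof -
  define g1 where "g1 = total_variation f"
  define g2 where "g2 x = total_variation f x - f x" for x
  have d1: "g1 q - g1 p = variation f p q" if "p \<le> q" for p q
    using total_variation_diff[OF that] by (simp add: g1_def)
  have d2: "g2 q - g2 p = variation f p q - (f q - f p)" if "p \<le> q" for p q
    using total_variation_diff[OF that] by (simp add: g2_def)
  note v0 = variation_nonneg[OF ac] and fv = abs_diff_le_variation[OF ac]
  have b1: "0 \<le> g1 q - g1 p" "g1 q - g1 p \<le> 2 * variation f p q" if "p \<le> q" for p q
    using d1[OF that] v0[of p q] by auto
  have b2: "0 \<le> g2 q - g2 p" "g2 q - g2 p \<le> 2 * variation f p q" if "p \<le> q" for p q
    using d2[OF that] fv[OF that] by auto
  have m1: "mono g1" "mono g2" using b1(1) b2(1) by (auto simp: mono_def)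
  obtain k1 where k1: "k1 \<in> borel_measurable borel" "\<And>x. 0 \<le> k1 x"
    "\<And>p q. p \<le> q \<Longrightarrow> set_integrable lborel {p..q} k1"
    "\<And>p q. p \<le> q \<Longrightarrow> (LBINT x:{p..q}. k1 x) = g1 q - g1 p"
    by (rule density_if_diff_le_variation[OF m1(1) b1(2)]) (assumption | rule that)+
  obtain k2 where k2: "k2 \<in> borel_measurable borel" "\<And>x. 0 \<le> k2 x"
    "\<And>p q. p \<le> q \<Longrightarrow> set_integrable lborel {p..q} k2"
    "\<And>p q. p \<le> q \<Longrightarrow> (LBINT x:{p..q}. k2 x) = g2 q - g2 p"
    by (rule density_if_diff_le_variation[OF m1(2) b2(2)]) (assumption | rule that)+
  define k where "k x = k1 x - k2 x" for x
  have km [measurable]: "k \<in> borel_measurable borel" unfolding k_def using k1(1) k2(1) by simp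
  have ki: "set_integrable lborel {p..q} k" if "p \<le> q" for p q
    unfolding k_def using k1(3)[OF that] k2(3)[OF that] by (rule set_integral_diff)
  have kint: "(LBINT x:{p..q}. k x) = f q - f p" if "p \<le> q" for p q
    unfolding k_def set_integral_diff(2)[OF k1(3)[OF that] k2(3)[OF that]] k1(4)[OF that] k2(4)[OF that]
    using d1[OF that] d2[OF that] by simp
  have ka: "set_integrable lborel {p..q} (\<lambda>x. \<bar>k x\<bar>)" if "p \<le> q" for p q
    by (rule set_integrable_abs[OF ki[OF that]])
  define J where "J p q = (LBINT x:{p..q}. \<bar>k x\<bar>)" for p q
  \<comment> \<open>\<open>g1\<close> contributes the variation once, \<open>g2\<close> at most
    twice.\<close>
  have J_le: "J p q \<le> 3 * variation f p q" if "p \<le> q" for p q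
  proof -
    have "J p q \<le> (LBINT x:{p..q}. k1 x + k2 x)"
      unfolding J_def
    proof (rule set_integral_mono[OF ka[OF that] set_integral_add(1)[OF k1(3)[OF that] k2(3)[OF that]]])
      show "\<bar>k x\<bar> \<le> k1 x + k2 x" for x using k1(2)[of x] k2(2)[of x] by (simp add: k_def)
    qed
    also have "\<dots> = (g1 q - g1 p) + (g2 q - g2 p)"
      unfolding set_integral_add(2)[OF k1(3)[OF that] k2(3)[OF that]] k1(4)[OF that] k2(4)[OF that] ..
    also have "\<dots> \<le> 3 * variation f p q" using d1[OF that] d2[OF that] fv[OF that] by simp
    finally show ?thesis .
  qed
  have J_nonneg: "0 \<le> J p q" for p q
    unfolding J_def set_lebesgue_integral_def by (rule Bochner_Integration.integral_nonneg) simp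
  have J_add: "J p q = J p r + J r q" if "p \<le> r" "r \<le> q" for p q r
  proof -
    have "{p..q} = {p..r} \<union> {r<..q}" using that by auto
    moreover have disj: "{p..r} \<inter> {r<..q} = {}" by auto
    moreover have i2: "set_integrable lborel {r<..q} (\<lambda>x. \<bar>k x\<bar>)"
      by (rule set_integrable_subset[OF ka[OF that(2)]]) auto
    ultimately have "J p q = J p r + (LBINT x:{r<..q}. \<bar>k x\<bar>)"
      unfolding J_def using set_integral_Un[OF disj ka[OF that(1)] i2] by simp
    also have "(LBINT x:{r<..q}. \<bar>k x\<bar>) = J r q"
      unfolding J_def set_lebesgue_integral_def
    proof (rule integral_cong_AE)
      have "AE x in lborel. x \<noteq> r" by (rule AE_lborel_singleton)
      then show "AE x in lborel. indicator {r<..q} x *\<^sub>R \<bar>k x\<bar> = indicator {r..q} x *\<^sub>R \<bar>k x\<bar>"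
        by eventually_elim (auto simp: indicator_def)
    qed auto
    finally show ?thesis .
  qed
  define G where "G x = (if 0 \<le> x then J 0 x else - J x 0)" for x
  have G: "G q - G p = J p q" if "p \<le> q" for p q
  proof -
    have 0: "J 0 0 = 0" using J_add[of 0 0 0] by simp
    consider "0 \<le> p" | "p < 0" "0 \<le> q" | "q < 0" using that by linarith
    then show ?thesis
    proof cases
      case 1
      then show ?thesis using J_add[of 0 p q] that by (simp add: G_def)
    next
      case 2
      then show ?thesis using J_add[of p 0 q] that by (simp add: G_def)
    next
      case 3
      then show ?thesis using J_add[of p q 0] that by (simp add: G_def)
    qed
  qed
  obtain C where C: "\<And>p q. p \<le> q \<Longrightarrow> variation f p q \<le> C * (1 + (q - p))"
    using variation_growth[OF ac] by blast
  have AE1: "AE x in lborel. deriv f x = k x"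
  proof -
    have "AE x in lborel. (f has_real_derivative k x) (at x)"
      by (rule has_derivative_of_integral) (auto intro: ki kint)
    then show ?thesis by eventually_elim (rule DERIV_imp_deriv)
  qed
  show thesis
  proof (rule that[of G "3 * C"])
    show "mono G"
    proof (rule monoI)
      fix p q :: real assume "p \<le> q"
      then show "G p \<le> G q" using G[of p q] J_nonneg[of p q] by simp
    qed
    show "continuous_on UNIV G"
      by (rule continuous_if_diff_le_variation[where C=3]) (use G J_nonneg J_le in auto)
    show "G q - G p \<le> 3 * C * (1 + (q - p))" if "p \<le> q" for p q
      using G[OF that] J_le[OF that] C[OF that] by simp
    show "\<bar>f q - f p\<bar> \<le> G q - G p" if "p \<le> q" for p q
    proof -
      have "\<bar>f q - f p\<bar> = \<bar>LBINT x:{p..q}. k x\<bar>" by (simp add: kint[OF that])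
      also have "\<dots> \<le> (LBINT x:{p..q}. \<bar>k x\<bar>)"
        using set_integral_norm_bound[OF ki[OF that]] by simp
      finally show ?thesis using G[OF that] by (simp add: J_def)
    qed
    show "(LINT x:{p..q}|lebesgue. \<bar>deriv f x\<bar>) = G q - G p" if "p \<le> q" for p q
    proof -
      have ae: "AE x in lebesgue. deriv f x = k x" using AE1 by (rule AE_completion)
      have kl: "k \<in> borel_measurable lebesgue" by (rule measurable_completion) simp
      \<comment> \<open>\<open>deriv f\<close> takes unspecified values where \<open>f\<close> has
        no derivative. It is measurable because it agrees with \<open>k\<close> off a null set and
        Lebesgue measure is complete.\<close>
      have dm: "deriv f \<in> borel_measurable lebesgue"
      proof -
        obtain N where N: "{x \<in> space lebesgue. deriv f x \<noteq> k x} \<subseteq> N" "N \<in> null_sets lebesgue"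
          using ae unfolding eventually_ae_filter by auto
        show ?thesis
        proof (rule borel_measurableI)
          fix B :: "real set" assume "open B"
          then have kB: "k -` B \<in> sets lebesgue" using measurable_sets[OF kl, of B] by simp
          have "deriv f -` B \<inter> N \<in> null_sets lebesgue"
            by (rule completion.complete2[OF _ N(2)]) auto
          then have "deriv f -` B \<inter> N \<in> sets lebesgue" by (rule null_setsD2)
          moreover have "k -` B - N \<in> sets lebesgue" using kB N(2) by auto
          moreover have "deriv f -` B = (k -` B - N) \<union> (deriv f -` B \<inter> N)"
            using N(1) by auto
          ultimately have "deriv f -` B \<in> sets lebesgue" by (metis sets.Un)
          then show "deriv f -` B \<inter> space lebesgue \<in> sets lebesgue" by simp
        qed
      qed
      have "(LINT x:{p..q}|lebesgue. \<bar>deriv f x\<bar>) = (LINT x:{p..q}|lebesgue. \<bar>k x\<bar>)"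
        unfolding set_lebesgue_integral_def
      proof (rule integral_cong_AE)
        show "(\<lambda>x. indicator {p..q} x *\<^sub>R \<bar>deriv f x\<bar>) \<in> borel_measurable lebesgue"
          by (intro borel_measurable_scaleR borel_measurable_indicator borel_measurable_abs dm) simp
        show "(\<lambda>x. indicator {p..q} x *\<^sub>R \<bar>k x\<bar>) \<in> borel_measurable lebesgue"
          by (intro borel_measurable_scaleR borel_measurable_indicator borel_measurable_abs kl) simp
        show "AE x in lebesgue. indicator {p..q} x *\<^sub>R \<bar>deriv f x\<bar> = indicator {p..q} x *\<^sub>R \<bar>k x\<bar>"
          using ae by eventually_elim simp
      qed
      also have "\<dots> = J p q"
        unfolding J_def set_lebesgue_integral_def by (rule integral_completion) simp
      finally show ?thesis using G[OF that] by simp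
    qed
  qed
qed

end

section \<open>Approximation by finitely many particles\<close>

lemma not_msuppD: "y \<notin> msupp \<rho> \<Longrightarrow> \<exists>\<delta>>0. emeasure \<rho> {y - \<delta><..<y + \<delta>} = 0"
  by (auto simp: msupp_def zero_less_iff_neq_zero)

lemma not_msuppI:
  assumes "sets \<rho> = sets borel" "emeasure \<rho> {a<..<b} = 0" "a < y" "y < b"
  shows "y \<notin> msupp \<rho>"
proof -
  define d where "d = min (y - a) (b - y)"
  have d: "d > 0" using assms by (simp add: d_def)
  have "emeasure \<rho> {y - d<..<y + d} \<le> emeasure \<rho> {a<..<b}"
    by (rule emeasure_mono) (auto simp: d_def assms(1))
  then have "emeasure \<rho> {y - d<..<y + d} = 0" using assms(2) by simp
  then show ?thesis using d by (auto simp: msupp_def)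
qed

lemma closed_msupp:
  assumes "sets \<rho> = sets borel" shows "closed (msupp \<rho>)"
  unfolding closed_def open_contains_ball
proof
  fix y assume "y \<in> - msupp \<rho>"
  then obtain \<delta> where \<delta>: "\<delta> > 0" "emeasure \<rho> {y - \<delta><..<y + \<delta>} = 0" using not_msuppD[of y \<rho>] by auto
  have "z \<notin> msupp \<rho>" if "z \<in> ball y \<delta>" for z
    by (rule not_msuppI[OF assms \<delta>(2)]) (use that in \<open>auto simp: dist_real_def\<close>)
  then show "\<exists>e>0. ball y e \<subseteq> - msupp \<rho>" using \<delta>(1) by blast
qed

text \<open>Every point outside the support has a neighbourhood of measure zero, which may be shrunk
  to an interval with rational endpoints; there are countably many of these.\<close>

lemma AE_msupp:
  assumes \<rho>: "sets \<rho> = sets borel" shows "AE y in \<rho>. y \<in> msupp \<rho>"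
proof -
  define J where "J = {(a, b). a \<in> \<rat> \<and> b \<in> \<rat> \<and> emeasure \<rho> {a<..<b} = 0}"
  have "countable (\<rat> \<times> \<rat> :: (real \<times> real) set)" using countable_rat by blast
  then have cJ: "countable J" by (rule countable_subset[rotated]) (auto simp: J_def)
  have "(\<Union>i\<in>J. {fst i<..<snd i}) \<in> null_sets \<rho>"
    by (rule null_sets_UN'[OF cJ]) (auto simp: J_def null_sets_def \<rho>)
  moreover have "{y \<in> space \<rho>. y \<notin> msupp \<rho>} \<subseteq> (\<Union>i\<in>J. {fst i<..<snd i})"
  proof
    fix y assume "y \<in> {y \<in> space \<rho>. y \<notin> msupp \<rho>}"
    then obtain \<delta> where \<delta>: "\<delta> > 0" "emeasure \<rho> {y - \<delta><..<y + \<delta>} = 0" using not_msuppD[of y \<rho>] by auto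
    obtain a where a: "a \<in> \<rat>" "y - \<delta> < a" "a < y" using Rats_dense_in_real[of "y - \<delta>" y] \<delta> by auto
    obtain b where b: "b \<in> \<rat>" "y < b" "b < y + \<delta>" using Rats_dense_in_real[of y "y + \<delta>"] \<delta> by auto
    have "emeasure \<rho> {a<..<b} \<le> emeasure \<rho> {y - \<delta><..<y + \<delta>}"
      by (rule emeasure_mono) (use a b in \<open>auto simp: \<rho>\<close>)
    then have "(a, b) \<in> J" using \<delta> a b by (simp add: J_def)
    then show "y \<in> (\<Union>i\<in>J. {fst i<..<snd i})" using a b by force
  qed
  ultimately show ?thesis by (rule AE_I')
qed

text \<open>The flow depends on the potential only through \<open>W'\<close>. \<open>G\<close>
  stands for a primitive of \<open>|v'|\<close>, reduced to the properties that the gap and growth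
  bounds use.\<close>

locale flow_data = prob_space \<rho> for \<rho> :: "real measure" +
  fixes v W' G :: "real \<Rightarrow> real" and c K0 CG :: real
  assumes sets_\<rho> [measurable_cong]: "sets \<rho> = sets borel"
    and second_moment: "integrable \<rho> (\<lambda>x. x\<^sup>2)"
    and c: "c > 0"
    and W'_mono: "\<And>x y. x \<le> y \<Longrightarrow> W' x + c * x \<le> W' y + c * y"
    and W'_odd: "\<And>x. W' (- x) = - W' x"
    and W'_cont: "continuous_on UNIV W'"
    and K0: "0 \<le> K0" and W'_growth: "\<And>x. \<bar>W' x\<bar> \<le> K0 * (1 + \<bar>x\<bar>)"
    and G_mono: "mono G" and G_cont: "continuous_on UNIV G"
    and CG: "0 \<le> CG" and G_growth: "\<And>p q. p \<le> q \<Longrightarrow> G q - G p \<le> CG * (1 + (q - p))"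
    and v_G: "\<And>p q. p \<le> q \<Longrightarrow> \<bar>v q - v p\<bar> \<le> G q - G p"
begin

abbreviation S :: "real set" where "S \<equiv> msupp \<rho>"

lemma space_\<rho> [simp]: "space \<rho> = UNIV" using sets_eq_imp_space_eq[OF sets_\<rho>] by simp

lemma prob_UNIV [simp]: "prob UNIV = 1" using prob_space by simp

lemma S_closed: "closed S" by (rule closed_msupp[OF sets_\<rho>])

lemma AE_S: "AE y in \<rho>. y \<in> S" by (rule AE_msupp[OF sets_\<rho>])

lemma S_ne: "S \<noteq> {}"
proof
  assume "S = {}"
  then have "AE y in \<rho>. False" using AE_S by simp
  then show False by simp
qed

lemma W'_borel [measurable]: "W' \<in> borel_measurable borel"
  by (rule borel_measurable_continuous_onI[OF W'_cont])

lemma G_abs_growth: "\<bar>G q - G p\<bar> \<le> CG * (1 + \<bar>q - p\<bar>)"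
  using G_growth[of p q] G_growth[of q p] monoD[OF G_mono, of p q] monoD[OF G_mono, of q p]
  by (cases "p \<le> q") auto

lemma v_abs_growth: "\<bar>v q - v p\<bar> \<le> CG * (1 + \<bar>q - p\<bar>)"
  using v_G[of p q] v_G[of q p] G_abs_growth[of q p]
  by (cases "p \<le> q") (auto simp: abs_minus_commute)

lemma v_cont: "continuous_on UNIV v"
  unfolding continuous_on_iff
proof (intro ballI allI impI)
  fix x e :: real assume "0 < e"
  then obtain d where d: "d > 0" "\<And>y. dist y x < d \<Longrightarrow> dist (G y) (G x) < e"
    using G_cont unfolding continuous_on_iff by (metis UNIV_I)
  have "dist (v y) (v x) \<le> dist (G y) (G x)" for y
    using v_G[of x y] v_G[of y x] by (cases "x \<le> y") (auto simp: dist_real_def abs_minus_commute)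
  then show "\<exists>d>0. \<forall>y\<in>UNIV. dist y x < d \<longrightarrow> dist (v y) (v x) < e"
    using d by (intro exI[of _ d]) (auto intro: le_less_trans)
qed

lemma v_borel [measurable]: "v \<in> borel_measurable borel"
  by (rule borel_measurable_continuous_onI[OF v_cont])

lemma lin_L2: "(\<lambda>y. 1 + \<bar>y\<bar>) \<in> L2 \<rho>"
proof -
  have "(\<lambda>y. y) \<in> L2 \<rho>" using second_moment by (simp add: L2_def)
  from L2_add[OF L2_const[of 1] L2_abs[OF this]] show ?thesis .
qed

lemma lin_integrable: "integrable \<rho> (\<lambda>y. 1 + \<bar>y\<bar>)" by (rule L2_integrable[OF lin_L2])

definition M1 :: real where "M1 = (\<integral>y. 1 + \<bar>y\<bar> \<partial>\<rho>)"

lemma M1: "0 \<le> M1" unfolding M1_def by (rule Bochner_Integration.integral_nonneg) simp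

lemma linear_bound_integrable:
  assumes [measurable]: "f \<in> borel_measurable \<rho>" and "\<And>y. \<bar>f y\<bar> \<le> B * (1 + \<bar>y\<bar>)"
  shows "integrable \<rho> f" "\<bar>\<integral>y. f y \<partial>\<rho>\<bar> \<le> B * M1" "(\<integral>y. \<bar>f y\<bar> \<partial>\<rho>) \<le> B * M1"
proof -
  have i: "integrable \<rho> (\<lambda>y. B * (1 + \<bar>y\<bar>))" using lin_integrable by simp
  show fi: "integrable \<rho> f"
  proof (rule Bochner_Integration.integrable_bound[OF i])
    show "AE y in \<rho>. norm (f y) \<le> norm (B * (1 + \<bar>y\<bar>))"
      using assms(2) by (auto intro!: AE_I2 order_trans[OF _ abs_ge_self])
  qed simp
  have "(\<integral>y. \<bar>f y\<bar> \<partial>\<rho>) \<le> (\<integral>y. B * (1 + \<bar>y\<bar>) \<partial>\<rho>)"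
    by (rule integral_mono[OF _ i]) (use fi assms in auto)
  also have "\<dots> = B * M1" using lin_integrable by (simp add: M1_def)
  finally show "(\<integral>y. \<bar>f y\<bar> \<partial>\<rho>) \<le> B * M1" .
  then show "\<bar>\<integral>y. f y \<partial>\<rho>\<bar> \<le> B * M1" using integral_abs_bound[of \<rho> f] by linarith
qed

lemma linear_bound_L2:
  assumes "f \<in> borel_measurable \<rho>" "\<And>y. \<bar>f y\<bar> \<le> B * (1 + \<bar>y\<bar>)"
  shows "f \<in> L2 \<rho>" "L2_norm \<rho> f \<le> B * L2_norm \<rho> (\<lambda>y. 1 + \<bar>y\<bar>)"
proof -
  have l: "(\<lambda>y. B * (1 + \<bar>y\<bar>)) \<in> L2 \<rho>" by (rule L2_cmult[OF lin_L2])
  have ae: "AE y in \<rho>. \<bar>f y\<bar> \<le> \<bar>B * (1 + \<bar>y\<bar>)\<bar>"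
    using assms(2) by (auto intro!: AE_I2 order_trans[OF _ abs_ge_self])
  show f: "f \<in> L2 \<rho>" by (rule L2_dominated[OF l assms(1) ae])
  have "0 \<le> B"
    using order_trans[OF abs_ge_zero assms(2)[of 0]] by simp
  then show "L2_norm \<rho> f \<le> B * L2_norm \<rho> (\<lambda>y. 1 + \<bar>y\<bar>)"
    using L2_norm_mono[OF l f ae] by (simp only: L2_norm_cmult abs_of_nonneg)
qed

text \<open>A dense sequence in the support. Its points are the starting points of the particles and
  also the countable set on which the subsequence is selected.\<close>

definition q :: "nat \<Rightarrow> real" where "q = (SOME q. range q \<subseteq> S \<and> S \<subseteq> closure (range q))"

lemma q: "q i \<in> S" "S \<subseteq> closure (range q)"
proof -
  obtain D where D: "countable D" "D \<subseteq> S" "S \<subseteq> closure D" by (rule separable)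
  have "D \<noteq> {}" using D(3) S_ne by auto
  then have "range (from_nat_into D) = D" using D(1) by (rule range_from_nat_into)
  then have "\<exists>q :: nat \<Rightarrow> real. range q \<subseteq> S \<and> S \<subseteq> closure (range q)" using D by (intro exI[of _ "from_nat_into D"]) auto
  then have "range q \<subseteq> S \<and> S \<subseteq> closure (range q)" unfolding q_def by (rule someI_ex)
  then show "q i \<in> S" "S \<subseteq> closure (range q)" by auto
qed

lemma q_dense: "y \<in> S \<Longrightarrow> 0 < e \<Longrightarrow> \<exists>j. \<bar>q j - y\<bar> < e"
  using q(2) closure_approachable[of y "range q"] by (auto simp: dist_real_def)

definition A :: "nat \<Rightarrow> real set" where "A n = q ` {..n}"
text \<open>Every real follows the particle that starts nearest to it. Sums over particles thus
  become integrals against \<open>\<rho>\<close>, and the schemes for all \<open>n\<close> live on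
  the same space \<open>L2 \<rho>\<close>.\<close>

definition T :: "nat \<Rightarrow> real \<Rightarrow> real" where "T n = closest_point (A n)"
definition m :: "nat \<Rightarrow> real \<Rightarrow> real" where "m n a = measure \<rho> {y. T n y = a}"
definition h :: "nat \<Rightarrow> real" where "h n = 1 / (real n + 1)"

lemma A: "finite (A n)" "A n \<noteq> {}" "A n \<subseteq> S" "closed (A n)" "j \<le> n \<Longrightarrow> q j \<in> A n"
  using q by (auto simp: A_def intro: finite_imp_closed)

lemma T_in: "T n y \<in> A n" unfolding T_def using A closest_point_in_set by blast

lemma T_le: "a \<in> A n \<Longrightarrow> \<bar>y - T n y\<bar> \<le> \<bar>y - a\<bar>"
  using closest_point_le[OF A(4)] by (simp add: T_def dist_real_def)

lemma T_mono: assumes "y \<le> z" shows "T n y \<le> T n z"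
proof (rule ccontr)
  assume "\<not> T n y \<le> T n z"
  then have "T n z < T n y" by simp
  moreover have "\<bar>y - T n y\<bar> \<le> \<bar>y - T n z\<bar>" "\<bar>z - T n z\<bar> \<le> \<bar>z - T n y\<bar>" by (auto intro: T_le T_in)
  ultimately have "y = z" using assms by (auto simp: abs_if split: if_splits)
  then show False using \<open>T n z < T n y\<close> by simp
qed

lemma T_borel [measurable]: "T n \<in> borel_measurable borel"
  by (rule borel_measurable_mono) (auto simp: mono_def T_mono)

lemma h: "0 < h n" "h n \<le> 1" by (auto simp: h_def)

lemma h_lim: "h \<longlonglongrightarrow> 0"
  unfolding h_def using LIMSEQ_inverse_real_of_nat by (simp add: inverse_eq_divide add.commute)

lemma sum_m: "(\<Sum>a\<in>A n. m n a * g a) = (\<integral>y. g (T n y) \<partial>\<rho>)"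
proof -
  have "g (T n y) = (\<Sum>a\<in>A n. g a * indicator {y. T n y = a} y)" for y
  proof -
    have "(\<Sum>a\<in>A n. g a * indicator {y. T n y = a} y) = (\<Sum>a\<in>A n. if a = T n y then g a else 0)"
      by (intro sum.cong refl) (auto simp: indicator_def)
    then show ?thesis using A(1) T_in by simp
  qed
  moreover have "{y. T n y = a} \<in> sets borel" for a using measurable_sets[OF T_borel[of n], of "{a}"] by (simp add: vimage_def)
  ultimately show ?thesis
    by (simp add: m_def mult.commute Bochner_Integration.integral_sum sets_\<rho> emeasure_eq_measure)
qed

text \<open>The reals nearest to \<open>a\<close> include an open interval around \<open>a\<close>,
  and this has positive mass because \<open>a\<close> lies in the support.\<close>

lemma m_pos: assumes a: "a \<in> A n" shows "m n a > 0"
proof -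
  obtain d where d: "d > 0" "\<And>b. b \<in> A n \<Longrightarrow> b \<noteq> a \<Longrightarrow> d \<le> \<bar>a - b\<bar>"
    using finite_set_avoid[OF A(1)[of n], of a] by (auto simp: dist_real_def)
  have "T n y = a" if "\<bar>y - a\<bar> < d / 2" for y
  proof (rule ccontr)
    assume "T n y \<noteq> a"
    then have "d \<le> \<bar>a - T n y\<bar>" using d(2) T_in by blast
    moreover have "\<bar>y - T n y\<bar> \<le> \<bar>y - a\<bar>" by (rule T_le[OF a])
    ultimately show False using that by linarith
  qed
  then have sub: "{a - d/2<..<a + d/2} \<subseteq> {y. T n y = a}"
    by (metis (mono_tags, lifting) abs_diff_less_iff greaterThanLessThan_iff mem_Collect_eq subsetI)
  have "{y. T n y = a} \<in> sets \<rho>" using measurable_sets[OF T_borel[of n], of "{a}"] by (simp add: vimage_def sets_\<rho>)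
  then have "emeasure \<rho> {a - d/2<..<a + d/2} \<le> emeasure \<rho> {y. T n y = a}" using sub by (rule emeasure_mono[rotated])
  moreover have "emeasure \<rho> {a - d/2<..<a + d/2} > 0"
    using A(3) a d(1) unfolding msupp_def by (auto dest!: subsetD[OF A(3)] simp: msupp_def)
  ultimately show ?thesis by (simp add: m_def emeasure_eq_measure)
qed

lemma particle_scheme: "particle_scheme (A n) (m n) W' v G c (h n)"
proof
  show "(\<Sum>a\<in>A n. m n a) = 1" using sum_m[of n "\<lambda>_. 1"] by (simp add: prob_space)
  show "v q - v p \<le> G q - G p" if "p \<in> A n" "q \<in> A n" "p \<le> q" for p q using v_G[OF that(3)] by simp
qed (use A m_pos c h W'_mono W'_odd G_mono in auto)

sublocale P: particle_scheme "A n" "m n" W' v G c "h n" for n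
  by (rule particle_scheme)

definition xn :: "nat \<Rightarrow> nat \<Rightarrow> real \<Rightarrow> real" where "xn n k y = P.pos_at n k (T n y)"
definition Fn :: "nat \<Rightarrow> nat \<Rightarrow> real \<Rightarrow> real" where "Fn n k y = P.force n (P.pos_at n k) (T n y)"
definition Vn :: "nat \<Rightarrow> nat \<Rightarrow> real \<Rightarrow> real" where "Vn n k y = P.free_vel n k (T n y)"
definition Zn :: "nat \<Rightarrow> nat \<Rightarrow> real \<Rightarrow> real" where "Zn n k y = P.free_pos n k (T n y)"

text \<open>\<open>f\<close> may be arbitrary here, because \<open>T n\<close> takes only finitely
  many values.\<close>

lemma T_simple_borel [measurable]: "(\<lambda>y. f (T n y) :: real) \<in> borel_measurable borel"
proof -
  have eq: "(\<lambda>y. f (T n y)) = (\<lambda>y. \<Sum>a\<in>A n. f a * indicator {y. T n y = a} y)"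
  proof
    fix y
    have "(\<Sum>a\<in>A n. f a * indicator {y. T n y = a} y) = (\<Sum>a\<in>A n. if a = T n y then f a else 0)"
      by (intro sum.cong refl) (auto simp: indicator_def)
    then show "f (T n y) = (\<Sum>a\<in>A n. f a * indicator {y. T n y = a} y)" using A(1) T_in by simp
  qed
  have "{y. T n y = a} \<in> sets borel" for a using measurable_sets[OF T_borel[of n], of "{a}"] by (simp add: vimage_def)
  then show ?thesis unfolding eq by measurable
qed

lemma scheme_borel [measurable]:
  "xn n k \<in> borel_measurable borel" "Fn n k \<in> borel_measurable borel"
  "Vn n k \<in> borel_measurable borel" "Zn n k \<in> borel_measurable borel"
  unfolding xn_def[abs_def] Fn_def[abs_def] Vn_def[abs_def] Zn_def[abs_def] by measurable

lemma xn_mono: assumes "y \<le> z" shows "0 \<le> xn n k z - xn n k y"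
  using P.pos_at_mono[of n k] T_mono[OF assms] T_in by (auto simp: xn_def mono_on_def)

lemma xn_gap_le:
  assumes "y \<le> z"
  shows "xn n k z - xn n k y \<le> cosh (sqrt c * (k * h n)) * (T n z - T n y)
    + 1 / sqrt c * sinh (sqrt c * (k * h n)) * (G (T n z) - G (T n y))"
  using P.pos_at_gap_le[OF T_in T_in T_mono[OF assms], of n k]
  by (simp add: xn_def P.gap_bound_def algebra_simps diff_divide_distrib)

definition ch :: "real \<Rightarrow> real" where "ch t = cosh (sqrt c * t)"
definition sh :: "real \<Rightarrow> real" where "sh t = 1 / sqrt c * sinh (sqrt c * t)"

lemma ch_sh_mono: assumes "0 \<le> s" "s \<le> t" shows "ch s \<le> ch t" "sh s \<le> sh t" "0 \<le> ch s" "0 \<le> sh s"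
  using assms c by (auto simp: ch_def sh_def cosh_real_nonneg_le_iff divide_right_mono)

lemma xn_dist_le:
  assumes "k * h n \<le> t"
  shows "\<bar>xn n k z - xn n k y\<bar> \<le> ch t * \<bar>T n z - T n y\<bar> + sh t * \<bar>G (T n z) - G (T n y)\<bar>"
proof -
  have kh: "0 \<le> k * h n" using h[of n] by simp
  have "\<bar>xn n k z - xn n k y\<bar> \<le> ch t * \<bar>T n z - T n y\<bar> + sh t * \<bar>G (T n z) - G (T n y)\<bar>" if "y \<le> z" for y z
  proof -
    have "\<bar>xn n k z - xn n k y\<bar> = xn n k z - xn n k y" using xn_mono[OF that] by simp
    also have "\<dots> \<le> ch (k * h n) * (T n z - T n y) + sh (k * h n) * (G (T n z) - G (T n y))"
      using xn_gap_le[OF that] by (simp add: ch_def sh_def)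
    also have "\<dots> \<le> ch t * \<bar>T n z - T n y\<bar> + sh t * \<bar>G (T n z) - G (T n y)\<bar>"
      using ch_sh_mono[OF kh assms] T_mono[OF that, of n] monoD[OF G_mono T_mono[OF that, of n]]
      by (intro add_mono mult_mono) auto
    finally show ?thesis .
  qed
  from this[of y z] this[of z y] show ?thesis by (cases "y \<le> z") (auto simp: abs_minus_commute)
qed

definition D :: real where "D = 2 + \<bar>q 0\<bar>"

lemma T_bound: "\<bar>T n y\<bar> \<le> D * (1 + \<bar>y\<bar>)"
proof -
  have "\<bar>y - T n y\<bar> \<le> \<bar>y - q 0\<bar>" by (rule T_le) (rule A, simp)
  then have "\<bar>T n y\<bar> \<le> 2 * \<bar>y\<bar> + \<bar>q 0\<bar>" by linarith
  also have "\<dots> \<le> D * (1 + \<bar>y\<bar>)" by (simp add: D_def algebra_simps)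
  finally show ?thesis .
qed

definition D' :: real where "D' = \<bar>v 0\<bar> + CG * (1 + D)"

lemma D_nonneg: "0 \<le> D" "0 \<le> D'" using CG by (auto simp: D_def D'_def)

lemma v_T_bound: "\<bar>v (T n y)\<bar> \<le> D' * (1 + \<bar>y\<bar>)"
proof -
  have "\<bar>v (T n y)\<bar> \<le> \<bar>v 0\<bar> + CG * (1 + \<bar>T n y\<bar>)" using v_abs_growth[of "T n y" 0] by simp
  also have "\<dots> \<le> \<bar>v 0\<bar> * (1 + \<bar>y\<bar>) + CG * ((1 + \<bar>y\<bar>) + D * (1 + \<bar>y\<bar>))"
    using T_bound[of n y] CG by (intro add_mono mult_left_mono) (auto simp: algebra_simps)
  also have "\<dots> = D' * (1 + \<bar>y\<bar>)" by (simp add: D'_def algebra_simps)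
  finally show ?thesis .
qed

text \<open>Factors of the weight \<open>1 + |y|\<close>, uniform in \<open>n\<close>:
  \<open>B'\<close> for differences of positions, \<open>B\<close> for positions. \<open>B\<close>
  adds a bound for the mean position to a bound for the mean difference from it.\<close>

definition B' :: "real \<Rightarrow> real" where "B' t = ch t * D + sh t * (CG * (1 + D))"
definition B :: "real \<Rightarrow> real" where "B t = (D + t * D' + B' t) * M1 + B' t"

lemma B'_nonneg: assumes "0 \<le> t" shows "0 \<le> B' t"
  unfolding B'_def using ch_sh_mono(3,4)[OF assms order_refl] CG D_nonneg
  by (intro add_nonneg_nonneg mult_nonneg_nonneg) auto

lemma B_nonneg: assumes "0 \<le> t" shows "0 \<le> B t"
  unfolding B_def using B'_nonneg[OF assms] M1 D_nonneg assms
  by (intro add_nonneg_nonneg mult_nonneg_nonneg) auto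

lemma xn_dist_lin:
  assumes "k * h n \<le> t"
  shows "\<bar>xn n k z - xn n k y\<bar> \<le> B' t * ((1 + \<bar>y\<bar>) + (1 + \<bar>z\<bar>))"
proof -
  have t: "0 \<le> t" using assms h[of n] order_trans[of 0 "k * h n" t] by simp
  have T2: "\<bar>T n z - T n y\<bar> \<le> D * ((1 + \<bar>y\<bar>) + (1 + \<bar>z\<bar>))"
    using T_bound[of n y] T_bound[of n z] by (simp add: distrib_left)
  have "\<bar>xn n k z - xn n k y\<bar> \<le> ch t * \<bar>T n z - T n y\<bar> + sh t * \<bar>G (T n z) - G (T n y)\<bar>"
    by (rule xn_dist_le[OF assms])
  also have "\<dots> \<le> ch t * (D * ((1 + \<bar>y\<bar>) + (1 + \<bar>z\<bar>))) + sh t * (CG * ((1 + D) * ((1 + \<bar>y\<bar>) + (1 + \<bar>z\<bar>))))"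
  proof (intro add_mono mult_left_mono T2)
    have "1 + \<bar>T n z - T n y\<bar> \<le> ((1 + \<bar>y\<bar>) + (1 + \<bar>z\<bar>)) + D * ((1 + \<bar>y\<bar>) + (1 + \<bar>z\<bar>))" using T2 by simp
    then have "CG * (1 + \<bar>T n z - T n y\<bar>) \<le> CG * ((1 + D) * ((1 + \<bar>y\<bar>) + (1 + \<bar>z\<bar>)))"
      using CG by (intro mult_left_mono) (simp_all add: distrib_right)
    then show "\<bar>G (T n z) - G (T n y)\<bar> \<le> CG * ((1 + D) * ((1 + \<bar>y\<bar>) + (1 + \<bar>z\<bar>)))"
      using G_abs_growth[of "T n z" "T n y"] by simp
  qed (use ch_sh_mono(3,4)[OF t order_refl] in auto)
  also have "\<dots> = B' t * ((1 + \<bar>y\<bar>) + (1 + \<bar>z\<bar>))" by (simp add: B'_def algebra_simps)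
  finally show ?thesis .
qed

text \<open>A position is the mean of all positions minus the mean of their differences from it. The
  mean moves at constant velocity by \<open>momentum\<close>, and the differences are gaps.\<close>

lemma xn_bound:
  assumes "k * h n \<le> t"
  shows "\<bar>xn n k y\<bar> \<le> B t * (1 + \<bar>y\<bar>)"
proof -
  have t: "0 \<le> t" using assms h[of n] order_trans[of 0 "k * h n" t] by simp
  have Ti: "integrable \<rho> (T n)" "\<bar>\<integral>y. T n y \<partial>\<rho>\<bar> \<le> D * M1"
    using linear_bound_integrable[of "T n", OF _ T_bound] by auto
  have vi: "\<bar>\<integral>y. v (T n y) \<partial>\<rho>\<bar> \<le> D' * M1"
    using linear_bound_integrable[of "\<lambda>y. v (T n y)", OF _ v_T_bound] by auto
  have mom: "(\<integral>z. xn n k z \<partial>\<rho>) = (\<integral>z. T n z \<partial>\<rho>) + k * h n * (\<integral>z. v (T n z) \<partial>\<rho>)"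
    using P.momentum[of n k] by (simp add: sum_m xn_def)
  have d: "\<bar>xn n k z - xn n k 0\<bar> \<le> (B' t * 2) * (1 + \<bar>z\<bar>)" for z
  proof -
    have "\<bar>xn n k z - xn n k 0\<bar> \<le> B' t * ((1 + \<bar>0\<bar>) + (1 + \<bar>z\<bar>))" by (rule xn_dist_lin[OF assms])
    also have "\<dots> \<le> B' t * (2 * (1 + \<bar>z\<bar>))" using B'_nonneg[OF t] by (intro mult_left_mono) auto
    finally show ?thesis by (simp only: mult.assoc)
  qed
  have "integrable \<rho> (\<lambda>z. xn n k z - xn n k 0)" by (rule linear_bound_integrable(1)[OF _ d]) simp
  then have xi: "integrable \<rho> (xn n k)" using Bochner_Integration.integrable_add[of \<rho> "\<lambda>z. xn n k z - xn n k 0" "\<lambda>_. xn n k 0"] by simp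
  have "xn n k y = (\<integral>z. xn n k z \<partial>\<rho>) - (\<integral>z. xn n k z - xn n k y \<partial>\<rho>)"
    using xi by (simp add: prob_space)
  then have "\<bar>xn n k y\<bar> \<le> \<bar>\<integral>z. xn n k z \<partial>\<rho>\<bar> + \<bar>\<integral>z. xn n k z - xn n k y \<partial>\<rho>\<bar>" by linarith
  also have "\<bar>\<integral>z. xn n k z \<partial>\<rho>\<bar> \<le> D * M1 + t * (D' * M1)"
  proof -
    have "\<bar>k * h n * (\<integral>z. v (T n z) \<partial>\<rho>)\<bar> \<le> t * (D' * M1)"
      unfolding abs_mult using vi assms h[of n] t by (intro mult_mono) auto
    then show ?thesis using mom Ti(2) by linarith
  qed
  also have "\<bar>\<integral>z. xn n k z - xn n k y \<partial>\<rho>\<bar> \<le> (\<integral>z. \<bar>xn n k z - xn n k y\<bar> \<partial>\<rho>)"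
    using integral_abs_bound[of \<rho> "\<lambda>z. xn n k z - xn n k y"] by simp
  also have "\<dots> \<le> (\<integral>z. B' t * (1 + \<bar>y\<bar>) + B' t * (1 + \<bar>z\<bar>) \<partial>\<rho>)"
  proof (rule integral_mono)
    show "integrable \<rho> (\<lambda>z. \<bar>xn n k z - xn n k y\<bar>)" using xi by simp
    show "integrable \<rho> (\<lambda>z. B' t * (1 + \<bar>y\<bar>) + B' t * (1 + \<bar>z\<bar>))"
      by (rule Bochner_Integration.integrable_add[OF integrable_const integrable_mult_right[OF lin_integrable]])
    show "\<bar>xn n k z - xn n k y\<bar> \<le> B' t * (1 + \<bar>y\<bar>) + B' t * (1 + \<bar>z\<bar>)" for z
      using xn_dist_lin[OF assms, of z y] by (simp only: distrib_left)
  qed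
  also have "\<dots> = B' t * (1 + \<bar>y\<bar>) + B' t * M1" using lin_integrable by (simp add: M1_def prob_space)
  finally have "\<bar>xn n k y\<bar> \<le> (D + t * D' + B' t) * M1 + B' t * (1 + \<bar>y\<bar>)" by (simp add: algebra_simps)
  also have "\<dots> \<le> (D + t * D' + B' t) * M1 * (1 + \<bar>y\<bar>) + B' t * (1 + \<bar>y\<bar>)"
    using M1 D_nonneg t B'_nonneg[OF t] by (simp add: algebra_simps)
  also have "\<dots> = B t * (1 + \<bar>y\<bar>)" by (simp add: B_def algebra_simps)
  finally show ?thesis .
qed

lemma Fn_eq: "Fn n k y = - (\<integral>z. W' (xn n k y - xn n k z) \<partial>\<rho>)"
  by (simp add: Fn_def P.force_def sum_m xn_def)

definition BF :: "real \<Rightarrow> real" where "BF t = K0 * (1 + B t + B t * M1)"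

lemma BF_nonneg: "0 \<le> t \<Longrightarrow> 0 \<le> BF t"
  unfolding BF_def using B_nonneg K0 M1 by (intro mult_nonneg_nonneg add_nonneg_nonneg) auto

lemma W'_diff_bound:
  assumes "\<bar>a\<bar> \<le> C * (1 + \<bar>y\<bar>)" "\<bar>b\<bar> \<le> C * (1 + \<bar>z\<bar>)"
  shows "\<bar>W' (a - b)\<bar> \<le> K0 * (1 + C * (1 + \<bar>y\<bar>) + C * (1 + \<bar>z\<bar>))"
proof -
  have "\<bar>W' (a - b)\<bar> \<le> K0 * (1 + \<bar>a - b\<bar>)" by (rule W'_growth)
  also have "\<dots> \<le> K0 * (1 + C * (1 + \<bar>y\<bar>) + C * (1 + \<bar>z\<bar>))"
    using assms K0 by (intro mult_left_mono) auto
  finally show ?thesis .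
qed

lemma W'_dominator_integrable: "integrable \<rho> (\<lambda>z. K0 * (1 + C * (1 + \<bar>y\<bar>) + C * (1 + \<bar>z\<bar>)))"
  by (intro integrable_mult_right Bochner_Integration.integrable_add[OF integrable_const]
    integrable_mult_right[OF lin_integrable])

lemma W'_conv_bound:
  assumes f: "f \<in> borel_measurable \<rho>" "\<And>z. \<bar>f z\<bar> \<le> C * (1 + \<bar>z\<bar>)" and a: "\<bar>a\<bar> \<le> C * (1 + \<bar>y\<bar>)" and C: "0 \<le> C"
  shows "integrable \<rho> (\<lambda>z. W' (a - f z))"
    "\<bar>\<integral>z. W' (a - f z) \<partial>\<rho>\<bar> \<le> K0 * (1 + C + C * M1) * (1 + \<bar>y\<bar>)"
proof -
  note [measurable] = f(1)
  note d = W'_dominator_integrable[of C y]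
  have b: "\<bar>W' (a - f z)\<bar> \<le> K0 * (1 + C * (1 + \<bar>y\<bar>) + C * (1 + \<bar>z\<bar>))" for z
    by (rule W'_diff_bound[OF a f(2)])
  show i: "integrable \<rho> (\<lambda>z. W' (a - f z))"
    by (rule Bochner_Integration.integrable_bound[OF d]) (auto intro!: AE_I2 order_trans[OF b])
  have "\<bar>\<integral>z. W' (a - f z) \<partial>\<rho>\<bar> \<le> (\<integral>z. \<bar>W' (a - f z)\<bar> \<partial>\<rho>)" by (rule integral_abs_bound)
  also have "\<dots> \<le> (\<integral>z. K0 * (1 + C * (1 + \<bar>y\<bar>) + C * (1 + \<bar>z\<bar>)) \<partial>\<rho>)"
    by (rule integral_mono[OF _ d b]) (use i in simp)
  also have "\<dots> = K0 * (1 + C * (1 + \<bar>y\<bar>) + C * M1)"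
  proof -
    have "(\<integral>z. K0 * (1 + C * (1 + \<bar>y\<bar>) + C * (1 + \<bar>z\<bar>)) \<partial>\<rho>)
      = (\<integral>z. K0 * (1 + C * (1 + \<bar>y\<bar>)) + (K0 * C) * (1 + \<bar>z\<bar>) \<partial>\<rho>)"
      by (rule Bochner_Integration.integral_cong) (simp_all add: algebra_simps)
    also have "\<dots> = K0 * (1 + C * (1 + \<bar>y\<bar>)) + (K0 * C) * M1"
      using Bochner_Integration.integral_add[of \<rho> "\<lambda>_. K0 * (1 + C * (1 + \<bar>y\<bar>))" "\<lambda>z. (K0 * C) * (1 + \<bar>z\<bar>)"]
        lin_integrable integral_mult_right_zero[of \<rho> "K0 * C" "\<lambda>z. 1 + \<bar>z\<bar>"]
      by (simp only: M1_def) (simp add: integrable_mult_right)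
    finally show ?thesis by (simp only: distrib_left mult.assoc)
  qed
  also have "\<dots> \<le> K0 * ((1 + \<bar>y\<bar>) + C * (1 + \<bar>y\<bar>) + C * M1 * (1 + \<bar>y\<bar>))"
    using K0 C M1 by (intro mult_left_mono add_mono) (auto simp: algebra_simps)
  also have "\<dots> = K0 * (1 + C + C * M1) * (1 + \<bar>y\<bar>)" by (simp add: algebra_simps)
  finally show "\<bar>\<integral>z. W' (a - f z) \<partial>\<rho>\<bar> \<le> K0 * (1 + C + C * M1) * (1 + \<bar>y\<bar>)" .
qed

lemma time_nonneg: "real k * h n \<le> t \<Longrightarrow> 0 \<le> t"
  using h[of n] order_trans[of 0 "real k * h n" t] by simp

lemma Fn_bound:
  assumes "real k * h n \<le> t" shows "\<bar>Fn n k y\<bar> \<le> BF t * (1 + \<bar>y\<bar>)"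
  using W'_conv_bound(2)[OF _ xn_bound[OF assms] xn_bound[OF assms] B_nonneg[OF time_nonneg[OF assms]], of y]
  by (simp add: Fn_eq BF_def)

text \<open>The weight of the force per unit of time. It tends to 1, so the sum in
  \<open>Vn_eq\<close> becomes a Riemann sum of the force in the limit.\<close>

definition kr :: "nat \<Rightarrow> real" where "kr n = P.kappa n / h n"

lemma kr_nonneg: "0 \<le> kr n" using P.kappa_pos[of n] h[of n] by (simp add: kr_def)

lemma kappa_eq: "P.kappa n = kr n * h n" using h(1)[of n] by (simp add: kr_def)

lemma kr_lim: "kr \<longlonglongrightarrow> 1"
proof -
  define g where "g x = (2 * cosh x - 2) / x\<^sup>2" for x :: real
  have "g \<midarrow>0\<rightarrow> 1"
    unfolding g_def cosh_field_def by real_asymp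
  moreover have "(\<lambda>n. sqrt c * h n) \<longlonglongrightarrow> 0"
    using tendsto_mult[OF tendsto_const h_lim, of "sqrt c"] by simp
  moreover have "\<forall>\<^sub>F n in sequentially. sqrt c * h n \<noteq> 0" using c h(1) by (auto intro!: always_eventually simp: less_imp_neq[symmetric])
  ultimately have "(\<lambda>n. g (sqrt c * h n)) \<longlonglongrightarrow> 1"
    using tendsto_compose_eventually[of g 1 0 "\<lambda>n. sqrt c * h n"] by simp
  moreover have "g (sqrt c * h n) = kr n" for n
    using c h(1)[of n] by (simp add: g_def kr_def P.kappa_def power2_eq_square field_simps)
  ultimately show ?thesis by simp
qed

definition KR :: real where "KR = (SOME C. 0 \<le> C \<and> (\<forall>n. kr n \<le> C))"

lemma KR: "0 \<le> KR" "kr n \<le> KR"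
proof -
  have "Bseq kr" using kr_lim convergent_imp_Bseq convergentI by blast
  then obtain C where "C > 0" "\<And>n. norm (kr n) \<le> C" by (auto elim: BseqE)
  then have "\<exists>C. 0 \<le> C \<and> (\<forall>n. kr n \<le> C)"
    by (metis abs_ge_self less_imp_le order_trans real_norm_def)
  then have "0 \<le> KR \<and> (\<forall>n. kr n \<le> KR)" unfolding KR_def by (rule someI_ex)
  then show "0 \<le> KR" "kr n \<le> KR" by auto
qed

lemma Vn_eq: "Vn n k y = v (T n y) + (\<Sum>i<k. h n * (kr n * Fn n (Suc i) y))"
  by (simp add: Vn_def P.free_vel_def Fn_def kappa_eq mult_ac)

lemma Zn_eq: "Zn n k y = T n y + (\<Sum>i<k. h n * Vn n i y)"
  by (simp add: Zn_def P.free_pos_def Vn_def)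

definition BV :: "real \<Rightarrow> real" where "BV t = D' + t * (KR * BF t)"

lemma BV_nonneg: "0 \<le> t \<Longrightarrow> 0 \<le> BV t"
  unfolding BV_def using D_nonneg KR BF_nonneg by (intro add_nonneg_nonneg mult_nonneg_nonneg) auto

lemma Vn_bound:
  assumes "real k * h n \<le> t" shows "\<bar>Vn n k y\<bar> \<le> BV t * (1 + \<bar>y\<bar>)"
proof -
  have t: "0 \<le> t" by (rule time_nonneg[OF assms])
  have b: "\<bar>h n * (kr n * Fn n (Suc i) y)\<bar> \<le> h n * (KR * (BF t * (1 + \<bar>y\<bar>)))" if "i < k" for i
  proof -
    have "real (Suc i) * h n \<le> real k * h n" using that h[of n] by (intro mult_right_mono) auto
    then have "\<bar>Fn n (Suc i) y\<bar> \<le> BF t * (1 + \<bar>y\<bar>)" using assms by (intro Fn_bound) simp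
    then show ?thesis unfolding abs_mult using h[of n] KR kr_nonneg[of n]
      by (intro mult_mono) (auto simp: abs_of_nonneg)
  qed
  have "\<bar>Vn n k y\<bar> \<le> \<bar>v (T n y)\<bar> + (\<Sum>i<k. \<bar>h n * (kr n * Fn n (Suc i) y)\<bar>)"
    unfolding Vn_eq by (rule order_trans[OF abs_triangle_ineq add_left_mono[OF sum_abs]])
  also have "\<dots> \<le> D' * (1 + \<bar>y\<bar>) + (\<Sum>i<k. h n * (KR * (BF t * (1 + \<bar>y\<bar>))))"
    using b by (intro add_mono v_T_bound sum_mono) auto
  also have "(\<Sum>i<k. h n * (KR * (BF t * (1 + \<bar>y\<bar>)))) = (real k * h n) * (KR * (BF t * (1 + \<bar>y\<bar>)))" by simp
  also have "\<dots> \<le> t * (KR * (BF t * (1 + \<bar>y\<bar>)))"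
    using assms KR BF_nonneg[OF t] by (intro mult_right_mono mult_nonneg_nonneg) auto
  finally show ?thesis by (simp add: BV_def algebra_simps)
qed

definition N1 :: real where "N1 = L2_norm \<rho> (\<lambda>y. 1 + \<bar>y\<bar>)"

lemma N1: "0 \<le> N1" by (simp add: N1_def L2_norm_nonneg)

lemma xn_L2: "xn n k \<in> L2 \<rho>"
  by (rule linear_bound_L2(1)[OF _ xn_bound[OF order_refl]]) simp

lemma xn_step: assumes "real k * h n \<le> t" shows "L2_norm \<rho> (\<lambda>y. xn n (Suc k) y - xn n k y) \<le> h n * (BV t * N1)"
proof -
  have V: "Vn n k \<in> L2 \<rho>" "L2_norm \<rho> (Vn n k) \<le> BV t * N1"
    using linear_bound_L2[OF _ Vn_bound[OF assms]] by (auto simp: N1_def)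
  have "(L2_norm \<rho> (\<lambda>y. xn n (Suc k) y - xn n k y))\<^sup>2 \<le> (h n)\<^sup>2 * (L2_norm \<rho> (Vn n k))\<^sup>2"
    using P.pos_at_step[of n k] by (simp add: sum_m L2_norm_sq xn_def Vn_def)
  also have "\<dots> \<le> (h n)\<^sup>2 * (BV t * N1)\<^sup>2"
    using V(2) by (intro mult_left_mono power_mono L2_norm_nonneg) auto
  also have "\<dots> = (h n * (BV t * N1))\<^sup>2" by (simp add: power_mult_distrib)
  finally show ?thesis
    by (rule power2_le_imp_le) (use h[of n] BV_nonneg[OF time_nonneg[OF assms]] N1 in auto)
qed

lemma xn_L2_lipschitz:
  assumes "j \<le> k" "real k * h n \<le> t"
  shows "L2_norm \<rho> (\<lambda>y. xn n k y - xn n j y) \<le> BV t * N1 * (real k * h n - real j * h n)"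
  using assms
proof (induction k rule: dec_induct)
  case base
  then show ?case by (simp add: L2_norm_def)
next
  case (step k)
  have kt: "real k * h n \<le> t" using step.prems h[of n] by (simp add: algebra_simps)
  have "L2_norm \<rho> (\<lambda>y. xn n (Suc k) y - xn n j y)
    \<le> L2_norm \<rho> (\<lambda>y. xn n (Suc k) y - xn n k y) + L2_norm \<rho> (\<lambda>y. xn n k y - xn n j y)"
    by (rule L2_norm_triangle_diff[OF xn_L2 xn_L2 xn_L2])
  also have "\<dots> \<le> h n * (BV t * N1) + BV t * N1 * (real k * h n - real j * h n)"
    using xn_step[OF kt] step.IH[OF kt] by simp
  also have "\<dots> = BV t * N1 * (real (Suc k) * h n - real j * h n)" by (simp add: algebra_simps)
  finally show ?case .
qed

end

section \<open>The limit flow\<close>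

context flow_data
begin

text \<open>\<open>T n\<close> is a step function, but a point \<open>y\<close> of the support has
  some \<open>q j\<close> nearby. From \<open>n = j\<close> on, \<open>T n\<close> moves
  \<open>y\<close> and the reals close to \<open>y\<close> only a little; the gap bound and the
  continuity of \<open>G\<close> at \<open>y\<close> do the rest.\<close>

lemma equicontinuous_space:
  assumes y: "y \<in> S" and \<epsilon>: "0 < \<epsilon>" and t: "0 \<le> t"
  obtains \<delta> N where "\<delta> > 0"
    "\<And>n k z. N \<le> n \<Longrightarrow> real k * h n \<le> t \<Longrightarrow> \<bar>z - y\<bar> < \<delta> \<Longrightarrow> \<bar>xn n k z - xn n k y\<bar> < \<epsilon>"
proof -
  have cs: "0 \<le> ch t" "0 \<le> sh t" using ch_sh_mono[OF t order_refl] by auto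
  define \<eta> where "\<eta> = \<epsilon> / (ch t + sh t + 1)"
  have \<eta>: "\<eta> > 0" using \<epsilon> cs by (simp add: \<eta>_def)
  then have "0 < \<eta> / 2" by simp
  with G_cont have "\<exists>d>0. \<forall>p\<in>UNIV. dist p y < d \<longrightarrow> dist (G p) (G y) < \<eta> / 2"
    unfolding continuous_on_iff by blast
  then obtain d where d: "d > 0" "\<And>p. \<bar>p - y\<bar> < d \<Longrightarrow> \<bar>G p - G y\<bar> < \<eta> / 2"
    unfolding dist_real_def by blast
  define \<delta> where "\<delta> = min d \<eta> / 4"
  have \<delta>: "\<delta> > 0" "4 * \<delta> \<le> d" "4 * \<delta> \<le> \<eta>" using d(1) \<eta> by (auto simp: \<delta>_def)
  obtain j where j: "\<bar>q j - y\<bar> < \<delta>" using q_dense[OF y \<delta>(1)] by auto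
  show thesis
  proof (rule that[of \<delta> j, OF \<delta>(1)])
    fix n k z assume n: "j \<le> n" and k: "real k * h n \<le> t" and z: "\<bar>z - y\<bar> < \<delta>"
    have Ty: "\<bar>y - T n y\<bar> \<le> \<bar>y - q j\<bar>" and Tz: "\<bar>z - T n z\<bar> \<le> \<bar>z - q j\<bar>"
      using A(5)[OF n] by (auto intro: T_le)
    have 1: "\<bar>T n y - y\<bar> < d" "\<bar>T n z - y\<bar> < d" "\<bar>T n z - T n y\<bar> < \<eta>"
      using Ty Tz j z \<delta> by linarith+
    have 2: "\<bar>G (T n z) - G (T n y)\<bar> < \<eta>" using d(2)[OF 1(1)] d(2)[OF 1(2)] by linarith
    have "\<bar>xn n k z - xn n k y\<bar> \<le> ch t * \<bar>T n z - T n y\<bar> + sh t * \<bar>G (T n z) - G (T n y)\<bar>"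
      by (rule xn_dist_le[OF k])
    also have "\<dots> \<le> ch t * \<eta> + sh t * \<eta>"
      using cs 1(3) 2 by (intro add_mono mult_left_mono) auto
    also have "\<dots> < (ch t + sh t + 1) * \<eta>" using \<eta> by (simp add: distrib_right)
    also have "\<dots> = \<epsilon>" using cs by (simp add: \<eta>_def)
    finally show "\<bar>xn n k z - xn n k y\<bar> < \<epsilon>" .
  qed
qed

text \<open>Single trajectories are equicontinuous although the scheme is Lipschitz in time only in the mean:
  a neighbourhood of a point of the support has positive mass and moves together with the point.\<close>

lemma equicontinuous_time:
  assumes y: "y \<in> S" and \<epsilon>: "0 < \<epsilon>" and t: "0 \<le> t"
  obtains \<delta> N where "\<delta> > 0"
    "\<And>n j k. N \<le> n \<Longrightarrow> real k * h n \<le> t \<Longrightarrow> real j * h n \<le> t \<Longrightarrow> \<bar>real k * h n - real j * h n\<bar> < \<delta> \<Longrightarrow>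
      \<bar>xn n k y - xn n j y\<bar> < \<epsilon>"
proof -
  have e4: "0 < \<epsilon> / 4" using \<epsilon> by simp
  obtain \<delta>1 N where \<delta>1: "\<delta>1 > 0"
    "\<And>n k z. N \<le> n \<Longrightarrow> real k * h n \<le> t \<Longrightarrow> \<bar>z - y\<bar> < \<delta>1 \<Longrightarrow> \<bar>xn n k z - xn n k y\<bar> < \<epsilon> / 4"
    by (rule equicontinuous_space[OF y e4 t]) blast
  define E where "E = {y - \<delta>1<..<y + \<delta>1}"
  define p where "p = measure \<rho> E"
  have E: "E \<in> sets \<rho>" by (simp add: E_def sets_\<rho>)
  have p: "p > 0" using y \<delta>1(1) by (auto simp: p_def E_def msupp_def emeasure_eq_measure)
  define L where "L = BV t * N1"
  have L: "0 \<le> L" unfolding L_def using BV_nonneg[OF t] N1 by simp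
  \<comment> \<open>If \<open>y\<close> moves by \<open>d\<close>, every point of \<open>E\<close>
    moves by at least \<open>d - \<epsilon> / 2\<close>, so the mean displacement is at least
    \<open>p * (d - \<epsilon> / 2)\<close>. With this \<open>\<delta>\<close> the Lipschitz bound
    in the mean keeps it at or below \<open>p * \<epsilon> / 4\<close>.\<close>
  define \<delta> where "\<delta> = p * \<epsilon> / (4 * (L + 1))"
  have \<delta>: "\<delta> > 0" using p \<epsilon> L by (simp add: \<delta>_def)
  have main: "\<bar>xn n k y - xn n j y\<bar> < \<epsilon>"
    if n: "N \<le> n" and k: "real k * h n \<le> t" and jk: "j \<le> k" "real k * h n - real j * h n < \<delta>" for n j k
  proof -
    have j: "real j * h n \<le> t" using jk(1) k h[of n] by (meson less_imp_le mult_right_mono of_nat_le_iff order_trans)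
    define d where "d = \<bar>xn n k y - xn n j y\<bar>"
    define f where "f z = xn n k z - xn n j z" for z
    have f: "f \<in> L2 \<rho>" unfolding f_def by (rule L2_diff[OF xn_L2 xn_L2])
    have pt: "indicator E z * (d - \<epsilon> / 2) \<le> \<bar>f z\<bar>" for z
    proof (cases "z \<in> E")
      case True
      then have "\<bar>z - y\<bar> < \<delta>1" by (auto simp: E_def)
      from \<delta>1(2)[OF n k this] \<delta>1(2)[OF n j this] have "d - \<epsilon> / 2 \<le> \<bar>f z\<bar>"
        unfolding d_def f_def by linarith
      then show ?thesis using True by simp
    qed simp
    have "p * (d - \<epsilon> / 2) = (\<integral>z. indicator E z * (d - \<epsilon> / 2) \<partial>\<rho>)" using E by (simp add: p_def)
    also have "\<dots> \<le> (\<integral>z. \<bar>f z\<bar> \<partial>\<rho>)"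
      by (rule integral_mono[OF _ _ pt]) (use E L2_integrable[OF L2_abs[OF f]] in \<open>auto simp: emeasure_eq_measure\<close>)
    also have "\<dots> \<le> L2_norm \<rho> f"
    proof -
      have "\<bar>\<integral>z. \<bar>f z\<bar> * 1 \<partial>\<rho>\<bar> \<le> L2_norm \<rho> (\<lambda>z. \<bar>f z\<bar>) * L2_norm \<rho> (\<lambda>_. 1)"
        by (rule L2_Cauchy_Schwarz[OF L2_abs[OF f] L2_const])
      then show ?thesis by (simp add: L2_norm_const) (simp add: L2_norm_def)
    qed
    also have "\<dots> \<le> L * (real k * h n - real j * h n)"
      using xn_L2_lipschitz[OF jk(1) k] by (simp add: f_def[abs_def] L_def)
    also have "\<dots> \<le> (L + 1) * \<delta>" using jk L h[of n] by (intro mult_mono) (auto intro: mult_right_mono)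
    also have "\<dots> = p * (\<epsilon> / 4)"
    proof -
      have "l * (p * \<epsilon> / (4 * l)) = p * (\<epsilon> / 4)" if "l > 0" for l :: real using that by simp
      from this[of "L + 1"] show ?thesis using L by (simp only: \<delta>_def)
    qed
    finally have "d - \<epsilon> / 2 \<le> \<epsilon> / 4" using p by simp
    then show ?thesis using \<epsilon> by (simp add: d_def)
  qed
  show thesis
  proof (rule that[of \<delta> N, OF \<delta>])
    fix n j k assume a: "N \<le> n" "real k * h n \<le> t" "real j * h n \<le> t" "\<bar>real k * h n - real j * h n\<bar> < \<delta>"
    show "\<bar>xn n k y - xn n j y\<bar> < \<epsilon>"
      using main[of n k j] main[of n j k] a by (cases "j \<le> k") (auto simp: abs_minus_commute)
  qed
qed

section \<open>Selection of a convergent subsequence\<close>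

definition k_at :: "nat \<Rightarrow> real \<Rightarrow> nat" where "k_at n t = nat \<lfloor>t / h n\<rfloor>"

lemma k_at:
  assumes "0 \<le> t" shows "real (k_at n t) * h n \<le> t" "t < real (k_at n t) * h n + h n"
proof -
  have r: "real (k_at n t) = of_int \<lfloor>t / h n\<rfloor>" using assms h[of n] by (simp add: k_at_def)
  have "real (k_at n t) \<le> t / h n" "t / h n < real (k_at n t) + 1" unfolding r by linarith+
  then show "real (k_at n t) * h n \<le> t" "t < real (k_at n t) * h n + h n"
    using h(1)[of n] by (auto simp: field_simps)
qed

text \<open>Diagonal selection over the countably many pairs of a rational time and a starting
  point. Division by \<open>C\<close> gives all pairs the common bound 1.\<close>

lemma approx_bounded_subsequence:
  "\<exists>s. strict_mono (s :: nat \<Rightarrow> nat) \<and> (\<forall>r\<in>\<rat>. 0 \<le> r \<longrightarrow> (\<forall>j. convergent (\<lambda>n. xn (s n) (k_at (s n) r) (q j))))"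
proof -
  define C where "C = (\<lambda>(r, j). B r * (1 + \<bar>q j\<bar>) + 1)"
  define f where "f n = (\<lambda>(r, j). xn n (k_at n r) (q j) / C (r, j))" for n
  have C: "C (r, j) > 0" if "0 \<le> r" for r j
    unfolding C_def using B_nonneg[OF that] by (auto intro!: add_nonneg_pos)
  have bd: "norm (f n x) \<le> 1" if "x \<in> (\<rat> \<inter> {0..}) \<times> (UNIV :: nat set)" for n x
  proof -
    obtain r j where "x = (r, j)" by (cases x)
    then have x: "x = (r, j)" "0 \<le> r" using that by auto
    have "\<bar>xn n (k_at n r) (q j)\<bar> \<le> C (r, j)"
      using xn_bound[OF k_at(1)[OF x(2)], of n "q j"] by (simp add: C_def)
    then show ?thesis using C[OF x(2), of j] by (simp add: x f_def abs_divide)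
  qed
  have "countable ((\<rat> \<inter> {0..}) \<times> (UNIV :: nat set))" using countable_rat by auto
  then obtain s where s: "strict_mono (s :: nat \<Rightarrow> nat)"
    "\<And>x. x \<in> (\<rat> \<inter> {0..}) \<times> UNIV \<Longrightarrow> \<exists>l. (\<lambda>n. f (s n) x) \<longlonglongrightarrow> l"
    using function_convergent_subsequence[of "(\<rat> \<inter> {0..}) \<times> UNIV" f 1] bd by blast
  have "convergent (\<lambda>n. xn (s n) (k_at (s n) r) (q j))" if r: "r \<in> \<rat>" "0 \<le> r" for r j
  proof -
    obtain l where "(\<lambda>n. f (s n) (r, j)) \<longlonglongrightarrow> l" using s(2)[of "(r, j)"] r by auto
    then have "(\<lambda>n. f (s n) (r, j) * C (r, j)) \<longlonglongrightarrow> l * C (r, j)" by (intro tendsto_intros)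
    moreover have "f (s n) (r, j) * C (r, j) = xn (s n) (k_at (s n) r) (q j)" for n
      using C[OF r(2), of j] by (simp add: f_def)
    ultimately show ?thesis by (auto simp: convergent_def)
  qed
  then show ?thesis using s(1) by blast
qed

definition s :: "nat \<Rightarrow> nat" where
  "s = (SOME s. strict_mono s \<and> (\<forall>r\<in>\<rat>. 0 \<le> r \<longrightarrow> (\<forall>j. convergent (\<lambda>n. xn (s n) (k_at (s n) r) (q j)))))"

lemma s: "strict_mono s"
  "r \<in> \<rat> \<Longrightarrow> 0 \<le> r \<Longrightarrow> convergent (\<lambda>n. xn (s n) (k_at (s n) r) (q j))"
  using someI_ex[OF approx_bounded_subsequence] unfolding s_def[symmetric] by blast+

lemma s_ge: "n \<le> s n" by (rule seq_suble[OF s(1)])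

lemma hs_lim: "(\<lambda>n. h (s n)) \<longlonglongrightarrow> 0"
  using LIMSEQ_subseq_LIMSEQ[OF h_lim s(1)] by (simp add: o_def)

lemma k_at_lim:
  assumes "0 \<le> t" shows "(\<lambda>n. real (k_at (s n) t) * h (s n)) \<longlonglongrightarrow> t"
proof (rule tendsto_sandwich)
  show "(\<lambda>n. t - h (s n)) \<longlonglongrightarrow> t" using tendsto_diff[OF tendsto_const hs_lim, of t] by simp
  show "\<forall>\<^sub>F n in sequentially. t - h (s n) \<le> real (k_at (s n) t) * h (s n)"
    using k_at(2)[OF assms] by (intro always_eventually) (simp add: algebra_simps less_imp_le)
  show "\<forall>\<^sub>F n in sequentially. real (k_at (s n) t) * h (s n) \<le> t"
    using k_at(1)[OF assms] by (intro always_eventually) simp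
qed simp

text \<open>The limit depends on the time and not on how it is rounded to step numbers, so
  \<open>k_at\<close>, its successor and, at time 0, the constant 0 may all be used.\<close>

lemma approx_close:
  assumes y: "y \<in> S" and k: "(\<lambda>n. real (k n) * h (s n)) \<longlonglongrightarrow> t" and j: "(\<lambda>n. real (j n) * h (s n)) \<longlonglongrightarrow> r"
    and "t = r"
  shows "(\<lambda>n. xn (s n) (k n) y - xn (s n) (j n) y) \<longlonglongrightarrow> 0"
proof (rule LIMSEQ_I)
  fix \<epsilon> :: real assume \<epsilon>: "0 < \<epsilon>"
  have t0: "0 \<le> t" by (rule LIMSEQ_le_const[OF k]) (auto intro!: exI[of _ 0] simp: less_imp_le[OF h(1)])
  then have t1: "0 \<le> t + 1" by simp
  obtain \<delta> N where \<delta>: "\<delta> > 0"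
    "\<And>n j k. N \<le> n \<Longrightarrow> real k * h n \<le> t + 1 \<Longrightarrow> real j * h n \<le> t + 1 \<Longrightarrow> \<bar>real k * h n - real j * h n\<bar> < \<delta> \<Longrightarrow>
      \<bar>xn n k y - xn n j y\<bar> < \<epsilon>"
    by (rule equicontinuous_time[OF y \<epsilon> t1]) blast
  have "\<forall>\<^sub>F n in sequentially. real (k n) * h (s n) < t + 1" using order_tendstoD(2)[OF k, of "t + 1"] by simp
  moreover have "\<forall>\<^sub>F n in sequentially. real (j n) * h (s n) < t + 1"
    using order_tendstoD(2)[OF j, of "t + 1"] assms(4) by simp
  moreover have "(\<lambda>n. \<bar>real (k n) * h (s n) - real (j n) * h (s n)\<bar>) \<longlonglongrightarrow> 0"
    using tendsto_rabs[OF tendsto_diff[OF k j]] assms(4) by simp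
  then have "\<forall>\<^sub>F n in sequentially. \<bar>real (k n) * h (s n) - real (j n) * h (s n)\<bar> < \<delta>"
    using \<delta>(1) by (rule order_tendstoD(2))
  ultimately have "\<forall>\<^sub>F n in sequentially. N \<le> n \<and> \<bar>xn (s n) (k n) y - xn (s n) (j n) y\<bar> < \<epsilon>"
    using eventually_ge_at_top[of N]
  proof eventually_elim
    case (elim n)
    then show ?case using s_ge[of n] by (auto intro!: \<delta>(2))
  qed
  then show "\<exists>no. \<forall>n\<ge>no. norm (xn (s n) (k n) y - xn (s n) (j n) y - 0) < \<epsilon>"
    by (auto simp: eventually_sequentially)
qed

text \<open>Passage from the dense set: \<open>y\<close> is replaced by a starting point nearby and
  \<open>t\<close> by a rational time shortly after it, at an error that is uniform in large
  \<open>n\<close>.\<close>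

lemma approx_convergent:
  assumes y: "y \<in> S" and t: "0 \<le> t"
  shows "convergent (\<lambda>n. xn (s n) (k_at (s n) t) y)"
  unfolding Cauchy_convergent_iff[symmetric]
proof (rule metric_CauchyI)
  fix \<epsilon> :: real assume "0 < \<epsilon>"
  then have \<epsilon>: "0 < \<epsilon> / 8" by simp
  have t1: "0 \<le> t + 1" using t by simp
  obtain \<delta>1 N1 where \<delta>1: "\<delta>1 > 0"
    "\<And>n k z. N1 \<le> n \<Longrightarrow> real k * h n \<le> t + 1 \<Longrightarrow> \<bar>z - y\<bar> < \<delta>1 \<Longrightarrow> \<bar>xn n k z - xn n k y\<bar> < \<epsilon> / 8"
    by (rule equicontinuous_space[OF y \<epsilon> t1]) blast
  obtain j where j: "\<bar>q j - y\<bar> < \<delta>1" using q_dense[OF y \<delta>1(1)] by auto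
  obtain \<delta>2 N2 where \<delta>2: "\<delta>2 > 0"
    "\<And>n i k. N2 \<le> n \<Longrightarrow> real k * h n \<le> t + 1 \<Longrightarrow> real i * h n \<le> t + 1 \<Longrightarrow> \<bar>real k * h n - real i * h n\<bar> < \<delta>2 \<Longrightarrow>
      \<bar>xn n k (q j) - xn n i (q j)\<bar> < \<epsilon> / 8"
    by (rule equicontinuous_time[OF q(1) \<epsilon> t1]) blast
  obtain r where r: "r \<in> \<rat>" "t < r" "r < t + min 1 (\<delta>2 / 2)"
    using Rats_dense_in_real[of t "t + min 1 (\<delta>2 / 2)"] \<delta>2(1) by auto
  have "\<forall>\<^sub>F n in sequentially. h (s n) < \<delta>2 / 2" using order_tendstoD(2)[OF hs_lim, of "\<delta>2 / 2"] \<delta>2(1) by simp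
  then obtain N3 where N3: "\<And>n. N3 \<le> n \<Longrightarrow> h (s n) < \<delta>2 / 2" by (auto simp: eventually_sequentially)
  define b where "b n = xn (s n) (k_at (s n) r) (q j)" for n
  have r0: "0 \<le> r" using r t by simp
  have close: "\<bar>xn (s n) (k_at (s n) t) y - b n\<bar> < \<epsilon> / 4" if n: "N1 \<le> n" "N2 \<le> n" "N3 \<le> n" for n
  proof -
    have sn: "N1 \<le> s n" "N2 \<le> s n" using n s_ge[of n] by auto
    note kt = k_at[OF t, of "s n"] and kr = k_at[OF r0, of "s n"]
    have le: "real (k_at (s n) t) * h (s n) \<le> t + 1" "real (k_at (s n) r) * h (s n) \<le> t + 1"
      using kt kr r by linarith+
    have "\<bar>real (k_at (s n) t) * h (s n) - real (k_at (s n) r) * h (s n)\<bar> < \<delta>2"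
      using kt kr r N3[OF n(3)] by (auto simp: abs_less_iff min_def split: if_splits)
    from \<delta>2(2)[OF sn(2) le this] \<delta>1(2)[OF sn(1) le(1) j] show ?thesis unfolding b_def by linarith
  qed
  have "Cauchy b" using s(2)[OF r(1) r0, of j] by (simp add: b_def[abs_def] Cauchy_convergent_iff)
  then obtain M where M: "\<And>m n. M \<le> m \<Longrightarrow> M \<le> n \<Longrightarrow> dist (b m) (b n) < \<epsilon> / 2"
    using \<open>0 < \<epsilon>\<close> by (meson half_gt_zero metric_CauchyD)
  show "\<exists>M. \<forall>m\<ge>M. \<forall>n\<ge>M. dist (xn (s m) (k_at (s m) t) y) (xn (s n) (k_at (s n) t) y) < \<epsilon>"
  proof (intro exI[of _ "Max {M, N1, N2, N3}"] allI impI)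
    fix m n assume "Max {M, N1, N2, N3} \<le> m" "Max {M, N1, N2, N3} \<le> n"
    then have "M \<le> m" "M \<le> n" "N1 \<le> m" "N1 \<le> n" "N2 \<le> m" "N2 \<le> n" "N3 \<le> m" "N3 \<le> n" by auto
    then show "dist (xn (s m) (k_at (s m) t) y) (xn (s n) (k_at (s n) t) y) < \<epsilon>"
      using M[of m n] close[of m] close[of n] unfolding dist_real_def by linarith
  qed
qed

text \<open>Convergence is known only on the support. Elsewhere \<open>X\<close> borrows its value
  at \<open>q 0\<close>, so that limits and measurability hold on the whole line; the support has
  full measure.\<close>

definition supp_pt :: "real \<Rightarrow> real" where "supp_pt y = (if y \<in> S then y else q 0)"

lemma supp_pt: "supp_pt y \<in> S" "y \<in> S \<Longrightarrow> supp_pt y = y" by (auto simp: supp_pt_def q)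

lemma supp_pt_borel [measurable]: "supp_pt \<in> borel_measurable borel"
proof -
  have "S \<in> sets borel" using S_closed by simp
  then show ?thesis unfolding supp_pt_def[abs_def] by simp
qed

lemma supp_pt_bound: "1 + \<bar>supp_pt y\<bar> \<le> D * (1 + \<bar>y\<bar>)"
  by (auto simp: supp_pt_def D_def algebra_simps)

definition X :: "real \<Rightarrow> real \<Rightarrow> real" where
  "X t y = lim (\<lambda>n. xn (s n) (k_at (s n) t) (supp_pt y))"

lemma X_supp_pt: "X t (supp_pt y) = X t y" by (simp add: X_def supp_pt)

lemma X_tendsto:
  assumes t: "0 \<le> t" and k: "(\<lambda>n. real (k n) * h (s n)) \<longlonglongrightarrow> t"
  shows "(\<lambda>n. xn (s n) (k n) (supp_pt y)) \<longlonglongrightarrow> X t y"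
proof -
  have "(\<lambda>n. xn (s n) (k_at (s n) t) (supp_pt y)) \<longlonglongrightarrow> X t y"
    using approx_convergent[OF supp_pt(1) t] unfolding X_def by (simp only: convergent_LIMSEQ_iff)
  from tendsto_add[OF approx_close[OF supp_pt(1)[of y] k k_at_lim[OF t] refl] this] show ?thesis by simp
qed

lemmas X_tendsto_at = X_tendsto[OF _ k_at_lim]

lemma X_borel [measurable]: assumes t: "0 \<le> t" shows "X t \<in> borel_measurable borel"
proof (rule borel_measurable_LIMSEQ_real)
  show "(\<lambda>n. xn (s n) (k_at (s n) t) (supp_pt y)) \<longlonglongrightarrow> X t y" for y by (rule X_tendsto_at[OF t t])
qed simp

definition BX :: "real \<Rightarrow> real" where "BX t = B t * D"

lemma BX_nonneg: "0 \<le> t \<Longrightarrow> 0 \<le> BX t" unfolding BX_def using B_nonneg D_nonneg by simp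

lemma xn_supp_pt_bound: assumes "real k * h n \<le> t" shows "\<bar>xn n k (supp_pt y)\<bar> \<le> BX t * (1 + \<bar>y\<bar>)"
proof -
  have "\<bar>xn n k (supp_pt y)\<bar> \<le> B t * (1 + \<bar>supp_pt y\<bar>)" by (rule xn_bound[OF assms])
  also have "\<dots> \<le> B t * (D * (1 + \<bar>y\<bar>))"
    by (intro mult_left_mono supp_pt_bound B_nonneg time_nonneg[OF assms])
  finally show ?thesis by (simp add: BX_def mult.assoc)
qed

lemma X_bound: assumes "0 \<le> t" "t \<le> T'" shows "\<bar>X t y\<bar> \<le> BX T' * (1 + \<bar>y\<bar>)"
proof (rule LIMSEQ_le_const2[OF tendsto_rabs[OF X_tendsto_at[OF assms(1,1)]]])
  show "\<exists>N. \<forall>n\<ge>N. \<bar>xn (s n) (k_at (s n) t) (supp_pt y)\<bar> \<le> BX T' * (1 + \<bar>y\<bar>)"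
    using xn_supp_pt_bound[OF order_trans[OF k_at(1)[OF assms(1)] assms(2)]] by blast
qed

lemma X_L2: "0 \<le> t \<Longrightarrow> X t \<in> L2 \<rho>"
  by (rule linear_bound_L2(1)[OF _ X_bound[OF _ order_refl]]) simp_all

lemma T_tendsto: assumes "y \<in> S" shows "(\<lambda>n. T n y) \<longlonglongrightarrow> y"
proof (rule LIMSEQ_I)
  fix e :: real assume "0 < e"
  then obtain j where "\<bar>q j - y\<bar> < e" using q_dense[OF assms] by blast
  moreover have "\<bar>y - T n y\<bar> \<le> \<bar>y - q j\<bar>" if "j \<le> n" for n using A(5)[OF that] by (rule T_le)
  ultimately show "\<exists>no. \<forall>n\<ge>no. norm (T n y - y) < e"
    by (intro exI[of _ j]) (auto simp: abs_minus_commute intro: le_less_trans)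
qed

lemma Ts_tendsto: "y \<in> S \<Longrightarrow> (\<lambda>n. T (s n) y) \<longlonglongrightarrow> y"
  using LIMSEQ_subseq_LIMSEQ[OF T_tendsto s(1)] by (simp add: o_def)

lemma X_0: assumes "y \<in> S" shows "X 0 y = y"
proof -
  have "(\<lambda>n. real ((\<lambda>_. 0::nat) n) * h (s n)) \<longlonglongrightarrow> 0" by simp
  from X_tendsto[OF order_refl this, of y] have "(\<lambda>n. T (s n) y) \<longlonglongrightarrow> X 0 y"
    by (simp add: xn_def P.pos_at_0 supp_pt(2)[OF assms])
  then show ?thesis using Ts_tendsto[OF assms] LIMSEQ_unique by blast
qed

lemma G_tendsto: "f \<longlonglongrightarrow> y \<Longrightarrow> (\<lambda>n. G (f n)) \<longlonglongrightarrow> G y"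
  using G_cont by (auto simp: continuous_on_eq_continuous_at intro: isCont_tendsto_compose)

lemma X_gap:
  assumes t: "0 \<le> t" and yz: "y \<in> S" "z \<in> S" "z \<le> y"
  shows "0 \<le> X t y - X t z" "X t y - X t z \<le> ch t * (y - z) + sh t * (G y - G z)"
proof -
  have lim: "(\<lambda>n. xn (s n) (k_at (s n) t) y - xn (s n) (k_at (s n) t) z) \<longlonglongrightarrow> X t y - X t z"
    using tendsto_diff[OF X_tendsto_at[OF t t, of y] X_tendsto_at[OF t t, of z]] yz by (simp add: supp_pt)
  show "0 \<le> X t y - X t z"
    by (rule LIMSEQ_le_const[OF lim]) (use xn_mono[OF yz(3)] in blast)
  have "(\<lambda>n. ch t * \<bar>T (s n) y - T (s n) z\<bar> + sh t * \<bar>G (T (s n) y) - G (T (s n) z)\<bar>)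
     \<longlonglongrightarrow> ch t * \<bar>y - z\<bar> + sh t * \<bar>G y - G z\<bar>"
    by (intro tendsto_intros Ts_tendsto G_tendsto yz)
  moreover have "xn (s n) (k_at (s n) t) y - xn (s n) (k_at (s n) t) z
     \<le> ch t * \<bar>T (s n) y - T (s n) z\<bar> + sh t * \<bar>G (T (s n) y) - G (T (s n) z)\<bar>" for n
    using xn_dist_le[OF k_at(1)[OF t], of "s n" y z] by linarith
  ultimately have "X t y - X t z \<le> ch t * \<bar>y - z\<bar> + sh t * \<bar>G y - G z\<bar>"
    by (intro LIMSEQ_le[OF lim]) auto
  then show "X t y - X t z \<le> ch t * (y - z) + sh t * (G y - G z)"
    using yz(3) monoD[OF G_mono yz(3)] by simp
qed

lemma X_gap_sinh:
  assumes st: "0 < t1" "t1 \<le> t2" and yz: "y \<in> S" "z \<in> S" "z \<le> y"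
  shows "(X t2 y - X t2 z) / sinh (sqrt c * t2) \<le> (X t1 y - X t1 z) / sinh (sqrt c * t1)"
proof -
  define d where "d t n = (xn (s n) (k_at (s n) t) y - xn (s n) (k_at (s n) t) z)
      / sinh (sqrt c * (real (k_at (s n) t) * h (s n)))" for t n
  have lim: "d t \<longlonglongrightarrow> (X t y - X t z) / sinh (sqrt c * t)" if "0 < t" for t
  proof -
    have t: "0 \<le> t" using that by simp
    have "(\<lambda>n. sinh (sqrt c * (real (k_at (s n) t) * h (s n)))) \<longlonglongrightarrow> sinh (sqrt c * t)"
      by (intro tendsto_sinh tendsto_mult_left k_at_lim t)
    moreover have "sinh (sqrt c * t) \<noteq> 0" using that c by simp
    moreover have "(\<lambda>n. xn (s n) (k_at (s n) t) y - xn (s n) (k_at (s n) t) z) \<longlonglongrightarrow> X t y - X t z"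
      using tendsto_diff[OF X_tendsto_at[OF t t, of y] X_tendsto_at[OF t t, of z]] yz by (simp add: supp_pt)
    ultimately show ?thesis unfolding d_def by (intro tendsto_divide)
  qed
  have "\<forall>\<^sub>F n in sequentially. d t2 n \<le> d t1 n"
  proof -
    have "\<forall>\<^sub>F n in sequentially. h (s n) < t1" using order_tendstoD(2)[OF hs_lim st(1)] .
    then show ?thesis
    proof eventually_elim
      case (elim n)
      \<comment> \<open>A positive step number keeps the denominator away from
        \<open>sinh 0\<close>; it is guaranteed once the step length is below
        \<open>t1\<close>.\<close>
      have "0 < k_at (s n) t1"
      proof (rule ccontr)
        assume "\<not> 0 < k_at (s n) t1"
        then show False using k_at(2)[of t1 "s n"] st(1) elim by simp
      qed
      moreover have "k_at (s n) t1 \<le> k_at (s n) t2"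
        unfolding k_at_def using st h[of "s n"] by (intro nat_mono floor_mono divide_right_mono) auto
      ultimately show ?case unfolding d_def xn_def
        by (rule P.pos_at_gap_sinh[OF T_in T_in T_mono[OF yz(3)]])
    qed
  qed
  then show ?thesis
    using lim[of t1] lim[of t2] st by (intro tendsto_le[OF _ lim lim]) auto
qed

lemma X_sinh:
  assumes st: "0 < t1" "t1 \<le> t2" and yz: "y \<in> S" "z \<in> S"
  shows "\<bar>X t2 y - X t2 z\<bar> / sinh (sqrt c * t2) \<le> \<bar>X t1 y - X t1 z\<bar> / sinh (sqrt c * t1)"
proof -
  have *: "\<bar>X t2 y - X t2 z\<bar> / sinh (sqrt c * t2) \<le> \<bar>X t1 y - X t1 z\<bar> / sinh (sqrt c * t1)"
    if "y \<in> S" "z \<in> S" "z \<le> y" for y z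
    using X_gap_sinh[OF st that] X_gap(1)[OF _ that, of t1] X_gap(1)[OF _ that, of t2] st by simp
  from *[of y z] *[of z y] show ?thesis using yz by (cases "z \<le> y") (auto simp: abs_minus_commute)
qed

text \<open>By the previous bound \<open>X t2\<close> is a Lipschitz function of \<open>X t1\<close>; the infimum extends it to all reals.\<close>

lemma X_factor:
  assumes st: "0 < t1" "t1 \<le> t2"
  shows "\<exists>\<phi>\<in>borel_measurable borel. \<forall>y. X t2 y = \<phi> (X t1 y)"
proof -
  define l where "l = sinh (sqrt c * t2) / sinh (sqrt c * t1)"
  have s1: "sinh (sqrt c * t1) > 0" "sinh (sqrt c * t2) > 0" using st c by auto
  have l: "0 \<le> l" using s1 by (simp add: l_def)
  have lip: "\<bar>X t2 y - X t2 z\<bar> \<le> l * \<bar>X t1 y - X t1 z\<bar>" if "y \<in> S" "z \<in> S" for y z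
    using X_sinh[OF st that] s1 by (simp add: l_def field_simps)
  define f where "f x z = X t2 z + l * \<bar>x - X t1 z\<bar>" for x z
  define \<phi> where "\<phi> x = (INF z\<in>S. f x z)" for x
  have bdd: "bdd_below (f x ` S)" for x
  proof (rule bdd_belowI2)
    fix z assume z: "z \<in> S"
    have "l * \<bar>X t1 z - X t1 (q 0)\<bar> \<le> l * \<bar>x - X t1 z\<bar> + l * \<bar>x - X t1 (q 0)\<bar>"
      using l by (auto simp flip: distrib_left intro!: mult_left_mono)
    then show "X t2 (q 0) - l * \<bar>x - X t1 (q 0)\<bar> \<le> f x z"
      using lip[OF z q(1)[of 0]] by (simp add: f_def)
  qed
  have le: "\<phi> x \<le> \<phi> x' + l * \<bar>x - x'\<bar>" for x x'
  proof -
    have "\<phi> x - l * \<bar>x - x'\<bar> \<le> \<phi> x'"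
      unfolding \<phi>_def[of x']
    proof (rule cINF_greatest[OF S_ne])
      fix z assume z: "z \<in> S"
      have "\<phi> x \<le> f x z" unfolding \<phi>_def by (rule cINF_lower[OF bdd z])
      also have "\<dots> \<le> f x' z + l * \<bar>x - x'\<bar>"
        unfolding f_def using mult_left_mono[OF abs_triangle_ineq[of "x - x'" "x' - X t1 z"] l]
        by (simp add: algebra_simps)
      finally show "\<phi> x - l * \<bar>x - x'\<bar> \<le> f x' z" by simp
    qed
    then show ?thesis by simp
  qed
  have "continuous_on UNIV \<phi>"
    unfolding continuous_on_iff
  proof (intro ballI allI impI)
    fix x e :: real assume e: "0 < e"
    show "\<exists>d>0. \<forall>x'\<in>UNIV. dist x' x < d \<longrightarrow> dist (\<phi> x') (\<phi> x) < e"
    proof (intro exI[of _ "e / (l + 1)"] conjI ballI impI)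
      show "e / (l + 1) > 0" using e l by simp
      fix x' assume "dist x' x < e / (l + 1)"
      then have "(l + 1) * \<bar>x - x'\<bar> < e" using l by (simp add: dist_real_def abs_minus_commute field_simps)
      moreover have "l * \<bar>x - x'\<bar> \<le> (l + 1) * \<bar>x - x'\<bar>" by (intro mult_right_mono) auto
      ultimately show "dist (\<phi> x') (\<phi> x) < e"
        using le[of x x'] le[of x' x] by (simp add: dist_real_def abs_minus_commute[of x' x])
    qed
  qed
  then have "\<phi> \<in> borel_measurable borel" by (rule borel_measurable_continuous_onI)
  moreover have "X t2 y = \<phi> (X t1 y)" if y: "y \<in> S" for y
  proof (rule antisym)
    show "X t2 y \<le> \<phi> (X t1 y)"
      unfolding \<phi>_def
    proof (rule cINF_greatest[OF S_ne])
      fix z assume "z \<in> S"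
      then show "X t2 y \<le> f (X t1 y) z" using lip[OF y] by (fastforce simp: f_def abs_le_iff)
    qed
    have "\<phi> (X t1 y) \<le> f (X t1 y) y" unfolding \<phi>_def by (rule cINF_lower[OF bdd y])
    then show "\<phi> (X t1 y) \<le> X t2 y" by (simp add: f_def)
  qed
  \<comment> \<open>Off the support the identity is inherited from \<open>q 0\<close>, where
    \<open>X\<close> takes its values at both times.\<close>
  then have "X t2 y = \<phi> (X t1 y)" for y using supp_pt(1)[of y] X_supp_pt by metis
  ultimately show ?thesis by blast
qed

text \<open>Both times are compared within one scheme, where \<open>equicontinuous_time\<close> is
  uniform in large \<open>n\<close>; so every single trajectory is continuous, not only the curve in
  \<open>L2 \<rho>\<close>.\<close>

lemma X_continuous_time:
  assumes "0 \<le> t" "\<And>n. 0 \<le> r n" "r \<longlonglongrightarrow> t"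
  shows "(\<lambda>n. X (r n) y) \<longlonglongrightarrow> X t y"
proof (rule LIMSEQ_I)
  fix e :: real assume "0 < e"
  then have e: "0 < e / 2" by simp
  have t1: "0 \<le> t + 1" using assms by simp
  obtain \<delta> N where \<delta>: "\<delta> > 0"
    "\<And>n j k. N \<le> n \<Longrightarrow> real k * h n \<le> t + 1 \<Longrightarrow> real j * h n \<le> t + 1 \<Longrightarrow> \<bar>real k * h n - real j * h n\<bar> < \<delta> \<Longrightarrow>
      \<bar>xn n k (supp_pt y) - xn n j (supp_pt y)\<bar> < e / 2"
    by (rule equicontinuous_time[OF supp_pt(1) e t1]) blast
  have near: "\<bar>X u y - X t y\<bar> \<le> e / 2" if u: "0 \<le> u" "u \<le> t + 1" "\<bar>u - t\<bar> < \<delta>" for u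
  proof (rule tendsto_upperbound[OF tendsto_rabs[OF tendsto_diff[OF X_tendsto_at[OF u(1,1)] X_tendsto_at[OF assms(1,1)]]]])
    have "(\<lambda>n. \<bar>real (k_at (s n) u) * h (s n) - real (k_at (s n) t) * h (s n)\<bar>) \<longlonglongrightarrow> \<bar>u - t\<bar>"
      by (intro tendsto_intros k_at_lim u assms)
    then have "\<forall>\<^sub>F n in sequentially. \<bar>real (k_at (s n) u) * h (s n) - real (k_at (s n) t) * h (s n)\<bar> < \<delta>"
      using u(3) by (rule order_tendstoD(2))
    then show "\<forall>\<^sub>F n in sequentially. \<bar>xn (s n) (k_at (s n) u) (supp_pt y) - xn (s n) (k_at (s n) t) (supp_pt y)\<bar> \<le> e / 2"
      using eventually_ge_at_top[of N]
    proof eventually_elim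
      case (elim n)
      then show ?case
        using \<delta>(2)[of "s n" "k_at (s n) u" "k_at (s n) t"] s_ge[of n] k_at(1)[OF u(1), of "s n"]
          k_at(1)[OF assms(1), of "s n"] u(2) by force
    qed
  qed simp
  have "\<forall>\<^sub>F n in sequentially. dist (r n) t < min \<delta> 1" using assms(3) \<delta>(1) by (intro tendstoD) auto
  then obtain no where "\<And>n. no \<le> n \<Longrightarrow> dist (r n) t < min \<delta> 1" by (auto simp: eventually_sequentially)
  then have "\<bar>X (r n) y - X t y\<bar> \<le> e / 2" if "no \<le> n" for n
    using near[of "r n"] assms(2)[of n] that by (fastforce simp: dist_real_def)
  then show "\<exists>no. \<forall>n\<ge>no. norm (X (r n) y - X t y) < e"
    using \<open>0 < e\<close> by (intro exI[of _ no]) (fastforce)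
qed

lemma AE_supp_pt: "AE y in \<rho>. supp_pt y = y" using AE_S by eventually_elim (rule supp_pt(2))

lemma X_lipschitz:
  assumes "0 \<le> r" "r \<le> t" "t \<le> T'"
  shows "L2_norm \<rho> (\<lambda>y. X t y - X r y) \<le> BV T' * N1 * (t - r)"
proof -
  have t: "0 \<le> t" using assms by simp
  define f where "f n y = xn (s n) (k_at (s n) t) y - xn (s n) (k_at (s n) r) y" for n y
  define g where "g y = X t y - X r y" for y
  have kT: "real (k_at (s n) t) * h (s n) \<le> T'" "real (k_at (s n) r) * h (s n) \<le> T'" for n
    using k_at(1)[OF t, of "s n"] k_at(1)[OF assms(1), of "s n"] assms by linarith+
  have fL: "f n \<in> L2 \<rho>" for n unfolding f_def by (rule L2_diff[OF xn_L2 xn_L2])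
  have gL: "g \<in> L2 \<rho>" unfolding g_def by (rule L2_diff[OF X_L2[OF t] X_L2[OF assms(1)]])
  have "(\<lambda>n. L2_norm \<rho> (\<lambda>y. f n y - g y)) \<longlonglongrightarrow> 0"
  proof (rule L2_norm_dominated_tendsto)
    show "(\<lambda>y. (2 * B T') * (1 + \<bar>y\<bar>)) \<in> L2 \<rho>" by (rule L2_cmult[OF lin_L2])
    show "AE y in \<rho>. (\<lambda>n. f n y) \<longlonglongrightarrow> g y"
      using AE_supp_pt
    proof eventually_elim
      case (elim y)
      show ?case unfolding f_def g_def
        using tendsto_diff[OF X_tendsto_at[OF t t, of y] X_tendsto_at[OF assms(1,1), of y]] elim by simp
    qed
    show "AE y in \<rho>. \<bar>f n y\<bar> \<le> (2 * B T') * (1 + \<bar>y\<bar>)" for n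
    proof (rule AE_I2)
      fix y
      show "\<bar>f n y\<bar> \<le> (2 * B T') * (1 + \<bar>y\<bar>)"
        using xn_bound[OF kT(1), of n y] xn_bound[OF kT(2), of n y] by (simp add: f_def)
    qed
  qed (use fL gL in \<open>auto dest: L2_borel\<close>)
  moreover have "L2_norm \<rho> g \<le> BV T' * N1 * (real (k_at (s n) t) * h (s n) - real (k_at (s n) r) * h (s n))
      + L2_norm \<rho> (\<lambda>y. f n y - g y)" for n
  proof -
    have "k_at (s n) r \<le> k_at (s n) t"
      unfolding k_at_def using assms h[of "s n"] by (intro nat_mono floor_mono divide_right_mono) auto
    then have "L2_norm \<rho> (f n) \<le> BV T' * N1 * (real (k_at (s n) t) * h (s n) - real (k_at (s n) r) * h (s n))"
      unfolding f_def by (rule xn_L2_lipschitz[OF _ kT(1)])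
    moreover have "L2_norm \<rho> g \<le> L2_norm \<rho> (f n) + L2_norm \<rho> (\<lambda>y. g y - f n y)"
      using L2_norm_triangle[OF fL[of n] L2_diff[OF gL fL[of n]]] by simp
    ultimately show ?thesis by (simp add: L2_norm_minus_commute[of \<rho> g])
  qed
  moreover have "(\<lambda>n. BV T' * N1 * (real (k_at (s n) t) * h (s n) - real (k_at (s n) r) * h (s n)))
     \<longlonglongrightarrow> BV T' * N1 * (t - r)"
    by (intro tendsto_intros k_at_lim t assms)
  ultimately have "L2_norm \<rho> g \<le> BV T' * N1 * (t - r) + 0"
    by (intro LIMSEQ_le_const[OF tendsto_add]) auto
  then show ?thesis by (simp add: g_def[abs_def])
qed

end

section \<open>Riemann sums of converging step functions\<close>

lemma step_sum_tendsto_integral: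
  fixes a :: "nat \<Rightarrow> nat \<Rightarrow> real" and f :: "real \<Rightarrow> real" and \<tau> :: "nat \<Rightarrow> real"
  assumes \<tau>: "\<And>n. 0 < \<tau> n" and k: "(\<lambda>n. real (k n) * \<tau> n) \<longlonglongrightarrow> t" and k_le: "\<And>n. real (k n) * \<tau> n \<le> t"
    and conv: "\<And>r. 0 \<le> r \<Longrightarrow> r < t \<Longrightarrow> (\<lambda>n. a n (nat \<lfloor>r / \<tau> n\<rfloor>)) \<longlonglongrightarrow> f r"
    and bound: "\<And>n i. i < k n \<Longrightarrow> \<bar>a n i\<bar> \<le> C" and C: "0 \<le> C"
    and cont: "continuous_on {0..t} f"
  shows "(\<lambda>n. \<Sum>i<k n. \<tau> n * a n i) \<longlonglongrightarrow> integral {0..t} f"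
proof -
  define I where "I n i = {real i * \<tau> n..<real (Suc i) * \<tau> n}" for n i
  \<comment> \<open>The sum is the integral of the step function with value \<open>a n i\<close> on
    the cell \<open>I n i\<close>; pointwise convergence and the common bound \<open>C\<close> then
    allow dominated convergence.\<close>
  define g where "g n r = (\<Sum>i<k n. a n i * indicator (I n i) r)" for n r
  have I_iff: "r \<in> I n i \<longleftrightarrow> 0 \<le> r \<and> nat \<lfloor>r / \<tau> n\<rfloor> = i" for r n i
  proof -
    have "r \<in> I n i \<longleftrightarrow> real i \<le> r / \<tau> n \<and> r / \<tau> n < real i + 1"
      using \<tau>[of n] by (auto simp: I_def field_simps)
    also have "\<dots> \<longleftrightarrow> \<lfloor>r / \<tau> n\<rfloor> = int i" by (auto simp: floor_eq_iff)
    also have "\<dots> \<longleftrightarrow> 0 \<le> r \<and> nat \<lfloor>r / \<tau> n\<rfloor> = i"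
    proof
      assume *: "\<lfloor>r / \<tau> n\<rfloor> = int i"
      then have "0 \<le> r / \<tau> n" by (metis of_nat_0_le_iff zero_le_floor)
      then show "0 \<le> r \<and> nat \<lfloor>r / \<tau> n\<rfloor> = i" using * \<tau>[of n] by (simp add: zero_le_divide_iff)
    next
      assume "0 \<le> r \<and> nat \<lfloor>r / \<tau> n\<rfloor> = i"
      then show "\<lfloor>r / \<tau> n\<rfloor> = int i" using \<tau>[of n] by auto
    qed
    finally show ?thesis .
  qed
  have g_eq: "g n r = (if 0 \<le> r \<and> nat \<lfloor>r / \<tau> n\<rfloor> < k n then a n (nat \<lfloor>r / \<tau> n\<rfloor>) else 0)" for n r
  proof -
    have "g n r = (\<Sum>i<k n. if i = nat \<lfloor>r / \<tau> n\<rfloor> then (if 0 \<le> r then a n i else 0) else 0)"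
      unfolding g_def by (intro sum.cong refl) (auto simp: indicator_def I_iff)
    then show ?thesis by simp
  qed
  have lt_iff: "nat \<lfloor>r / \<tau> n\<rfloor> < k n \<longleftrightarrow> r < real (k n) * \<tau> n" if "0 \<le> r" for r n
  proof -
    have "nat \<lfloor>r / \<tau> n\<rfloor> < k n \<longleftrightarrow> \<lfloor>r / \<tau> n\<rfloor> < int (k n)" using that \<tau>[of n] by (simp add: nat_less_iff)
    also have "\<dots> \<longleftrightarrow> r / \<tau> n < real (k n)" by (simp add: floor_less_iff)
    also have "\<dots> \<longleftrightarrow> r < real (k n) * \<tau> n" using \<tau>[of n] by (simp add: pos_divide_less_eq)
    finally show ?thesis .
  qed
  have g_int: "(\<integral>r. g n r \<partial>lborel) = (\<Sum>i<k n. \<tau> n * a n i)" for n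
  proof -
    have m: "measure lborel (I n i) = \<tau> n" "emeasure lborel (I n i) < \<infinity>" for i
      using \<tau>[of n] by (auto simp: I_def algebra_simps)
    have "(\<integral>r. g n r \<partial>lborel) = (\<Sum>i<k n. a n i * measure lborel (I n i))"
      unfolding g_def using m(2) by (subst Bochner_Integration.integral_sum) (auto simp: I_def)
    then show ?thesis by (simp add: m(1) mult.commute)
  qed
  have "(\<lambda>n. \<integral>r. g n r \<partial>lborel) \<longlonglongrightarrow> (\<integral>r. indicator {0..t} r *\<^sub>R f r \<partial>lborel)"
  proof (rule integral_dominated_convergence)
    show "(\<lambda>r. indicator {0..t} r *\<^sub>R f r) \<in> borel_measurable lborel"
      using borel_measurable_continuous_on_indicator[OF _ cont] by simp
    show "g n \<in> borel_measurable lborel" for n unfolding g_def[abs_def] I_def by measurable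
    show "integrable lborel (\<lambda>r. C * indicator {0..t} r)"
      by (intro integrable_mult_right integrable_real_indicator) (auto simp: emeasure_lborel_Icc_eq)
    show "AE r in lborel. (\<lambda>n. g n r) \<longlonglongrightarrow> indicator {0..t} r *\<^sub>R f r"
      \<comment> \<open>At \<open>r = t\<close> the step functions vanish while the limit need
        not.\<close>
      using AE_lborel_singleton[of t]
    proof eventually_elim
      case (elim r)
      show ?case
      proof (cases "0 \<le> r \<and> r < t")
        case True
        then have "\<forall>\<^sub>F n in sequentially. r < real (k n) * \<tau> n" using k by (auto intro: order_tendstoD(1))
        then have "\<forall>\<^sub>F n in sequentially. a n (nat \<lfloor>r / \<tau> n\<rfloor>) = g n r"
          by eventually_elim (use True in \<open>simp add: g_eq lt_iff\<close>)
        then have "(\<lambda>n. g n r) \<longlonglongrightarrow> f r" using conv[of r] True by (auto intro: Lim_transform_eventually)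
        then show ?thesis using True by simp
      next
        case False
        then have "g n r = 0" for n
          using k_le[of n] lt_iff[of r n] by (auto simp: g_eq)
        then show ?thesis using False elim by (auto simp: indicator_def)
      qed
    qed
    show "AE r in lborel. norm (g n r) \<le> C * indicator {0..t} r" for n
    proof (rule AE_I2)
      fix r
      show "norm (g n r) \<le> C * indicator {0..t} r"
      proof (cases "0 \<le> r \<and> nat \<lfloor>r / \<tau> n\<rfloor> < k n")
        case True
        then have "r \<le> t" using lt_iff[of r n] k_le[of n] by auto
        then show ?thesis using True bound by (simp add: g_eq)
      next
        case False
        then have "g n r = 0" by (simp only: g_eq if_False)
        then show ?thesis using C by (simp add: indicator_def)
      qed
    qed
  qed
  moreover have "(\<integral>r. indicator {0..t} r *\<^sub>R f r \<partial>lborel) = integral {0..t} f"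
    using set_borel_integral_eq_integral(2)[OF borel_integrable_atLeastAtMost'[OF cont]]
    by (simp add: set_lebesgue_integral_def)
  ultimately show ?thesis by (simp add: g_int)
qed

section \<open>Force, free velocity and free position of the limit flow\<close>

context flow_data
begin

text \<open>The force as a function of place, so that \<open>F t\<close> is visibly a function of
  \<open>X t\<close>; both orthogonality and energy depend on this. The sign makes it an
  acceleration.\<close>

definition \<Phi> :: "real \<Rightarrow> real \<Rightarrow> real" where "\<Phi> t x = - (\<integral>z. W' (x - X t z) \<partial>\<rho>)"
definition F :: "real \<Rightarrow> real \<Rightarrow> real" where "F t y = \<Phi> t (X t y)"

lemma \<Phi>_borel: assumes "0 \<le> t" shows "\<Phi> t \<in> borel_measurable borel"
proof -
  have [measurable]: "X t \<in> borel_measurable borel" by (rule X_borel[OF assms])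
  show ?thesis unfolding \<Phi>_def[abs_def] by measurable
qed

lemma F_borel [measurable]: assumes "0 \<le> t" shows "F t \<in> borel_measurable borel"
  unfolding F_def[abs_def] by (rule measurable_compose[OF X_borel[OF assms] \<Phi>_borel[OF assms]])

definition BFX :: "real \<Rightarrow> real" where "BFX t = K0 * (1 + BX t + BX t * M1)"

lemma BFX_nonneg: "0 \<le> t \<Longrightarrow> 0 \<le> BFX t"
  unfolding BFX_def using BX_nonneg K0 M1 by (intro mult_nonneg_nonneg add_nonneg_nonneg) auto

lemma F_lin_bound: assumes "0 \<le> t" "t \<le> T'" shows "\<bar>F t y\<bar> \<le> BFX T' * (1 + \<bar>y\<bar>)"
  unfolding F_def \<Phi>_def BFX_def abs_minus_cancel
  by (rule W'_conv_bound(2)) (use assms X_bound[OF assms] BX_nonneg in auto)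

text \<open>Serves two limits of the force: that of the schemes, and continuity in time along the
  flow.\<close>

lemma conv_tendsto:
  assumes a: "a \<longlonglongrightarrow> a'" "\<And>n. \<bar>a n\<bar> \<le> C * (1 + \<bar>y\<bar>)"
    and f: "\<And>n. f n \<in> borel_measurable \<rho>" "f' \<in> borel_measurable \<rho>"
    and lim: "AE z in \<rho>. (\<lambda>n. f n z) \<longlonglongrightarrow> f' z" and b: "\<And>n z. \<bar>f n z\<bar> \<le> C * (1 + \<bar>z\<bar>)"
  shows "(\<lambda>n. \<integral>z. W' (a n - f n z) \<partial>\<rho>) \<longlonglongrightarrow> (\<integral>z. W' (a' - f' z) \<partial>\<rho>)"
proof (rule integral_dominated_convergence[OF _ _ W'_dominator_integrable[of C y]])
  note [measurable] = f
  show "(\<lambda>z. W' (a' - f' z)) \<in> borel_measurable \<rho>" "\<And>n. (\<lambda>z. W' (a n - f n z)) \<in> borel_measurable \<rho>"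
    by measurable
  show "AE z in \<rho>. (\<lambda>n. W' (a n - f n z)) \<longlonglongrightarrow> W' (a' - f' z)"
    using lim
  proof eventually_elim
    case (elim z)
    have "isCont W' (a' - f' z)" using W'_cont by (simp add: continuous_on_eq_continuous_at)
    then show ?case by (rule isCont_tendsto_compose) (intro tendsto_diff a(1) elim)
  qed
  show "AE z in \<rho>. norm (W' (a n - f n z)) \<le> K0 * (1 + C * (1 + \<bar>y\<bar>) + C * (1 + \<bar>z\<bar>))" for n
    using W'_diff_bound[OF a(2) b] by simp
qed

lemma D_ge_1: "1 \<le> D" by (simp add: D_def)

lemma Fn_tendsto:
  assumes t: "0 \<le> t" and k: "(\<lambda>n. real (k n) * h (s n)) \<longlonglongrightarrow> t"
  shows "(\<lambda>n. Fn (s n) (k n) (supp_pt y)) \<longlonglongrightarrow> F t y"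
proof -
  obtain \<tau> where \<tau>: "\<And>n. real (k n) * h (s n) \<le> \<tau>"
    using convergent_imp_Bseq[OF convergentI[OF k]] by (auto elim!: BseqE) (metis abs_le_D1)
  have \<tau>0: "0 \<le> \<tau>" by (rule time_nonneg[OF \<tau>])
  have "(\<lambda>n. \<integral>z. W' (xn (s n) (k n) (supp_pt y) - xn (s n) (k n) z) \<partial>\<rho>) \<longlonglongrightarrow> (\<integral>z. W' (X t y - X t z) \<partial>\<rho>)"
  proof (rule conv_tendsto[where C="BX \<tau>" and y=y])
    show "\<bar>xn (s n) (k n) (supp_pt y)\<bar> \<le> BX \<tau> * (1 + \<bar>y\<bar>)" for n by (rule xn_supp_pt_bound[OF \<tau>])
    show "\<bar>xn (s n) (k n) z\<bar> \<le> BX \<tau> * (1 + \<bar>z\<bar>)" for n z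
    proof -
      have "\<bar>xn (s n) (k n) z\<bar> \<le> B \<tau> * (1 + \<bar>z\<bar>)" by (rule xn_bound[OF \<tau>])
      also have "\<dots> \<le> BX \<tau> * (1 + \<bar>z\<bar>)"
        unfolding BX_def using mult_left_mono[OF D_ge_1 B_nonneg[OF \<tau>0]] by (intro mult_right_mono) auto
      finally show ?thesis .
    qed
    show "AE z in \<rho>. (\<lambda>n. xn (s n) (k n) z) \<longlonglongrightarrow> X t z"
      using AE_supp_pt by eventually_elim (use X_tendsto[OF t k] in metis)
  qed (use X_tendsto[OF t k] X_borel[OF t] in auto)
  then show ?thesis unfolding Fn_eq F_def \<Phi>_def by (rule tendsto_minus)
qed

lemma F_continuous_time:
  assumes t: "0 \<le> t" and r: "\<And>n. 0 \<le> r n" "r \<longlonglongrightarrow> t"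
  shows "(\<lambda>n. F (r n) y) \<longlonglongrightarrow> F t y"
proof -
  obtain \<tau> where \<tau>: "\<And>n. r n \<le> \<tau>"
    using convergent_imp_Bseq[OF convergentI[OF r(2)]] by (auto elim!: BseqE) (metis abs_le_D1)
  have "(\<lambda>n. \<integral>z. W' (X (r n) y - X (r n) z) \<partial>\<rho>) \<longlonglongrightarrow> (\<integral>z. W' (X t y - X t z) \<partial>\<rho>)"
    by (rule conv_tendsto[where C="BX \<tau>" and y=y])
      (use X_continuous_time[OF t r] X_bound[OF r(1) \<tau>] X_borel t r in auto)
  then show ?thesis unfolding F_def \<Phi>_def by (rule tendsto_minus)
qed

lemma F_continuous_on: "continuous_on {0..t} (\<lambda>r. F r y)"
proof (cases "0 \<le> t")
  case True
  show ?thesis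
    unfolding continuous_on_sequentially
  proof (intro allI ballI impI)
    fix r u assume "u \<in> {0..t}" "(\<forall>n. r n \<in> {0..t}) \<and> r \<longlonglongrightarrow> u"
    then show "((\<lambda>r. F r y) \<circ> r) \<longlonglongrightarrow> F u y"
      using F_continuous_time[of u r y] by (auto simp: o_def)
  qed
qed simp

lemma F_integrable_on: assumes "0 \<le> a" shows "(\<lambda>r. F r y) integrable_on {a..b}"
  by (rule integrable_continuous_real) (rule continuous_on_subset[OF F_continuous_on[of b y]], use assms in auto)

text \<open>The time integral is taken for each \<open>y\<close> separately, over a continuous
  function of time; \<open>has_L2_integral_force\<close> identifies it with the integral in
  \<open>L2 \<rho>\<close>.\<close>

definition V :: "real \<Rightarrow> real \<Rightarrow> real" where "V t y = v (supp_pt y) + integral {0..t} (\<lambda>r. F r y)"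

lemma V_diff: assumes "0 \<le> a" "a \<le> b" shows "V b y - V a y = integral {a..b} (\<lambda>r. F r y)"
  using Henstock_Kurzweil_Integration.integral_combine[OF assms F_integrable_on[OF order_refl, of y b]]
  by (simp add: V_def)

lemma V_lin_lip: assumes "0 \<le> a" "a \<le> b" "b \<le> T'" shows "\<bar>V b y - V a y\<bar> \<le> BFX T' * (1 + \<bar>y\<bar>) * (b - a)"
proof -
  have "norm (integral {a..b} (\<lambda>r. F r y)) \<le> (BFX T' * (1 + \<bar>y\<bar>)) * (b - a)"
    using assms F_lin_bound
    by (intro integral_bound continuous_on_subset[OF F_continuous_on[of b y]]) auto
  then show ?thesis by (simp add: V_diff[OF assms(1,2)])
qed

lemma v_tendsto: "f \<longlonglongrightarrow> y \<Longrightarrow> (\<lambda>n. v (f n)) \<longlonglongrightarrow> v y"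
  using v_cont by (auto simp: continuous_on_eq_continuous_at intro: isCont_tendsto_compose)

lemma k_at_Suc_lim: assumes "0 \<le> t" shows "(\<lambda>n. real (Suc (k_at (s n) t)) * h (s n)) \<longlonglongrightarrow> t"
  using tendsto_add[OF k_at_lim[OF assms] hs_lim] by (simp add: algebra_simps)

lemma krs_lim: "(\<lambda>n. kr (s n)) \<longlonglongrightarrow> 1"
  using LIMSEQ_subseq_LIMSEQ[OF kr_lim s(1)] by (simp add: o_def)

lemma Vn_tendsto:
  assumes t: "0 \<le> t" shows "(\<lambda>n. Vn (s n) (k_at (s n) t) (supp_pt y)) \<longlonglongrightarrow> V t y"
proof -
  let ?p = "supp_pt y"
  have "(\<lambda>n. \<Sum>i<k_at (s n) t. h (s n) * (kr (s n) * Fn (s n) (Suc i) ?p)) \<longlonglongrightarrow> integral {0..t} (\<lambda>r. F r y)"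
  proof (rule step_sum_tendsto_integral[where C="KR * (BF t * (1 + \<bar>?p\<bar>))"])
    \<comment> \<open>The scheme adds the force after the move, hence the successor; a shift by one
      step leaves the limit time unchanged.\<close>
    show "(\<lambda>n. kr (s n) * Fn (s n) (Suc (nat \<lfloor>r / h (s n)\<rfloor>)) ?p) \<longlonglongrightarrow> F r y" if "0 \<le> r" for r
      using tendsto_mult[OF krs_lim Fn_tendsto[OF that k_at_Suc_lim[OF that], of y]] by (simp add: k_at_def)
    show "\<bar>kr (s n) * Fn (s n) (Suc i) ?p\<bar> \<le> KR * (BF t * (1 + \<bar>?p\<bar>))" if i: "i < k_at (s n) t" for n i
    proof -
      have "real (Suc i) * h (s n) \<le> real (k_at (s n) t) * h (s n)"
        using i h[of "s n"] by (intro mult_right_mono) auto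
      then have "\<bar>Fn (s n) (Suc i) ?p\<bar> \<le> BF t * (1 + \<bar>?p\<bar>)" using k_at(1)[OF t, of "s n"] by (intro Fn_bound) simp
      then show ?thesis unfolding abs_mult using KR kr_nonneg by (intro mult_mono) auto
    qed
    show "0 \<le> KR * (BF t * (1 + \<bar>?p\<bar>))" using KR BF_nonneg[OF t] by auto
  qed (use h k_at_lim[OF t] k_at(1)[OF t] F_continuous_on in auto)
  moreover have "(\<lambda>n. v (T (s n) ?p)) \<longlonglongrightarrow> v ?p" by (intro v_tendsto Ts_tendsto supp_pt)
  ultimately show ?thesis unfolding Vn_eq V_def by (intro tendsto_add)
qed

lemma V_borel [measurable]: assumes t: "0 \<le> t" shows "V t \<in> borel_measurable borel"
  by (rule borel_measurable_LIMSEQ_real[OF Vn_tendsto[OF t]]) simp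

definition BVX :: "real \<Rightarrow> real" where "BVX t = BV t * D"

lemma BVX_nonneg: "0 \<le> t \<Longrightarrow> 0 \<le> BVX t" unfolding BVX_def using BV_nonneg D_nonneg by simp

lemma Vn_supp_pt_bound: assumes "real k * h n \<le> t" shows "\<bar>Vn n k (supp_pt y)\<bar> \<le> BVX t * (1 + \<bar>y\<bar>)"
proof -
  have "\<bar>Vn n k (supp_pt y)\<bar> \<le> BV t * (1 + \<bar>supp_pt y\<bar>)" by (rule Vn_bound[OF assms])
  also have "\<dots> \<le> BV t * (D * (1 + \<bar>y\<bar>))"
    by (intro mult_left_mono supp_pt_bound BV_nonneg time_nonneg[OF assms])
  finally show ?thesis by (simp add: BVX_def mult.assoc)
qed

lemma V_lin_bound: assumes "0 \<le> t" "t \<le> T'" shows "\<bar>V t y\<bar> \<le> BVX T' * (1 + \<bar>y\<bar>)"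
proof (rule LIMSEQ_le_const2[OF tendsto_rabs[OF Vn_tendsto[OF assms(1)]]])
  show "\<exists>N. \<forall>n\<ge>N. \<bar>Vn (s n) (k_at (s n) t) (supp_pt y)\<bar> \<le> BVX T' * (1 + \<bar>y\<bar>)"
    using Vn_supp_pt_bound[OF order_trans[OF k_at(1)[OF assms(1)] assms(2)]] by blast
qed

lemma V_continuous_on: "continuous_on {0..t} (\<lambda>r. V r y)"
  unfolding V_def by (intro continuous_intros indefinite_integral_continuous_1 F_integrable_on) simp

lemma V_integrable_on: assumes "0 \<le> a" shows "(\<lambda>r. V r y) integrable_on {a..b}"
  by (rule integrable_continuous_real) (rule continuous_on_subset[OF V_continuous_on[of b y]], use assms in auto)

definition Z :: "real \<Rightarrow> real \<Rightarrow> real" where "Z t y = supp_pt y + integral {0..t} (\<lambda>r. V r y)"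

lemma Z_diff: assumes "0 \<le> a" "a \<le> b" shows "Z b y - Z a y = integral {a..b} (\<lambda>r. V r y)"
  using Henstock_Kurzweil_Integration.integral_combine[OF assms V_integrable_on[OF order_refl, of y b]]
  by (simp add: Z_def)

lemma Z_lin:
  assumes "0 \<le> a" "a \<le> b" "b \<le> T'" "0 \<le> r" "r \<le> T'"
  shows "\<bar>(Z b y - Z a y) - (b - a) * V r y\<bar> \<le> (b - a) * (BFX T' * (\<bar>a - r\<bar> + \<bar>b - r\<bar>)) * (1 + \<bar>y\<bar>)"
proof -
  have T0: "0 \<le> T'" using assms by simp
  have lip: "\<bar>V u y - V r y\<bar> \<le> BFX T' * (1 + \<bar>y\<bar>) * (\<bar>a - r\<bar> + \<bar>b - r\<bar>)" if u: "u \<in> {a..b}" for u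
  proof -
    have "\<bar>V u y - V r y\<bar> \<le> BFX T' * (1 + \<bar>y\<bar>) * \<bar>u - r\<bar>"
      using V_lin_lip[of u r T' y] V_lin_lip[of r u T' y] assms u
      by (cases "u \<le> r") (auto simp: abs_minus_commute)
    also have "\<dots> \<le> BFX T' * (1 + \<bar>y\<bar>) * (\<bar>a - r\<bar> + \<bar>b - r\<bar>)"
      using u BFX_nonneg[OF T0] by (intro mult_left_mono) auto
    finally show ?thesis .
  qed
  have "(Z b y - Z a y) - (b - a) * V r y = integral {a..b} (\<lambda>u. V u y - V r y)"
    using Henstock_Kurzweil_Integration.integral_diff[OF V_integrable_on[OF assms(1), of y b] integrable_const_ivl[of "V r y" a b]]
      assms by (simp add: Z_diff)
  moreover have "norm (integral {a..b} (\<lambda>u. V u y - V r y)) \<le> (BFX T' * (1 + \<bar>y\<bar>) * (\<bar>a - r\<bar> + \<bar>b - r\<bar>)) * (b - a)"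
    using assms lip by (intro integral_bound continuous_intros continuous_on_subset[OF V_continuous_on[of b y]]) auto
  ultimately show ?thesis by (simp add: mult_ac)
qed

lemma Zn_tendsto:
  assumes t: "0 \<le> t" shows "(\<lambda>n. Zn (s n) (k_at (s n) t) (supp_pt y)) \<longlonglongrightarrow> Z t y"
proof -
  let ?p = "supp_pt y"
  have "(\<lambda>n. \<Sum>i<k_at (s n) t. h (s n) * Vn (s n) i ?p) \<longlonglongrightarrow> integral {0..t} (\<lambda>r. V r y)"
  proof (rule step_sum_tendsto_integral[where C="BV t * (1 + \<bar>?p\<bar>)"])
    show "(\<lambda>n. Vn (s n) (nat \<lfloor>r / h (s n)\<rfloor>) ?p) \<longlonglongrightarrow> V r y" if "0 \<le> r" for r
      using Vn_tendsto[OF that, of y] by (simp add: k_at_def)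
    show "\<bar>Vn (s n) i ?p\<bar> \<le> BV t * (1 + \<bar>?p\<bar>)" if i: "i < k_at (s n) t" for n i
    proof -
      have "real i * h (s n) \<le> real (k_at (s n) t) * h (s n)"
        using i h[of "s n"] by (intro mult_right_mono) auto
      then show ?thesis using k_at(1)[OF t, of "s n"] by (intro Vn_bound) simp
    qed
    show "0 \<le> BV t * (1 + \<bar>?p\<bar>)" using BV_nonneg[OF t] by auto
  qed (use h k_at_lim[OF t] k_at(1)[OF t] V_continuous_on in auto)
  then show ?thesis unfolding Zn_eq Z_def by (intro tendsto_add Ts_tendsto supp_pt)
qed

lemma Z_borel [measurable]: assumes t: "0 \<le> t" shows "Z t \<in> borel_measurable borel"
  by (rule borel_measurable_LIMSEQ_real[OF Zn_tendsto[OF t]]) simp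

definition BZ :: "real \<Rightarrow> real" where "BZ t = D + t * BV t"

lemma Zn_bound: assumes "real k * h n \<le> t" shows "\<bar>Zn n k y\<bar> \<le> BZ t * (1 + \<bar>y\<bar>)"
proof -
  have t: "0 \<le> t" by (rule time_nonneg[OF assms])
  have "\<bar>Zn n k y\<bar> \<le> \<bar>T n y\<bar> + (\<Sum>i<k. \<bar>h n * Vn n i y\<bar>)"
    unfolding Zn_eq by (rule order_trans[OF abs_triangle_ineq add_left_mono[OF sum_abs]])
  also have "\<dots> \<le> D * (1 + \<bar>y\<bar>) + (\<Sum>i<k. h n * (BV t * (1 + \<bar>y\<bar>)))"
  proof (intro add_mono T_bound sum_mono)
    fix i assume "i \<in> {..<k}"
    then have "real i * h n \<le> real k * h n" using h[of n] by (intro mult_right_mono) auto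
    then have "\<bar>Vn n i y\<bar> \<le> BV t * (1 + \<bar>y\<bar>)" using assms by (intro Vn_bound) simp
    then show "\<bar>h n * Vn n i y\<bar> \<le> h n * (BV t * (1 + \<bar>y\<bar>))" using h[of n] by (simp add: abs_mult)
  qed
  also have "\<dots> = D * (1 + \<bar>y\<bar>) + (real k * h n) * (BV t * (1 + \<bar>y\<bar>))" by simp
  also have "\<dots> \<le> D * (1 + \<bar>y\<bar>) + t * (BV t * (1 + \<bar>y\<bar>))"
    using assms BV_nonneg[OF t] by (intro add_left_mono mult_right_mono) auto
  finally show ?thesis by (simp add: BZ_def algebra_simps)
qed

lemma Z_L2: assumes t: "0 \<le> t" shows "Z t \<in> L2 \<rho>"
proof (rule linear_bound_L2(1))
  show "\<bar>Z t y\<bar> \<le> (BZ t * D) * (1 + \<bar>y\<bar>)" for y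
  proof (rule LIMSEQ_le_const2[OF tendsto_rabs[OF Zn_tendsto[OF t]]])
    have BZ: "0 \<le> BZ t" using D_nonneg BV_nonneg[OF t] t by (simp add: BZ_def)
    have "\<bar>Zn (s n) (k_at (s n) t) (supp_pt y)\<bar> \<le> BZ t * D * (1 + \<bar>y\<bar>)" for n
      using order_trans[OF Zn_bound[OF k_at(1)[OF t]] mult_left_mono[OF supp_pt_bound BZ]] by (simp add: mult.assoc)
    then show "\<exists>N. \<forall>n\<ge>N. \<bar>Zn (s n) (k_at (s n) t) (supp_pt y)\<bar> \<le> BZ t * D * (1 + \<bar>y\<bar>)" by blast
  qed
qed (use Z_borel[OF t] in auto)

text \<open>In the scheme the orthogonality holds for every test function. Continuity makes the test
  factor converge along the positions, and boundedness keeps the integrands dominated.\<close>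

lemma orthogonal_continuous:
  assumes t: "0 \<le> t" and \<phi>: "continuous_on UNIV \<phi>" "\<And>x. \<bar>\<phi> x\<bar> \<le> 1"
  shows "(\<integral>y. (Z t y - X t y) * \<phi> (X t y) \<partial>\<rho>) = 0"
proof -
  have [measurable]: "\<phi> \<in> borel_measurable borel" by (rule borel_measurable_continuous_onI[OF \<phi>(1)])
  note [measurable] = Z_borel[OF t] X_borel[OF t]
  define f where "f n y = (Zn (s n) (k_at (s n) t) y - xn (s n) (k_at (s n) t) y) * \<phi> (xn (s n) (k_at (s n) t) y)" for n y
  have f0: "(\<integral>y. f n y \<partial>\<rho>) = 0" for n
    using P.free_pos_orthogonal[of "s n" "k_at (s n) t" \<phi>]
    by (simp add: mult.assoc sum_m f_def Zn_def xn_def)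
  have "(\<lambda>n. \<integral>y. f n y \<partial>\<rho>) \<longlonglongrightarrow> (\<integral>y. (Z t y - X t y) * \<phi> (X t y) \<partial>\<rho>)"
  proof (rule integral_dominated_convergence)
    show "integrable \<rho> (\<lambda>y. (BZ t + B t) * (1 + \<bar>y\<bar>))" by (intro integrable_mult_right lin_integrable)
    show "AE y in \<rho>. (\<lambda>n. f n y) \<longlonglongrightarrow> (Z t y - X t y) * \<phi> (X t y)"
      using AE_supp_pt
    proof eventually_elim
      case (elim y)
      have x: "(\<lambda>n. xn (s n) (k_at (s n) t) y) \<longlonglongrightarrow> X t y" using X_tendsto_at[OF t t, of y] elim by simp
      have z: "(\<lambda>n. Zn (s n) (k_at (s n) t) y) \<longlonglongrightarrow> Z t y" using Zn_tendsto[OF t, of y] elim by simp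
      have "isCont \<phi> (X t y)" using \<phi>(1) by (simp add: continuous_on_eq_continuous_at)
      then have "(\<lambda>n. \<phi> (xn (s n) (k_at (s n) t) y)) \<longlonglongrightarrow> \<phi> (X t y)" using x by (rule isCont_tendsto_compose)
      then show ?case unfolding f_def by (intro tendsto_mult tendsto_diff z x)
    qed
    show "AE y in \<rho>. norm (f n y) \<le> (BZ t + B t) * (1 + \<bar>y\<bar>)" for n
    proof (rule AE_I2)
      fix y
      have 1: "\<bar>Zn (s n) (k_at (s n) t) y - xn (s n) (k_at (s n) t) y\<bar> \<le> (BZ t + B t) * (1 + \<bar>y\<bar>)"
        using Zn_bound[OF k_at(1)[OF t], of "s n" y] xn_bound[OF k_at(1)[OF t], of "s n" y]
        by (simp add: distrib_right)
      have "norm (f n y) \<le> \<bar>Zn (s n) (k_at (s n) t) y - xn (s n) (k_at (s n) t) y\<bar> * 1"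
        unfolding f_def real_norm_def abs_mult by (intro mult_left_mono \<phi>) simp
      then show "norm (f n y) \<le> (BZ t + B t) * (1 + \<bar>y\<bar>)" using 1 by simp
    qed
  qed (auto simp: f_def[abs_def])
  then show ?thesis by (simp add: f0 LIMSEQ_const_iff)
qed

end

section \<open>Orthogonality to the sigma-algebra generated by the position\<close>

context flow_data
begin

lemma residual_L2: "0 \<le> t \<Longrightarrow> (\<lambda>y. Z t y - X t y) \<in> L2 \<rho>"
  by (intro L2_diff Z_L2 X_L2)

lemma orthogonal_atMost:
  assumes t: "0 \<le> t" shows "(\<integral>y. (Z t y - X t y) * indicator {..a} (X t y) \<partial>\<rho>) = 0"
proof -
  note [measurable] = Z_borel[OF t] X_borel[OF t]
  \<comment> \<open>For positive \<open>n\<close> this ramp is 1 up to \<open>a\<close> and falls to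
    0 at \<open>a + 1 / n\<close>.\<close>
  define \<phi> where "\<phi> n x = max 0 (min 1 (1 - real n * (x - a)))" for n :: nat and x :: real
  have c\<phi>: "continuous_on UNIV (\<phi> n)" for n unfolding \<phi>_def by (intro continuous_intros)
  then have [measurable]: "\<phi> n \<in> borel_measurable borel" for n by (rule borel_measurable_continuous_onI)
  have b\<phi>: "\<bar>\<phi> n x\<bar> \<le> 1" for n x by (simp add: \<phi>_def)
  have lim: "(\<lambda>n. \<phi> n x) \<longlonglongrightarrow> indicator {..a} x" for x
  proof (cases "x \<le> a")
    case True
    then have "\<phi> n x = 1" for n by (simp add: \<phi>_def mult_nonneg_nonpos min_def max_def)
    then show ?thesis using True by simp
  next
    case False
    obtain N :: nat where N: "1 / (x - a) < N" using reals_Archimedean2 by blast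
    have "\<phi> n x = 0" if "N \<le> n" for n
    proof -
      have "1 / (x - a) \<le> real n" using N that by linarith
      then have "1 \<le> real n * (x - a)" using False by (simp add: divide_le_eq)
      then show ?thesis by (simp add: \<phi>_def)
    qed
    then have "\<forall>\<^sub>F n in sequentially. \<phi> n x = 0" by (auto simp: eventually_sequentially)
    then show ?thesis using False by (simp add: tendsto_eventually)
  qed
  have "(\<lambda>n. \<integral>y. (Z t y - X t y) * \<phi> n (X t y) \<partial>\<rho>) \<longlonglongrightarrow> (\<integral>y. (Z t y - X t y) * indicator {..a} (X t y) \<partial>\<rho>)"
  proof (rule integral_dominated_convergence)
    show "integrable \<rho> (\<lambda>y. \<bar>Z t y - X t y\<bar>)" using L2_integrable[OF L2_abs[OF residual_L2[OF t]]] .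
    show "AE y in \<rho>. (\<lambda>n. (Z t y - X t y) * \<phi> n (X t y)) \<longlonglongrightarrow> (Z t y - X t y) * indicator {..a} (X t y)"
      by (intro AE_I2 tendsto_mult_left lim)
    show "AE y in \<rho>. norm ((Z t y - X t y) * \<phi> n (X t y)) \<le> \<bar>Z t y - X t y\<bar>" for n
      using mult_left_mono[OF b\<phi>] by (fastforce simp: abs_mult)
  qed auto
  then show ?thesis using orthogonal_continuous[OF t c\<phi> b\<phi>] by (simp add: LIMSEQ_const_iff)
qed

text \<open>Half-lines are closed under intersection and generate the Borel sets. The sets with the
  claimed property are closed under complements, by the test function 1, and under disjoint
  countable unions, by dominated convergence.\<close>

lemma orthogonal_indicator:
  assumes t: "0 \<le> t" and C: "C \<in> sets borel"
  shows "(\<integral>y. (Z t y - X t y) * indicator C (X t y) \<partial>\<rho>) = 0"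
proof -
  note [measurable] = Z_borel[OF t] X_borel[OF t]
  define f where "f y = Z t y - X t y" for y
  have [measurable]: "f \<in> borel_measurable borel" unfolding f_def[abs_def] by measurable
  have fi: "integrable \<rho> f" using L2_integrable[OF residual_L2[OF t]] by (simp add: f_def[abs_def])
  have fin: "integrable \<rho> (\<lambda>y. f y * indicator E (X t y))" if "E \<in> sets borel" for E
  proof (rule Bochner_Integration.integrable_bound[OF fi])
    have [measurable]: "E \<in> sets borel" by (rule that)
    show "(\<lambda>y. f y * indicator E (X t y)) \<in> borel_measurable \<rho>" by measurable
  qed (auto simp: indicator_def)
  have f0: "(\<integral>y. f y \<partial>\<rho>) = 0"
    using orthogonal_continuous[OF t, of "\<lambda>_. 1"] by (simp add: f_def)
  have Int: "Int_stable (range (\<lambda>a::real. {..a}))" by (auto simp: Int_stable_def)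
  have Pow: "range (\<lambda>a::real. {..a}) \<subseteq> Pow UNIV" by simp
  have "C \<in> sigma_sets UNIV (range (\<lambda>a::real. {..a}))" using C by (simp add: borel_eq_atMost)
  with Int Pow have "(\<integral>y. f y * indicator C (X t y) \<partial>\<rho>) = 0"
  proof (induction C rule: sigma_sets_induct_disjoint)
    case (basic E)
    then show ?case using orthogonal_atMost[OF t] by (auto simp: f_def)
  next
    case empty
    then show ?case by simp
  next
    case (compl E)
    then have E: "E \<in> sets borel" by (simp add: borel_eq_atMost)
    have "(\<integral>y. f y * indicator (UNIV - E) (X t y) \<partial>\<rho>) = (\<integral>y. f y - f y * indicator E (X t y) \<partial>\<rho>)"
      by (rule Bochner_Integration.integral_cong) (auto simp: indicator_def)
    then show ?case using fi fin[OF E] f0 compl by simp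
  next
    case (union E)
    have E: "E i \<in> sets borel" for i using union(2) by (auto simp: borel_eq_atMost)
    have "(\<lambda>n. \<integral>y. f y * indicator (\<Union>i<n. E i) (X t y) \<partial>\<rho>) \<longlonglongrightarrow> (\<integral>y. f y * indicator (\<Union>i. E i) (X t y) \<partial>\<rho>)"
    proof (rule integral_dominated_convergence)
      show "integrable \<rho> (\<lambda>y. \<bar>f y\<bar>)" using fi by simp
      show "AE y in \<rho>. (\<lambda>n. f y * indicator (\<Union>i<n. E i) (X t y)) \<longlonglongrightarrow> f y * indicator (\<Union>i. E i) (X t y)"
        by (intro AE_I2 tendsto_mult_left LIMSEQ_indicator_UN)
      show "(\<lambda>y. f y * indicator (\<Union>i. E i) (X t y)) \<in> borel_measurable \<rho>"
        "\<And>n. (\<lambda>y. f y * indicator (\<Union>i<n. E i) (X t y)) \<in> borel_measurable \<rho>"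
        by (rule borel_measurable_integrable[OF fin], use E in auto)+
    qed (auto simp: indicator_def)
    moreover have "(\<integral>y. f y * indicator (\<Union>i<n. E i) (X t y) \<partial>\<rho>) = 0" for n
    proof -
      have "indicator (\<Union>i<n. E i) x = (\<Sum>i<n. indicator (E i) x :: real)" for x
        using union(1) by (intro indicator_UN_disjoint) (auto simp: disjoint_family_on_def)
      then have "(\<integral>y. f y * indicator (\<Union>i<n. E i) (X t y) \<partial>\<rho>) = (\<integral>y. (\<Sum>i<n. f y * indicator (E i) (X t y)) \<partial>\<rho>)"
        by (simp add: sum_distrib_left)
      also have "\<dots> = (\<Sum>i<n. \<integral>y. f y * indicator (E i) (X t y) \<partial>\<rho>)"
        by (rule Bochner_Integration.integral_sum) (rule fin[OF E])
      finally show ?thesis using union(3) by simp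
    qed
    ultimately show ?case by (simp add: LIMSEQ_const_iff)
  qed
  then show ?thesis by (simp add: f_def)
qed

text \<open>The claim for indicators says that the conditional expectation of the residual given
  \<open>X t\<close> is zero; the projection property extends it to square integrable
  \<open>g\<close>.\<close>

lemma orthogonal_L2:
  assumes t: "0 \<le> t" and g: "g \<in> L2 \<rho>" "g \<in> borel_measurable (sigma_gen \<rho> (X t))"
  shows "(\<integral>y. (Z t y - X t y) * g y \<partial>\<rho>) = 0"
proof -
  have Xm: "X t \<in> borel_measurable \<rho>" using X_borel[OF t] by simp
  interpret Sg: finite_measure_subalgebra \<rho> "sigma_gen \<rho> (X t)" by (rule cond_exp_given_sigma[OF Xm])
  let ?f = "\<lambda>y. Z t y - X t y"
  have f: "?f \<in> L2 \<rho>" by (rule residual_L2[OF t])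
  have "AE y in \<rho>. real_cond_exp \<rho> (sigma_gen \<rho> (X t)) ?f y = 0"
  proof (rule Sg.real_cond_exp_charact)
    fix E assume "E \<in> sets (sigma_gen \<rho> (X t))"
    then obtain C where C: "C \<in> sets borel" "E = X t -` C \<inter> space \<rho>" by (auto simp: sets_vimage_algebra2)
    have "set_lebesgue_integral \<rho> E ?f = (\<integral>y. ?f y * indicator C (X t y) \<partial>\<rho>)"
      unfolding set_lebesgue_integral_def
      by (rule Bochner_Integration.integral_cong) (auto simp: C indicator_def)
    then show "set_lebesgue_integral \<rho> E ?f = set_lebesgue_integral \<rho> E (\<lambda>_. 0)"
      using orthogonal_indicator[OF t C(1)] by (simp add: set_lebesgue_integral_def)
  qed (use L2_integrable[OF f] in auto)
  then have "AE y in \<rho>. cond_exp_given \<rho> ?f (X t) y * g y = 0"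
    unfolding cond_exp_given_def by eventually_elim simp
  then have "(\<integral>y. cond_exp_given \<rho> ?f (X t) y * g y \<partial>\<rho>) = 0"
    by (simp add: integral_eq_zero_AE)
  then show ?thesis using cond_exp_given_inner[OF Xm f g] by simp
qed

definition LX :: "real \<Rightarrow> real" where "LX t = BV (max 0 t) * N1"
text \<open>One constant for several bounds: the sizes of \<open>F\<close> and \<open>V\<close>, the
  Lipschitz constant of \<open>V\<close>, and the second-order error of the potential. The maximum
  with 0 keeps it nonnegative for negative arguments too.\<close>

definition KX :: "real \<Rightarrow> real" where
  "KX t = (BFX (max 0 t) + BVX (max 0 t)) * N1 + c * (LX t)\<^sup>2"

lemma LX_nonneg: "0 \<le> LX t" unfolding LX_def using BV_nonneg N1 by simp

lemma KX_ge:
  assumes "0 \<le> t" shows "BFX t * N1 \<le> KX t" "BVX t * N1 \<le> KX t" "c * (BV t * N1)\<^sup>2 \<le> KX t"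
proof -
  have 1: "0 \<le> BFX t * N1" "0 \<le> BVX t * N1" using BFX_nonneg[OF assms] BVX_nonneg[OF assms] N1 by auto
  have 2: "0 \<le> c * (BV t * N1)\<^sup>2" using c by simp
  have "KX t = BFX t * N1 + BVX t * N1 + c * (BV t * N1)\<^sup>2"
    using assms by (simp add: KX_def LX_def distrib_right max_def)
  then show "BFX t * N1 \<le> KX t" "BVX t * N1 \<le> KX t" "c * (BV t * N1)\<^sup>2 \<le> KX t" using 1 2 by linarith+
qed

lemma KX_nonneg: "0 \<le> KX t"
  unfolding KX_def using BFX_nonneg[of "max 0 t"] BVX_nonneg[of "max 0 t"] N1 c
  by (intro add_nonneg_nonneg mult_nonneg_nonneg) auto

lemma V_L2: "0 \<le> t \<Longrightarrow> V t \<in> L2 \<rho>"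
  by (rule linear_bound_L2(1)[OF _ V_lin_bound[OF _ order_refl]]) simp_all

lemma F_L2: "0 \<le> t \<Longrightarrow> F t \<in> L2 \<rho>"
  by (rule linear_bound_L2(1)[OF _ F_lin_bound[OF _ order_refl]]) simp_all

sublocale flow: sticky_flow \<rho> X Z V LX KX
proof
  fix r t T' :: real
  assume a: "0 \<le> r" "r \<le> t" "t \<le> T'"
  then have T0: "0 \<le> T'" by simp
  show "L2_norm \<rho> (\<lambda>y. X t y - X r y) \<le> LX T' * (t - r)"
    using X_lipschitz[OF a] T0 by (simp add: LX_def max_def)
  have "L2_norm \<rho> (\<lambda>y. V t y - V r y) \<le> (BFX T' * (t - r)) * N1"
    unfolding N1_def
  proof (rule linear_bound_L2(2))
    show "(\<lambda>y. V t y - V r y) \<in> borel_measurable \<rho>" using V_borel[of t] V_borel[of r] a by simp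
    show "\<bar>V t y - V r y\<bar> \<le> BFX T' * (t - r) * (1 + \<bar>y\<bar>)" for y
      using V_lin_lip[OF a, of y] by (simp add: mult_ac)
  qed
  also have "\<dots> = (BFX T' * N1) * (t - r)" by simp
  also have "\<dots> \<le> KX T' * (t - r)" using KX_ge(1)[OF T0] a by (intro mult_right_mono) auto
  finally show "L2_norm \<rho> (\<lambda>y. V t y - V r y) \<le> KX T' * (t - r)" .
next
  fix T' a b r :: real
  assume a: "0 \<le> a" "a \<le> b" "b \<le> T'" "0 \<le> r" "r \<le> T'"
  then have T0: "0 \<le> T'" by simp
  have "L2_norm \<rho> (\<lambda>y. Z b y - Z a y - (b - a) * V r y) \<le> ((b - a) * (BFX T' * (\<bar>a - r\<bar> + \<bar>b - r\<bar>))) * N1"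
    unfolding N1_def
  proof (rule linear_bound_L2(2))
    show "(\<lambda>y. Z b y - Z a y - (b - a) * V r y) \<in> borel_measurable \<rho>"
      using Z_borel[of a] Z_borel[of b] V_borel[of r] a by simp
    show "\<bar>Z b y - Z a y - (b - a) * V r y\<bar> \<le> (b - a) * (BFX T' * (\<bar>a - r\<bar> + \<bar>b - r\<bar>)) * (1 + \<bar>y\<bar>)" for y
      by (rule Z_lin[OF a])
  qed
  also have "\<dots> = (b - a) * ((BFX T' * N1) * (\<bar>a - r\<bar> + \<bar>b - r\<bar>))" by (simp add: mult_ac)
  also have "\<dots> \<le> (b - a) * (KX T' * (\<bar>a - r\<bar> + \<bar>b - r\<bar>))"
    using KX_ge(1)[OF T0] a by (intro mult_left_mono mult_right_mono) auto
  finally show "L2_norm \<rho> (\<lambda>y. Z b y - Z a y - (b - a) * V r y) \<le> (b - a) * (KX T' * (\<bar>a - r\<bar> + \<bar>b - r\<bar>))" .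
next
  fix s t :: real assume "0 < s" "s \<le> t"
  then show "\<exists>\<phi>\<in>borel_measurable borel. \<forall>y\<in>space \<rho>. X t y = \<phi> (X s y)" using X_factor[of s t] by simp
next
  fix t g assume "0 < t" "g \<in> L2 \<rho>" "g \<in> borel_measurable (sigma_gen \<rho> (X t))"
  then show "(\<integral>y. (Z t y - X t y) * g y \<partial>\<rho>) = 0" by (intro orthogonal_L2) auto
qed (auto intro: X_L2 Z_L2 V_L2 KX_nonneg LX_nonneg)

lemma F_L2_continuous:
  assumes t: "0 \<le> t" and r: "\<And>n. 0 \<le> r n" "r \<longlonglongrightarrow> t"
  shows "(\<lambda>n. L2_norm \<rho> (\<lambda>y. F (r n) y - F t y)) \<longlonglongrightarrow> 0"
proof -
  obtain \<tau> where \<tau>: "\<And>n. r n \<le> \<tau>"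
    using convergent_imp_Bseq[OF convergentI[OF r(2)]] by (auto elim!: BseqE) (metis abs_le_D1)
  show ?thesis
  proof (rule L2_norm_dominated_tendsto)
    show "(\<lambda>y. BFX \<tau> * (1 + \<bar>y\<bar>)) \<in> L2 \<rho>" by (rule L2_cmult[OF lin_L2])
    show "AE y in \<rho>. (\<lambda>n. F (r n) y) \<longlonglongrightarrow> F t y" by (intro AE_I2 F_continuous_time[OF t r])
    show "AE y in \<rho>. \<bar>F (r n) y\<bar> \<le> BFX \<tau> * (1 + \<bar>y\<bar>)" for n by (intro AE_I2 F_lin_bound r \<tau>)
  qed (use F_borel t r in auto)
qed

text \<open>\<open>W'\<close> is merely continuous, so no explicit modulus is at hand. Two sequences
  of times that violate the claim would have a common limit point in \<open>{0..T'}\<close>, against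
  continuity of \<open>F\<close> in the norm there.\<close>

lemma F_uniformly_continuous:
  assumes T': "0 \<le> T'" and \<epsilon>: "0 < \<epsilon>"
  obtains \<delta> where "\<delta> > 0" "\<And>r t. 0 \<le> r \<Longrightarrow> r \<le> T' \<Longrightarrow> 0 \<le> t \<Longrightarrow> t \<le> T' \<Longrightarrow> \<bar>r - t\<bar> < \<delta> \<Longrightarrow>
    L2_norm \<rho> (\<lambda>y. F r y - F t y) \<le> \<epsilon>"
proof (rule ccontr)
  assume contr: "\<not> thesis"
  have "\<exists>r t. 0 \<le> r \<and> r \<le> T' \<and> 0 \<le> t \<and> t \<le> T' \<and> \<bar>r - t\<bar> < 1 / real (Suc n) \<and> \<not> L2_norm \<rho> (\<lambda>y. F r y - F t y) \<le> \<epsilon>" for n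
  proof (rule ccontr)
    assume "\<not> ?thesis"
    then have "thesis" by (intro that[of "1 / real (Suc n)"]) auto
    then show False using contr by simp
  qed
  then obtain r t where rt: "\<And>n. 0 \<le> r n" "\<And>n. r n \<le> T'" "\<And>n. 0 \<le> t n" "\<And>n. t n \<le> T'"
    "\<And>n. \<bar>r n - t n\<bar> < 1 / real (Suc n)" "\<And>n. \<not> L2_norm \<rho> (\<lambda>y. F (r n) y - F (t n) y) \<le> \<epsilon>"
    by metis
  have "compact {0..T'}" by simp
  then obtain l \<sigma> where l: "l \<in> {0..T'}" "strict_mono (\<sigma> :: nat \<Rightarrow> nat)" "(r \<circ> \<sigma>) \<longlonglongrightarrow> l"
    using rt(1,2) unfolding compact_def by (metis atLeastAtMost_iff)
  have d0: "(\<lambda>n. r n - t n) \<longlonglongrightarrow> 0"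
  proof (rule LIMSEQ_norm_0)
    show "norm (r n - t n) < 1 / real (Suc n)" for n using rt(5)[of n] by simp
  qed
  have tl: "(t \<circ> \<sigma>) \<longlonglongrightarrow> l"
    using tendsto_diff[OF l(3) LIMSEQ_subseq_LIMSEQ[OF d0 l(2)]] by (simp add: o_def)
  have l0: "0 \<le> l" using l(1) by simp
  have "(\<lambda>n. L2_norm \<rho> (\<lambda>y. F ((r \<circ> \<sigma>) n) y - F l y) + L2_norm \<rho> (\<lambda>y. F ((t \<circ> \<sigma>) n) y - F l y)) \<longlonglongrightarrow> 0 + 0"
  proof (rule tendsto_add)
    show "(\<lambda>n. L2_norm \<rho> (\<lambda>y. F ((r \<circ> \<sigma>) n) y - F l y)) \<longlonglongrightarrow> 0"
      by (rule F_L2_continuous[OF l0 _ l(3)]) (simp add: rt)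
    show "(\<lambda>n. L2_norm \<rho> (\<lambda>y. F ((t \<circ> \<sigma>) n) y - F l y)) \<longlonglongrightarrow> 0"
      by (rule F_L2_continuous[OF l0 _ tl]) (simp add: rt)
  qed
  then have "\<forall>\<^sub>F n in sequentially. L2_norm \<rho> (\<lambda>y. F ((r \<circ> \<sigma>) n) y - F l y) + L2_norm \<rho> (\<lambda>y. F ((t \<circ> \<sigma>) n) y - F l y) < \<epsilon>"
    using \<epsilon> by (intro order_tendstoD(2)) auto
  then obtain n where n: "L2_norm \<rho> (\<lambda>y. F ((r \<circ> \<sigma>) n) y - F l y) + L2_norm \<rho> (\<lambda>y. F ((t \<circ> \<sigma>) n) y - F l y) < \<epsilon>"
    by (auto simp: eventually_sequentially)
  have "L2_norm \<rho> (\<lambda>y. F (r (\<sigma> n)) y - F (t (\<sigma> n)) y)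
    \<le> L2_norm \<rho> (\<lambda>y. F (r (\<sigma> n)) y - F l y) + L2_norm \<rho> (\<lambda>y. F l y - F (t (\<sigma> n)) y)"
    by (rule L2_norm_triangle_diff) (use rt l0 in \<open>auto intro: F_L2\<close>)
  then show False using n rt(6)[of "\<sigma> n"] by (simp add: L2_norm_minus_commute[of \<rho> "F l"])
qed

lemma nat_floor_mult_tendsto:
  assumes "\<And>n. 0 < \<tau> n" "\<tau> \<longlonglongrightarrow> 0" "0 \<le> (r::real)"
  shows "(\<lambda>n. real (nat \<lfloor>r / \<tau> n\<rfloor>) * \<tau> n) \<longlonglongrightarrow> r"
proof (rule tendsto_sandwich)
  have b: "r - \<tau> n \<le> real (nat \<lfloor>r / \<tau> n\<rfloor>) * \<tau> n" "real (nat \<lfloor>r / \<tau> n\<rfloor>) * \<tau> n \<le> r" for n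
  proof -
    have e: "real (nat \<lfloor>r / \<tau> n\<rfloor>) = of_int \<lfloor>r / \<tau> n\<rfloor>" using assms(1)[of n] assms(3) by simp
    have "real (nat \<lfloor>r / \<tau> n\<rfloor>) \<le> r / \<tau> n" "r / \<tau> n - 1 \<le> real (nat \<lfloor>r / \<tau> n\<rfloor>)" unfolding e by linarith+
    then show "r - \<tau> n \<le> real (nat \<lfloor>r / \<tau> n\<rfloor>) * \<tau> n" "real (nat \<lfloor>r / \<tau> n\<rfloor>) * \<tau> n \<le> r"
      using assms(1)[of n] by (auto simp: field_simps)
  qed
  show "(\<lambda>n. r - \<tau> n) \<longlonglongrightarrow> r" using tendsto_diff[OF tendsto_const assms(2), of r] by simp
  show "\<forall>\<^sub>F n in sequentially. r - \<tau> n \<le> real (nat \<lfloor>r / \<tau> n\<rfloor>) * \<tau> n" using b by simp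
  show "\<forall>\<^sub>F n in sequentially. real (nat \<lfloor>r / \<tau> n\<rfloor>) * \<tau> n \<le> r" using b by simp
qed simp

text \<open>Minkowski's inequality for the integral of \<open>F\<close>, by Riemann sums.\<close>

lemma V_increment_bound:
  assumes rt: "0 \<le> r" "r \<le> t" and \<epsilon>: "\<And>u. r \<le> u \<Longrightarrow> u \<le> t \<Longrightarrow> L2_norm \<rho> (\<lambda>y. F u y - F t y) \<le> \<epsilon>"
  shows "L2_norm \<rho> (\<lambda>y. (V t y - V r y) - (t - r) * F t y) \<le> (t - r) * \<epsilon>"
proof (cases "r = t")
  case True
  then show ?thesis by (simp add: L2_norm_def)
next
  case False
  define \<tau> where "\<tau> n = (t - r) / real (Suc n)" for n
  have \<tau>: "0 < \<tau> n" "real (Suc n) * \<tau> n = t - r" for n using False rt by (auto simp: \<tau>_def)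
  have \<tau>0: "\<tau> \<longlonglongrightarrow> 0"
    using tendsto_mult[OF tendsto_const LIMSEQ_inverse_real_of_nat, of "t - r"]
    unfolding \<tau>_def by (simp add: divide_inverse)
  have t0: "0 \<le> t" using rt by simp
  define R where "R n y = (\<Sum>i<Suc n. \<tau> n * (F (r + real i * \<tau> n) y - F t y))" for n y
  define g where "g y = (V t y - V r y) - (t - r) * F t y" for y
  have i_le: "r + real i * \<tau> n \<le> t" "r \<le> r + real i * \<tau> n" if "i < Suc n" for i n
  proof -
    have "real i * \<tau> n \<le> real (Suc n) * \<tau> n" using that \<tau>(1)[of n] by (intro mult_right_mono) auto
    then show "r + real i * \<tau> n \<le> t" using \<tau>(2)[of n] by simp
    show "r \<le> r + real i * \<tau> n" using \<tau>(1)[of n] by simp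
  qed
  have d: "\<bar>F u y - F t y\<bar> \<le> 2 * BFX t * (1 + \<bar>y\<bar>)" if "r \<le> u" "u \<le> t" for u y
    using F_lin_bound[of u t y] F_lin_bound[of t t y] that rt by simp
  have RL: "R n \<in> L2 \<rho>" for n
    unfolding R_def using rt \<tau>(1) t0
    by (intro L2_sum L2_cmult L2_diff F_L2) (auto intro!: add_nonneg_nonneg mult_nonneg_nonneg simp: less_imp_le[OF \<tau>(1)])
  have gL: "g \<in> L2 \<rho>" unfolding g_def using rt by (intro L2_diff L2_cmult F_L2 V_L2) auto
  have Rb: "L2_norm \<rho> (R n) \<le> (t - r) * \<epsilon>" for n
  proof -
    have "L2_norm \<rho> (R n) \<le> (\<Sum>i<Suc n. L2_norm \<rho> (\<lambda>y. \<tau> n * (F (r + real i * \<tau> n) y - F t y)))"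
      unfolding R_def using rt \<tau>(1)[of n] t0
      by (intro L2_norm_sum_le L2_cmult L2_diff F_L2) (auto intro!: add_nonneg_nonneg mult_nonneg_nonneg simp: less_imp_le[OF \<tau>(1)])
    also have "\<dots> \<le> (\<Sum>i<Suc n. \<tau> n * \<epsilon>)"
    proof (rule sum_mono)
      fix i assume "i \<in> {..<Suc n}"
      then have "L2_norm \<rho> (\<lambda>y. F (r + real i * \<tau> n) y - F t y) \<le> \<epsilon>" using i_le by (intro \<epsilon>) auto
      then show "L2_norm \<rho> (\<lambda>y. \<tau> n * (F (r + real i * \<tau> n) y - F t y)) \<le> \<tau> n * \<epsilon>"
        unfolding L2_norm_cmult using \<tau>(1)[of n] by (simp add: mult_left_mono)
    qed
    also have "\<dots> = (real (Suc n) * \<tau> n) * \<epsilon>" by simp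
    also have "\<dots> = (t - r) * \<epsilon>" unfolding \<tau>(2) ..
    finally show ?thesis .
  qed
  have lim: "(\<lambda>n. R n y) \<longlonglongrightarrow> g y" for y
  proof -
    have cont: "continuous_on {0..t - r} (\<lambda>u. F (r + u) y - F t y)"
      by (intro continuous_intros continuous_on_compose2[OF F_continuous_on[of t y]]) (use rt in auto)
    have "(\<lambda>n. R n y) \<longlonglongrightarrow> integral {0..t - r} (\<lambda>u. F (r + u) y - F t y)"
      unfolding R_def
    proof (rule step_sum_tendsto_integral[where C="2 * BFX t * (1 + \<bar>y\<bar>)"])
      show "(\<lambda>n. F (r + real (nat \<lfloor>u / \<tau> n\<rfloor>) * \<tau> n) y - F t y) \<longlonglongrightarrow> F (r + u) y - F t y"
        if "0 \<le> u" for u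
        using that rt \<tau>(1) nat_floor_mult_tendsto[OF \<tau>(1) \<tau>0 that]
        by (intro tendsto_diff tendsto_const F_continuous_time tendsto_add)
          (auto intro!: add_nonneg_nonneg mult_nonneg_nonneg simp: less_imp_le[OF \<tau>(1)])
      show "\<bar>F (r + real i * \<tau> n) y - F t y\<bar> \<le> 2 * BFX t * (1 + \<bar>y\<bar>)" if "i < Suc n" for n i
        using i_le[OF that] by (intro d)
    qed (use \<tau> cont BFX_nonneg[OF t0] in auto)
    also have "integral {0..t - r} (\<lambda>u. F (r + u) y - F t y) = integral {r..t} (\<lambda>u. F u y - F t y)"
    proof -
      have "((\<lambda>u. F u y - F t y) has_integral integral {r..t} (\<lambda>u. F u y - F t y)) {r..t}"
        by (intro integrable_integral integrable_diff F_integrable_on rt integrable_const_ivl)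
      from has_integral_affinity'[OF this[folded box_real(2)] zero_less_one, of r]
      have "((\<lambda>u. F (r + u) y - F t y) has_integral integral {r..t} (\<lambda>u. F u y - F t y)) {0..t - r}"
        by (simp add: add.commute)
      then show ?thesis by (rule integral_unique)
    qed
    also have "\<dots> = g y"
      using Henstock_Kurzweil_Integration.integral_diff[OF F_integrable_on[OF rt(1), of y t] integrable_const_ivl[of "F t y" r t]] rt
      by (simp add: g_def V_diff)
    finally show ?thesis .
  qed
  have "(\<lambda>n. L2_norm \<rho> (\<lambda>y. R n y - g y)) \<longlonglongrightarrow> 0"
  proof (rule L2_norm_dominated_tendsto)
    show "(\<lambda>y. ((t - r) * (2 * BFX t)) * (1 + \<bar>y\<bar>)) \<in> L2 \<rho>" by (rule L2_cmult[OF lin_L2])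
    show "AE y in \<rho>. \<bar>R n y\<bar> \<le> ((t - r) * (2 * BFX t)) * (1 + \<bar>y\<bar>)" for n
    proof (rule AE_I2)
      fix y
      have "\<bar>R n y\<bar> \<le> (\<Sum>i<Suc n. \<bar>\<tau> n * (F (r + real i * \<tau> n) y - F t y)\<bar>)" unfolding R_def by (rule sum_abs)
      also have "\<dots> \<le> (\<Sum>i<Suc n. \<tau> n * (2 * BFX t * (1 + \<bar>y\<bar>)))"
      proof (rule sum_mono)
        fix i assume "i \<in> {..<Suc n}"
        then show "\<bar>\<tau> n * (F (r + real i * \<tau> n) y - F t y)\<bar> \<le> \<tau> n * (2 * BFX t * (1 + \<bar>y\<bar>))"
          using d[OF i_le(2,1)] \<tau>(1)[of n] by (simp add: abs_mult mult_left_mono)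
      qed
      also have "\<dots> = (real (Suc n) * \<tau> n) * (2 * BFX t * (1 + \<bar>y\<bar>))" by simp
      also have "\<dots> = ((t - r) * (2 * BFX t)) * (1 + \<bar>y\<bar>)" unfolding \<tau>(2) by (simp only: mult.assoc)
      finally show "\<bar>R n y\<bar> \<le> ((t - r) * (2 * BFX t)) * (1 + \<bar>y\<bar>)" .
    qed
  qed (use RL gL lim in \<open>auto dest: L2_borel\<close>)
  moreover have "L2_norm \<rho> g \<le> (t - r) * \<epsilon> + L2_norm \<rho> (\<lambda>y. R n y - g y)" for n
    using L2_norm_triangle[OF RL[of n] L2_diff[OF gL RL[of n]]] Rb[of n]
    by (simp add: L2_norm_minus_commute[of \<rho> g])
  ultimately have "L2_norm \<rho> g \<le> (t - r) * \<epsilon> + 0"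
    by (intro LIMSEQ_le_const[OF tendsto_add[OF tendsto_const]]) auto
  then show ?thesis by (simp add: g_def[abs_def])
qed

end

section \<open>Energy and the flow equation\<close>

locale interaction_flow = flow_data \<rho> v W' G c K0 CG
  for \<rho> :: "real measure" and v W' G :: "real \<Rightarrow> real" and c K0 CG :: real +
  fixes W :: "real \<Rightarrow> real"
  assumes W_deriv: "\<And>x. (W has_real_derivative W' x) (at x)"
    and W_convex: "convex_on UNIV (\<lambda>x. W x + c / 2 * x\<^sup>2)"
begin

lemma W_borel [measurable]: "W \<in> borel_measurable borel"
  using W_deriv by (intro borel_measurable_continuous_onI continuous_at_imp_continuous_on)
    (auto intro: DERIV_isCont)

text \<open>The tangent of the convex function is taken at \<open>a\<close>, which will be the later
  position, because \<open>pot_le\<close> involves the force at the later time.\<close>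

lemma W_le: "W a - W b \<le> W' a * (a - b) + c / 2 * (a - b)\<^sup>2"
proof -
  have "((\<lambda>x. W x + c / 2 * x\<^sup>2) has_real_derivative (W' a + c * a)) (at a within UNIV)"
    by (auto intro!: derivative_eq_intros W_deriv)
  then have "(W b + c / 2 * b\<^sup>2) - (W a + c / 2 * a\<^sup>2) \<ge> (W' a + c * a) * (b - a)"
    by (intro convex_on_imp_above_tangent[OF W_convex]) auto
  then show ?thesis by (simp add: power2_eq_square algebra_simps)
qed

lemma W_growth: "\<bar>W x\<bar> \<le> (\<bar>W 0\<bar> + K0) * (1 + \<bar>x\<bar>)\<^sup>2"
proof -
  have "\<bar>W x - W 0\<bar> \<le> K0 * (1 + \<bar>x\<bar>) * \<bar>x - 0\<bar>"
  proof (rule field_differentiable_bound[of "{- \<bar>x\<bar>..\<bar>x\<bar>}", unfolded real_norm_def])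
    show "(W has_real_derivative W' z) (at z within {- \<bar>x\<bar>..\<bar>x\<bar>})" for z
      by (rule has_field_derivative_at_within[OF W_deriv])
    show "\<bar>W' z\<bar> \<le> K0 * (1 + \<bar>x\<bar>)" if "z \<in> {- \<bar>x\<bar>..\<bar>x\<bar>}" for z
      using W'_growth[of z] mult_left_mono[of "1 + \<bar>z\<bar>" "1 + \<bar>x\<bar>" K0] K0 that by force
  qed auto
  then have "\<bar>W x\<bar> \<le> \<bar>W 0\<bar> + K0 * (1 + \<bar>x\<bar>) * \<bar>x\<bar>" by simp
  also have "\<dots> \<le> \<bar>W 0\<bar> * (1 + \<bar>x\<bar>)\<^sup>2 + K0 * (1 + \<bar>x\<bar>) * (1 + \<bar>x\<bar>)"
  proof (rule add_mono)
    have "1 \<le> (1 + \<bar>x\<bar>)\<^sup>2" by (simp add: one_le_power)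
    from mult_left_mono[OF this, of "\<bar>W 0\<bar>"] show "\<bar>W 0\<bar> \<le> \<bar>W 0\<bar> * (1 + \<bar>x\<bar>)\<^sup>2" by simp
    show "K0 * (1 + \<bar>x\<bar>) * \<bar>x\<bar> \<le> K0 * (1 + \<bar>x\<bar>) * (1 + \<bar>x\<bar>)"
      using K0 by (intro mult_left_mono) auto
  qed
  finally show ?thesis by (simp add: power2_eq_square algebra_simps)
qed

interpretation pair: pair_sigma_finite \<rho> \<rho> ..

abbreviation "\<rho>2 \<equiv> \<rho> \<Otimes>\<^sub>M \<rho>"
abbreviation "lin y \<equiv> 1 + \<bar>y :: real\<bar>"

text \<open>The squared weight is integrable, so its product in two variables dominates all
  integrands over pairs that occur below.\<close>

lemma product_integrable:
  assumes f: "(\<lambda>x. f (fst x) (snd x)) \<in> borel_measurable \<rho>2"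
    and b: "\<And>z y. \<bar>f z y\<bar> \<le> C * ((lin z)\<^sup>2 * (lin y)\<^sup>2)"
  shows "integrable \<rho>2 (\<lambda>x. f (fst x) (snd x) :: real)"
proof -
  have i: "integrable \<rho> (\<lambda>y. (lin y)\<^sup>2)" by (rule L2_integrable_sq[OF lin_L2])
  have d: "integrable \<rho>2 (\<lambda>x. (lin (fst x))\<^sup>2 * (lin (snd x))\<^sup>2)"
  proof (rule pair.Fubini_integrable)
    show "integrable \<rho> (\<lambda>z. \<integral>y. norm ((lin (fst (z, y)))\<^sup>2 * (lin (snd (z, y)))\<^sup>2) \<partial>\<rho>)"
      using i by (simp add: abs_mult)
    show "AE z in \<rho>. integrable \<rho> (\<lambda>y. (lin (fst (z, y)))\<^sup>2 * (lin (snd (z, y)))\<^sup>2)"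
      using i by simp
  qed measurable
  have "integrable \<rho>2 (\<lambda>x. C * ((lin (fst x))\<^sup>2 * (lin (snd x))\<^sup>2))" using d by simp
  then show ?thesis
    by (rule Bochner_Integration.integrable_bound[OF _ f])
      (use b in \<open>auto intro!: AE_I2 order_trans[OF _ abs_ge_self]\<close>)
qed

lemma product_integral:
  assumes "integrable \<rho>2 (\<lambda>x. f (fst x) (snd x) :: real)"
  shows "(\<integral>z. (\<integral>y. f z y \<partial>\<rho>) \<partial>\<rho>) = (\<integral>x. f (fst x) (snd x) \<partial>\<rho>2)"
    "(\<integral>y. (\<integral>z. f z y \<partial>\<rho>) \<partial>\<rho>) = (\<integral>x. f (fst x) (snd x) \<partial>\<rho>2)"
proof -
  have i: "integrable \<rho>2 (\<lambda>(z, y). f z y)" using assms unfolding case_prod_unfold .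
  have e: "(\<lambda>(z, y). f z y) = (\<lambda>x. f (fst x) (snd x))" by (rule ext) (simp add: case_prod_beta)
  show "(\<integral>z. (\<integral>y. f z y \<partial>\<rho>) \<partial>\<rho>) = (\<integral>x. f (fst x) (snd x) \<partial>\<rho>2)"
    using pair.integral_fst[OF i] unfolding e .
  show "(\<integral>y. (\<integral>z. f z y \<partial>\<rho>) \<partial>\<rho>) = (\<integral>x. f (fst x) (snd x) \<partial>\<rho>2)"
    using pair.integral_snd[OF i] unfolding e .
qed

definition pot :: "real \<Rightarrow> real" where
  "pot t = (\<integral>z. (\<integral>y. 1/2 * W (X t y - X t z) \<partial>\<rho>) \<partial>\<rho>)"

lemma diff_lin:
  assumes "\<bar>a\<bar> \<le> C * lin y" "\<bar>b\<bar> \<le> C * lin z" "0 \<le> C"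
  shows "1 + \<bar>a - b\<bar> \<le> (1 + 2 * C) * (lin z * lin y)"
proof -
  have "lin y \<le> lin z * lin y" "lin z \<le> lin z * lin y" "1 \<le> lin z * lin y"
    by (simp_all add: algebra_simps add_increasing)
  then have "C * lin y \<le> C * (lin z * lin y)" "C * lin z \<le> C * (lin z * lin y)" "1 \<le> lin z * lin y"
    using assms(3) by (auto intro!: mult_left_mono simp del: mult_le_cancel_left1 mult_le_cancel_left2)
  moreover have "1 + \<bar>a - b\<bar> \<le> 1 + C * lin y + C * lin z" using assms by linarith
  ultimately show ?thesis unfolding distrib_right[of 1 "2 * C"] by linarith
qed

text \<open>\<open>W_le\<close> is applied to every pair of points. By antisymmetry of
  \<open>W'\<close> both points of a pair contribute equally, which uses up the factor 1/2 of the
  potential and leaves the force. A squared relative displacement is at most twice the sum of the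
  squared displacements.\<close>

lemma pot_increment:
  assumes rt: "0 \<le> r" "r \<le> t"
  shows "pot t - pot r \<le> - (\<integral>y. F t y * (X t y - X r y) \<partial>\<rho>) + c * (L2_norm \<rho> (\<lambda>y. X t y - X r y))\<^sup>2"
proof -
  have t: "0 \<le> t" using rt by simp
  note [measurable] = X_borel[OF t] X_borel[OF rt(1)]
  define C where "C = BX t"
  have C: "0 \<le> C" unfolding C_def by (rule BX_nonneg[OF t])
  have bt: "\<bar>X t y\<bar> \<le> C * lin y" for y unfolding C_def by (rule X_bound[OF t order_refl])
  have br: "\<bar>X r y\<bar> \<le> C * lin y" for y unfolding C_def by (rule X_bound[OF rt])
  define d where "d y = X t y - X r y" for y
  have dL: "d \<in> L2 \<rho>" unfolding d_def by (rule L2_diff[OF X_L2[OF t] X_L2[OF rt(1)]])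
  have [measurable]: "d \<in> borel_measurable borel" unfolding d_def[abs_def] by measurable
  have bd: "\<bar>d y\<bar> \<le> 2 * C * lin y" for y using bt[of y] br[of y] unfolding d_def by linarith
  have W_int: "integrable \<rho>2 (\<lambda>x. 1/2 * W (X u (snd x) - X u (fst x)))"
    if u: "0 \<le> u" and bu: "\<And>y. \<bar>X u y\<bar> \<le> C * lin y" for u
  proof (rule product_integrable[where f="\<lambda>z y. 1/2 * W (X u y - X u z)" and C="(\<bar>W 0\<bar> + K0) * (1 + 2 * C)\<^sup>2"])
    note [measurable] = X_borel[OF u]
    show "(\<lambda>x. 1/2 * W (X u (snd x) - X u (fst x))) \<in> borel_measurable \<rho>2" by measurable
    fix z y
    have "(1 + \<bar>X u y - X u z\<bar>)\<^sup>2 \<le> ((1 + 2 * C) * (lin z * lin y))\<^sup>2"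
      using diff_lin[OF bu bu C] by (intro power_mono) auto
    then have "(\<bar>W 0\<bar> + K0) * (1 + \<bar>X u y - X u z\<bar>)\<^sup>2 \<le> (\<bar>W 0\<bar> + K0) * ((1 + 2 * C) * (lin z * lin y))\<^sup>2"
      using K0 by (intro mult_left_mono) auto
    then have "\<bar>W (X u y - X u z)\<bar> \<le> (\<bar>W 0\<bar> + K0) * ((1 + 2 * C) * (lin z * lin y))\<^sup>2"
      using W_growth[of "X u y - X u z"] by linarith
    then show "\<bar>1/2 * W (X u y - X u z)\<bar> \<le> (\<bar>W 0\<bar> + K0) * (1 + 2 * C)\<^sup>2 * ((lin z)\<^sup>2 * (lin y)\<^sup>2)"
      by (simp add: abs_mult power_mult_distrib mult.assoc)
  qed
  define w where "w z y = W' (X t y - X t z)" for z y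
  have wm [measurable]: "(\<lambda>x. w (fst x) (snd x)) \<in> borel_measurable \<rho>2" unfolding w_def by measurable
  have bw: "\<bar>w z y\<bar> \<le> K0 * (1 + 2 * C) * (lin z * lin y)" for z y
  proof -
    have "\<bar>w z y\<bar> \<le> K0 * (1 + \<bar>X t y - X t z\<bar>)" unfolding w_def by (rule W'_growth)
    also have "\<dots> \<le> K0 * ((1 + 2 * C) * (lin z * lin y))" by (intro mult_left_mono diff_lin bt C K0)
    finally show ?thesis by (simp add: mult.assoc)
  qed
  have w1: "integrable \<rho>2 (\<lambda>x. w (fst x) (snd x) * d (snd x))"
  proof (rule product_integrable[where f="\<lambda>z y. w z y * d y" and C="K0 * (1 + 2 * C) * (2 * C)"])
    fix z y
    have "\<bar>w z y * d y\<bar> \<le> (K0 * (1 + 2 * C) * (lin z * lin y)) * (2 * C * lin y)"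
      unfolding abs_mult using bw bd K0 C by (intro mult_mono) auto
    also have "\<dots> = (K0 * (1 + 2 * C) * (2 * C)) * (lin z * (lin y)\<^sup>2)" by (simp only: power2_eq_square mult_ac)
    also have "\<dots> \<le> (K0 * (1 + 2 * C) * (2 * C)) * ((lin z)\<^sup>2 * (lin y)\<^sup>2)"
      using K0 C by (intro mult_left_mono mult_right_mono) (auto simp: power2_eq_square algebra_simps)
    finally show "\<bar>w z y * d y\<bar> \<le> (K0 * (1 + 2 * C) * (2 * C)) * ((lin z)\<^sup>2 * (lin y)\<^sup>2)" .
  qed measurable
  have w2: "integrable \<rho>2 (\<lambda>x. w (fst x) (snd x) * d (fst x))"
  proof (rule product_integrable[where f="\<lambda>z y. w z y * d z" and C="K0 * (1 + 2 * C) * (2 * C)"])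
    fix z y
    have "\<bar>w z y * d z\<bar> \<le> (K0 * (1 + 2 * C) * (lin z * lin y)) * (2 * C * lin z)"
      unfolding abs_mult using bw bd K0 C by (intro mult_mono) auto
    also have "\<dots> = (K0 * (1 + 2 * C) * (2 * C)) * ((lin z)\<^sup>2 * lin y)" by (simp only: power2_eq_square mult_ac)
    also have "\<dots> \<le> (K0 * (1 + 2 * C) * (2 * C)) * ((lin z)\<^sup>2 * (lin y)\<^sup>2)"
      using K0 C by (intro mult_left_mono) (auto simp: power2_eq_square algebra_simps)
    finally show "\<bar>w z y * d z\<bar> \<le> (K0 * (1 + 2 * C) * (2 * C)) * ((lin z)\<^sup>2 * (lin y)\<^sup>2)" .
  qed measurable
  have d2: "integrable \<rho> (\<lambda>y. (d y)\<^sup>2)" by (rule L2_integrable_sq[OF dL])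
  have "integrable \<rho>2 (\<lambda>x. (d (fst x))\<^sup>2)" "integrable \<rho>2 (\<lambda>x. (d (snd x))\<^sup>2)"
  proof -
    have sq: "\<bar>(d y)\<^sup>2\<bar> \<le> (2 * C)\<^sup>2 * (lin y)\<^sup>2" for y
      using power_mono[OF bd[of y], of 2] by (simp add: power_mult_distrib)
    have "\<bar>(d z)\<^sup>2\<bar> \<le> (2 * C)\<^sup>2 * ((lin z)\<^sup>2 * (lin y)\<^sup>2)" "\<bar>(d y)\<^sup>2\<bar> \<le> (2 * C)\<^sup>2 * ((lin z)\<^sup>2 * (lin y)\<^sup>2)" for z y
    proof -
      have l: "1 \<le> (lin y)\<^sup>2" for y :: real by (simp add: one_le_power)
      have "(lin z)\<^sup>2 * 1 \<le> (lin z)\<^sup>2 * (lin y)\<^sup>2" "1 * (lin y)\<^sup>2 \<le> (lin z)\<^sup>2 * (lin y)\<^sup>2"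
        by (intro mult_left_mono mult_right_mono l; simp)+
      then have "(2 * C)\<^sup>2 * (lin z)\<^sup>2 \<le> (2 * C)\<^sup>2 * ((lin z)\<^sup>2 * (lin y)\<^sup>2)"
        "(2 * C)\<^sup>2 * (lin y)\<^sup>2 \<le> (2 * C)\<^sup>2 * ((lin z)\<^sup>2 * (lin y)\<^sup>2)"
        by (intro mult_left_mono; simp)+
      then show "\<bar>(d z)\<^sup>2\<bar> \<le> (2 * C)\<^sup>2 * ((lin z)\<^sup>2 * (lin y)\<^sup>2)" "\<bar>(d y)\<^sup>2\<bar> \<le> (2 * C)\<^sup>2 * ((lin z)\<^sup>2 * (lin y)\<^sup>2)"
        using sq order_trans by blast+
    qed
    then show "integrable \<rho>2 (\<lambda>x. (d (fst x))\<^sup>2)" "integrable \<rho>2 (\<lambda>x. (d (snd x))\<^sup>2)"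
      by (intro product_integrable[where f="\<lambda>z y. (d z)\<^sup>2"] product_integrable[where f="\<lambda>z y. (d y)\<^sup>2"]; measurable)+
  qed
  note dd = this
  have n2: "(\<integral>x. (d (fst x))\<^sup>2 \<partial>\<rho>2) = (L2_norm \<rho> d)\<^sup>2" "(\<integral>x. (d (snd x))\<^sup>2 \<partial>\<rho>2) = (L2_norm \<rho> d)\<^sup>2"
    using product_integral(2)[of "\<lambda>z y. (d z)\<^sup>2", OF dd(1)] product_integral(1)[of "\<lambda>z y. (d y)\<^sup>2", OF dd(2)]
    by (simp_all add: L2_norm_sq)
  \<comment> \<open>Integrating out the point that exerts the force gives \<open>- F t\<close>;
    integrating out the other one gives \<open>F t\<close>, because \<open>W'\<close> is
    odd.\<close>
  have Fw: "(\<integral>z. w z y \<partial>\<rho>) = - F t y" for y by (simp add: w_def F_def \<Phi>_def)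
  have Fw': "(\<integral>y. w z y \<partial>\<rho>) = F t z" for z
  proof -
    have "w z y = - W' (X t z - X t y)" for y using W'_odd[of "X t z - X t y"] by (simp add: w_def)
    then show ?thesis by (simp add: F_def \<Phi>_def)
  qed
  have i1: "(\<integral>x. w (fst x) (snd x) * d (snd x) \<partial>\<rho>2) = - (\<integral>y. F t y * d y \<partial>\<rho>)"
    using product_integral(2)[of "\<lambda>z y. w z y * d y", OF w1] by (simp add: Fw)
  have i2: "(\<integral>x. w (fst x) (snd x) * d (fst x) \<partial>\<rho>2) = (\<integral>y. F t y * d y \<partial>\<rho>)"
    using product_integral(1)[of "\<lambda>z y. w z y * d z", OF w2] by (simp add: Fw')
  note it = W_int[OF t bt] and ir = W_int[OF rt(1) br]
  have "pot t - pot r = (\<integral>x. 1/2 * W (X t (snd x) - X t (fst x)) - 1/2 * W (X r (snd x) - X r (fst x)) \<partial>\<rho>2)"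
    unfolding pot_def using product_integral(1)[of "\<lambda>z y. 1/2 * W (X t y - X t z)", OF it]
      product_integral(1)[of "\<lambda>z y. 1/2 * W (X r y - X r z)", OF ir] Bochner_Integration.integral_diff[OF it ir] by simp
  also have "\<dots> \<le> (\<integral>x. (1/2 * (w (fst x) (snd x) * d (snd x)) - 1/2 * (w (fst x) (snd x) * d (fst x)))
      + (c/2 * (d (fst x))\<^sup>2 + c/2 * (d (snd x))\<^sup>2) \<partial>\<rho>2)"
  proof (rule integral_mono)
    show "integrable \<rho>2 (\<lambda>x. 1/2 * W (X t (snd x) - X t (fst x)) - 1/2 * W (X r (snd x) - X r (fst x)))"
      using it ir by (rule Bochner_Integration.integrable_diff)
    show "integrable \<rho>2 (\<lambda>x. (1/2 * (w (fst x) (snd x) * d (snd x)) - 1/2 * (w (fst x) (snd x) * d (fst x)))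
      + (c/2 * (d (fst x))\<^sup>2 + c/2 * (d (snd x))\<^sup>2))"
      by (intro Bochner_Integration.integrable_add Bochner_Integration.integrable_diff integrable_mult_right w1 w2 dd)
    fix x
    define a where "a = X t (snd x) - X t (fst x)"
    define b where "b = X r (snd x) - X r (fst x)"
    have ab: "a - b = d (snd x) - d (fst x)" by (simp add: a_def b_def d_def)
    have "W a - W b \<le> w (fst x) (snd x) * (d (snd x) - d (fst x)) + c / 2 * (d (snd x) - d (fst x))\<^sup>2"
      using W_le[of a b] unfolding ab by (simp add: w_def a_def)
    also have "c / 2 * (d (snd x) - d (fst x))\<^sup>2 \<le> c / 2 * (2 * (d (fst x))\<^sup>2 + 2 * (d (snd x))\<^sup>2)"
    proof (rule mult_left_mono)
      show "(d (snd x) - d (fst x))\<^sup>2 \<le> 2 * (d (fst x))\<^sup>2 + 2 * (d (snd x))\<^sup>2"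
        using zero_le_power2[of "d (snd x) + d (fst x)"] by (simp add: power2_diff power2_sum)
    qed (use c in simp)
    finally show "1/2 * W (X t (snd x) - X t (fst x)) - 1/2 * W (X r (snd x) - X r (fst x))
      \<le> (1/2 * (w (fst x) (snd x) * d (snd x)) - 1/2 * (w (fst x) (snd x) * d (fst x)))
      + (c/2 * (d (fst x))\<^sup>2 + c/2 * (d (snd x))\<^sup>2)"
      by (simp add: a_def b_def algebra_simps)
  qed
  also have "\<dots> = (1/2 * (- (\<integral>y. F t y * d y \<partial>\<rho>)) - 1/2 * (\<integral>y. F t y * d y \<partial>\<rho>))
      + (c/2 * (L2_norm \<rho> d)\<^sup>2 + c/2 * (L2_norm \<rho> d)\<^sup>2)"
    using w1 w2 dd by (simp add: i1 i2 n2 del: times_divide_eq_left times_divide_eq_right)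
  also have "\<dots> = - (\<integral>y. F t y * d y \<partial>\<rho>) + c * (L2_norm \<rho> d)\<^sup>2" by simp
  finally show ?thesis by (simp add: d_def[abs_def])
qed

sublocale flow: sticky_flow_force \<rho> X Z V LX KX F pot
proof
  fix t T' :: real assume a: "0 \<le> t" "t \<le> T'"
  then have T0: "0 \<le> T'" by simp
  show "L2_norm \<rho> (F t) \<le> KX T'"
    using linear_bound_L2(2)[OF _ F_lin_bound[OF a]] F_borel[OF a(1)] KX_ge(1)[OF T0] by (auto simp: N1_def)
  show "L2_norm \<rho> (V t) \<le> KX T'"
    using linear_bound_L2(2)[OF _ V_lin_bound[OF a]] V_borel[OF a(1)] KX_ge(2)[OF T0] by (auto simp: N1_def)
next
  fix t :: real assume "0 < t"
  then show "F t \<in> borel_measurable (sigma_gen \<rho> (X t))"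
    unfolding F_def[abs_def] using X_borel[of t] \<Phi>_borel[of t] by (intro sigma_gen_borel) auto
next
  fix T' \<epsilon> :: real assume a: "0 < T'" "0 < \<epsilon>"
  then have T0: "0 \<le> T'" by simp
  obtain \<delta> where \<delta>: "\<delta> > 0" "\<And>r t. 0 \<le> r \<Longrightarrow> r \<le> T' \<Longrightarrow> 0 \<le> t \<Longrightarrow> t \<le> T' \<Longrightarrow> \<bar>r - t\<bar> < \<delta> \<Longrightarrow>
    L2_norm \<rho> (\<lambda>y. F r y - F t y) \<le> \<epsilon>"
    by (rule F_uniformly_continuous[OF T0 a(2)]) blast
  show "\<exists>\<delta>>0. \<forall>s t. 0 \<le> s \<longrightarrow> s \<le> t \<longrightarrow> t \<le> T' \<longrightarrow> t - s < \<delta> \<longrightarrow>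
      L2_norm \<rho> (\<lambda>y. V t y - V s y - (t - s) * F t y) \<le> (t - s) * \<epsilon>"
  proof (intro exI[of _ \<delta>] conjI allI impI \<delta>(1))
    fix s t assume st: "0 \<le> s" "s \<le> t" "t \<le> T'" "t - s < \<delta>"
    show "L2_norm \<rho> (\<lambda>y. V t y - V s y - (t - s) * F t y) \<le> (t - s) * \<epsilon>"
      by (rule V_increment_bound[OF st(1,2)]) (use st in \<open>auto intro!: \<delta>(2)\<close>)
  qed
next
  fix s t T' :: real assume st: "0 < s" "s \<le> t" "t \<le> T'"
  then have T0: "0 \<le> T'" by simp
  have "pot t - pot s \<le> - (\<integral>y. F t y * (X t y - X s y) \<partial>\<rho>) + c * (L2_norm \<rho> (\<lambda>y. X t y - X s y))\<^sup>2"
    using st by (intro pot_increment) auto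
  also have "c * (L2_norm \<rho> (\<lambda>y. X t y - X s y))\<^sup>2 \<le> c * (BV T' * N1 * (t - s))\<^sup>2"
    using X_lipschitz[of s t T'] st c by (intro mult_left_mono power_mono L2_norm_nonneg) auto
  also have "\<dots> = (c * (BV T' * N1)\<^sup>2) * (t - s)\<^sup>2" by (simp add: power_mult_distrib)
  also have "\<dots> \<le> KX T' * (t - s)\<^sup>2" by (intro mult_right_mono KX_ge(3) T0) simp
  finally show "pot t - pot s \<le> - (\<integral>y. F t y * (X t y - X s y) \<partial>\<rho>) + KX T' * (t - s)\<^sup>2" by simp
qed (auto intro: F_L2)

end

section \<open>Bochner integrals of continuous curves\<close>

text \<open>The values of \<open>S\<close> are themselves functions. At a fixed \<open>y\<close> the
  sum over them is an ordinary integral, to which dominated convergence can be applied.\<close>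

lemma L2_simple_integral_eq:
  assumes "simple_function N S" "\<And>s. s \<in> space N \<Longrightarrow> emeasure N {r \<in> space N. S r = S s} < \<infinity>"
  shows "L2_simple_integral N S y = (\<integral>s. S s y \<partial>N)"
proof -
  have fin: "finite (S ` space N)" using assms(1) by (simp add: simple_function_def)
  have meas: "{s \<in> space N. S s = g} \<in> sets N" if "g \<in> S ` space N" for g
    using simple_functionD(2)[OF assms(1), of "{g}"] by (simp add: vimage_def Int_def conj_commute)
  have "(\<integral>s. S s y \<partial>N) = (\<integral>s. (\<Sum>g\<in>S ` space N. g y * indicator {s \<in> space N. S s = g} s) \<partial>N)"
  proof (rule Bochner_Integration.integral_cong)
    fix s assume s: "s \<in> space N"
    have "(\<Sum>g\<in>S ` space N. g y * indicator {s \<in> space N. S s = g} s) = (\<Sum>g\<in>S ` space N. if g = S s then g y else 0)"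
      using s by (intro sum.cong refl) (auto simp: indicator_def)
    then show "S s y = (\<Sum>g\<in>S ` space N. g y * indicator {s \<in> space N. S s = g} s)" using s fin by simp
  qed simp
  also have "\<dots> = (\<Sum>g\<in>S ` space N. g y * measure N {s \<in> space N. S s = g})"
  proof (subst Bochner_Integration.integral_sum)
    fix g assume g: "g \<in> S ` space N"
    then show "integrable N (\<lambda>s. g y * indicator {s \<in> space N. S s = g} s)"
      using assms(2) meas[OF g] by (intro integrable_mult_right integrable_real_indicator) auto
  next
    show "(\<Sum>g\<in>S ` space N. \<integral>s. g y * indicator {s \<in> space N. S s = g} s \<partial>N)
       = (\<Sum>g\<in>S ` space N. g y * measure N {s \<in> space N. S s = g})"
      using meas by (intro sum.cong refl) (simp add: Int_def cong: conj_cong)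
  qed
  finally show ?thesis by (simp add: L2_simple_integral_def mult.commute)
qed

context interaction_flow
begin

definition grid :: "nat \<Rightarrow> real \<Rightarrow> nat \<Rightarrow> real" where "grid i t j = real j * (t / real (Suc i))"
definition idx :: "nat \<Rightarrow> real \<Rightarrow> real \<Rightarrow> nat" where "idx i t r = nat \<lfloor>r / (t / real (Suc i))\<rfloor>"

lemma grid_idx:
  assumes "0 < t" "0 \<le> r" "r \<le> t"
  shows "0 \<le> grid i t (idx i t r)" "grid i t (idx i t r) \<le> r" "r - grid i t (idx i t r) \<le> t / real (Suc i)"
proof -
  define \<tau> where "\<tau> = t / real (Suc i)"
  have \<tau>: "\<tau> > 0" using assms by (simp add: \<tau>_def)
  have e: "real (nat \<lfloor>r / \<tau>\<rfloor>) = of_int \<lfloor>r / \<tau>\<rfloor>" using \<tau> assms(2) by simp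
  have "real (nat \<lfloor>r / \<tau>\<rfloor>) \<le> r / \<tau>" "r / \<tau> - 1 \<le> real (nat \<lfloor>r / \<tau>\<rfloor>)" unfolding e by linarith+
  then have "real (nat \<lfloor>r / \<tau>\<rfloor>) * \<tau> \<le> r" "r - real (nat \<lfloor>r / \<tau>\<rfloor>) * \<tau> \<le> \<tau>"
    using \<tau> by (auto simp: field_simps)
  then show "grid i t (idx i t r) \<le> r" "r - grid i t (idx i t r) \<le> t / real (Suc i)"
    by (auto simp: grid_def idx_def \<tau>_def)
  show "0 \<le> grid i t (idx i t r)" using assms by (simp add: grid_def)
qed

lemma idx_simple: assumes t: "0 < t" shows "simple_function (lebesgue_on {0..t}) (idx i t)"
  unfolding simple_function_def
proof (intro conjI ballI)
  have [measurable]: "(\<lambda>r. r) \<in> borel_measurable (lebesgue_on {0..t})"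
    by (rule continuous_imp_measurable_on_sets_lebesgue) auto
  have "idx i t \<in> measurable (lebesgue_on {0..t}) (count_space UNIV)"
    unfolding idx_def[abs_def] by measurable
  then show "idx i t -` {j} \<inter> space (lebesgue_on {0..t}) \<in> sets (lebesgue_on {0..t})" for j
    by (rule measurable_sets) simp
  show "finite (idx i t ` space (lebesgue_on {0..t}))"
  proof (rule finite_subset)
    \<comment> \<open>The index \<open>Suc i\<close> occurs only at the end
      \<open>r = t\<close>.\<close>
    show "idx i t ` space (lebesgue_on {0..t}) \<subseteq> {..Suc i}"
    proof
      fix j assume "j \<in> idx i t ` space (lebesgue_on {0..t})"
      then obtain r where r: "0 \<le> r" "r \<le> t" "j = idx i t r" by auto
      have "r / (t / real (Suc i)) \<le> real (Suc i)"
        using mult_right_mono[OF r(2), of "real (Suc i)"] t by (simp add: divide_le_eq mult.commute)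
      then show "j \<in> {..Suc i}" unfolding r(3) idx_def by (simp add: nat_le_iff floor_le_iff)
    qed
  qed simp
qed

text \<open>Freezing the force at the last grid point before \<open>s\<close> gives simple
  functions. Uniform continuity of \<open>F\<close> in the norm makes the integrated error small.
  Their integrals converge for each \<open>y\<close>, and a dominating function turns this into
  convergence in the norm.\<close>

lemma has_L2_integral_force:
  assumes t: "0 < t"
  shows "has_L2_integral (lebesgue_on {0..t}) \<rho> (\<lambda>s y. convol W' (distr \<rho> borel (X s)) (X s y))
    (\<lambda>y. - integral {0..t} (\<lambda>r. F r y))"
proof -
  let ?N = "lebesgue_on {0..t}"
  have t0: "0 \<le> t" using t by simp
  have conv: "convol W' (distr \<rho> borel (X s)) (X s y) = - F s y" if "0 \<le> s" for s y
  proof -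
    have [measurable]: "X s \<in> borel_measurable \<rho>" using X_borel[OF that] by simp
    have "convol W' (distr \<rho> borel (X s)) (X s y) = (\<integral>z. W' (X s y - X s z) \<partial>\<rho>)"
      unfolding convol_def by (rule integral_distr) measurable
    then show ?thesis by (simp add: F_def \<Phi>_def)
  qed
  define H where "H s y = - F s y" for s y
  have HL: "H s \<in> L2 \<rho>" if "0 \<le> s" for s unfolding H_def using L2_cmult[OF F_L2[OF that], of "-1"] by simp
  define G' where "G' y = - integral {0..t} (\<lambda>r. F r y)" for y
  have G'_eq: "G' y = v (supp_pt y) - V t y" for y by (simp add: G'_def V_def)
  have G'L: "G' \<in> L2 \<rho>"
  proof -
    have eq: "G' y = V 0 y - V t y" for y by (simp add: G'_eq V_def)
    show ?thesis unfolding eq[abs_def] using V_L2[of 0] V_L2[OF t0] by (intro L2_diff) auto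
  qed
  define S where "S i s = H (grid i t (idx i t s))" for i s
  have gr: "0 \<le> grid i t (idx i t s)" "grid i t (idx i t s) \<le> t" "0 \<le> s" if "s \<in> space ?N" for i s
    using grid_idx[OF t, of s i] that by auto
  have Ssf: "simple_function ?N (S i)" for i
    using simple_function_compose[OF idx_simple[OF t, of i], of "\<lambda>j. H (grid i t j)"] by (simp add: S_def[abs_def] o_def)
  have fin: "emeasure ?N E < \<infinity>" for E
  proof -
    have "emeasure ?N E \<le> emeasure ?N (space ?N)" by (rule emeasure_space)
    also have "\<dots> < \<infinity>" using t by (simp add: emeasure_restrict_space emeasure_lborel_Icc_eq)
    finally show ?thesis .
  qed
  have S_int: "L2_simple_integral ?N (S i) y = (\<integral>s. S i s y \<partial>?N)" for i y
    by (rule L2_simple_integral_eq[OF Ssf fin])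
  have simp: "L2_simple ?N \<rho> (S i)" for i
    unfolding L2_simple_def using Ssf[of i] HL gr(1) fin less_imp_neq[OF fin] by (auto simp: S_def)
  define nrm where "nrm i s = L2_norm \<rho> (\<lambda>y. H s y - S i s y)" for i s
  have dist_H: "L2_norm \<rho> (\<lambda>y. H a y - H b y) = L2_norm \<rho> (\<lambda>y. F a y - F b y)" for a b
    unfolding H_def using L2_norm_minus_commute[of \<rho> "F a" "F b"] by (simp add: algebra_simps)
  have cont: "continuous_on {0..t} (\<lambda>s. L2_norm \<rho> (\<lambda>y. H s y - H b y))" if b: "0 \<le> b" for b
    unfolding continuous_on_sequentially
  proof (intro allI ballI impI)
    fix x a assume a: "a \<in> {0..t}" "(\<forall>n. x n \<in> {0..t}) \<and> x \<longlonglongrightarrow> a"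
    then have a0: "0 \<le> a" "\<And>n. 0 \<le> x n" by auto
    have l: "(\<lambda>n. L2_norm \<rho> (\<lambda>y. F (x n) y - F a y)) \<longlonglongrightarrow> 0"
      by (rule F_L2_continuous) (use a a0 in auto)
    have "\<bar>L2_norm \<rho> (\<lambda>y. F (x n) y - F b y) - L2_norm \<rho> (\<lambda>y. F a y - F b y)\<bar> \<le> L2_norm \<rho> (\<lambda>y. F (x n) y - F a y)" for n
      using L2_norm_triangle_diff[OF F_L2[OF a0(2)] F_L2[OF a0(1)] F_L2[OF b], of n]
        L2_norm_triangle_diff[OF F_L2[OF a0(1)] F_L2[OF a0(2)] F_L2[OF b], of n]
        L2_norm_minus_commute[of \<rho> "F (x n)" "F a"] by (simp add: abs_le_iff)
    then have "(\<lambda>n. L2_norm \<rho> (\<lambda>y. F (x n) y - F b y) - L2_norm \<rho> (\<lambda>y. F a y - F b y)) \<longlonglongrightarrow> 0"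
      by (intro Lim_null_comparison[OF _ l]) auto
    then show "((\<lambda>s. L2_norm \<rho> (\<lambda>y. H s y - H b y)) \<circ> x) \<longlonglongrightarrow> L2_norm \<rho> (\<lambda>y. H a y - H b y)"
      by (simp add: o_def dist_H LIM_zero_cancel)
  qed
  \<comment> \<open>For a fixed grid point the norm is continuous in \<open>s\<close>; composition
    with the countably valued measurable index glues the cells.\<close>
  have nrm_meas: "nrm i \<in> borel_measurable ?N" for i
  proof -
    have "(\<lambda>s. L2_norm \<rho> (\<lambda>y. H s y - H (grid i t j) y)) \<in> borel_measurable ?N" for j
      by (rule continuous_imp_measurable_on_sets_lebesgue[OF cont]) (use t in \<open>auto simp: grid_def\<close>)
    moreover have "idx i t \<in> measurable ?N (count_space UNIV)"
      using idx_simple[OF t] by (rule measurable_simple_function)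
    ultimately have "(\<lambda>s. L2_norm \<rho> (\<lambda>y. H s y - H (grid i t (idx i t s)) y)) \<in> borel_measurable ?N"
      by (rule measurable_compose_countable)
    then show ?thesis by (simp add: nrm_def[abs_def] S_def)
  qed
  have nn: "(\<lambda>i. \<integral>\<^sup>+s. ennreal (nrm i s) \<partial>?N) \<longlonglongrightarrow> 0"
  proof (rule order_tendstoI)
    fix e :: ennreal assume "0 < e"
    \<comment> \<open>\<open>e\<close> may be infinite; a smaller positive value is finite and can
      be turned into a real.\<close>
    then obtain e1 where e1: "0 < e1" "e1 < e" using dense by blast
    define e' where "e' = enn2real e1"
    have "e1 < top" using e1(2) by (rule less_le_trans) simp
    then have e': "0 < e'" "ennreal e' < e" using e1 by (auto simp: e'_def enn2real_positive_iff)
    define \<epsilon> where "\<epsilon> = e' / t"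
    have \<epsilon>: "\<epsilon> > 0" using e' t by (simp add: \<epsilon>_def)
    obtain \<delta> where \<delta>: "\<delta> > 0" "\<And>r u. 0 \<le> r \<Longrightarrow> r \<le> t \<Longrightarrow> 0 \<le> u \<Longrightarrow> u \<le> t \<Longrightarrow> \<bar>r - u\<bar> < \<delta> \<Longrightarrow>
      L2_norm \<rho> (\<lambda>y. F r y - F u y) \<le> \<epsilon>"
      by (rule F_uniformly_continuous[OF t0 \<epsilon>]) blast
    have "(\<lambda>i. t * (1 / real (Suc i))) \<longlonglongrightarrow> t * 0"
      using LIMSEQ_inverse_real_of_nat by (intro tendsto_mult_left) (simp add: inverse_eq_divide)
    then have "\<forall>\<^sub>F i in sequentially. t * (1 / real (Suc i)) < \<delta>" using \<delta>(1) by (intro order_tendstoD(2)) auto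
    then show "\<forall>\<^sub>F i in sequentially. (\<integral>\<^sup>+s. ennreal (nrm i s) \<partial>?N) < e"
    proof eventually_elim
      case (elim i)
      have "(\<integral>\<^sup>+s. ennreal (nrm i s) \<partial>?N) \<le> (\<integral>\<^sup>+s. ennreal \<epsilon> \<partial>?N)"
      proof (rule nn_integral_mono)
        fix s assume s: "s \<in> space ?N"
        then have "L2_norm \<rho> (\<lambda>y. F s y - F (grid i t (idx i t s)) y) \<le> \<epsilon>"
          using grid_idx[OF t, of s i] elim by (intro \<delta>(2)) auto
        then show "ennreal (nrm i s) \<le> ennreal \<epsilon>" by (simp add: nrm_def S_def dist_H ennreal_leI)
      qed
      also have "\<dots> = ennreal \<epsilon> * ennreal t" using t by (simp add: emeasure_restrict_space emeasure_lborel_Icc_eq)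
      also have "\<dots> = ennreal e'" using \<epsilon> t by (simp add: \<epsilon>_def flip: ennreal_mult)
      finally show ?case using e'(2) by simp
    qed
  qed simp
  have int_lim: "(\<lambda>i. L2_simple_integral ?N (S i) y) \<longlonglongrightarrow> G' y" for y
  proof -
    have "(\<lambda>i. \<integral>s. S i s y \<partial>?N) \<longlonglongrightarrow> (\<integral>s. H s y \<partial>?N)"
    proof (rule integral_dominated_convergence)
      have cH: "continuous_on {0..t} (\<lambda>s. H s y)" unfolding H_def by (intro continuous_intros F_continuous_on)
      show "(\<lambda>s. H s y) \<in> borel_measurable ?N"
        by (rule continuous_imp_measurable_on_sets_lebesgue[OF cH]) simp
      show "(\<lambda>s. S i s y) \<in> borel_measurable ?N" for i
        using borel_measurable_simple_function[OF simple_function_compose[OF Ssf[of i], of "\<lambda>f. f y"]] by (simp add: o_def)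
      show "integrable ?N (\<lambda>s. BFX t * (1 + \<bar>y\<bar>))"
        using fin[of "space ?N"] by (intro finite_measure.integrable_const finite_measureI) auto
      show "AE s in ?N. norm (S i s y) \<le> BFX t * (1 + \<bar>y\<bar>)" for i
      proof (rule AE_I2)
        fix s assume "s \<in> space ?N"
        from F_lin_bound[OF gr(1,2)[OF this], of i y] show "norm (S i s y) \<le> BFX t * (1 + \<bar>y\<bar>)"
          by (simp add: S_def H_def)
      qed
      show "AE s in ?N. (\<lambda>i. S i s y) \<longlonglongrightarrow> H s y"
      proof (rule AE_I2)
        fix s assume "s \<in> space ?N"
        then have s: "0 \<le> s" "s \<le> t" by auto
        have "(\<lambda>i. grid i t (idx i t s)) \<longlonglongrightarrow> s"
        proof -
          have "(\<lambda>i. t / real (Suc i)) \<longlonglongrightarrow> 0"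
            using tendsto_mult[OF tendsto_const LIMSEQ_inverse_real_of_nat, of t] by (simp add: divide_inverse)
          from nat_floor_mult_tendsto[OF _ this s(1)] show ?thesis using t by (simp add: grid_def idx_def)
        qed
        then have "(\<lambda>i. F (grid i t (idx i t s)) y) \<longlonglongrightarrow> F s y"
          using grid_idx(1)[OF t s] s by (intro F_continuous_time) auto
        then show "(\<lambda>i. S i s y) \<longlonglongrightarrow> H s y" unfolding S_def H_def by (rule tendsto_minus)
      qed
    qed
    moreover have "(\<integral>s. H s y \<partial>?N) = G' y"
    proof -
      have "integrable ?N (\<lambda>s. H s y)"
        by (rule continuous_imp_integrable_real) (unfold H_def, intro continuous_intros F_continuous_on)
      then have "(\<integral>s. H s y \<partial>?N) = integral {0..t} (\<lambda>s. H s y)"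
        by (rule lebesgue_integral_eq_integral) simp
      then show ?thesis by (simp add: H_def G'_def)
    qed
    ultimately show ?thesis by (simp add: S_int)
  qed
  have "(\<lambda>i. L2_norm \<rho> (\<lambda>y. L2_simple_integral ?N (S i) y - G' y)) \<longlonglongrightarrow> 0"
  proof (rule L2_norm_dominated_tendsto)
    show "(\<lambda>y. (t * BFX t) * (1 + \<bar>y\<bar>)) \<in> L2 \<rho>" by (rule L2_cmult[OF lin_L2])
    show "L2_simple_integral ?N (S i) \<in> borel_measurable \<rho>" for i
    proof -
      have "g \<in> borel_measurable \<rho>" if "g \<in> S i ` space ?N" for g
        using that simp[of i] by (auto simp: L2_simple_def dest: L2_borel)
      then show ?thesis unfolding L2_simple_integral_def[abs_def] by (intro borel_measurable_sum borel_measurable_times) auto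
    qed
    show "AE y in \<rho>. \<bar>L2_simple_integral ?N (S i) y\<bar> \<le> (t * BFX t) * (1 + \<bar>y\<bar>)" for i
    proof (rule AE_I2)
      fix y
      interpret N: finite_measure ?N by (rule finite_measureI) (use fin[of "space ?N"] in auto)
      have "\<bar>\<integral>s. S i s y \<partial>?N\<bar> \<le> (\<integral>s. BFX t * (1 + \<bar>y\<bar>) \<partial>?N)"
      proof (rule order_trans[OF integral_abs_bound integral_mono])
        have b: "\<bar>S i s y\<bar> \<le> BFX t * (1 + \<bar>y\<bar>)" if "s \<in> space ?N" for s
          using F_lin_bound[OF gr(1,2)[OF that]] by (simp add: S_def H_def)
        then show "\<And>s. s \<in> space ?N \<Longrightarrow> \<bar>S i s y\<bar> \<le> BFX t * (1 + \<bar>y\<bar>)" .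
        show "integrable ?N (\<lambda>s. \<bar>S i s y\<bar>)"
          using borel_measurable_simple_function[OF simple_function_compose[OF Ssf[of i], of "\<lambda>f. f y"]] b
          by (intro N.integrable_const_bound[where B="BFX t * (1 + \<bar>y\<bar>)"]) (auto simp: o_def)
      qed simp
      also have "\<dots> = (t * BFX t) * (1 + \<bar>y\<bar>)"
        using t by (simp add: measure_restrict_space)
      finally show "\<bar>L2_simple_integral ?N (S i) y\<bar> \<le> (t * BFX t) * (1 + \<bar>y\<bar>)" by (simp add: S_int)
    qed
  qed (use int_lim G'L in \<open>auto dest: L2_borel\<close>)
  note int_L2 = this
  have H: "(\<lambda>y. convol W' (distr \<rho> borel (X s)) (X s y)) = H s" if "s \<in> space ?N" for s
    using conv[of s] that by (auto simp: H_def)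
  have nrm: "L2_norm \<rho> (\<lambda>y. convol W' (distr \<rho> borel (X s)) (X s y) - S i s y) = nrm i s"
    if "s \<in> space ?N" for s i
    using fun_cong[OF H[OF that]] by (simp add: nrm_def)
  have "(\<integral>\<^sup>+s. ennreal (L2_norm \<rho> (\<lambda>y. convol W' (distr \<rho> borel (X s)) (X s y) - S i s y)) \<partial>?N)
    = (\<integral>\<^sup>+s. ennreal (nrm i s) \<partial>?N)" for i
    by (rule nn_integral_cong) (simp only: nrm)
  moreover have "(\<lambda>s. L2_norm \<rho> (\<lambda>y. convol W' (distr \<rho> borel (X s)) (X s y) - S i s y)) \<in> borel_measurable ?N" for i
    by (rule measurable_cong[THEN iffD2, OF nrm nrm_meas[of i]])
  moreover have "(\<lambda>y. convol W' (distr \<rho> borel (X s)) (X s y)) \<in> L2 \<rho>" if "s \<in> space ?N" for s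
    unfolding H[OF that] using that by (intro HL) simp
  ultimately show ?thesis
    unfolding has_L2_integral_def using simp nn G'L int_L2 by (auto simp: G'_def[abs_def] intro!: exI[of _ S])
qed

section \<open>Uniqueness of the derivative, the flow equation and the decrease of energy\<close>

lemma L2_derivative_unique:
  assumes "has_L2_derivative \<rho> Y D1 t" "has_L2_derivative \<rho> Y D2 t" and Y: "\<And>s. 0 \<le> s \<Longrightarrow> Y s \<in> L2 \<rho>" and t: "0 < t"
  shows "AE y in \<rho>. D1 y = D2 y"
proof -
  define e where "e D \<tau> = L2_norm \<rho> (\<lambda>y. (Y (t + \<tau>) y - Y t y) / \<tau> - D y)" for D \<tau>
  have D: "D1 \<in> L2 \<rho>" "D2 \<in> L2 \<rho>" and lim: "(e D1 \<longlongrightarrow> 0) (at 0)" "(e D2 \<longlongrightarrow> 0) (at 0)"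
    using assms(1,2) by (auto simp: has_L2_derivative_def e_def[abs_def])
  have "((\<lambda>\<tau>. e D1 \<tau> + e D2 \<tau>) \<longlongrightarrow> 0) (at 0)" using tendsto_add[OF lim] by simp
  moreover have "\<forall>\<^sub>F \<tau> in at 0. L2_norm \<rho> (\<lambda>y. D1 y - D2 y) \<le> e D1 \<tau> + e D2 \<tau>"
    unfolding eventually_at
  \<comment> \<open>Increments shorter than \<open>t\<close> keep the time \<open>t + \<tau>\<close>
    nonnegative, where \<open>Y\<close> is known to be square integrable.\<close>
  proof (intro exI[of _ t] conjI ballI impI t)
    fix \<tau> :: real assume "\<tau> \<noteq> 0 \<and> dist \<tau> 0 < t"
    then have \<tau>: "0 \<le> t + \<tau>" by (auto simp: dist_real_def)
    define Q where "Q y = (Y (t + \<tau>) y - Y t y) / \<tau>" for y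
    have Q: "Q \<in> L2 \<rho>"
      using L2_cmult[OF L2_diff[OF Y[OF \<tau>] Y[of t]], of "1 / \<tau>"] t by (simp add: Q_def[abs_def])
    show "L2_norm \<rho> (\<lambda>y. D1 y - D2 y) \<le> e D1 \<tau> + e D2 \<tau>"
      using L2_norm_triangle_diff[OF D(1) Q D(2)] L2_norm_minus_commute[of \<rho> D1 Q] by (simp add: e_def Q_def)
  qed
  ultimately have "L2_norm \<rho> (\<lambda>y. D1 y - D2 y) \<le> 0"
    by (rule tendsto_lowerbound) simp
  then have "(\<integral>y. (D1 y - D2 y)\<^sup>2 \<partial>\<rho>) = 0"
    using L2_norm_sq[of \<rho> "\<lambda>y. D1 y - D2 y"] L2_norm_nonneg[of \<rho> "\<lambda>y. D1 y - D2 y"] by simp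
  then have "AE y in \<rho>. (D1 y - D2 y)\<^sup>2 = 0"
    using integral_nonneg_eq_0_iff_AE[OF L2_integrable_sq[OF L2_diff[OF D]]] by simp
  then show ?thesis by eventually_elim simp
qed

text \<open>\<open>L2_deriv\<close> is some choice among the functions that represent the
  derivative, so it agrees with \<open>U t\<close> only up to a null set.\<close>

lemma L2_deriv_eq: assumes "flow.regular_time t" shows "AE y in \<rho>. L2_deriv \<rho> X t y = flow.U t y"
proof (rule L2_derivative_unique)
  have d: "has_L2_derivative \<rho> X (flow.U t) t" by (rule flow.has_L2_derivative_regular[OF assms])
  then show "has_L2_derivative \<rho> X (L2_deriv \<rho> X t) t"
    unfolding L2_deriv_def by (rule someI[where P="\<lambda>D. has_L2_derivative \<rho> X D t"])
  show "has_L2_derivative \<rho> X (flow.U t) t" by (rule d)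
  show "0 < t" using assms by (simp add: flow.regular_time_def)
qed (rule X_L2)

lemma AE_regular_time: "AE t in lborel. t > 0 \<longrightarrow> flow.regular_time t"
proof -
  obtain N where N: "countable N" "\<And>t. t > 0 \<Longrightarrow> t \<notin> N \<Longrightarrow> flow.regular_time t"
    using flow.regular_time_countable by blast
  have "N \<in> null_sets lborel" by (rule countable_imp_null_set_lborel[OF N(1)])
  then have "AE t in lborel. t \<notin> N" by (rule AE_not_in)
  then show ?thesis by eventually_elim (use N(2) in blast)
qed

lemma flow_solution: "is_flow_solution \<rho> v W' X"
  unfolding is_flow_solution_def
  using AE_regular_time
proof eventually_elim
  case (elim t)
  show ?case
  proof
    assume t: "t > 0"
    then have reg: "flow.regular_time t" using elim by simp
    have t0: "0 \<le> t" using t by simp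
    define I where "I y = - integral {0..t} (\<lambda>r. F r y)" for y
    have Xm: "X t \<in> borel_measurable \<rho>" using X_borel[OF t0] by simp
    interpret Sg: finite_measure_subalgebra \<rho> "sigma_gen \<rho> (X t)" by (rule cond_exp_given_sigma[OF Xm])
    have Im: "I \<in> borel_measurable \<rho>"
    proof -
      have "I y = V 0 y - V t y" for y by (simp add: I_def V_def)
      then have "I = (\<lambda>y. V 0 y - V t y)" by auto
      then show ?thesis using V_borel[of 0] V_borel[OF t0] by simp
    qed
    \<comment> \<open>This holds on the support, where \<open>supp_pt y = y\<close>; elsewhere
      \<open>V\<close> starts from \<open>v (q 0)\<close>.\<close>
    have "AE y in \<rho>. v y - I y = V t y"
      using AE_supp_pt by eventually_elim (simp add: I_def V_def)
    then have "AE y in \<rho>. real_cond_exp \<rho> (sigma_gen \<rho> (X t)) (\<lambda>y. v y - I y) y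
        = real_cond_exp \<rho> (sigma_gen \<rho> (X t)) (V t) y"
      using V_borel[OF t0] Im by (intro Sg.real_cond_exp_cong) auto
    with L2_deriv_eq[OF reg] have "AE y in \<rho>. L2_deriv \<rho> X t y = cond_exp_given \<rho> (\<lambda>y. v y - I y) (X t) y"
      by eventually_elim (simp add: flow.U_def flow.P_def cond_exp_given_def)
    moreover have "has_L2_integral (lebesgue_on {0..t}) \<rho> (\<lambda>s y. convol W' (distr \<rho> borel (X s)) (X s y)) I"
      using has_L2_integral_force[OF t] by (simp add: I_def[abs_def])
    ultimately show "(\<exists>D. has_L2_derivative \<rho> X D t) \<and>
       (\<exists>G. has_L2_integral (lebesgue_on {0..t}) \<rho> (\<lambda>s y. convol W' (distr \<rho> borel (X s)) (X s y)) G \<and>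
            (AE y in \<rho>. L2_deriv \<rho> X t y = cond_exp_given \<rho> (\<lambda>y. v y - G y) (X t) y))"
      using flow.has_L2_derivative_regular[OF reg] by blast
  qed
qed

lemma L2_deriv_measurable: "L2_deriv \<rho> X t \<in> L2 \<rho>" if "flow.regular_time t"
proof -
  have "has_L2_derivative \<rho> X (L2_deriv \<rho> X t) t"
    unfolding L2_deriv_def
    by (rule someI[where P="\<lambda>D. has_L2_derivative \<rho> X D t", OF flow.has_L2_derivative_regular[OF that]])
  then show ?thesis by (simp add: has_L2_derivative_def)
qed

lemma energy_eq: assumes "flow.regular_time t" shows "energy \<rho> W X t = (L2_norm \<rho> (flow.U t))\<^sup>2 / 2 + pot t"
proof -
  have "L2_norm \<rho> (L2_deriv \<rho> X t) = L2_norm \<rho> (flow.U t)"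
  proof (rule L2_norm_cong_AE[OF L2_borel[OF L2_deriv_measurable[OF assms]] _ L2_deriv_eq[OF assms]])
    show "flow.U t \<in> borel_measurable \<rho>"
      using flow.has_L2_derivative_regular[OF assms] by (auto simp: has_L2_derivative_def dest: L2_borel)
  qed
  then show ?thesis by (simp add: energy_def pot_def flip: L2_norm_sq)
qed

lemma energy_decreasing:
  "\<exists>N\<in>null_sets lborel. \<forall>s\<in>{0..} - N. \<forall>t\<in>{0..} - N. s \<le> t \<longrightarrow> energy \<rho> W X t \<le> energy \<rho> W X s"
proof -
  obtain N where N: "countable N" "\<And>t. t > 0 \<Longrightarrow> t \<notin> N \<Longrightarrow> flow.regular_time t"
    using flow.regular_time_countable by blast
  show ?thesis
  \<comment> \<open>Time 0 joins the exceptional set because regular times are positive.\<close>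
  proof (intro bexI[of _ "insert 0 N"] ballI impI)
    show "insert 0 N \<in> null_sets lborel" using N(1) by (intro countable_imp_null_set_lborel) simp
    fix s t assume "s \<in> {0..} - insert 0 N" "t \<in> {0..} - insert 0 N" "s \<le> t"
    then have st: "0 < s" "s \<le> t" "flow.regular_time s" "flow.regular_time t" using N(2) by auto
    show "energy \<rho> W X t \<le> energy \<rho> W X s"
      unfolding energy_eq[OF st(3)] energy_eq[OF st(4)] by (rule flow.total_energy_antimono[OF st(1,2)])
  qed
qed

lemma locally_lipschitz: "L2_locally_lipschitz \<rho> X"
  unfolding L2_locally_lipschitz_def
proof (intro conjI allI impI)
  fix T' :: real assume T': "0 \<le> T'"
  show "\<exists>C. \<forall>s\<in>{0..T'}. \<forall>t\<in>{0..T'}. L2_norm \<rho> (\<lambda>y. X t y - X s y) \<le> C * \<bar>t - s\<bar>"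
  proof (intro exI[of _ "BV T' * N1"] ballI)
    fix s t assume "s \<in> {0..T'}" "t \<in> {0..T'}"
    then show "L2_norm \<rho> (\<lambda>y. X t y - X s y) \<le> BV T' * N1 * \<bar>t - s\<bar>"
      using X_lipschitz[of s t T'] X_lipschitz[of t s T'] L2_norm_minus_commute[of \<rho> "X s" "X t"]
      by (cases "s \<le> t") auto
  qed
qed (rule X_L2)

end

theorem theorem1p1:
  fixes \<rho>\<^sub>0 :: "real measure" and v\<^sub>0 W W' :: "real \<Rightarrow> real" and c :: real
  assumes "prob_space \<rho>\<^sub>0" and "sets \<rho>\<^sub>0 = sets borel"
    and "integrable \<rho>\<^sub>0 (\<lambda>x. x\<^sup>2)"
    and "abs_cont v\<^sub>0"
    and "\<And>x. (W has_real_derivative W' x) (at x)" and "continuous_on UNIV W'"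
    and "\<And>x. W (- x) = W x"
    and "bdd_above (range (\<lambda>x. \<bar>W' x\<bar> / (1 + \<bar>x\<bar>)))"
    and "c > 0" and "convex_on UNIV (\<lambda>x. W x + c / 2 * x\<^sup>2)"
  shows "\<exists>X :: real \<Rightarrow> real \<Rightarrow> real.
    L2_locally_lipschitz \<rho>\<^sub>0 X \<and>
    is_flow_solution \<rho>\<^sub>0 v\<^sub>0 W' X \<and>
    (AE y in \<rho>\<^sub>0. X 0 y = y) \<and>
    (\<exists>N\<in>null_sets lborel. \<forall>s\<in>{0..} - N. \<forall>t\<in>{0..} - N. s \<le> t \<longrightarrow>
       energy \<rho>\<^sub>0 W X t \<le> energy \<rho>\<^sub>0 W X s) \<and>
    (\<forall>t\<ge>0. \<forall>y\<in>msupp \<rho>\<^sub>0. \<forall>z\<in>msupp \<rho>\<^sub>0. z \<le> y \<longrightarrow>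
       0 \<le> X t y - X t z \<and>
       X t y - X t z \<le> cosh (sqrt c * t) * (y - z) +
         1 / sqrt c * sinh (sqrt c * t) * (LINT x:{z..y}|lebesgue. \<bar>deriv v\<^sub>0 x\<bar>)) \<and>
    (\<forall>s t. 0 < s \<longrightarrow> s \<le> t \<longrightarrow> (\<forall>y\<in>msupp \<rho>\<^sub>0. \<forall>z\<in>msupp \<rho>\<^sub>0.
       \<bar>X t y - X t z\<bar> / sinh (sqrt c * t) \<le> \<bar>X s y - X s z\<bar> / sinh (sqrt c * s)))"
proof -
  obtain G CG where G: "mono G" "continuous_on UNIV G" "\<And>p q. p \<le> q \<Longrightarrow> G q - G p \<le> CG * (1 + (q - p))"
    "\<And>p q. p \<le> q \<Longrightarrow> \<bar>v\<^sub>0 q - v\<^sub>0 p\<bar> \<le> G q - G p"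
    "\<And>p q. p \<le> q \<Longrightarrow> (LINT x:{p..q}|lebesgue. \<bar>deriv v\<^sub>0 x\<bar>) = G q - G p"
    by (rule abs_cont_deriv[OF assms(4)]) blast
  obtain K where K: "\<And>x. \<bar>W' x\<bar> / (1 + \<bar>x\<bar>) \<le> K" using assms(8) by (auto simp: bdd_above_def)
  have CG: "0 \<le> CG" using G(3)[of 0 0] by simp
  have K0: "0 \<le> K" using K[of 0] by (rule order_trans[rotated]) simp
  have odd: "W' (- x) = - W' x" for x
  proof -
    have "((\<lambda>x. W (- x)) has_real_derivative - W' (- x)) (at x)"
      using DERIV_chain2[OF assms(5)[of "- x"] DERIV_minus[OF DERIV_ident]] by simp
    then have "(W has_real_derivative - W' (- x)) (at x)" by (simp add: assms(7))
    from DERIV_unique[OF this assms(5)[of x]] show ?thesis by simp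
  qed
  \<comment> \<open>The tangent at \<open>x\<close> evaluated at \<open>y\<close>, added to the
    tangent at \<open>y\<close> evaluated at \<open>x\<close>, shows that the derivative of the
    convex function is monotone.\<close>
  have mono: "W' x + c * x \<le> W' y + c * y" if "x \<le> y" for x y
  proof -
    have d: "((\<lambda>x. W x + c / 2 * x\<^sup>2) has_real_derivative (W' x + c * x)) (at x within UNIV)" for x
      by (auto intro!: derivative_eq_intros assms(5))
    have "(W' x + c * x) * (y - x) \<le> (W y + c / 2 * y\<^sup>2) - (W x + c / 2 * x\<^sup>2)"
      by (rule convex_on_imp_above_tangent[OF assms(10) _ _ _ d]) auto
    moreover have "(W' y + c * y) * (x - y) \<le> (W x + c / 2 * x\<^sup>2) - (W y + c / 2 * y\<^sup>2)"
      by (rule convex_on_imp_above_tangent[OF assms(10) _ _ _ d]) auto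
    ultimately have "0 \<le> ((W' y + c * y) - (W' x + c * x)) * (y - x)" by (simp add: algebra_simps)
    then show ?thesis using that by (cases "x = y") (auto simp: zero_le_mult_iff)
  qed
  interpret prob_space \<rho>\<^sub>0 by (rule assms(1))
  interpret I: interaction_flow \<rho>\<^sub>0 v\<^sub>0 W' G c K CG W
  proof
    show "\<bar>W' x\<bar> \<le> K * (1 + \<bar>x\<bar>)" for x using K[of x] by (simp add: divide_le_eq)
  qed (use assms G CG K0 odd mono in auto)
  show ?thesis
  proof (intro exI[of _ I.X] conjI allI ballI impI)
    show "L2_locally_lipschitz \<rho>\<^sub>0 I.X" by (rule I.locally_lipschitz)
    show "is_flow_solution \<rho>\<^sub>0 v\<^sub>0 W' I.X" by (rule I.flow_solution)
    show "AE y in \<rho>\<^sub>0. I.X 0 y = y" using I.AE_S by eventually_elim (rule I.X_0)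
    show "\<exists>N\<in>null_sets lborel. \<forall>s\<in>{0..} - N. \<forall>t\<in>{0..} - N. s \<le> t \<longrightarrow>
       energy \<rho>\<^sub>0 W I.X t \<le> energy \<rho>\<^sub>0 W I.X s" by (rule I.energy_decreasing)
  next
    fix t y z :: real assume a: "0 \<le> t" "y \<in> msupp \<rho>\<^sub>0" "z \<in> msupp \<rho>\<^sub>0" "z \<le> y"
    show "0 \<le> I.X t y - I.X t z" by (rule I.X_gap(1)[OF a])
    show "I.X t y - I.X t z \<le> cosh (sqrt c * t) * (y - z) +
         1 / sqrt c * sinh (sqrt c * t) * (LINT x:{z..y}|lebesgue. \<bar>deriv v\<^sub>0 x\<bar>)"
      using I.X_gap(2)[OF a] unfolding G(5)[OF a(4)] I.ch_def I.sh_def .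
  next
    fix s t y z :: real assume "0 < s" "s \<le> t" "y \<in> msupp \<rho>\<^sub>0" "z \<in> msupp \<rho>\<^sub>0"
    then show "\<bar>I.X t y - I.X t z\<bar> / sinh (sqrt c * t) \<le> \<bar>I.X s y - I.X s z\<bar> / sinh (sqrt c * s)"
      by (rule I.X_sinh)
  qed
qed

end
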